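(* Let $n\ge2$, $s\in(0,1)$, $T>0$, let $\Omega\subset\mathbb{R}^n$ be a bounded open set with Lipschitz boundary, $\Omega_e:=\mathbb{R}^n\setminus\overline\Omega$, and $f\in C_c^\infty((\Omega_e)_T)$. For $j=1,2$ let $\sigma_j$ be an admissible coefficient on $\mathbb{R}^n$ with $\sigma_j=\mathbf{I}_n$ in $\Omega_e$, $\mathcal{L}_j=-\nabla\cdot(\sigma_j\nabla)$, $\mathcal{H}_j=\partial_t+\mathcal{L}_j$, let $u_j\in\mathbb{H}^s(\mathbb{R}^{n+1})$ be the solution of $(\mathcal{H}_j)^su_j=0$ in $\Omega_T$, $u_j=f$ in $(\Omega_e)_T$, $u_j(t,x)=0$ for $t\le-T$, $x\in\mathbb{R}^n$, and let $$\mathbf{U}_j(t,\tau,x)=\int_{\mathbb{R}^n}p_j(x,z,\tau)\,u_j(t-\tau,z)\,dz,$$ where $p_j$ is the heat kernel of $\partial_\tau+\mathcal{L}_j$ on $\mathbb{R}^n$. Then $\mathbf{U}_j$ solves $$\begin{cases}(\partial_t+\partial_\tau)\mathbf{U}_j+\mathcal{L}_j\mathbf{U}_j=0&\text{for }(t,\tau,x)\in(-T,T)\times(0,\infty)\times\mathbb{R}^n,\\ \mathbf{U}_j(t,0,x)=u_j(t,x)&\text{for }(t,x)\in(-T,T)\times\mathbb{R}^n,\\ \mathbf{U}_j(-T,\tau,x)=0&\text{for }(\tau,x)\in(0,\infty)\times\mathbb{R}^n,\end{cases}$$ where $\mathbf{U}_j(t,0,x)$ is understood as the limit $\tau\to0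$.
   Context: Notation: $B_T:=(-T,T)\times B$. Admissible coefficient: $\sigma=(\sigma_{ik})$ is a symmetric matrix-valued function on $\mathbb{R}^n$ with $c_0|\xi|^2\le\sum\sigma_{ik}(x)\xi_i\xi_k\le c_0^{-1}|\xi|^2$ and $|\sigma(x)-\sigma(z)|\le C_0|x-z|$ for all $x,z,\xi\in\mathbb{R}^n$, for some $c_0\in(0,1)$, $C_0>0$. Write $\mathcal{L}=-\nabla\cdot(\sigma\nabla)$, $\mathcal{H}=\partial_t+\mathcal{L}$. Nonlocal operator: with $\{E_\lambda\}_{\lambda\ge0}$ the spectral resolution of $\mathcal{L}$ on $L^2(\mathbb{R}^n)$ and $\mathcal{F}_t$ the Fourier transform in $t$, $\mathcal{F}_t(\mathcal{H}^r u)(\rho,\cdot)=\int_0^\infty(\lambda+\mathbf{i}\rho)^r\,dE_\lambda(\mathcal{F}_tu(\rho,\cdot))$ and $\mathcal{F}_t(\mathcal{H}^r_\ast u)(\rho,\cdot)=\int_0^\infty(\lambda-\mathbf{i}\rho)^r\,dE_\lambda(\mathcal{F}_tu(\rho,\cdot))$ for $0<r\le1$. Spaces: $\mathbb{H}^a(\mathbb{R}^{n+1})$ has norm $\|u\|^2_{\mathbb{H}^a}=\int_{\mathbb{R}^{n+1}}(1+(|\xi|^4+\rho^2)^{1/2})^{a}|\widehat u(\rho,\xi)|^2\,d\rho\,d\xi$; $\mathbb{H}^s_E$ is the subspace of functions supported in the closed set $E$. Solution of the nonlocal problem: the unique $u\in\mathbb{H}^s(\mathbb{R}^{n+1})$ with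 $u-f\in\mathbb{H}^s_{\overline{\Omega_T}}$ ($f$ extended by zero) and $\langle\mathcal{H}^{s/2}u,\mathcal{H}^{s/2}_\ast\phi\rangle_{\mathbb{R}^{n+1}}=0$ for all $\phi\in\mathbb{H}^s_{\overline{\Omega_T}}$. *)

theory Defs
  imports "HOL-Analysis.Analysis"
begin

section \<open>Test functions, Lipschitz domains, weak derivatives\<close>

abbreviation dir_deriv ::
  "('a::euclidean_space \<Rightarrow> 'b::real_normed_vector) \<Rightarrow> 'a \<Rightarrow> 'a \<Rightarrow> 'b" where
  "dir_deriv f v x \<equiv> frechet_derivative f (at x) v"

primrec Ck :: "nat \<Rightarrow> ('a::euclidean_space \<Rightarrow> 'b::real_normed_vector) \<Rightarrow> bool" where
  "Ck 0 f \<longleftrightarrow> continuous_on UNIV f"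
| "Ck (Suc k) f \<longleftrightarrow> (\<forall>x. f differentiable (at x)) \<and> (\<forall>v\<in>Basis. Ck k (dir_deriv f v))"

definition test_functions ::
  "'a set \<Rightarrow> ('a::euclidean_space \<Rightarrow> 'b::real_normed_vector) set" where
  "test_functions D =
     {\<phi>. (\<forall>k. Ck k \<phi>) \<and> compact (closure {x. \<phi> x \<noteq> 0}) \<and> closure {x. \<phi> x \<noteq> 0} \<subseteq> D}"

text \<open>Near each boundary point, the set is the strict epigraph, in the direction of a unit vector
  \<open>\<nu>\<close>, of a Lipschitz function on the hyperplane orthogonal to \<open>\<nu>\<close>.\<close>

definition lipschitz_boundary :: "(real ^ 'n) set \<Rightarrow> bool" where
  "lipschitz_boundary \<Omega> \<longleftrightarrow>
     (\<forall>q\<in>frontier \<Omega>. \<exists>r>0. \<exists>\<nu> \<gamma> M. norm \<nu> = 1 \<and> M-lipschitz_on {y. y \<bullet> \<nu> = 0} \<gamma> \<and>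
        (\<forall>x\<in>ball q r. x \<in> \<Omega> \<longleftrightarrow> \<gamma> (x - (x \<bullet> \<nu>) *\<^sub>R \<nu>) < x \<bullet> \<nu>))"

text \<open>Real-valued test functions suffice for complex-valued \<open>f\<close> and \<open>g\<close>, by linearity.\<close>

definition weak_deriv ::
  "'a set \<Rightarrow> 'a \<Rightarrow> ('a::euclidean_space \<Rightarrow> complex) \<Rightarrow> ('a \<Rightarrow> complex) \<Rightarrow> bool" where
  "weak_deriv D v f g \<longleftrightarrow>
     (\<forall>\<phi>\<in>test_functions D.
        (LINT x:D|lborel. f x * of_real (dir_deriv \<phi> v x))
          = - (LINT x:D|lborel. g x * of_real (\<phi> x)))"


section \<open>Square-integrable functions\<close>

text \<open>Elements of \<open>L\<^sup>2\<close> are represented by Borel functions; equality is equality almost everywhere.\<close>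

definition L2 :: "('a::euclidean_space \<Rightarrow> complex) set" where
  "L2 = {f. f \<in> borel_measurable lborel \<and> integrable lborel (\<lambda>x. (norm (f x))\<^sup>2)}"

definition L2_inner :: "('a::euclidean_space \<Rightarrow> complex) \<Rightarrow> ('a \<Rightarrow> complex) \<Rightarrow> complex" where
  "L2_inner f g = (LINT x|lborel. f x * cnj (g x))"

definition L2_dist_sq :: "('a::euclidean_space \<Rightarrow> complex) \<Rightarrow> ('a \<Rightarrow> complex) \<Rightarrow> ennreal" where
  "L2_dist_sq f g = (\<integral>\<^sup>+ x. ennreal ((norm (f x - g x))\<^sup>2) \<partial>lborel)"

definition loc_L2 :: "'a set \<Rightarrow> ('a::euclidean_space \<Rightarrow> complex) \<Rightarrow> bool" where
  "loc_L2 D f \<longleftrightarrow> set_borel_measurable lborel D f \<and>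
     (\<forall>K. compact K \<and> K \<subseteq> D \<longrightarrow> set_integrable lborel K (\<lambda>x. (norm (f x))\<^sup>2))"


section \<open>Spectral calculus on \<open>L\<^sup>2\<close>\<close>

definition resolution_of_identity ::
  "(real \<Rightarrow> ('a::euclidean_space \<Rightarrow> complex) \<Rightarrow> ('a \<Rightarrow> complex)) \<Rightarrow> bool" where
  "resolution_of_identity E \<longleftrightarrow>
     (\<forall>l. \<forall>f\<in>L2. E l f \<in> L2) \<and>
     (\<forall>l. \<forall>f\<in>L2. \<forall>g\<in>L2. \<forall>a b.
        AE x in lborel. E l (\<lambda>y. a * f y + b * g y) x = a * E l f x + b * E l g x) \<and>
     (\<forall>l. \<forall>f\<in>L2. \<forall>g\<in>L2. L2_inner (E l f) g = L2_inner f (E l g)) \<and>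
     (\<forall>l m. \<forall>f\<in>L2. AE x in lborel. E l (E m f) x = E (min l m) f x) \<and>
     (\<forall>l<0. \<forall>f\<in>L2. AE x in lborel. E l f x = 0) \<and>
     (\<forall>l. \<forall>f\<in>L2. ((\<lambda>m. L2_dist_sq (E m f) (E l f)) \<longlongrightarrow> 0) (at_right l)) \<and>
     (\<forall>f\<in>L2. ((\<lambda>m. L2_dist_sq (E m f) f) \<longlongrightarrow> 0) at_top)"

text \<open>The measure \<open>d\<langle>E\<^sub>\<lambda> f, f\<rangle>\<close>; it has no mass on the negative half-line, and a possible atom at
  \<open>0\<close> is counted, so integrals against it are integrals over \<open>[0,\<infinity>)\<close>.\<close>

definition spectral_measure ::
  "(real \<Rightarrow> ('a::euclidean_space \<Rightarrow> complex) \<Rightarrow> ('a \<Rightarrow> complex)) \<Rightarrow> ('a \<Rightarrow> complex) \<Rightarrow> real measure"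
  where
  "spectral_measure E f = interval_measure (\<lambda>l. Re (L2_inner (E l f) f))"

text \<open>The integral of \<open>g\<close> against the complex measure \<open>d\<langle>E\<^sub>\<lambda> f, k\<rangle>\<close>, which is expressed by
  polarization.\<close>

definition spectral_pairing ::
  "(real \<Rightarrow> ('a::euclidean_space \<Rightarrow> complex) \<Rightarrow> ('a \<Rightarrow> complex)) \<Rightarrow>
     (real \<Rightarrow> complex) \<Rightarrow> ('a \<Rightarrow> complex) \<Rightarrow> ('a \<Rightarrow> complex) \<Rightarrow> complex" where
  "spectral_pairing E g f k =
     (\<Sum>m<4. \<i> ^ m * (LINT l|spectral_measure E (\<lambda>x. f x + \<i> ^ m * k x). g l)) / 4"

definition spectral_domain ::
  "(real \<Rightarrow> ('a::euclidean_space \<Rightarrow> complex) \<Rightarrow> ('a \<Rightarrow> complex)) \<Rightarrow>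
     (real \<Rightarrow> complex) \<Rightarrow> ('a \<Rightarrow> complex) set" where
  "spectral_domain E g = {f \<in> L2. integrable (spectral_measure E f) (\<lambda>l. (norm (g l))\<^sup>2)}"

text \<open>\<open>h\<close> is \<open>\<integral> g(\<lambda>) dE\<^sub>\<lambda> f\<close>. Testing against the spectral domain determines \<open>h\<close>, since this domain
  is dense; for other \<open>k\<close> the four integrals in the polarized pairing need not converge separately.\<close>

definition is_spectral_integral ::
  "(real \<Rightarrow> ('a::euclidean_space \<Rightarrow> complex) \<Rightarrow> ('a \<Rightarrow> complex)) \<Rightarrow>
     (real \<Rightarrow> complex) \<Rightarrow> ('a \<Rightarrow> complex) \<Rightarrow> ('a \<Rightarrow> complex) \<Rightarrow> bool" where
  "is_spectral_integral E g f h \<longleftrightarrow>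
     f \<in> spectral_domain E g \<and> h \<in> L2 \<and>
     (\<forall>k\<in>spectral_domain E g. L2_inner h k = spectral_pairing E g f k)"


section \<open>The divergence-form operator\<close>

definition admissible :: "(real ^ 'n \<Rightarrow> real ^ 'n ^ 'n) \<Rightarrow> bool" where
  "admissible \<sigma> \<longleftrightarrow>
     (\<forall>x. transpose (\<sigma> x) = \<sigma> x) \<and>
     (\<exists>c0. 0 < c0 \<and> c0 < 1 \<and>
        (\<forall>x \<xi>. c0 * (norm \<xi>)\<^sup>2 \<le> (\<Sum>i\<in>UNIV. \<Sum>k\<in>UNIV. \<sigma> x $ i $ k * \<xi> $ i * \<xi> $ k) \<and>
           (\<Sum>i\<in>UNIV. \<Sum>k\<in>UNIV. \<sigma> x $ i $ k * \<xi> $ i * \<xi> $ k) \<le> inverse c0 * (norm \<xi>)\<^sup>2)) \<and>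
     (\<exists>C0>0. \<forall>x z. norm (\<sigma> x - \<sigma> z) \<le> C0 * norm (x - z))"

text \<open>The graph of \<open>-\<nabla>\<cdot>(\<sigma>\<nabla>)\<close> as a self-adjoint operator on \<open>L\<^sup>2\<close>: \<open>f\<close> lies in \<open>H\<^sup>1\<close>, with weak
  gradient \<open>G\<close>, and \<open>-\<nabla>\<cdot>(\<sigma> G) = h\<close> in the sense of distributions, with \<open>h\<close> in \<open>L\<^sup>2\<close>.\<close>

definition div_form_op ::
  "(real ^ 'n \<Rightarrow> real ^ 'n ^ 'n) \<Rightarrow> (real ^ 'n \<Rightarrow> complex) \<Rightarrow> (real ^ 'n \<Rightarrow> complex) \<Rightarrow> bool" where
  "div_form_op \<sigma> f h \<longleftrightarrow> f \<in> L2 \<and> h \<in> L2 \<and>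
     (\<exists>G :: real ^ 'n \<Rightarrow> complex ^ 'n.
        (\<forall>i. (\<lambda>x. G x $ i) \<in> L2 \<and> weak_deriv UNIV (axis i 1) f (\<lambda>x. G x $ i)) \<and>
        (\<forall>\<phi>\<in>test_functions UNIV.
           (LINT x|lborel. (\<Sum>i\<in>UNIV. \<Sum>k\<in>UNIV.
              of_real (\<sigma> x $ i $ k) * G x $ k * of_real (dir_deriv \<phi> (axis i 1) x)))
           = (LINT x|lborel. h x * of_real (\<phi> x))))"

definition spectral_resolution ::
  "(real ^ 'n \<Rightarrow> real ^ 'n ^ 'n) \<Rightarrow>
     (real \<Rightarrow> (real ^ 'n \<Rightarrow> complex) \<Rightarrow> (real ^ 'n \<Rightarrow> complex)) \<Rightarrow> bool" where
  "spectral_resolution \<sigma> E \<longleftrightarrow> resolution_of_identity E \<and>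
     (\<forall>f h. div_form_op \<sigma> f h \<longleftrightarrow> is_spectral_integral E of_real f h)"

text \<open>The heat kernel \<open>p x z \<tau>\<close> is the continuous integral kernel of the heat semigroup
  \<open>\<integral> exp(-\<tau>\<lambda>) dE\<^sub>\<lambda>\<close>. The spectral resolution of the operator is unique up to equality almost
  everywhere, so the existential quantifier, here and below, only names it.\<close>

definition heat_kernel ::
  "(real ^ 'n \<Rightarrow> real ^ 'n ^ 'n) \<Rightarrow> (real ^ 'n \<Rightarrow> real ^ 'n \<Rightarrow> real \<Rightarrow> real) \<Rightarrow> bool" where
  "heat_kernel \<sigma> p \<longleftrightarrow>
     continuous_on {(x, z, \<tau>). 0 < \<tau>} (\<lambda>(x, z, \<tau>). p x z \<tau>) \<and>
     (\<exists>E. spectral_resolution \<sigma> E \<and>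
        (\<forall>\<tau>>0. \<forall>g\<in>L2.
           (AE x in lborel. integrable lborel (\<lambda>z. of_real (p x z \<tau>) * g z)) \<and>
           is_spectral_integral E (\<lambda>l. of_real (exp (- \<tau> * l))) g
             (\<lambda>x. LINT z|lborel. of_real (p x z \<tau>) * g z)))"


section \<open>Fourier transforms and parabolic Sobolev spaces\<close>

text \<open>Fourier--Plancherel transforms as \<open>L\<^sup>2\<close>-limits of truncated integrals. They are not
  normalized; the normalization affects neither the fractional operators nor the spaces below.\<close>

definition is_fourier :: "('a::euclidean_space \<Rightarrow> complex) \<Rightarrow> ('a \<Rightarrow> complex) \<Rightarrow> bool" where
  "is_fourier u v \<longleftrightarrow> v \<in> L2 \<and>
     ((\<lambda>R. L2_dist_sq (\<lambda>\<eta>. LINT y:cball 0 R|lborel. cis (- (y \<bullet> \<eta>)) * u y) v) \<longlongrightarrow> 0) at_top"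

definition is_time_fourier ::
  "(real \<times> (real ^ 'n) \<Rightarrow> complex) \<Rightarrow> (real \<times> (real ^ 'n) \<Rightarrow> complex) \<Rightarrow> bool" where
  "is_time_fourier u v \<longleftrightarrow> v \<in> L2 \<and>
     ((\<lambda>R. L2_dist_sq (\<lambda>(\<rho>, x). LINT t:{-R..R}|lborel. cis (- (t * \<rho>)) * u (t, x)) v)
        \<longlongrightarrow> 0) at_top"

text \<open>This describes the space only for \<open>a \<ge> 0\<close>, where its elements are functions in \<open>L\<^sup>2\<close>.\<close>

definition parabolic_H :: "real \<Rightarrow> (real \<times> (real ^ 'n) \<Rightarrow> complex) set" where
  "parabolic_H a = {u \<in> L2. \<exists>v. is_fourier u v \<and>
     integrable lborel
       (\<lambda>(\<rho>, \<xi>). (1 + sqrt ((norm \<xi>) ^ 4 + \<rho>\<^sup>2)) powr a * (norm (v (\<rho>, \<xi>)))\<^sup>2)}"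

definition parabolic_H_supp ::
  "real \<Rightarrow> (real \<times> (real ^ 'n)) set \<Rightarrow> (real \<times> (real ^ 'n) \<Rightarrow> complex) set" where
  "parabolic_H_supp a F = {u \<in> parabolic_H a. AE q in lborel. q \<notin> F \<longrightarrow> u q = 0}"


section \<open>The nonlocal parabolic problem\<close>

text \<open>\<open>w\<close> is \<open>\<H>\<^sup>r u\<close>, respectively \<open>\<H>\<^sub>*\<^sup>r u\<close>, as an element of \<open>L\<^sup>2\<close>.\<close>

definition frac_heat ::
  "(real ^ 'n \<Rightarrow> real ^ 'n ^ 'n) \<Rightarrow> real \<Rightarrow>
     (real \<times> (real ^ 'n) \<Rightarrow> complex) \<Rightarrow> (real \<times> (real ^ 'n) \<Rightarrow> complex) \<Rightarrow> bool" where
  "frac_heat \<sigma> r u w \<longleftrightarrow> u \<in> L2 \<and> w \<in> L2 \<and>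
     (\<exists>E u' w'. spectral_resolution \<sigma> E \<and> is_time_fourier u u' \<and> is_time_fourier w w' \<and>
        (AE \<rho> in lborel.
           is_spectral_integral E (\<lambda>l. (of_real l + \<i> * of_real \<rho>) powr of_real r)
             (\<lambda>x. u' (\<rho>, x)) (\<lambda>x. w' (\<rho>, x))))"

definition frac_heat_adj ::
  "(real ^ 'n \<Rightarrow> real ^ 'n ^ 'n) \<Rightarrow> real \<Rightarrow>
     (real \<times> (real ^ 'n) \<Rightarrow> complex) \<Rightarrow> (real \<times> (real ^ 'n) \<Rightarrow> complex) \<Rightarrow> bool" where
  "frac_heat_adj \<sigma> r u w \<longleftrightarrow> u \<in> L2 \<and> w \<in> L2 \<and>
     (\<exists>E u' w'. spectral_resolution \<sigma> E \<and> is_time_fourier u u' \<and> is_time_fourier w w' \<and>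
        (AE \<rho> in lborel.
           is_spectral_integral E (\<lambda>l. (of_real l - \<i> * of_real \<rho>) powr of_real r)
             (\<lambda>x. u' (\<rho>, x)) (\<lambda>x. w' (\<rho>, x))))"

definition cyl :: "real \<Rightarrow> 'a set \<Rightarrow> (real \<times> 'a) set" where
  "cyl T B = {-T<..<T} \<times> B"

text \<open>The weak equation \<open>\<langle>\<H>\<^bsup>s/2\<^esup> u, \<H>\<^sub>*\<^bsup>s/2\<^esup> \<phi>\<rangle> = 0\<close>; both arguments of the pairing exist in \<open>L\<^sup>2\<close> for
  \<open>u\<close> and \<open>\<phi>\<close> in the parabolic space of order \<open>s\<close>, and are unique almost everywhere.\<close>

definition nonlocal_solution ::
  "(real ^ 'n \<Rightarrow> real ^ 'n ^ 'n) \<Rightarrow> real \<Rightarrow> real \<Rightarrow> (real ^ 'n) set \<Rightarrow>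
     (real \<times> (real ^ 'n) \<Rightarrow> complex) \<Rightarrow> (real \<times> (real ^ 'n) \<Rightarrow> complex) \<Rightarrow> bool" where
  "nonlocal_solution \<sigma> s T \<Omega> f u \<longleftrightarrow>
     u \<in> parabolic_H s \<and>
     (\<lambda>q. u q - f q) \<in> parabolic_H_supp s (closure (cyl T \<Omega>)) \<and>
     (\<exists>w. frac_heat \<sigma> (s / 2) u w \<and>
        (\<forall>\<phi>\<in>parabolic_H_supp s (closure (cyl T \<Omega>)).
           \<exists>v. frac_heat_adj \<sigma> (s / 2) \<phi> v \<and> L2_inner w v = 0))"


section \<open>The extended equation in the variables \<open>(t, \<tau>, x)\<close>\<close>

text \<open>Weak solutions of \<open>(\<partial>\<^sub>t + \<partial>\<^sub>\<tau>) U - \<nabla>\<cdot>(\<sigma>\<nabla>U) = 0\<close> in \<open>D\<close>; \<open>G\<close> is the weak gradient in \<open>x\<close>.\<close>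

definition weak_extension_solution ::
  "(real ^ 'n \<Rightarrow> real ^ 'n ^ 'n) \<Rightarrow> (real \<times> real \<times> (real ^ 'n)) set \<Rightarrow>
     (real \<Rightarrow> real \<Rightarrow> real ^ 'n \<Rightarrow> complex) \<Rightarrow> bool" where
  "weak_extension_solution \<sigma> D U \<longleftrightarrow>
     loc_L2 D (\<lambda>(t, \<tau>, x). U t \<tau> x) \<and>
     (\<exists>G :: real \<times> real \<times> (real ^ 'n) \<Rightarrow> complex ^ 'n.
        (\<forall>i. loc_L2 D (\<lambda>q. G q $ i) \<and>
             weak_deriv D (0, 0, axis i 1) (\<lambda>(t, \<tau>, x). U t \<tau> x) (\<lambda>q. G q $ i)) \<and>
        (\<forall>\<phi>\<in>test_functions D.
           (LINT (t, \<tau>, x):D|lborel.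
              - U t \<tau> x * of_real (dir_deriv \<phi> (1, 0, 0) (t, \<tau>, x) + dir_deriv \<phi> (0, 1, 0) (t, \<tau>, x))
              + (\<Sum>i\<in>UNIV. \<Sum>k\<in>UNIV. of_real (\<sigma> x $ i $ k) * G (t, \<tau>, x) $ k *
                   of_real (dir_deriv \<phi> (0, 0, axis i 1) (t, \<tau>, x)))) = 0))"

end

theory Submission
  imports Defs "HOL-Probability.Probability"
begin

text \<open>Integrating by parts in \<open>\<lambda>\<close>, the heat semigroup is weakly \<open>P\<^sub>\<tau> g = \<integral> \<tau> exp (- \<tau> \<lambda>) E\<^sub>\<lambda> g d\<lambda>\<close> over
  \<open>[0,\<infinity>)\<close>, which is linear in \<open>g\<close> and avoids complex spectral measures. It yields contractivity,
  strong continuity at \<open>0\<close>, and the convergence in \<open>L\<^sup>2\<close> of the difference quotients of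
  \<open>\<tau> \<mapsto> P\<^sub>\<tau> g\<close> to a function of norm at most \<open>6 / \<tau> * \<parallel>g\<parallel>\<close>, which is minus the image of
  \<open>P\<^sub>\<tau> g\<close> under the divergence-form operator. Density of test functions in \<open>H\<^sup>1\<close> gives the energy
  estimate for the gradient of \<open>P\<^sub>\<tau> g\<close>. As \<open>U(t,\<tau>,\<cdot>) = P\<^sub>\<tau> u(t - \<tau>,\<cdot>)\<close>, the field \<open>\<partial>\<^sub>t + \<partial>\<^sub>\<tau>\<close> acts
  along the lines where \<open>t - \<tau>\<close> is constant and the equation follows slice by slice. The initial
  value follows from \<open>\<parallel>P\<^sub>\<tau> u(t - \<tau>) - u(t)\<parallel> \<le> \<parallel>u(t - \<tau>) - u(t)\<parallel> + \<parallel>P\<^sub>\<tau> u(t) - u(t)\<parallel>\<close> and continuity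
  of translations in \<open>L\<^sup>2\<close>.\<close>

section \<open>The geometry of \<open>L\<^sup>2\<close>\<close>

text \<open>\<open>is_spectral_integral\<close> is phrased by four polarized integrals against
  measures, on a test space that changes with the integrated function. The functions
  \<open>\<lambda> -> <E_\<lambda> g, k>\<close> are bounded for all g and k in L2, so every bound
  on the semigroup reduces to the L1 norm of an explicit weight in \<lambda>; the constant 6 is the
  integral of the majorant \<open>(1 + m) exp (- m / 2)\<close> over
  \<open>[0, \<infinity>)\<close>. Three obstacles shape the rest. No time derivative of u in L2 is
  at hand, so U is differentiated neither in t nor in \<tau> alone: difference quotients are taken
  in the direction \<open>(1, 1, 0)\<close> only. The gradient of a slice and its image under the
  operator are chosen slice by slice, without measurability in (t, \<tau>); what is needed of it is
  recovered by writing them as limits of jointly Borel expressions. Finally only almost every slice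
  of u lies in L2, so the flow is built from a modification of u and compared with U almost
  everywhere.\<close>

definition L2_norm :: "('a::euclidean_space \<Rightarrow> complex) \<Rightarrow> real" where
  "L2_norm f = sqrt (LINT x|lborel. (norm (f x))\<^sup>2)"

lemma L2_measurable [measurable_dest]: "f \<in> L2 \<Longrightarrow> f \<in> borel_measurable borel"
  by (simp add: L2_def)

lemma L2_integrable_sq: "f \<in> L2 \<Longrightarrow> integrable lborel (\<lambda>x. (norm (f x))\<^sup>2)"
  by (simp add: L2_def)

lemma L2_nn_iff:
  "f \<in> L2 \<longleftrightarrow> f \<in> borel_measurable borel \<and> (\<integral>\<^sup>+ x. ennreal ((norm (f x))\<^sup>2) \<partial>lborel) < \<infinity>"
  by (auto simp: L2_def integrable_iff_bounded)

lemma L2_integrable_prod: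
  assumes "f \<in> L2" "g \<in> L2"
  shows "integrable lborel (\<lambda>x. f x * g x)"
proof (rule Bochner_Integration.integrable_bound)
  show "integrable lborel (\<lambda>x. (norm (f x))\<^sup>2 + (norm (g x))\<^sup>2)"
    using assms by (simp add: L2_integrable_sq)
  show "(\<lambda>x. f x * g x) \<in> borel_measurable lborel"
    using assms by measurable
  have "a * b \<le> a\<^sup>2 + b\<^sup>2" if "a \<ge> 0" "b \<ge> 0" for a b :: real
    using sum_squares_bound[of a b] mult_nonneg_nonneg[OF that] by linarith
  then show "AE x in lborel. norm (f x * g x) \<le> norm ((norm (f x))\<^sup>2 + (norm (g x))\<^sup>2)"
    by (simp add: norm_mult)
qed

lemma measurable_cnj [measurable]: "cnj \<in> borel_measurable borel"
  by (intro borel_measurable_continuous_onI continuous_intros)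

lemma L2_cnj: "f \<in> L2 \<Longrightarrow> (\<lambda>x. cnj (f x)) \<in> L2"
  by (simp add: L2_def measurable_compose[OF _ measurable_cnj])

lemma L2_integrable_inner:
  "f \<in> L2 \<Longrightarrow> g \<in> L2 \<Longrightarrow> integrable lborel (\<lambda>x. f x * cnj (g x))"
  by (intro L2_integrable_prod L2_cnj)

lemma L2_scale [intro]: "f \<in> L2 \<Longrightarrow> (\<lambda>x. c * f x) \<in> L2"
  by (auto simp: L2_def norm_mult power_mult_distrib)

lemma L2_zero [simp, intro]: "(\<lambda>x. 0) \<in> L2"
  by (simp add: L2_def)

lemma L2_add [intro]:
  assumes "f \<in> L2" "g \<in> L2"
  shows "(\<lambda>x. f x + g x) \<in> L2"
  unfolding L2_def
proof (intro CollectI conjI)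
  show "(\<lambda>x. f x + g x) \<in> borel_measurable lborel"
    using assms by measurable
  show "integrable lborel (\<lambda>x. (norm (f x + g x))\<^sup>2)"
  proof (rule Bochner_Integration.integrable_bound)
    show "integrable lborel (\<lambda>x. 2 * (norm (f x))\<^sup>2 + 2 * (norm (g x))\<^sup>2)"
      using assms by (simp add: L2_integrable_sq)
    show "(\<lambda>x. (norm (f x + g x))\<^sup>2) \<in> borel_measurable lborel"
      using assms by measurable
    have "(norm (a + b))\<^sup>2 \<le> 2 * (norm a)\<^sup>2 + 2 * (norm b)\<^sup>2" for a b :: complex
    proof -
      have "(norm (a + b))\<^sup>2 \<le> (norm a + norm b)\<^sup>2"
        by (intro power_mono norm_triangle_ineq) auto
      then show ?thesis
        using sum_squares_bound[of "norm a" "norm b"] by (simp add: power2_sum)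
    qed
    then show "AE x in lborel. norm ((norm (f x + g x))\<^sup>2)
        \<le> norm (2 * (norm (f x))\<^sup>2 + 2 * (norm (g x))\<^sup>2)"
      by simp
  qed
qed

lemma L2_uminus [intro]: "f \<in> L2 \<Longrightarrow> (\<lambda>x. - f x) \<in> L2"
  using L2_scale[of f "-1"] by simp

lemma L2_diff [intro]: "f \<in> L2 \<Longrightarrow> g \<in> L2 \<Longrightarrow> (\<lambda>x. f x - g x) \<in> L2"
  using L2_add[of f "\<lambda>x. - g x"] by auto

lemma L2_divide [intro]: "f \<in> L2 \<Longrightarrow> (\<lambda>x. f x / c) \<in> L2"
  using L2_scale[of f "1 / c"] by simp

lemma L2_bounded_mult:
  assumes "f \<in> L2" and [measurable]: "b \<in> borel_measurable borel" and b: "\<And>x. norm (b x) \<le> C"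
  shows "(\<lambda>x. b x * f x) \<in> L2"
  unfolding L2_def
proof (intro CollectI conjI)
  show m: "(\<lambda>x. b x * f x) \<in> borel_measurable lborel"
    using assms(1) by measurable
  show "integrable lborel (\<lambda>x. (norm (b x * f x))\<^sup>2)"
  proof (rule Bochner_Integration.integrable_bound)
    show "integrable lborel (\<lambda>x. C\<^sup>2 * (norm (f x))\<^sup>2)"
      using assms by (simp add: L2_integrable_sq)
    show "(\<lambda>x. (norm (b x * f x))\<^sup>2) \<in> borel_measurable lborel"
      using m by measurable
    show "AE x in lborel. norm ((norm (b x * f x))\<^sup>2) \<le> norm (C\<^sup>2 * (norm (f x))\<^sup>2)"
      using b by (auto simp: norm_mult power_mult_distrib intro!: mult_right_mono power_mono)
  qed
qed

lemma L2_inner_commute: "L2_inner g f = cnj (L2_inner f g)"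
  unfolding L2_inner_def
  by (subst Bochner_Integration.integral_cnj[symmetric]) (simp add: mult.commute)

lemma L2_inner_lincomb_left:
  assumes "f \<in> L2" "g \<in> L2" "k \<in> L2"
  shows "L2_inner (\<lambda>x. a * f x + b * g x) k = a * L2_inner f k + b * L2_inner g k"
  using L2_integrable_inner[OF assms(1,3)] L2_integrable_inner[OF assms(2,3)]
  by (simp add: L2_inner_def distrib_right mult.assoc)

lemma L2_inner_lincomb_right:
  assumes "f \<in> L2" "g \<in> L2" "k \<in> L2"
  shows "L2_inner k (\<lambda>x. a * f x + b * g x) = cnj a * L2_inner k f + cnj b * L2_inner k g"
  using L2_inner_lincomb_left[OF assms]
  by (subst L2_inner_commute) (simp flip: L2_inner_commute)

lemma L2_inner_diff_left:
  "f \<in> L2 \<Longrightarrow> g \<in> L2 \<Longrightarrow> k \<in> L2 \<Longrightarrow> L2_inner (\<lambda>x. f x - g x) k = L2_inner f k - L2_inner g k"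
  using L2_inner_lincomb_left[of f g k 1 "-1"] by simp

lemma L2_inner_diff_right:
  "f \<in> L2 \<Longrightarrow> g \<in> L2 \<Longrightarrow> k \<in> L2 \<Longrightarrow> L2_inner k (\<lambda>x. f x - g x) = L2_inner k f - L2_inner k g"
  using L2_inner_lincomb_right[of f g k 1 "-1"] by simp

lemma L2_inner_cong_AE:
  assumes "f \<in> L2" "f' \<in> L2" "AE x in lborel. f x = f' x"
    and "g \<in> L2" "g' \<in> L2" "AE x in lborel. g x = g' x"
  shows "L2_inner f g = L2_inner f' g'"
  unfolding L2_inner_def
proof (rule integral_cong_AE)
  show "AE x in lborel. f x * cnj (g x) = f' x * cnj (g' x)"
    using assms(3,6) by eventually_elim simp
qed (use assms in measurable)

lemma L2_norm_nonneg [simp]: "0 \<le> L2_norm f"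
  by (simp add: L2_norm_def)

lemma L2_norm_sq: "(L2_norm f)\<^sup>2 = (LINT x|lborel. (norm (f x))\<^sup>2)"
  by (simp add: L2_norm_def)

lemma L2_norm_sq_nn: "f \<in> L2 \<Longrightarrow> ennreal ((L2_norm f)\<^sup>2) = (\<integral>\<^sup>+ x. ennreal ((norm (f x))\<^sup>2) \<partial>lborel)"
  by (simp add: L2_norm_sq nn_integral_eq_integral L2_integrable_sq)

lemma L2_norm_cong_AE:
  assumes [measurable]: "f \<in> borel_measurable borel" "g \<in> borel_measurable borel"
    and "AE x in lborel. f x = g x"
  shows "L2_norm f = L2_norm g"
proof -
  have "(LINT x|lborel. (norm (f x))\<^sup>2) = (LINT x|lborel. (norm (g x))\<^sup>2)"
    by (rule integral_cong_AE) (use assms(3) in auto)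
  then show ?thesis
    by (simp add: L2_norm_def)
qed

lemma L2_inner_self: "L2_inner f f = of_real ((L2_norm f)\<^sup>2)"
  by (simp add: L2_inner_def L2_norm_sq complex_norm_square[symmetric] flip: of_real_power integral_of_real)

lemma L2_norm_scale: "L2_norm (\<lambda>x. c * f x) = norm c * L2_norm f"
  by (simp add: L2_norm_def norm_mult power_mult_distrib real_sqrt_mult)

lemma L2_norm_uminus [simp]: "L2_norm (\<lambda>x. - f x) = L2_norm f"
  by (simp add: L2_norm_def)

lemma L2_norm_minus_commute: "L2_norm (\<lambda>x. f x - g x) = L2_norm (\<lambda>x. g x - f x)"
  by (simp add: L2_norm_def norm_minus_commute)

lemma L2_norm_zero [simp]: "L2_norm (\<lambda>x. 0) = 0"
  by (simp add: L2_norm_def)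

text \<open>Bounding the product of the norms is stronger than bounding the inner product, and it is
  a statement on nonnegative integrals; it is pulled back from \<open>ennreal\<close> by comparing
  squares.\<close>

lemma L2_cauchy_schwarz_nn:
  assumes "f \<in> L2" "g \<in> L2"
  shows "(LINT x|lborel. norm (f x) * norm (g x)) \<le> L2_norm f * L2_norm g"
proof -
  let ?I = "LINT x|lborel. norm (f x) * norm (g x)"
  have i: "integrable lborel (\<lambda>x. norm (f x) * norm (g x))"
    using integrable_norm[OF L2_integrable_prod[OF assms]] by (simp add: norm_mult)
  have nonneg: "?I \<ge> 0"
    by simp
  have "(\<integral>\<^sup>+x. ennreal (norm (f x)) * ennreal (norm (g x)) \<partial>lborel)\<^sup>2
     \<le> (\<integral>\<^sup>+x. ennreal (norm (f x)) ^ 2 \<partial>lborel) * (\<integral>\<^sup>+x. ennreal (norm (g x)) ^ 2 \<partial>lborel)"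
    by (rule Cauchy_Schwarz_nn_integral) (use assms in measurable)
  then have "(\<integral>\<^sup>+x. ennreal (norm (f x) * norm (g x)) \<partial>lborel)\<^sup>2
     \<le> ennreal ((L2_norm f)\<^sup>2) * ennreal ((L2_norm g)\<^sup>2)"
    by (simp add: L2_norm_sq_nn assms ennreal_power ennreal_mult)
  then have "ennreal (?I\<^sup>2) \<le> ennreal ((L2_norm f)\<^sup>2 * (L2_norm g)\<^sup>2)"
    by (subst (asm) nn_integral_eq_integral[OF i]) (auto simp: ennreal_power ennreal_mult)
  then have "?I\<^sup>2 \<le> (L2_norm f * L2_norm g)\<^sup>2"
    by (simp add: power_mult_distrib)
  then show ?thesis
    by (rule power2_le_imp_le) simp
qed

lemma L2_cauchy_schwarz:
  assumes "f \<in> L2" "g \<in> L2"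
  shows "norm (L2_inner f g) \<le> L2_norm f * L2_norm g"
proof -
  have "norm (L2_inner f g) \<le> (LINT x|lborel. norm (f x * cnj (g x)))"
    unfolding L2_inner_def by (rule integral_norm_bound)
  also have "\<dots> \<le> L2_norm f * L2_norm g"
    using L2_cauchy_schwarz_nn[OF assms] by (simp add: norm_mult)
  finally show ?thesis .
qed

lemma L2_norm_sq_diff:
  assumes "f \<in> L2" "g \<in> L2"
  shows "(L2_norm (\<lambda>x. f x - g x))\<^sup>2 = (L2_norm f)\<^sup>2 - 2 * Re (L2_inner f g) + (L2_norm g)\<^sup>2"
proof -
  have "L2_inner (\<lambda>x. f x - g x) (\<lambda>x. f x - g x)
      = L2_inner f f - L2_inner f g - L2_inner g f + L2_inner g g"
    using assms by (simp add: L2_inner_diff_left L2_inner_diff_right L2_diff)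
  then have "Re (L2_inner (\<lambda>x. f x - g x) (\<lambda>x. f x - g x))
      = Re (L2_inner f f) - Re (L2_inner f g) - Re (L2_inner g f) + Re (L2_inner g g)"
    by simp
  then show ?thesis
    by (subst (asm) (2) L2_inner_commute) (simp add: L2_inner_self)
qed

lemma L2_norm_triangle:
  assumes "f \<in> L2" "g \<in> L2"
  shows "L2_norm (\<lambda>x. f x + g x) \<le> L2_norm f + L2_norm g"
proof (rule power2_le_imp_le)
  have "(L2_norm (\<lambda>x. f x + g x))\<^sup>2 = (L2_norm f)\<^sup>2 - 2 * Re (L2_inner f (\<lambda>x. - g x)) + (L2_norm g)\<^sup>2"
    using L2_norm_sq_diff[of f "\<lambda>x. - g x"] assms by (simp add: L2_uminus)
  moreover have "- Re (L2_inner f (\<lambda>x. - g x)) \<le> L2_norm f * L2_norm g"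
    using L2_cauchy_schwarz[of f "\<lambda>x. - g x"] abs_Re_le_cmod[of "L2_inner f (\<lambda>x. - g x)"] assms
    by (simp add: L2_uminus)
  ultimately show "(L2_norm (\<lambda>x. f x + g x))\<^sup>2 \<le> (L2_norm f + L2_norm g)\<^sup>2"
    by (simp add: power2_sum)
qed simp

lemma L2_norm_triangle_diff:
  assumes "f \<in> L2" "g \<in> L2"
  shows "L2_norm (\<lambda>x. f x - g x) \<le> L2_norm f + L2_norm g"
  using L2_norm_triangle[of f "\<lambda>x. - g x"] assms by (simp add: L2_uminus)

lemma L2_norm_triangle3:
  assumes "f \<in> L2" "g \<in> L2" "h \<in> L2"
  shows "L2_norm (\<lambda>x. f x - h x) \<le> L2_norm (\<lambda>x. f x - g x) + L2_norm (\<lambda>x. g x - h x)"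
  using L2_norm_triangle[of "\<lambda>x. f x - g x" "\<lambda>x. g x - h x"] assms by (simp add: L2_diff)

lemma L2_norm_diff_abs:
  assumes "f \<in> L2" "g \<in> L2"
  shows "\<bar>L2_norm f - L2_norm g\<bar> \<le> L2_norm (\<lambda>x. f x - g x)"
  using L2_norm_triangle[of "\<lambda>x. f x - g x" g] L2_norm_triangle[of "\<lambda>x. g x - f x" f]
    L2_norm_minus_commute[of f g] assms
  by (simp add: L2_diff abs_le_iff)

text \<open>A weakly defined element is known only through its pairings. Testing it against itself
  turns a bound on the pairings into a bound on its norm.\<close>

lemma L2_norm_le_by_inner:
  assumes "f \<in> L2" and "norm (L2_inner f f) \<le> C * L2_norm f" and "0 \<le> C"
  shows "L2_norm f \<le> C"
proof (cases "L2_norm f = 0")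
  case False
  then have "L2_norm f > 0"
    using L2_norm_nonneg[of f] by linarith
  moreover have "L2_norm f * L2_norm f \<le> C * L2_norm f"
    using assms(2) by (simp add: L2_inner_self power2_eq_square norm_mult)
  ultimately show ?thesis
    by (simp add: mult_le_cancel_right)
qed (use assms in auto)

section \<open>Convergence in the norm of L2\<close>

lemma L2_dist_sq_eq:
  "f \<in> L2 \<Longrightarrow> g \<in> L2 \<Longrightarrow> L2_dist_sq f g = ennreal ((L2_norm (\<lambda>x. f x - g x))\<^sup>2)"
  by (simp add: L2_dist_sq_def L2_norm_sq_nn L2_diff)

lemma L2_dist_sq_tendsto_0:
  assumes "\<And>m. F m \<in> L2" "f \<in> L2" "((\<lambda>m. L2_dist_sq (F m) f) \<longlongrightarrow> 0) A"
  shows "((\<lambda>m. L2_norm (\<lambda>x. F m x - f x)) \<longlongrightarrow> 0) A"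
proof -
  have "((\<lambda>m. ennreal ((L2_norm (\<lambda>x. F m x - f x))\<^sup>2)) \<longlongrightarrow> ennreal 0) A"
    using assms by (simp add: L2_dist_sq_eq)
  then have "((\<lambda>m. (L2_norm (\<lambda>x. F m x - f x))\<^sup>2) \<longlongrightarrow> 0) A"
    by (rule tendsto_ennrealD) auto
  from tendsto_real_sqrt[OF this] show ?thesis
    by simp
qed

lemma L2_inner_tendsto_left:
  assumes "\<And>m. F m \<in> L2" "f \<in> L2" "k \<in> L2"
    and "((\<lambda>m. L2_norm (\<lambda>x. F m x - f x)) \<longlongrightarrow> 0) A"
  shows "((\<lambda>m. L2_inner (F m) k) \<longlongrightarrow> L2_inner f k) A"
proof (rule Lim_transform)
  show "((\<lambda>m. L2_inner f k) \<longlongrightarrow> L2_inner f k) A"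
    by simp
  have "((\<lambda>m. L2_norm (\<lambda>x. F m x - f x) * L2_norm k) \<longlongrightarrow> 0 * L2_norm k) A"
    by (intro tendsto_mult tendsto_const assms)
  then have b: "((\<lambda>m. L2_norm (\<lambda>x. F m x - f x) * L2_norm k) \<longlongrightarrow> 0) A"
    by simp
  have "((\<lambda>m. L2_inner (\<lambda>x. F m x - f x) k) \<longlongrightarrow> 0) A"
    by (rule Lim_null_comparison[OF always_eventually b])
      (use assms in \<open>blast intro: L2_cauchy_schwarz L2_diff\<close>)
  then show "((\<lambda>m. L2_inner (F m) k - L2_inner f k) \<longlongrightarrow> 0) A"
    using assms by (simp add: L2_inner_diff_left)
qed

lemma L2_inner_tendsto_right:
  assumes "\<And>m. F m \<in> L2" "f \<in> L2" "k \<in> L2"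
    and "((\<lambda>m. L2_norm (\<lambda>x. F m x - f x)) \<longlongrightarrow> 0) A"
  shows "((\<lambda>m. L2_inner k (F m)) \<longlongrightarrow> L2_inner k f) A"
  using tendsto_cnj[OF L2_inner_tendsto_left[OF assms]] by (simp flip: L2_inner_commute)

lemma L2_norm_tendsto:
  assumes "\<And>m. F m \<in> L2" "f \<in> L2" and lim: "((\<lambda>m. L2_norm (\<lambda>x. F m x - f x)) \<longlongrightarrow> 0) A"
  shows "((\<lambda>m. L2_norm (F m)) \<longlongrightarrow> L2_norm f) A"
proof (rule Lim_transform)
  show "((\<lambda>m. L2_norm f) \<longlongrightarrow> L2_norm f) A"
    by simp
  show "((\<lambda>m. L2_norm (F m) - L2_norm f) \<longlongrightarrow> 0) A"
    by (rule Lim_null_comparison[OF always_eventually lim])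
      (use L2_norm_diff_abs[OF assms(1,2)] in simp)
qed

lemma L2_norm_sq_sum_bound:
  assumes "f \<in> L2" "g \<in> L2"
  shows "(L2_norm (\<lambda>x. f x + g x))\<^sup>2 \<le> 2 * (L2_norm f)\<^sup>2 + 2 * (L2_norm g)\<^sup>2"
proof -
  have "(L2_norm (\<lambda>x. f x + g x))\<^sup>2 \<le> (L2_norm f + L2_norm g)\<^sup>2"
    by (intro power_mono L2_norm_triangle assms) simp
  then show ?thesis
    using sum_squares_bound[of "L2_norm f" "L2_norm g"] by (simp add: power2_sum)
qed

section \<open>Almost everywhere limits and completeness of L2\<close>

lemma AE_zero_if_L2_norm_zero:
  assumes "f \<in> L2" "L2_norm f = 0"
  shows "AE x in lborel. f x = 0"
proof -
  have "(LINT x|lborel. (norm (f x))\<^sup>2) = 0"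
    using assms(2) by (simp add: L2_norm_def)
  then have "AE x in lborel. (norm (f x))\<^sup>2 = 0"
    using integral_nonneg_eq_0_iff_AE[OF L2_integrable_sq[OF assms(1)]] by simp
  then show ?thesis
    by simp
qed

text \<open>Along a subsequence with summable increments, \<open>\<Sum> \<bar>F\<^sub>k\<^sub>+\<^sub>1 - F\<^sub>k\<bar>\<close> is square integrable, hence finite
  almost everywhere.\<close>

lemma L2_Cauchy_AE_subseq:
  fixes F :: "nat \<Rightarrow> 'a::euclidean_space \<Rightarrow> complex"
  assumes F: "\<And>n. F n \<in> L2"
    and C: "\<And>e. e > 0 \<Longrightarrow> \<exists>N. \<forall>m\<ge>N. \<forall>n\<ge>N. L2_norm (\<lambda>x. F m x - F n x) < e"
  shows "\<exists>r. strict_mono r \<and> (AE x in lborel. convergent (\<lambda>k. F (r k) x))"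
proof -
  have [measurable]: "F n \<in> borel_measurable borel" for n
    using F by measurable
  have "\<exists>N. \<forall>m\<ge>N. \<forall>n\<ge>N. L2_norm (\<lambda>x. F m x - F n x) < (1/4) ^ k" for k :: nat
    by (rule C) simp
  then obtain N where N: "\<And>k m n. m \<ge> N k \<Longrightarrow> n \<ge> N k \<Longrightarrow> L2_norm (\<lambda>x. F m x - F n x) < (1/4::real) ^ k"
    by metis
  \<comment> \<open>Each index lies beyond the threshold for its own rate and beyond its
    predecessor, so the increments decay like 4^-k along a genuine subsequence.\<close>
  define r where "r = rec_nat (N 0) (\<lambda>k rk. max (Suc rk) (N (Suc k)))"
  have r_Suc: "r (Suc k) = max (Suc (r k)) (N (Suc k))" for k
    by (simp add: r_def)
  have r: "strict_mono r"
    by (rule strict_mono_Suc_iff[THEN iffD2]) (auto simp: r_Suc)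
  have rN: "r k \<ge> N k" for k
    by (cases k) (auto simp: r_Suc, auto simp: r_def)
  have inc: "L2_norm (\<lambda>x. F (r (Suc k)) x - F (r k) x) < (1/4) ^ k" for k
    using N[of k "r (Suc k)" "r k"] rN[of k] strict_monoD[OF r, of k "Suc k"] by auto
  \<comment> \<open>The squared increments are below 16^-k, so with the weight 2^k they are still
    dominated by a geometric series. The weight pays for the passage from squares to first powers
    below.\<close>
  define a where "a k x = 2 ^ k * (norm (F (r (Suc k)) x - F (r k) x))\<^sup>2" for k x
  have a_nonneg: "0 \<le> a k x" for k x
    by (simp add: a_def)
  have "(\<integral>\<^sup>+ x. (\<Sum>k. ennreal (a k x)) \<partial>lborel) = (\<Sum>k. \<integral>\<^sup>+ x. ennreal (a k x) \<partial>lborel)"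
    by (rule nn_integral_suminf) (simp add: a_def)
  also have "\<dots> \<le> (\<Sum>k. ennreal ((1/2) ^ k))"
  proof (intro suminf_le)
    fix k
    have "(\<integral>\<^sup>+ x. ennreal (a k x) \<partial>lborel)
        = ennreal (2 ^ k) * (\<integral>\<^sup>+ x. ennreal ((norm (F (r (Suc k)) x - F (r k) x))\<^sup>2) \<partial>lborel)"
      unfolding a_def by (subst nn_integral_cmult[symmetric]) (auto simp: ennreal_mult)
    also have "\<dots> = ennreal (2 ^ k) * ennreal ((L2_norm (\<lambda>x. F (r (Suc k)) x - F (r k) x))\<^sup>2)"
      using F by (simp add: L2_norm_sq_nn L2_diff)
    also have "\<dots> \<le> ennreal (2 ^ k) * ennreal (((1/4) ^ k)\<^sup>2)"
      using inc[of k] by (intro mult_left_mono ennreal_leI power_mono) auto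
    also have "\<dots> = ennreal (2 ^ k * ((1/4) ^ k)\<^sup>2)"
      by (simp add: ennreal_mult)
    also have "2 ^ k * ((1/4) ^ k)\<^sup>2 = (2 * (1/4)\<^sup>2 :: real) ^ k"
      by (simp only: power_mult_distrib power_mult[symmetric] mult.commute)
    also have "\<dots> \<le> (1/2) ^ k"
      by (intro power_mono) (auto simp: power2_eq_square)
    finally show "(\<integral>\<^sup>+ x. ennreal (a k x) \<partial>lborel) \<le> ennreal ((1/2) ^ k)"
      by (simp add: ennreal_leI)
  qed auto
  also have "\<dots> = ennreal (\<Sum>k. (1/2) ^ k)"
    by (rule suminf_ennreal2) (auto simp: summable_geometric)
  finally have fin: "(\<integral>\<^sup>+ x. (\<Sum>k. ennreal (a k x)) \<partial>lborel) \<noteq> \<infinity>"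
    by (metis ennreal_less_top infinity_ennreal_def leD)
  have "AE x in lborel. (\<Sum>k. ennreal (a k x)) \<noteq> \<infinity>"
    by (rule nn_integral_PInf_AE) (use fin in \<open>auto simp: a_def\<close>)
  then have "AE x in lborel. convergent (\<lambda>k. F (r k) x)"
  proof eventually_elim
    fix x
    assume "(\<Sum>k. ennreal (a k x)) \<noteq> \<infinity>"
    then have sa: "summable (\<lambda>k. a k x)"
      using a_nonneg by (intro summable_suminf_not_top) (auto simp: top_unique infinity_ennreal_def)
    let ?b = "\<lambda>k. F (r (Suc k)) x - F (r k) x"
    have "summable (\<lambda>k. norm (?b k))"
    proof (rule summable_comparison_test')
      show "summable (\<lambda>k. a k x + (1/2) ^ k)"
        by (intro summable_add sa summable_geometric) auto
      fix k :: nat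
      \<comment> \<open>With \<open>q = 2 ^ k\<close> this bounds an increment by its weighted
        square plus 2^-k, both summable. It is \<open>(q n - 1)^2 + q n \<ge> 0\<close> divided by
        q.\<close>
      have *: "n \<le> q * n\<^sup>2 + 1 / q" if "q > 0" "n \<ge> 0" for n q :: real
      proof -
        have "0 \<le> (q * n - 1)\<^sup>2 + q * n"
          using that by simp
        then have "q * n \<le> q * (q * n\<^sup>2) + 1"
          by (simp add: power2_eq_square algebra_simps)
        then have "q * n \<le> q * (q * n\<^sup>2 + 1 / q)"
          using that by (simp add: distrib_left)
        then show ?thesis
          using that by (simp add: mult_le_cancel_left)
      qed
      show "norm (norm (?b k)) \<le> a k x + (1/2) ^ k"
        using *[of "2 ^ k" "norm (?b k)"] by (simp add: a_def power_one_over)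
    qed
    then have "summable ?b"
      by (rule summable_norm_cancel)
    then have "convergent (\<lambda>n. (\<Sum>k<n. ?b k) + F (r 0) x)"
      by (intro convergent_add convergent_const) (simp add: summable_iff_convergent)
    moreover have "(\<Sum>k<n. ?b k) + F (r 0) x = F (r n) x" for n
      using sum_lessThan_telescope[of "\<lambda>k. F (r k) x" n] by simp
    ultimately show "convergent (\<lambda>k. F (r k) x)"
      by simp
  qed
  with r show ?thesis
    by blast
qed

text \<open>Fatou's lemma for the squared norms. Membership in L2 is a conclusion, since the limit
  is only known to be measurable.\<close>

lemma L2_norm_le_of_AE_limit:
  fixes F :: "nat \<Rightarrow> 'a::euclidean_space \<Rightarrow> complex"
  assumes F: "\<And>n. F n \<in> L2" and [measurable]: "f \<in> borel_measurable borel"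
    and lim: "AE x in lborel. (\<lambda>k. F k x) \<longlonglongrightarrow> f x"
    and b: "eventually (\<lambda>k. L2_norm (F k) \<le> C) sequentially"
  shows "f \<in> L2" "L2_norm f \<le> C"
proof -
  have [measurable]: "F n \<in> borel_measurable borel" for n
    using F by measurable
  have C: "C \<ge> 0"
    using eventually_happens'[OF sequentially_bot b] L2_norm_nonneg[of "F _"] order_trans by blast
  have "(\<integral>\<^sup>+ x. ennreal ((norm (f x))\<^sup>2) \<partial>lborel)
      = (\<integral>\<^sup>+ x. liminf (\<lambda>k. ennreal ((norm (F k x))\<^sup>2)) \<partial>lborel)"
  proof (rule nn_integral_cong_AE)
    show "AE x in lborel. ennreal ((norm (f x))\<^sup>2) = liminf (\<lambda>k. ennreal ((norm (F k x))\<^sup>2))"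
      using lim
    proof eventually_elim
      case (elim x)
      have "(\<lambda>k. ennreal ((norm (F k x))\<^sup>2)) \<longlonglongrightarrow> ennreal ((norm (f x))\<^sup>2)"
        by (intro tendsto_ennrealI tendsto_power tendsto_norm elim)
      from lim_imp_Liminf[OF sequentially_bot this] show ?case
        by (rule sym)
    qed
  qed
  also have "\<dots> \<le> liminf (\<lambda>k. \<integral>\<^sup>+ x. ennreal ((norm (F k x))\<^sup>2) \<partial>lborel)"
    by (rule nn_integral_liminf) simp
  also have "\<dots> \<le> ennreal (C\<^sup>2)"
  proof (rule Liminf_le)
    show "eventually (\<lambda>k. (\<integral>\<^sup>+ x. ennreal ((norm (F k x))\<^sup>2) \<partial>lborel) \<le> ennreal (C\<^sup>2)) sequentially"
      using b
    proof eventually_elim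
      case (elim k)
      have "(L2_norm (F k))\<^sup>2 \<le> C\<^sup>2"
        by (intro power_mono elim) simp
      then show ?case
        using F[of k] by (simp add: L2_norm_sq_nn[symmetric] ennreal_leI)
    qed
  qed simp
  finally have le: "(\<integral>\<^sup>+ x. ennreal ((norm (f x))\<^sup>2) \<partial>lborel) \<le> ennreal (C\<^sup>2)" .
  then show f: "f \<in> L2"
    by (auto simp: L2_nn_iff intro: le_less_trans)
  have "(L2_norm f)\<^sup>2 \<le> C\<^sup>2"
    using le by (simp add: L2_norm_sq_nn[OF f, symmetric])
  then show "L2_norm f \<le> C"
    by (rule power2_le_imp_le) (rule C)
qed

text \<open>The candidate is the almost everywhere limit of a fast subsequence. Fatou's lemma
  applied to \<open>F n - F (r k)\<close> for fixed n and growing k bounds the distance of the whole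
  sequence from it, and puts the candidate into L2 as well.\<close>

lemma L2_complete:
  fixes F :: "nat \<Rightarrow> 'a::euclidean_space \<Rightarrow> complex"
  assumes F: "\<And>n. F n \<in> L2"
    and C: "\<And>e. e > 0 \<Longrightarrow> \<exists>N. \<forall>m\<ge>N. \<forall>n\<ge>N. L2_norm (\<lambda>x. F m x - F n x) < e"
  obtains f where "f \<in> L2" "(\<lambda>n. L2_norm (\<lambda>x. F n x - f x)) \<longlonglongrightarrow> 0"
proof -
  have [measurable]: "F n \<in> borel_measurable borel" for n
    using F by measurable
  obtain r where r: "strict_mono r" and conv: "AE x in lborel. convergent (\<lambda>k. F (r k) x)"
    using L2_Cauchy_AE_subseq[OF assms] by blast
  \<comment> \<open>\<open>lim\<close> is a total function and Borel in x even where the sequence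
    diverges, so the exceptional null set can stay in place.\<close>
  define f where "f x = lim (\<lambda>k. F (r k) x)" for x
  have [measurable]: "f \<in> borel_measurable borel"
    unfolding f_def by measurable
  have lim: "AE x in lborel. (\<lambda>k. F (r k) x) \<longlonglongrightarrow> f x"
    using conv by eventually_elim (simp add: f_def convergent_LIMSEQ_iff)
  have *: "\<exists>N. \<forall>n\<ge>N. (\<lambda>x. F n x - f x) \<in> L2 \<and> L2_norm (\<lambda>x. F n x - f x) \<le> e" if "e > 0" for e
  proof -
    obtain N where N: "\<And>m n. m \<ge> N \<Longrightarrow> n \<ge> N \<Longrightarrow> L2_norm (\<lambda>x. F m x - F n x) < e"
      using C[OF \<open>e > 0\<close>] by blast
    have "(\<lambda>x. F n x - f x) \<in> L2 \<and> L2_norm (\<lambda>x. F n x - f x) \<le> e" if "n \<ge> N" for n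
    proof -
      have a: "AE x in lborel. (\<lambda>k. F n x - F (r k) x) \<longlonglongrightarrow> F n x - f x"
        using lim by eventually_elim (intro tendsto_intros)
      have b: "eventually (\<lambda>k. L2_norm (\<lambda>x. F n x - F (r k) x) \<le> e) sequentially"
        using eventually_ge_at_top[of N]
        by eventually_elim
          (rule less_imp_le, rule N, rule \<open>n \<ge> N\<close>, rule order_trans[OF _ seq_suble[OF r]])
      show ?thesis
        using L2_norm_le_of_AE_limit[of "\<lambda>k x. F n x - F (r k) x" "\<lambda>x. F n x - f x" e] a b F
        by (simp add: L2_diff)
    qed
    then show ?thesis
      by blast
  qed
  obtain N where "(\<lambda>x. F N x - f x) \<in> L2"
    using *[of 1] by auto
  from L2_diff[OF F[of N] this] have "f \<in> L2"
    by simp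
  moreover have "(\<lambda>n. L2_norm (\<lambda>x. F n x - f x)) \<longlonglongrightarrow> 0"
  proof (rule LIMSEQ_I)
    fix e :: real
    assume "e > 0"
    then obtain N where "\<forall>n\<ge>N. L2_norm (\<lambda>x. F n x - f x) \<le> e / 2"
      using *[of "e / 2"] by auto
    then show "\<exists>N. \<forall>n\<ge>N. norm (L2_norm (\<lambda>x. F n x - f x) - 0) < e"
      using \<open>e > 0\<close> by (intro exI[of _ N]) force
  qed
  ultimately show ?thesis
    by (rule that)
qed

section \<open>Weak integrals against a resolution of the identity\<close>

text \<open>The Gamma integral, rescaled by \<open>x -> a x\<close>. It is applied with k = 0 and k
  = 1, for the masses and first moments of exponential weights.\<close>

lemma has_bochner_integral_power_exp:
  assumes "a > 0"
  shows "has_bochner_integral lborel (\<lambda>x. if 0 \<le> x then x ^ k * exp (- a * x) else 0 :: real)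
    (fact k / a ^ Suc k)"
proof -
  have "has_bochner_integral lborel (\<lambda>x. (0 + a * x) ^ k * exp (- (0 + a * x)) * indicator {0..} (0 + a * x))
      (fact k /\<^sub>R \<bar>a\<bar>)"
    using assms has_bochner_integral_I0i_power_exp_m'[of k]
    by (subst (asm) lborel_has_bochner_integral_real_affine_iff[of a _ _ 0]) auto
  then have "has_bochner_integral lborel
      (\<lambda>x. (1 / a ^ k) * ((0 + a * x) ^ k * exp (- (0 + a * x)) * indicator {0..} (0 + a * x)))
      ((1 / a ^ k) * (fact k /\<^sub>R \<bar>a\<bar>))"
    by (intro has_bochner_integral_mult_right) auto
  then show ?thesis
    using assms
    by (elim has_bochner_integral_cong[THEN iffD1, rotated -1])
      (auto simp: power_mult_distrib zero_le_mult_iff indicator_def field_simps)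
qed

text \<open>Writes an exponential as the integral over \<open>[l, \<infinity>)\<close> of minus its
  derivative, which is the integration by parts behind the weak integrals.\<close>

lemma has_bochner_integral_exp_tail:
  assumes "a > 0"
  shows "has_bochner_integral lborel (\<lambda>x. if l \<le> x then a * exp (- a * x) else 0 :: real) (exp (- a * l))"
proof -
  have "has_bochner_integral lborel (\<lambda>x. a * exp (- a * l) * (if 0 \<le> x then x ^ 0 * exp (- a * x) else 0))
      (a * exp (- a * l) * (fact 0 / a ^ Suc 0))"
    by (intro has_bochner_integral_mult_right has_bochner_integral_power_exp assms)
  then have "has_bochner_integral lborel (\<lambda>x. if l \<le> l + 1 * x then a * exp (- a * (l + 1 * x)) else 0 :: real)
     (exp (- a * l) /\<^sub>R \<bar>1\<bar>)"
    using assms by (elim has_bochner_integral_cong[THEN iffD1, rotated -1])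
      (auto simp: exp_add[symmetric] algebra_simps)
  then show ?thesis
    by (subst lborel_has_bochner_integral_real_affine_iff[of 1 _ _ l]) auto
qed

text \<open>The strict form suits \<open>f - E l f\<close>, whose spectral mass lies in
  \<open>(l, \<infinity>)\<close>.\<close>

lemma has_bochner_integral_exp_tail':
  assumes "a > 0"
  shows "has_bochner_integral lborel (\<lambda>x. if l < x then a * exp (- a * x) else 0 :: real) (exp (- a * l))"
proof (rule has_bochner_integral_cong_AE[THEN iffD1, OF _ _ _ has_bochner_integral_exp_tail[OF assms]])
  show "AE x in lborel. (if l \<le> x then a * exp (- a * x) else 0)
      = (if l < x then a * exp (- a * x) else 0)"
    using AE_lborel_singleton[of l] by eventually_elim auto
qed auto

text \<open>\<open>G m\<close> stands for a sesquilinear form evaluated at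
  \<open>f + \<i>^m k\<close>. The sums of \<open>\<i>^m\<close> and of \<open>\<i>^(2 m)\<close>
  over m < 4 vanish while \<open>\<i>^m cnj (\<i>^m) = 1\<close>, so only C, the pairing of f with
  k, survives.\<close>

lemma complex_polarization:
  assumes "\<And>m. G m = (A + \<i> ^ m * B + cnj (\<i> ^ m) * C + D :: complex)"
  shows "(\<Sum>m<4. \<i> ^ m * G m) / 4 = C"
  by (simp add: assms eval_nat_numeral algebra_simps)

section \<open>The spectral projections as a monotone family\<close>

locale identity_resolution =
  fixes E :: "real \<Rightarrow> ('a::euclidean_space \<Rightarrow> complex) \<Rightarrow> ('a \<Rightarrow> complex)"
  assumes resolution: "resolution_of_identity E"
begin

lemma E_L2 [simp, intro]: "f \<in> L2 \<Longrightarrow> E l f \<in> L2"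
  using resolution by (simp add: resolution_of_identity_def)

lemma E_inner: "f \<in> L2 \<Longrightarrow> g \<in> L2 \<Longrightarrow> L2_inner (E l f) g = L2_inner f (E l g)"
  using resolution unfolding resolution_of_identity_def by blast

lemma E_lincomb:
  "f \<in> L2 \<Longrightarrow> g \<in> L2 \<Longrightarrow> AE x in lborel. E l (\<lambda>y. a * f y + b * g y) x = a * E l f x + b * E l g x"
  using resolution unfolding resolution_of_identity_def by blast

lemma E_min: "f \<in> L2 \<Longrightarrow> AE x in lborel. E l (E m f) x = E (min l m) f x"
  using resolution unfolding resolution_of_identity_def by blast

lemma E_neg: "l < 0 \<Longrightarrow> f \<in> L2 \<Longrightarrow> AE x in lborel. E l f x = 0"
  using resolution unfolding resolution_of_identity_def by blast

lemma E_right: "f \<in> L2 \<Longrightarrow> ((\<lambda>m. L2_norm (\<lambda>x. E m f x - E l f x)) \<longlongrightarrow> 0) (at_right l)"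
  using resolution unfolding resolution_of_identity_def
  by (intro L2_dist_sq_tendsto_0) (auto simp del: E_L2)

lemma E_top: "f \<in> L2 \<Longrightarrow> ((\<lambda>m. L2_norm (\<lambda>x. E m f x - f x)) \<longlongrightarrow> 0) at_top"
  using resolution unfolding resolution_of_identity_def
  by (intro L2_dist_sq_tendsto_0) (auto simp del: E_L2)

text \<open>Moves both projections to one argument. Consequently the pairing of \<open>E m g\<close>
  with \<open>f - E l f\<close> is a difference of two values of the single function
  \<open>m -> <E_m g, f>\<close>, and it vanishes for m \<le> l.\<close>

lemma E_inner_min:
  assumes "f \<in> L2" "g \<in> L2"
  shows "L2_inner (E l f) (E m g) = L2_inner (E (min l m) f) g"
proof -
  have "L2_inner (E l f) (E m g) = L2_inner f (E l (E m g))"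
    using assms by (simp add: E_inner)
  also have "\<dots> = L2_inner f (E (min l m) g)"
    using assms by (intro L2_inner_cong_AE E_min) auto
  finally show ?thesis
    using assms by (simp add: E_inner)
qed

lemma E_inner_lincomb:
  assumes "f \<in> L2" "g \<in> L2" "k \<in> L2"
  shows "L2_inner (E l (\<lambda>x. a * f x + b * g x)) k = a * L2_inner (E l f) k + b * L2_inner (E l g) k"
proof -
  have "L2_inner (E l (\<lambda>x. a * f x + b * g x)) k = L2_inner (\<lambda>x. a * E l f x + b * E l g x) k"
    by (rule L2_inner_cong_AE) (use assms E_lincomb in \<open>auto intro!: E_L2 L2_add L2_scale\<close>)
  then show ?thesis
    using assms by (simp add: L2_inner_lincomb_left)
qed

lemma E_inner_neg: "l < 0 \<Longrightarrow> f \<in> L2 \<Longrightarrow> k \<in> L2 \<Longrightarrow> L2_inner (E l f) k = 0"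
  using L2_inner_cong_AE[of "E l f" "\<lambda>x. 0" k k] E_neg[of l f] by (simp add: L2_inner_def)

lemma E_inner_self: "f \<in> L2 \<Longrightarrow> L2_inner (E l f) f = of_real ((L2_norm (E l f))\<^sup>2)"
  using E_inner_min[of f f l l] by (simp add: L2_inner_self)

text \<open>For l \<le> m the squared norm of \<open>E l f\<close> is its pairing with
  \<open>E m f\<close>, so Cauchy-Schwarz gives the bound.\<close>

lemma E_norm_mono:
  assumes "f \<in> L2" "l \<le> m"
  shows "L2_norm (E l f) \<le> L2_norm (E m f)"
proof -
  have "L2_inner (E l f) (E l f) = L2_inner (E l f) (E m f)"
    using assms by (simp add: E_inner_min min_absorb1)
  then have "norm (L2_inner (E l f) (E l f)) \<le> L2_norm (E m f) * L2_norm (E l f)"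
    using L2_cauchy_schwarz[of "E l f" "E m f"] assms by (simp add: mult.commute)
  then show ?thesis
    using assms by (intro L2_norm_le_by_inner) auto
qed

lemma E_norm_tendsto: "f \<in> L2 \<Longrightarrow> ((\<lambda>m. L2_norm (E m f)) \<longlongrightarrow> L2_norm f) at_top"
  by (rule L2_norm_tendsto[OF _ _ E_top]) auto

lemma E_norm_tendsto_right:
  "f \<in> L2 \<Longrightarrow> ((\<lambda>m. L2_norm (E m f)) \<longlongrightarrow> L2_norm (E l f)) (at_right l)"
  by (rule L2_norm_tendsto[OF _ _ E_right]) auto

lemma E_norm_le: "f \<in> L2 \<Longrightarrow> L2_norm (E l f) \<le> L2_norm f"
  by (rule tendsto_lowerbound[OF E_norm_tendsto])
    (auto intro!: eventually_mono[OF eventually_ge_at_top[of l]] E_norm_mono)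

lemma E_norm_neg: "l < 0 \<Longrightarrow> f \<in> L2 \<Longrightarrow> L2_norm (E l f) = 0"
  using E_inner_neg[of l f f] E_inner_self[of f l] by simp

lemma E_inner_bound: "f \<in> L2 \<Longrightarrow> k \<in> L2 \<Longrightarrow> norm (L2_inner (E l f) k) \<le> L2_norm f * L2_norm k"
  by (rule order_trans[OF L2_cauchy_schwarz]) (auto intro!: mult_right_mono E_norm_le)

text \<open>Pythagoras for the orthogonal projection \<open>E l\<close>.\<close>

lemma E_defect:
  assumes "f \<in> L2"
  shows "(L2_norm (\<lambda>x. f x - E l f x))\<^sup>2 = (L2_norm f)\<^sup>2 - (L2_norm (E l f))\<^sup>2"
  using assms E_inner_self[OF assms, of l]
  by (simp add: L2_norm_sq_diff E_inner[symmetric])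

lemma E_inner_defect:
  assumes "f \<in> L2"
  shows "L2_inner f (\<lambda>x. f x - E l f x) = of_real ((L2_norm (\<lambda>x. f x - E l f x))\<^sup>2)"
  using assms E_inner_self[OF assms, of l]
  by (simp add: L2_inner_diff_right E_inner[symmetric] L2_inner_self E_defect)

lemma E_measurable_norm [measurable]: "f \<in> L2 \<Longrightarrow> (\<lambda>l. L2_norm (E l f)) \<in> borel_measurable borel"
  by (intro borel_measurable_mono monoI E_norm_mono)

lemma inner_expand:
  assumes "f \<in> L2" "k \<in> L2"
  shows "L2_inner (\<lambda>x. f x + c * k x) (\<lambda>x. f x + c * k x)
    = L2_inner f f + c * L2_inner k f + cnj c * L2_inner f k + c * cnj c * L2_inner k k"
proof -
  have "(\<lambda>x. f x + c * k x) = (\<lambda>x. 1 * f x + c * k x)"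
    by simp
  then show ?thesis
    using assms by (simp only: L2_inner_lincomb_left L2_inner_lincomb_right L2_add L2_scale)
      (simp add: algebra_simps)
qed

lemma polarization:
  assumes "f \<in> L2" "k \<in> L2"
  shows "(\<Sum>m<4. \<i> ^ m * of_real ((L2_norm (\<lambda>x. f x + \<i> ^ m * k x))\<^sup>2)) / 4 = L2_inner f k"
proof (rule complex_polarization)
  fix m :: nat
  have "\<i> ^ m * cnj (\<i> ^ m) = 1"
    by (simp flip: power_mult_distrib)
  then show "complex_of_real ((L2_norm (\<lambda>x. f x + \<i> ^ m * k x))\<^sup>2)
    = L2_inner f f + \<i> ^ m * L2_inner k f + cnj (\<i> ^ m) * L2_inner f k + L2_inner k k"
    by (simp add: L2_inner_self[symmetric] inner_expand assms del: of_real_power complex_cnj_power)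
qed

text \<open>\<open>E l\<close> is linear only up to null sets, so the four norms are first rewritten
  as norms of \<open>E l f + \<i>^m E l k\<close>. After polarization, \<open>E l\<close> is a
  self-adjoint idempotent and disappears from the second argument.\<close>

lemma E_polarization:
  assumes "f \<in> L2" "k \<in> L2"
  shows "(\<Sum>m<4. \<i> ^ m * of_real ((L2_norm (E l (\<lambda>x. f x + \<i> ^ m * k x)))\<^sup>2)) / 4
    = L2_inner (E l f) k"
proof -
  have "L2_norm (E l (\<lambda>x. f x + c * k x)) = L2_norm (\<lambda>x. E l f x + c * E l k x)" for c
    using assms E_lincomb[of f k l 1 c]
    by (intro L2_norm_cong_AE) (auto intro!: L2_measurable L2_add L2_scale E_L2)
  then have "(\<Sum>m<4. \<i> ^ m * of_real ((L2_norm (E l (\<lambda>x. f x + \<i> ^ m * k x)))\<^sup>2)) / 4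
    = L2_inner (E l f) (E l k)"
    using polarization[of "E l f" "E l k"] assms by simp
  then show ?thesis
    using assms by (simp add: E_inner_min)
qed

text \<open>Polarization expresses the pairing by squared norms of projections of four vectors, each
  monotone in l and hence Borel.\<close>

lemma E_measurable_inner [measurable]:
  assumes "f \<in> L2" "k \<in> L2"
  shows "(\<lambda>l. L2_inner (E l f) k) \<in> borel_measurable borel"
proof -
  have [measurable]: "(\<lambda>l. L2_norm (E l (\<lambda>x. f x + c * k x))) \<in> borel_measurable borel" for c
    using assms by (intro E_measurable_norm L2_add L2_scale)
  show ?thesis
    by (subst E_polarization[OF assms, symmetric]) measurable
qed

section \<open>The spectral measures of single vectors\<close>

definition \<mu> :: "('a \<Rightarrow> complex) \<Rightarrow> real measure" where
  "\<mu> f = spectral_measure E f"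

lemma \<mu>_eq: "f \<in> L2 \<Longrightarrow> \<mu> f = interval_measure (\<lambda>l. (L2_norm (E l f))\<^sup>2)"
  by (simp add: \<mu>_def spectral_measure_def E_inner_self)

lemma sets_\<mu> [simp, measurable_cong]: "sets (\<mu> f) = sets borel"
  by (simp add: \<mu>_def spectral_measure_def)

lemma space_\<mu> [simp]: "space (\<mu> f) = UNIV"
  by (simp add: \<mu>_def spectral_measure_def)

text \<open>The squared norm of \<open>E l f\<close> has all properties of a distribution function
  in l: it increases, is continuous from the right, vanishes for l < 0 and tends to the squared norm
  of f at infinity.\<close>

lemma
  assumes f: "f \<in> L2"
  shows emeasure_\<mu>_UNIV: "emeasure (\<mu> f) UNIV = (L2_norm f)\<^sup>2"
    and emeasure_\<mu>_Iic: "emeasure (\<mu> f) {..l} = (L2_norm (E l f))\<^sup>2"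
    and finite_measure_\<mu>: "finite_measure (\<mu> f)"
proof -
  let ?F = "\<lambda>l. (L2_norm (E l f))\<^sup>2"
  have mono: "?F x \<le> ?F y" if "x \<le> y" for x y
    by (intro power_mono E_norm_mono f that) simp
  have cont: "continuous (at_right a) ?F" for a
    unfolding continuous_within by (intro tendsto_power E_norm_tendsto_right f)
  have bot: "(?F \<longlongrightarrow> 0) at_bot"
    by (rule tendsto_eventually) (auto simp: eventually_at_bot_dense E_norm_neg f intro!: exI[of _ 0])
  have top: "(?F \<longlongrightarrow> (L2_norm f)\<^sup>2) at_top"
    by (intro tendsto_power E_norm_tendsto f)
  show U: "emeasure (\<mu> f) UNIV = (L2_norm f)\<^sup>2"
    using interval_measure_UNIV[OF mono cont bot top] f by (simp add: \<mu>_eq)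
  show "emeasure (\<mu> f) {..l} = (L2_norm (E l f))\<^sup>2"
    using emeasure_interval_measure_Iic[OF mono cont bot] f by (simp add: \<mu>_eq)
  show "finite_measure (\<mu> f)"
    by (rule finite_measureI) (simp add: U)
qed

lemma emeasure_\<mu>_Ioi:
  assumes "f \<in> L2"
  shows "emeasure (\<mu> f) {l<..} = (L2_norm (\<lambda>x. f x - E l f x))\<^sup>2"
proof -
  have "emeasure (\<mu> f) (UNIV - {..l}) = emeasure (\<mu> f) UNIV - emeasure (\<mu> f) {..l}"
    using assms by (intro emeasure_Diff) (auto simp: emeasure_\<mu>_Iic)
  moreover have "UNIV - {..l} = {l<..}"
    by auto
  ultimately show ?thesis
    using assms by (simp add: emeasure_\<mu>_UNIV emeasure_\<mu>_Iic E_defect ennreal_minus)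
qed

text \<open>The half-lines up to \<open>- 1 / (n + 1)\<close> are null and exhaust the negative
  reals. The half-line up to 0 would not do, since \<open>E 0 f\<close> may be nonzero: there may be
  an atom at 0.\<close>

lemma AE_\<mu>_nonneg:
  assumes "f \<in> L2"
  shows "AE l in \<mu> f. 0 \<le> l"
proof -
  have "AE l in \<mu> f. \<not> l \<le> - (1 / Suc n)" for n
    using assms by (intro AE_I[of _ _ "{.. - (1 / Suc n)}"]) (auto simp: emeasure_\<mu>_Iic E_norm_neg)
  then have "AE l in \<mu> f. \<forall>n. \<not> l \<le> - (1 / Suc n)"
    by (simp add: AE_all_countable)
  then show ?thesis
  proof eventually_elim
    case (elim l)
    show ?case
    proof (rule ccontr)
      assume "\<not> 0 \<le> l"
      then obtain n where "1 / Suc n < - l"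
        using reals_Archimedean[of "- l"] by (auto simp: inverse_eq_divide)
      then show False
        using elim by (auto dest: spec[of _ n])
    qed
  qed
qed

end

text \<open>Minus the derivative of \<open>exp (- \<tau> m)\<close> in \<open>m\<close>.\<close>

definition heat_weight :: "real \<Rightarrow> real \<Rightarrow> real" where
  "heat_weight \<tau> m = (if 0 \<le> m then \<tau> * exp (- \<tau> * m) else 0)"

lemma heat_weight_has_integral:
  "\<tau> > 0 \<Longrightarrow> has_bochner_integral lborel (heat_weight \<tau>) 1"
  using has_bochner_integral_exp_tail[of \<tau> 0] by (simp add: heat_weight_def[abs_def])

lemma heat_weight_integrable [simp]: "\<tau> > 0 \<Longrightarrow> integrable lborel (heat_weight \<tau>)"
  using heat_weight_has_integral by (rule integrable.intros)

lemma heat_weight_measurable [measurable]: "heat_weight \<tau> \<in> borel_measurable borel"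
  unfolding heat_weight_def[abs_def] by measurable

lemma heat_weight_nonneg: "\<tau> > 0 \<Longrightarrow> 0 \<le> heat_weight \<tau> m"
  by (simp add: heat_weight_def)

section \<open>Weak integrals over the projections\<close>

context identity_resolution
begin

text \<open>Reads \<open>h = \<integral> w(l) E_l f dl\<close> as an identity of pairings, with
  Lebesgue measure in l. If w vanishes on the negative axis and is minus the derivative of a
  function G on \<open>[0, \<infinity>)\<close> that tends to 0 at infinity, this is
  \<open>\<integral> G(l) dE_l f\<close>. In contrast to the spectral pairing, every k in L2 is
  allowed.\<close>

definition weak_int :: "(real \<Rightarrow> real) \<Rightarrow> ('a \<Rightarrow> complex) \<Rightarrow> ('a \<Rightarrow> complex) \<Rightarrow> bool" where
  "weak_int w f h \<longleftrightarrow> h \<in> L2 \<and>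
     (\<forall>k\<in>L2. L2_inner h k = (LINT l|lborel. of_real (w l) * L2_inner (E l f) k))"

lemma weak_integrand_integrable:
  assumes w: "integrable lborel w" and f: "f \<in> L2" "k \<in> L2"
  shows "integrable lborel (\<lambda>l. of_real (w l) * L2_inner (E l f) k)"
proof (rule Bochner_Integration.integrable_bound)
  have [measurable]: "w \<in> borel_measurable borel"
    using borel_measurable_integrable[OF w] by simp
  show "integrable lborel (\<lambda>l. \<bar>w l\<bar> * (L2_norm f * L2_norm k))"
    using w by (intro integrable_mult_left integrable_abs)
  show "(\<lambda>l. of_real (w l) * L2_inner (E l f) k) \<in> borel_measurable lborel"
    using f by measurable
  show "AE l in lborel. norm (of_real (w l) * L2_inner (E l f) k)
      \<le> norm (\<bar>w l\<bar> * (L2_norm f * L2_norm k))"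
    by (intro always_eventually allI) (auto simp: norm_mult intro!: mult_left_mono E_inner_bound f)
qed

text \<open>The estimates on the flow come down to this one: the projections are contractions, so
  the L1 norm of the weight bounds the operator that it defines.\<close>

lemma weak_integral_bound:
  assumes w: "integrable lborel w" and f: "f \<in> L2" "k \<in> L2"
  shows "norm (LINT l|lborel. of_real (w l) * L2_inner (E l f) k)
    \<le> (LINT l|lborel. \<bar>w l\<bar>) * L2_norm f * L2_norm k"
proof -
  have "norm (LINT l|lborel. of_real (w l) * L2_inner (E l f) k)
      \<le> (LINT l|lborel. \<bar>w l\<bar> * (L2_norm f * L2_norm k))"
  proof (rule Bochner_Integration.integral_norm_bound_integral[OF weak_integrand_integrable[OF assms]])
    show "integrable lborel (\<lambda>l. \<bar>w l\<bar> * (L2_norm f * L2_norm k))"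
      using w by (intro integrable_mult_left integrable_abs)
  qed (auto simp: norm_mult intro!: mult_left_mono E_inner_bound f)
  then show ?thesis
    by (simp add: mult.assoc)
qed

lemma weak_int_L2: "weak_int w f h \<Longrightarrow> h \<in> L2"
  by (simp add: weak_int_def)

lemma weak_int_norm_le:
  assumes "weak_int w f h" "integrable lborel w" "f \<in> L2"
  shows "L2_norm h \<le> (LINT l|lborel. \<bar>w l\<bar>) * L2_norm f"
  using assms weak_integral_bound[of w f h]
  by (intro L2_norm_le_by_inner) (auto simp: weak_int_def)

lemma weak_int_lincomb:
  fixes a b :: real
  assumes "weak_int w f h" "integrable lborel w" "weak_int w' f h'" "integrable lborel w'" "f \<in> L2"
  shows "weak_int (\<lambda>l. a * w l + b * w' l) f (\<lambda>x. of_real a * h x + of_real b * h' x)"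
  unfolding weak_int_def
proof (intro conjI ballI)
  show "(\<lambda>x. of_real a * h x + of_real b * h' x) \<in> L2"
    using assms by (auto simp: weak_int_def)
  fix k :: "'a \<Rightarrow> complex"
  assume k: "k \<in> L2"
  have "(LINT l|lborel. of_real (a * w l + b * w' l) * L2_inner (E l f) k)
    = (LINT l|lborel. of_real a * (of_real (w l) * L2_inner (E l f) k)
        + of_real b * (of_real (w' l) * L2_inner (E l f) k))"
    by (simp add: algebra_simps)
  also have "\<dots> = of_real a * L2_inner h k + of_real b * L2_inner h' k"
    using weak_integrand_integrable[OF assms(2,5) k] weak_integrand_integrable[OF assms(4,5) k]
      assms k by (simp add: weak_int_def)
  finally show "L2_inner (\<lambda>x. of_real a * h x + of_real b * h' x) k
      = (LINT l|lborel. of_real (a * w l + b * w' l) * L2_inner (E l f) k)"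
    using assms k by (simp add: L2_inner_lincomb_left weak_int_L2)
qed

lemma weak_int_dist_le:
  assumes "weak_int w f h" "integrable lborel w" "weak_int w' f h'" "integrable lborel w'" "f \<in> L2"
  shows "L2_norm (\<lambda>x. h x - h' x) \<le> (LINT l|lborel. \<bar>w l - w' l\<bar>) * L2_norm f"
  using weak_int_norm_le[OF weak_int_lincomb[OF assms, of 1 "-1"]] assms by simp

text \<open>Existence comes from completeness: weights that converge in L1 give a Cauchy sequence in
  L2, and the bound on weak integrals lets the pairings pass to the limit.\<close>

lemma weak_int_limit:
  fixes w :: "real \<Rightarrow> real" and wn :: "nat \<Rightarrow> real \<Rightarrow> real"
  assumes h: "\<And>n. weak_int (wn n) f (h n)" and iwn: "\<And>n. integrable lborel (wn n)"
    and w: "integrable lborel w" and f: "f \<in> L2"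
    and lim: "(\<lambda>n. LINT l|lborel. \<bar>wn n l - w l\<bar>) \<longlonglongrightarrow> 0"
  obtains h' where "weak_int w f h'"
proof -
  let ?d = "\<lambda>n. LINT l|lborel. \<bar>wn n l - w l\<bar>"
  have hL: "h n \<in> L2" for n
    by (rule weak_int_L2[OF h])
  have dist: "L2_norm (\<lambda>x. h m x - h n x) \<le> (?d m + ?d n) * L2_norm f" for m n
  proof -
    have "(LINT l|lborel. \<bar>wn m l - wn n l\<bar>) \<le> (LINT l|lborel. \<bar>wn m l - w l\<bar> + \<bar>wn n l - w l\<bar>)"
      using iwn w by (intro integral_mono) auto
    also have "\<dots> = ?d m + ?d n"
      using iwn w by (intro Bochner_Integration.integral_add) auto
    finally show ?thesis
      using weak_int_dist_le[OF h iwn h iwn f, of m n] mult_right_mono[OF _ L2_norm_nonneg[of f]]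
      by (meson order_trans)
  qed
  have "\<exists>N. \<forall>m\<ge>N. \<forall>n\<ge>N. L2_norm (\<lambda>x. h m x - h n x) < e" if "e > 0" for e
  proof -
    have "(\<lambda>n. ?d n * L2_norm f) \<longlonglongrightarrow> 0 * L2_norm f"
      by (intro tendsto_intros lim)
    then have "eventually (\<lambda>n. ?d n * L2_norm f < e / 2) sequentially"
      using \<open>e > 0\<close> by (intro order_tendstoD(2)) auto
    then obtain N where N: "\<And>n. n \<ge> N \<Longrightarrow> ?d n * L2_norm f < e / 2"
      by (auto simp: eventually_sequentially)
    have "L2_norm (\<lambda>x. h m x - h n x) < e" if "m \<ge> N" "n \<ge> N" for m n
      using dist[of m n] N[OF that(1)] N[OF that(2)] by (simp add: distrib_right)
    then show ?thesis
      by blast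
  qed
  from L2_complete[of h, OF hL this] obtain h' where
    h': "h' \<in> L2" "(\<lambda>n. L2_norm (\<lambda>x. h n x - h' x)) \<longlonglongrightarrow> 0"
    by blast
  have "weak_int w f h'"
    unfolding weak_int_def
  proof (intro conjI ballI)
    fix k :: "'a \<Rightarrow> complex"
    assume k: "k \<in> L2"
    let ?I = "\<lambda>w. LINT l|lborel. of_real (w l) * L2_inner (E l f) k"
    have "(\<lambda>n. ?I (wn n)) \<longlonglongrightarrow> ?I w"
    proof (rule Lim_transform[OF tendsto_const])
      have "(\<lambda>n. ?d n * L2_norm f * L2_norm k) \<longlonglongrightarrow> 0 * L2_norm f * L2_norm k"
        by (intro tendsto_intros lim)
      then have b: "(\<lambda>n. ?d n * L2_norm f * L2_norm k) \<longlonglongrightarrow> 0"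
        by simp
      have "norm (?I (wn n) - ?I w) \<le> ?d n * L2_norm f * L2_norm k" for n
      proof -
        have "?I (wn n) - ?I w = ?I (\<lambda>l. wn n l - w l)"
          using weak_integrand_integrable[OF iwn f k] weak_integrand_integrable[OF w f k]
          by (simp add: left_diff_distrib)
        then show ?thesis
          using weak_integral_bound[of "\<lambda>l. wn n l - w l" f k] iwn w f k by simp
      qed
      then show "(\<lambda>n. ?I (wn n) - ?I w) \<longlonglongrightarrow> 0"
        by (intro Lim_null_comparison[OF always_eventually b]) simp
    qed
    moreover have "(\<lambda>n. L2_inner (h n) k) \<longlonglongrightarrow> L2_inner h' k"
      by (rule L2_inner_tendsto_left[OF hL h'(1) k h'(2)])
    moreover have "L2_inner (h n) k = ?I (wn n)" for n
      using h k by (simp add: weak_int_def)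
    ultimately show "L2_inner h' k = ?I w"
      using LIMSEQ_unique by auto
  qed (rule h')
  then show ?thesis
    by (rule that)
qed

subsection \<open>Spectral integrals as weak integrals\<close>

text \<open>Integration by parts in the form of Fubini's theorem: integrating first over
  \<open>x \<le> l\<close> produces the distribution function of \<open>\<mu> f\<close> at
  l.\<close>

lemma integral_\<mu>_layer_cake:
  assumes f: "f \<in> L2" and w: "integrable lborel w"
  shows "(LINT x|\<mu> f. LINT l|lborel. (if x \<le> l then w l else 0))
    = (LINT l|lborel. w l * (L2_norm (E l f))\<^sup>2)"
proof -
  interpret finite_measure "\<mu> f"
    by (rule finite_measure_\<mu>[OF f])
  interpret P: pair_sigma_finite "\<mu> f" lborel
    by standard
  have [measurable]: "w \<in> borel_measurable borel"
    using borel_measurable_integrable[OF w] by simp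
  have int: "integrable lborel (\<lambda>l. if x \<le> l then w l else 0)" for x
    by (rule Bochner_Integration.integrable_bound[OF w]) auto
  have "integrable (\<mu> f \<Otimes>\<^sub>M lborel) (\<lambda>(x, l). if x \<le> l then w l else 0)"
  proof (rule P.Fubini_integrable)
    show "integrable (\<mu> f) (\<lambda>x. LINT l|lborel. norm (case (x, l) of (x, l) \<Rightarrow> if x \<le> l then w l else 0))"
    proof (rule integrable_const_bound[where B = "LINT l|lborel. \<bar>w l\<bar>"])
      have "(LINT l|lborel. \<bar>if x \<le> l then w l else 0\<bar>) \<le> (LINT l|lborel. \<bar>w l\<bar>)" for x
        using int[of x] w by (intro integral_mono) auto
      then show "AE x in \<mu> f. norm (LINT l|lborel. norm (case (x, l) of (x, l) \<Rightarrow> if x \<le> l then w l else 0))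
          \<le> (LINT l|lborel. \<bar>w l\<bar>)"
        by simp
    qed measurable
  qed (use int in auto)
  from P.Fubini_integral[OF this]
  have "(LINT x|\<mu> f. LINT l|lborel. (if x \<le> l then w l else 0))
     = (LINT l|lborel. LINT x|\<mu> f. (if x \<le> l then w l else 0))"
    by simp
  also have "\<dots> = (LINT l|lborel. w l * (L2_norm (E l f))\<^sup>2)"
  proof (rule Bochner_Integration.integral_cong[OF refl])
    fix l
    have "(LINT x|\<mu> f. (if x \<le> l then w l else 0)) = (LINT x|\<mu> f. w l * indicator {..l} x)"
      by (intro Bochner_Integration.integral_cong) (auto simp: indicator_def)
    also have "\<dots> = w l * measure (\<mu> f) {..l}"
      by simp
    also have "measure (\<mu> f) {..l} = (L2_norm (E l f))\<^sup>2"
      using f by (simp add: measure_def emeasure_\<mu>_Iic)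
    finally show "(LINT x|\<mu> f. (if x \<le> l then w l else 0)) = w l * (L2_norm (E l f))\<^sup>2" .
  qed
  finally show ?thesis .
qed

lemma integral_\<mu>_exp:
  assumes f: "f \<in> L2" and "\<tau> > 0"
  shows "(LINT x|\<mu> f. exp (- \<tau> * x)) = (LINT l|lborel. heat_weight \<tau> l * (L2_norm (E l f))\<^sup>2)"
proof -
  have "(LINT x|\<mu> f. exp (- \<tau> * x)) = (LINT x|\<mu> f. LINT l|lborel. (if x \<le> l then heat_weight \<tau> l else 0))"
  proof (rule integral_cong_AE)
    show "AE x in \<mu> f. exp (- \<tau> * x) = (LINT l|lborel. (if x \<le> l then heat_weight \<tau> l else 0))"
      using AE_\<mu>_nonneg[OF f]
    proof eventually_elim
      case (elim x)
      \<comment> \<open>For x \<ge> 0 the truncation of \<open>heat_weight\<close> at 0 is invisible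
        on \<open>[x, \<infinity>)\<close>. For x < 0 the identity fails, which is why it is
        asserted only almost everywhere.\<close>
      then have "(\<lambda>l. if x \<le> l then heat_weight \<tau> l else 0) = (\<lambda>l. if x \<le> l then \<tau> * exp (- \<tau> * l) else 0)"
        by (auto simp: heat_weight_def)
      then show ?case
        using has_bochner_integral_exp_tail[OF \<open>\<tau> > 0\<close>, of x]
        by (simp add: has_bochner_integral_integral_eq)
    qed
  qed measurable
  then show ?thesis
    using integral_\<mu>_layer_cake[OF f heat_weight_integrable[OF \<open>\<tau> > 0\<close>]] by simp
qed

text \<open>Each of the four measures in the polarized pairing is integrated by parts;
  \<open>E_polarization\<close> then recombines the four integrands into a single one, linear in
  f.\<close>

lemma spectral_pairing_exp:
  assumes f: "f \<in> L2" and k: "k \<in> L2" and \<tau>: "\<tau> > 0"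
  shows "spectral_pairing E (\<lambda>l. of_real (exp (- \<tau> * l))) f k
    = (LINT l|lborel. of_real (heat_weight \<tau> l) * L2_inner (E l f) k)"
proof -
  define v where "v m x = f x + \<i> ^ m * k x" for m :: nat and x
  have v: "v m \<in> L2" for m
    unfolding v_def using f k by auto
  have int: "integrable lborel (\<lambda>l. complex_of_real (heat_weight \<tau> l * (L2_norm (E l (v m)))\<^sup>2))" for m
    using weak_integrand_integrable[OF heat_weight_integrable[OF \<tau>] v v, of m m] v
    by (simp add: E_inner_self)
  have "spectral_pairing E (\<lambda>l. of_real (exp (- \<tau> * l))) f k
      = (\<Sum>m<4. \<i> ^ m * of_real (LINT x|\<mu> (v m). exp (- \<tau> * x))) / 4"
    by (simp only: spectral_pairing_def \<mu>_def v_def[abs_def] integral_complex_of_real)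
  also have "\<dots> = (\<Sum>m<4. \<i> ^ m * (LINT l|lborel. complex_of_real (heat_weight \<tau> l * (L2_norm (E l (v m)))\<^sup>2))) / 4"
    by (simp only: integral_\<mu>_exp[OF v \<tau>] integral_complex_of_real)
  also have "\<dots> = (LINT l|lborel. (\<Sum>m<4. \<i> ^ m * complex_of_real (heat_weight \<tau> l * (L2_norm (E l (v m)))\<^sup>2)) / 4)"
    using int by (subst integral_divide_zero, subst Bochner_Integration.integral_sum)
      (auto intro!: integrable_mult_right simp del: of_real_mult of_real_power)
  also have "\<dots> = (LINT l|lborel. of_real (heat_weight \<tau> l) *
      ((\<Sum>m<4. \<i> ^ m * of_real ((L2_norm (E l (v m)))\<^sup>2)) / 4))"
    by (intro Bochner_Integration.integral_cong refl) (simp add: sum_distrib_left mult_ac)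
  finally show ?thesis
    unfolding v_def by (simp only: E_polarization[OF f k])
qed

text \<open>The exponential is bounded by 1 on \<open>[0, \<infinity>)\<close>, which carries the
  spectral measures. Hence the test space in \<open>is_spectral_integral\<close> is all of L2, as
  \<open>weak_int\<close> demands.\<close>

lemma spectral_domain_exp:
  assumes "\<tau> > 0"
  shows "spectral_domain E (\<lambda>l. of_real (exp (- \<tau> * l))) = L2"
proof -
  have "integrable (\<mu> f) (\<lambda>l. (norm (complex_of_real (exp (- \<tau> * l))))\<^sup>2)" if f: "f \<in> L2" for f
  proof -
    interpret finite_measure "\<mu> f"
      by (rule finite_measure_\<mu>[OF f])
    show ?thesis
    proof (rule integrable_const_bound[where B = 1])
      show "AE l in \<mu> f. norm ((norm (complex_of_real (exp (- \<tau> * l))))\<^sup>2) \<le> 1"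
        using AE_\<mu>_nonneg[OF f]
        by eventually_elim (use assms in \<open>simp add: power_le_one\<close>)
    qed measurable
  qed
  then show ?thesis
    by (auto simp: spectral_domain_def \<mu>_def)
qed

lemma weak_int_heat:
  assumes "\<tau> > 0" "is_spectral_integral E (\<lambda>l. of_real (exp (- \<tau> * l))) g h"
  shows "weak_int (heat_weight \<tau>) g h"
  using assms(2) spectral_pairing_exp[OF _ _ assms(1), of g]
  unfolding is_spectral_integral_def weak_int_def spectral_domain_exp[OF assms(1)] by auto

text \<open>\<open>heat_weight \<tau>\<close> is a probability density, so h is a weak average of
  the vectors \<open>E l g\<close>, none of them longer than g.\<close>

lemma heat_contraction:
  assumes "weak_int (heat_weight \<tau>) g h" "\<tau> > 0" "g \<in> L2"
  shows "L2_norm h \<le> L2_norm g"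
proof -
  have "(LINT l|lborel. \<bar>heat_weight \<tau> l\<bar>) = 1"
    using heat_weight_has_integral[OF assms(2)] assms(2)
    by (simp add: heat_weight_nonneg has_bochner_integral_integral_eq)
  then show ?thesis
    using weak_int_norm_le[OF assms(1)] assms by simp
qed

text \<open>\<open>P \<tau> g - g\<close> is the average of \<open>E m g - g\<close> with density
  \<open>heat_weight \<tau>\<close>. For small \<tau> this density puts only the mass
  \<open>1 - exp (- \<tau> M)\<close> on \<open>[0, M)\<close>, and beyond a large M the averaged
  vectors are short.\<close>

lemma heat_tendsto:
  assumes P: "\<And>\<tau>. \<tau> > 0 \<Longrightarrow> weak_int (heat_weight \<tau>) g (P \<tau>)" and g: "g \<in> L2"
  shows "((\<lambda>\<tau>. L2_norm (\<lambda>x. P \<tau> x - g x)) \<longlongrightarrow> 0) (at_right 0)"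
proof -
  have bound: "L2_norm (\<lambda>x. P \<tau> x - g x) \<le> e + 2 * L2_norm g * (1 - exp (- \<tau> * M))"
    if M: "\<And>m. m \<ge> M \<Longrightarrow> L2_norm (\<lambda>x. E m g x - g x) \<le> e" "M \<ge> 0" and \<tau>: "\<tau> > 0" and e: "e > 0"
    for e M \<tau>
  proof -
    let ?k = "\<lambda>x. P \<tau> x - g x"
    have Pl: "P \<tau> \<in> L2"
      using weak_int_L2[OF P[OF \<tau>]] .
    then have k: "?k \<in> L2"
      using g by auto
    \<comment> \<open>Equals e times the density beyond M and \<open>e + 2 * L2_norm g\<close> times
      the density below M. Allowing the additional e below M makes the integral exactly
      \<open>e + 2 * L2_norm g * (1 - exp (- \<tau> * M))\<close>.\<close>
    let ?B = "\<lambda>m. (e + 2 * L2_norm g) * heat_weight \<tau> m - 2 * L2_norm g * (if M \<le> m then \<tau> * exp (- \<tau> * m) else 0)"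
    have hB: "has_bochner_integral lborel ?B ((e + 2 * L2_norm g) * 1 - 2 * L2_norm g * exp (- \<tau> * M))"
      by (intro has_bochner_integral_diff has_bochner_integral_mult_right heat_weight_has_integral
          has_bochner_integral_exp_tail \<tau>)
    have Eg: "L2_norm (\<lambda>x. E m g x - g x) \<le> 2 * L2_norm g" for m
      using L2_norm_triangle_diff[of "E m g" g] E_norm_le[of g m] g by auto
    have i1: "has_bochner_integral lborel (\<lambda>m. complex_of_real (heat_weight \<tau> m) * L2_inner g ?k) (1 * L2_inner g ?k)"
      using has_bochner_integral_of_real[OF heat_weight_has_integral[OF \<tau>], where 'a = complex]
      by (intro has_bochner_integral_mult_left) auto
    have "L2_inner ?k ?k = L2_inner (P \<tau>) ?k - L2_inner g ?k"
      using Pl g k by (simp add: L2_inner_diff_left)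
    also have "\<dots> = (LINT m|lborel. of_real (heat_weight \<tau> m) * L2_inner (E m g) ?k)
        - (LINT m|lborel. of_real (heat_weight \<tau> m) * L2_inner g ?k)"
      using P[OF \<tau>] k has_bochner_integral_integral_eq[OF i1] by (simp add: weak_int_def)
    also have "\<dots> = (LINT m|lborel. of_real (heat_weight \<tau> m) * L2_inner (E m g) ?k
        - of_real (heat_weight \<tau> m) * L2_inner g ?k)"
      using weak_integrand_integrable[OF heat_weight_integrable[OF \<tau>] g k] integrable.intros[OF i1]
      by simp
    also have "\<dots> = (LINT m|lborel. of_real (heat_weight \<tau> m) * L2_inner (\<lambda>x. E m g x - g x) ?k)"
      using g k by (simp add: L2_inner_diff_left right_diff_distrib)
    finally have eq: "L2_inner ?k ?k = \<dots>" .
    have "norm (L2_inner ?k ?k) \<le> (LINT m|lborel. ?B m * L2_norm ?k)"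
      unfolding eq
    proof (rule Bochner_Integration.integral_norm_bound_integral)
      show "integrable lborel (\<lambda>m. of_real (heat_weight \<tau> m) * L2_inner (\<lambda>x. E m g x - g x) ?k)"
        using weak_integrand_integrable[OF heat_weight_integrable[OF \<tau>] g k] integrable.intros[OF i1] g k
        by (simp add: L2_inner_diff_left right_diff_distrib)
      show "integrable lborel (\<lambda>m. ?B m * L2_norm ?k)"
        using integrable.intros[OF hB] by (rule integrable_mult_left)
      fix m
      have "heat_weight \<tau> m * L2_norm (\<lambda>x. E m g x - g x) \<le> ?B m"
      proof (cases "m \<ge> M")
        case True
        then have "heat_weight \<tau> m * L2_norm (\<lambda>x. E m g x - g x) \<le> heat_weight \<tau> m * e"
          by (intro mult_left_mono M heat_weight_nonneg \<tau>)
        then show ?thesis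
          using True M(2) by (simp add: heat_weight_def algebra_simps)
      next
        case False
        have "heat_weight \<tau> m * L2_norm (\<lambda>x. E m g x - g x) \<le> heat_weight \<tau> m * (e + 2 * L2_norm g)"
          using Eg[of m] e by (intro mult_left_mono heat_weight_nonneg \<tau>) auto
        then show ?thesis
          using False by (simp add: mult.commute)
      qed
      then have "heat_weight \<tau> m * L2_norm (\<lambda>x. E m g x - g x) * L2_norm ?k \<le> ?B m * L2_norm ?k"
        by (rule mult_right_mono) simp
      moreover have "heat_weight \<tau> m * norm (L2_inner (\<lambda>x. E m g x - g x) ?k)
          \<le> heat_weight \<tau> m * (L2_norm (\<lambda>x. E m g x - g x) * L2_norm ?k)"
        using g k by (intro mult_left_mono L2_cauchy_schwarz heat_weight_nonneg \<tau>) auto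
      ultimately show "norm (of_real (heat_weight \<tau> m) * L2_inner (\<lambda>x. E m g x - g x) ?k) \<le> ?B m * L2_norm ?k"
        using heat_weight_nonneg[OF \<tau>, of m] by (simp add: norm_mult mult.assoc)
    qed
    also have "\<dots> = ((e + 2 * L2_norm g) * 1 - 2 * L2_norm g * exp (- \<tau> * M)) * L2_norm ?k"
      using has_bochner_integral_integral_eq[OF hB] by simp
    also have "(e + 2 * L2_norm g) * 1 - 2 * L2_norm g * exp (- \<tau> * M)
        = e + 2 * L2_norm g * (1 - exp (- \<tau> * M))"
      by (simp add: algebra_simps)
    finally show ?thesis
      using k e M \<tau> by (intro L2_norm_le_by_inner) auto
  qed
  show ?thesis
  proof (rule tendstoI)
    fix e :: real
    assume e: "e > 0"
    have "eventually (\<lambda>m. L2_norm (\<lambda>x. E m g x - g x) < e / 2) at_top"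
      using E_top[OF g] e by (intro order_tendstoD(2)) auto
    then obtain M0 where M0: "\<And>m. m \<ge> M0 \<Longrightarrow> L2_norm (\<lambda>x. E m g x - g x) < e / 2"
      by (auto simp: eventually_at_top_linorder)
    \<comment> \<open>M must be nonnegative, because the tail \<open>\<tau> exp (- \<tau> m)\<close>
      agrees with \<open>heat_weight\<close> only for m \<ge> 0.\<close>
    define M where "M = max M0 0"
    have M: "M \<ge> 0" "\<And>m. m \<ge> M \<Longrightarrow> L2_norm (\<lambda>x. E m g x - g x) \<le> e / 2"
      using M0 by (auto simp: M_def intro: less_imp_le)
    have "((\<lambda>\<tau>. e / 2 + 2 * L2_norm g * (1 - exp (- \<tau> * M))) \<longlongrightarrow> e / 2 + 2 * L2_norm g * (1 - exp (- 0 * M)))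
        (at_right 0)"
      by (intro tendsto_intros)
    from order_tendstoD(2)[OF this, of e]
    have "eventually (\<lambda>\<tau>. e / 2 + 2 * L2_norm g * (1 - exp (- \<tau> * M)) < e) (at_right 0)"
      using e by simp
    moreover have "eventually (\<lambda>\<tau>::real. \<tau> > 0) (at_right 0)"
      by (rule eventually_at_right_less)
    ultimately show "eventually (\<lambda>\<tau>. dist (L2_norm (\<lambda>x. P \<tau> x - g x)) 0 < e) (at_right 0)"
    proof eventually_elim
      case (elim \<tau>)
      then show ?case
        using bound[OF M(2,1) elim(2)] e by simp
    qed
  qed
qed

end

subsection \<open>The generator\<close>

text \<open>Minus the derivative of \<open>heat_weight \<tau> m\<close> in \<open>\<tau>\<close>.\<close>

definition heat_weight' :: "real \<Rightarrow> real \<Rightarrow> real" where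
  "heat_weight' \<tau> m = (if 0 \<le> m then (\<tau> * m - 1) * exp (- \<tau> * m) else 0)"

text \<open>A common L1 bound for \<open>heat_weight' \<tau>\<close> and for the backward difference
  quotients of \<open>heat_weight\<close> in \<tau> with step at most \<tau>/2. The halved exponent
  accounts for the intermediate points of the mean value theorem, which may come down to
  \<tau>/2.\<close>

definition heat_majorant :: "real \<Rightarrow> real \<Rightarrow> real" where
  "heat_majorant \<tau> m = (if 0 \<le> m then (1 + \<tau> * m) * exp (- (\<tau> / 2) * m) else 0)"

text \<open>The two terms contribute 2/\<tau> and 4/\<tau>. This is the origin of the factor
  \<open>6 / \<tau>\<close> in the bounds on the generator and on the gradient.\<close>

lemma heat_majorant_has_integral:
  assumes "\<tau> > 0"
  shows "has_bochner_integral lborel (heat_majorant \<tau>) (6 / \<tau>)"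
proof -
  have "has_bochner_integral lborel
     (\<lambda>m. (if 0 \<le> m then m ^ 0 * exp (- (\<tau> / 2) * m) else 0) + \<tau> * (if 0 \<le> m then m ^ 1 * exp (- (\<tau> / 2) * m) else 0))
     (fact 0 / (\<tau> / 2) ^ Suc 0 + \<tau> * (fact 1 / (\<tau> / 2) ^ Suc 1))"
    using assms by (intro has_bochner_integral_add has_bochner_integral_mult_right has_bochner_integral_power_exp) auto
  moreover have "fact 0 / (\<tau> / 2) ^ Suc 0 + \<tau> * (fact 1 / (\<tau> / 2) ^ Suc 1) = 6 / \<tau>"
    using assms by (simp add: field_simps)
  moreover have "(\<lambda>m. (if 0 \<le> m then m ^ 0 * exp (- (\<tau> / 2) * m) else 0) + \<tau> * (if 0 \<le> m then m ^ 1 * exp (- (\<tau> / 2) * m) else 0))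
      = heat_majorant \<tau>"
    by (auto simp: heat_majorant_def fun_eq_iff distrib_right)
  ultimately show ?thesis
    by (simp only:)
qed

lemma heat_weight'_measurable [measurable]: "heat_weight' \<tau> \<in> borel_measurable borel"
  unfolding heat_weight'_def[abs_def] by measurable

lemma heat_weight'_le_majorant:
  assumes "\<tau> > 0"
  shows "\<bar>heat_weight' \<tau> m\<bar> \<le> heat_majorant \<tau> m"
proof (cases "m \<ge> 0")
  case True
  then have "\<bar>\<tau> * m - 1\<bar> \<le> 1 + \<tau> * m"
    using assms mult_nonneg_nonneg[of \<tau> m] by (simp add: abs_le_iff)
  moreover have "exp (- \<tau> * m) \<le> exp (- (\<tau> / 2) * m)"
    using True assms by simp
  ultimately have "\<bar>\<tau> * m - 1\<bar> * exp (- \<tau> * m) \<le> (1 + \<tau> * m) * exp (- (\<tau> / 2) * m)"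
    by (intro mult_mono) auto
  then show ?thesis
    using True by (simp add: heat_weight'_def heat_majorant_def abs_mult)
qed (simp add: heat_weight'_def heat_majorant_def)

lemma heat_weight'_integrable:
  assumes "\<tau> > 0"
  shows "integrable lborel (heat_weight' \<tau>)"
proof (rule Bochner_Integration.integrable_bound[OF integrable.intros[OF heat_majorant_has_integral[OF assms]]])
  show "AE m in lborel. norm (heat_weight' \<tau> m) \<le> norm (heat_majorant \<tau> m)"
    using heat_weight'_le_majorant[OF assms] abs_ge_self order_trans by fastforce
qed measurable

text \<open>Mean value theorem in \<tau>: \<open>z exp (- z m)\<close> has derivative
  \<open>(1 - z m) exp (- z m)\<close> in z, and the intermediate point z lies between \<tau>/2 and
  \<tau>.\<close>

lemma heat_weight_quotient_le_majorant:
  assumes "0 < e" "e \<le> \<tau> / 2"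
  shows "\<bar>(heat_weight (\<tau> - e) m - heat_weight \<tau> m) / e\<bar> \<le> heat_majorant \<tau> m"
proof (cases "m \<ge> 0")
  case True
  have "\<exists>z. \<tau> - e < z \<and> z < \<tau> \<and> \<tau> * exp (- \<tau> * m) - (\<tau> - e) * exp (- (\<tau> - e) * m)
      = (\<tau> - (\<tau> - e)) * ((1 - z * m) * exp (- z * m))"
    by (rule MVT2) (use assms in \<open>auto intro!: derivative_eq_intros simp: algebra_simps\<close>)
  then obtain z where z: "\<tau> - e < z" "z < \<tau>"
    and eq: "\<tau> * exp (- \<tau> * m) - (\<tau> - e) * exp (- (\<tau> - e) * m) = e * ((1 - z * m) * exp (- z * m))"
    by auto
  have "\<bar>(heat_weight (\<tau> - e) m - heat_weight \<tau> m) / e\<bar> = \<bar>\<tau> * exp (- \<tau> * m) - (\<tau> - e) * exp (- (\<tau> - e) * m)\<bar> / e"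
    using True assms by (simp add: heat_weight_def abs_minus_commute)
  also have "\<dots> = \<bar>1 - z * m\<bar> * exp (- z * m)"
    unfolding eq using assms by (simp add: abs_mult)
  also have "\<dots> \<le> (1 + \<tau> * m) * exp (- (\<tau> / 2) * m)"
  proof (rule mult_mono)
    have "z * m \<le> \<tau> * m" "0 \<le> z * m"
      using z assms True by (auto intro!: mult_right_mono mult_nonneg_nonneg)
    then show "\<bar>1 - z * m\<bar> \<le> 1 + \<tau> * m"
      by (simp add: abs_le_iff)
    show "0 \<le> 1 + \<tau> * m"
      using \<open>z * m \<le> \<tau> * m\<close> \<open>0 \<le> z * m\<close> by linarith
    have "\<tau> / 2 * m \<le> z * m"
      using z assms True by (intro mult_right_mono) auto
    then show "exp (- z * m) \<le> exp (- (\<tau> / 2) * m)"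
      by simp
  qed auto
  finally show ?thesis
    using True by (simp add: heat_majorant_def)
qed (simp add: heat_weight_def heat_majorant_def)

text \<open>Backward steps are taken because the transport argument compares \<open>P\<close> at
  \<tau> with \<open>P\<close> at the earlier \<open>\<tau> - X n\<close>. The restriction to at
  most \<tau>/2 keeps this time positive and the quotients below the majorant, so dominated
  convergence applies.\<close>

lemma heat_weight_quotient_tendsto:
  assumes X: "X \<longlonglongrightarrow> 0" "\<And>n. 0 < X n" "\<And>n. X n \<le> \<tau> / 2"
  shows "(\<lambda>n. LINT m|lborel. \<bar>(heat_weight (\<tau> - X n) m - heat_weight \<tau> m) / X n - heat_weight' \<tau> m\<bar>) \<longlonglongrightarrow> 0"
proof -
  let ?q = "\<lambda>n m. (heat_weight (\<tau> - X n) m - heat_weight \<tau> m) / X n"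
  have \<tau>: "\<tau> > 0"
    using X(2)[of 0] X(3)[of 0] by simp
  have "(\<lambda>n. LINT m|lborel. \<bar>?q n m - heat_weight' \<tau> m\<bar>) \<longlonglongrightarrow> (LINT m::real|lborel. 0 :: real)"
  proof (rule integral_dominated_convergence[where w = "\<lambda>m. 2 * heat_majorant \<tau> m"])
    show "AE m in lborel. (\<lambda>n. \<bar>?q n m - heat_weight' \<tau> m\<bar>) \<longlonglongrightarrow> 0"
    proof (rule AE_I2)
      fix m
      have d: "((\<lambda>s. heat_weight s m) has_real_derivative - heat_weight' \<tau> m) (at \<tau>)"
        unfolding heat_weight_def heat_weight'_def
        by (cases "0 \<le> m") (auto intro!: derivative_eq_intros simp: algebra_simps)
      \<comment> \<open>Dividing by \<open>X n\<close> instead of by the increment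
        \<open>- X n\<close> changes the sign, so the limit is \<open>heat_weight'\<close> rather
        than the derivative \<open>- heat_weight'\<close>.\<close>
      have "filterlim (\<lambda>n. - X n) (at 0) sequentially"
        using tendsto_minus[OF X(1)] X(2)
        by (intro filterlim_atI always_eventually allI) (simp_all add: less_imp_neq[symmetric])
      from tendsto_minus[OF filterlim_compose[OF d[unfolded DERIV_def] this]]
      have "(\<lambda>n. ?q n m) \<longlonglongrightarrow> heat_weight' \<tau> m"
        by simp
      then have "(\<lambda>n. \<bar>?q n m - heat_weight' \<tau> m\<bar>) \<longlonglongrightarrow> \<bar>heat_weight' \<tau> m - heat_weight' \<tau> m\<bar>"
        by (intro tendsto_intros)
      then show "(\<lambda>n. \<bar>?q n m - heat_weight' \<tau> m\<bar>) \<longlonglongrightarrow> 0"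
        by simp
    qed
    show "integrable lborel (\<lambda>m. 2 * heat_majorant \<tau> m)"
      using integrable.intros[OF heat_majorant_has_integral[OF \<tau>]] by simp
    show "AE m in lborel. norm \<bar>?q n m - heat_weight' \<tau> m\<bar> \<le> 2 * heat_majorant \<tau> m" for n
    proof (rule AE_I2)
      fix m
      show "norm \<bar>?q n m - heat_weight' \<tau> m\<bar> \<le> 2 * heat_majorant \<tau> m"
        using heat_weight_quotient_le_majorant[OF X(2,3), of n m] heat_weight'_le_majorant[OF \<tau>, of m]
        unfolding real_norm_def by arith
    qed
  qed measurable
  then show ?thesis
    by simp
qed

context identity_resolution
begin

context
  fixes g :: "'a \<Rightarrow> complex" and P :: "real \<Rightarrow> 'a \<Rightarrow> complex"
  assumes g: "g \<in> L2" and P: "\<And>\<tau>. \<tau> > 0 \<Longrightarrow> weak_int (heat_weight \<tau>) g (P \<tau>)"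
begin

lemma weak_int_heat_quotient:
  assumes "0 < e" "e \<le> \<tau> / 2"
  shows "weak_int (\<lambda>m. (heat_weight (\<tau> - e) m - heat_weight \<tau> m) / e) g (\<lambda>x. (P (\<tau> - e) x - P \<tau> x) / of_real e)"
    and "integrable lborel (\<lambda>m. (heat_weight (\<tau> - e) m - heat_weight \<tau> m) / e)"
proof -
  have i: "integrable lborel (heat_weight (\<tau> - e))" "integrable lborel (heat_weight \<tau>)"
    using assms by auto
  then show "integrable lborel (\<lambda>m. (heat_weight (\<tau> - e) m - heat_weight \<tau> m) / e)"
    by (intro integrable_divide Bochner_Integration.integrable_diff)
  show "weak_int (\<lambda>m. (heat_weight (\<tau> - e) m - heat_weight \<tau> m) / e) g (\<lambda>x. (P (\<tau> - e) x - P \<tau> x) / of_real e)"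
    using weak_int_lincomb[OF P i(1) P i(2) g, of "1 / e" "- 1 / e"] assms
    by (simp add: diff_divide_distrib)
qed

text \<open>Uniform in the step e, so that it dominates the difference quotients when they are
  integrated over t and \<tau>.\<close>

lemma heat_quotient_norm_le:
  assumes "0 < e" "e \<le> \<tau> / 2"
  shows "L2_norm (\<lambda>x. (P (\<tau> - e) x - P \<tau> x) / of_real e) \<le> 6 / \<tau> * L2_norm g"
proof -
  have \<tau>: "\<tau> > 0"
    using assms by simp
  have "(LINT m|lborel. \<bar>(heat_weight (\<tau> - e) m - heat_weight \<tau> m) / e\<bar>) \<le> (LINT m|lborel. heat_majorant \<tau> m)"
    using weak_int_heat_quotient(2)[OF assms] heat_weight_quotient_le_majorant[OF assms]
      integrable.intros[OF heat_majorant_has_integral[OF \<tau>]]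
    by (intro integral_mono integrable_abs) auto
  also have "\<dots> = 6 / \<tau>"
    by (rule has_bochner_integral_integral_eq[OF heat_majorant_has_integral[OF \<tau>]])
  finally show ?thesis
    using weak_int_norm_le[OF weak_int_heat_quotient[OF assms] g] mult_right_mono L2_norm_nonneg
    by (meson order_trans)
qed

text \<open>The difference quotients of the flow are themselves weak integrals, and their weights
  converge to \<open>heat_weight' \<tau>\<close> in L1.\<close>

lemma heat_generator_exists:
  assumes \<tau>: "\<tau> > 0"
  obtains h where "weak_int (heat_weight' \<tau>) g h"
proof -
  define X where "X n = \<tau> / 2 / real (Suc n)" for n
  have X: "X \<longlonglongrightarrow> 0" "0 < X n" "X n \<le> \<tau> / 2" for n
    unfolding X_def by real_asymp (use \<tau> in \<open>auto simp: field_simps\<close>)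
  show ?thesis
    using weak_int_limit[OF weak_int_heat_quotient[OF X(2,3)] heat_weight'_integrable[OF \<tau>] g
        heat_weight_quotient_tendsto[OF X]] that
    by blast
qed

lemma heat_quotient_tendsto:
  assumes h: "weak_int (heat_weight' \<tau>) g h"
    and X: "X \<longlonglongrightarrow> 0" "\<And>n. 0 < X n" "\<And>n. X n \<le> \<tau> / 2"
  shows "(\<lambda>n. L2_norm (\<lambda>x. (P (\<tau> - X n) x - P \<tau> x) / of_real (X n) - h x)) \<longlonglongrightarrow> 0"
proof -
  have \<tau>: "\<tau> > 0"
    using X(2)[of 0] X(3)[of 0] by simp
  have "(\<lambda>n. (LINT m|lborel. \<bar>(heat_weight (\<tau> - X n) m - heat_weight \<tau> m) / X n - heat_weight' \<tau> m\<bar>) * L2_norm g)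
      \<longlonglongrightarrow> 0 * L2_norm g"
    by (intro tendsto_intros heat_weight_quotient_tendsto X)
  then have b: "(\<lambda>n. (LINT m|lborel. \<bar>(heat_weight (\<tau> - X n) m - heat_weight \<tau> m) / X n - heat_weight' \<tau> m\<bar>) * L2_norm g)
      \<longlonglongrightarrow> 0"
    by simp
  show ?thesis
    by (rule Lim_null_comparison[OF always_eventually b])
      (use weak_int_dist_le[OF weak_int_heat_quotient[OF X(2,3)] h heat_weight'_integrable[OF \<tau>] g] in simp)
qed

lemma heat_generator_norm_le:
  assumes \<tau>: "\<tau> > 0" and h: "weak_int (heat_weight' \<tau>) g h"
  shows "L2_norm h \<le> 6 / \<tau> * L2_norm g"
proof -
  have "(LINT m|lborel. \<bar>heat_weight' \<tau> m\<bar>) \<le> (LINT m|lborel. heat_majorant \<tau> m)"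
    using heat_weight'_integrable[OF \<tau>] heat_weight'_le_majorant[OF \<tau>]
      integrable.intros[OF heat_majorant_has_integral[OF \<tau>]]
    by (intro integral_mono integrable_abs) auto
  also have "\<dots> = 6 / \<tau>"
    by (rule has_bochner_integral_integral_eq[OF heat_majorant_has_integral[OF \<tau>]])
  finally show ?thesis
    using weak_int_norm_le[OF h heat_weight'_integrable[OF \<tau>] g] mult_right_mono L2_norm_nonneg
    by (meson order_trans)
qed

end

subsection \<open>The spectral integral of the identity\<close>

text \<open>The mass of \<open>\<mu> f\<close> on \<open>(l, \<infinity>)\<close>, expressed by a
  norm so that it can be estimated for sums of vectors.\<close>

definition tail :: "('a \<Rightarrow> complex) \<Rightarrow> real \<Rightarrow> real" where
  "tail f l = (L2_norm (\<lambda>x. f x - E l f x))\<^sup>2"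

lemma tail_measurable [measurable]: "f \<in> L2 \<Longrightarrow> tail f \<in> borel_measurable borel"
  unfolding tail_def by (simp add: E_defect)

lemma tail_nonneg [simp]: "0 \<le> tail f l"
  by (simp add: tail_def)

text \<open>Tonelli on the region \<open>0 \<le> l < x\<close>. With w the derivative of a function
  that vanishes at 0, the left side is the integral of that function against \<open>\<mu> f\<close>:
  the choice 1 gives the first moment, \<open>2 l\<close> the second.\<close>

lemma nn_integral_\<mu>_tail:
  assumes f: "f \<in> L2" and [measurable]: "w \<in> borel_measurable borel"
  shows "(\<integral>\<^sup>+ x. (\<integral>\<^sup>+ l. (if 0 \<le> l \<and> l < x then w l else 0) \<partial>lborel) \<partial>\<mu> f)
    = (\<integral>\<^sup>+ l. (if 0 \<le> l then w l * ennreal (tail f l) else 0) \<partial>lborel)"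
proof -
  interpret finite_measure "\<mu> f"
    by (rule finite_measure_\<mu>[OF f])
  interpret P: pair_sigma_finite "\<mu> f" lborel
    by standard
  have "(\<integral>\<^sup>+ x. (\<integral>\<^sup>+ l. (if 0 \<le> l \<and> l < x then w l else 0) \<partial>lborel) \<partial>\<mu> f)
    = (\<integral>\<^sup>+ l. (\<integral>\<^sup>+ x. (if 0 \<le> l \<and> l < x then w l else 0) \<partial>\<mu> f) \<partial>lborel)"
    by (rule P.Fubini'[symmetric]) measurable
  also have "\<dots> = (\<integral>\<^sup>+ l. (if 0 \<le> l then w l * ennreal (tail f l) else 0) \<partial>lborel)"
  proof (rule nn_integral_cong)
    fix l
    have "(\<integral>\<^sup>+ x. (if 0 \<le> l \<and> l < x then w l else 0) \<partial>\<mu> f)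
        = (\<integral>\<^sup>+ x. (if 0 \<le> l then w l else 0) * indicator {l<..} x \<partial>\<mu> f)"
      by (intro nn_integral_cong) (auto simp: indicator_def)
    also have "\<dots> = (if 0 \<le> l then w l else 0) * emeasure (\<mu> f) {l<..}"
      by (subst nn_integral_cmult_indicator) auto
    finally show "(\<integral>\<^sup>+ x. (if 0 \<le> l \<and> l < x then w l else 0) \<partial>\<mu> f)
        = (if 0 \<le> l then w l * ennreal (tail f l) else 0)"
      using f by (simp add: emeasure_\<mu>_Ioi tail_def)
  qed
  finally show ?thesis .
qed

lemma nn_integral_Ico_2l:
  assumes "0 \<le> x"
  shows "(\<integral>\<^sup>+ l. (if 0 \<le> l \<and> l < x then ennreal (2 * l) else 0) \<partial>lborel) = ennreal (x\<^sup>2)"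
proof -
  have "(\<integral>\<^sup>+ l. (if 0 \<le> l \<and> l < x then ennreal (2 * l) else 0) \<partial>lborel)
      = (\<integral>\<^sup>+ l. ennreal (2 * l) * indicator {0..x} l \<partial>lborel)"
    by (rule nn_integral_cong_AE, use AE_lborel_singleton[of x] in eventually_elim) (auto simp: indicator_def)
  also have "\<dots> = x\<^sup>2 - 0\<^sup>2"
    using assms by (intro nn_integral_FTC_Icc) (auto intro!: derivative_eq_intros)
  finally show ?thesis
    by simp
qed

lemma nn_integral_Ico_1:
  assumes "0 \<le> x"
  shows "(\<integral>\<^sup>+ l. (if 0 \<le> l \<and> l < x then 1 else 0) \<partial>lborel) = ennreal x"
proof -
  have "(\<integral>\<^sup>+ l. (if 0 \<le> l \<and> l < x then 1 else 0) \<partial>lborel) = (\<integral>\<^sup>+ l. indicator {0..<x} l \<partial>lborel)"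
    by (intro nn_integral_cong) (auto simp: indicator_def)
  then show ?thesis
    using assms by simp
qed

text \<open>Membership means a finite second moment, which equals the integral of \<open>2 l\<close>
  times the tail. In this form it can be checked for sums of vectors and for rapidly decaying
  tails.\<close>

lemma spectral_domain_id_iff:
  "f \<in> spectral_domain E of_real \<longleftrightarrow>
     f \<in> L2 \<and> (\<integral>\<^sup>+ l. (if 0 \<le> l then ennreal (2 * l) * ennreal (tail f l) else 0) \<partial>lborel) < \<infinity>"
proof (cases "f \<in> L2")
  case True
  have "(\<integral>\<^sup>+ x. ennreal (x\<^sup>2) \<partial>\<mu> f)
      = (\<integral>\<^sup>+ x. (\<integral>\<^sup>+ l. (if 0 \<le> l \<and> l < x then ennreal (2 * l) else 0) \<partial>lborel) \<partial>\<mu> f)"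
    by (rule nn_integral_cong_AE, use AE_\<mu>_nonneg[OF True] in eventually_elim) (simp add: nn_integral_Ico_2l)
  also have "\<dots> = (\<integral>\<^sup>+ l. (if 0 \<le> l then ennreal (2 * l) * ennreal (tail f l) else 0) \<partial>lborel)"
    by (rule nn_integral_\<mu>_tail[OF True]) measurable
  finally show ?thesis
    using True by (simp add: spectral_domain_def \<mu>_def[symmetric] integrable_iff_bounded)
qed (simp add: spectral_domain_def)

lemma integral_\<mu>_tail:
  assumes f: "f \<in> spectral_domain E of_real"
  shows "has_bochner_integral lborel (\<lambda>l. if 0 \<le> l then tail f l else 0) (LINT x|\<mu> f. x)"
proof -
  have fL: "f \<in> L2" and i2: "integrable (\<mu> f) (\<lambda>x. x\<^sup>2)"
    using f by (auto simp: spectral_domain_def \<mu>_def)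
  interpret finite_measure "\<mu> f"
    by (rule finite_measure_\<mu>[OF fL])
  \<comment> \<open>The measure is finite, so the second moment controls the first.\<close>
  have i1: "integrable (\<mu> f) (\<lambda>x. x)"
  proof (rule Bochner_Integration.integrable_bound)
    show "integrable (\<mu> f) (\<lambda>x. 1 + x\<^sup>2)"
      using i2 by simp
    have "\<bar>x\<bar> \<le> 1 + x\<^sup>2" for x :: real
      using sum_squares_bound[of 1 "\<bar>x\<bar>"] by simp
    then show "AE x in \<mu> f. norm x \<le> norm (1 + x\<^sup>2)"
      by simp
  qed measurable
  have nonneg: "AE x in \<mu> f. 0 \<le> x"
    by (rule AE_\<mu>_nonneg[OF fL])
  have "(\<integral>\<^sup>+ l. ennreal (if 0 \<le> l then tail f l else 0) \<partial>lborel)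
      = (\<integral>\<^sup>+ l. (if 0 \<le> l then 1 * ennreal (tail f l) else 0) \<partial>lborel)"
    by (intro nn_integral_cong) auto
  also have "\<dots> = (\<integral>\<^sup>+ x. (\<integral>\<^sup>+ l. (if 0 \<le> l \<and> l < x then 1 else 0) \<partial>lborel) \<partial>\<mu> f)"
    by (rule nn_integral_\<mu>_tail[OF fL, symmetric]) measurable
  also have "\<dots> = (\<integral>\<^sup>+ x. ennreal x \<partial>\<mu> f)"
    by (rule nn_integral_cong_AE, use nonneg in eventually_elim) (rule nn_integral_Ico_1)
  also have "\<dots> = ennreal (LINT x|\<mu> f. x)"
    by (rule nn_integral_eq_integral[OF i1 nonneg])
  finally show ?thesis
    using fL integral_nonneg_AE[OF nonneg] by (intro has_bochner_integral_nn_integral) auto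
qed

text \<open>Polarization takes first moments at the four vectors \<open>f + \<i>^m k\<close>, so
  these have to lie in the domain. The spectral measure is not additive in the vector, but its tail
  is a squared norm and obeys \<open>(a + b)^2 \<le> 2 a^2 + 2 b^2\<close>.\<close>

lemma spectral_domain_id_add:
  assumes f: "f \<in> spectral_domain E of_real" and k: "k \<in> spectral_domain E of_real"
  shows "(\<lambda>x. f x + c * k x) \<in> spectral_domain E of_real"
proof -
  have L: "f \<in> L2" "k \<in> L2"
    using f k by (auto simp: spectral_domain_def)
  let ?v = "\<lambda>x. f x + c * k x"
  let ?N = "\<lambda>f. \<integral>\<^sup>+ l. (if 0 \<le> l then ennreal (2 * l) * ennreal (tail f l) else 0) \<partial>lborel"
  have t: "tail ?v l \<le> 2 * tail f l + 2 * (norm c)\<^sup>2 * tail k l" for l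
  proof -
    have "L2_norm (\<lambda>x. ?v x - E l ?v x) = L2_norm (\<lambda>x. (f x - E l f x) + c * (k x - E l k x))"
    proof (rule L2_norm_cong_AE)
      show "AE x in lborel. ?v x - E l ?v x = (f x - E l f x) + c * (k x - E l k x)"
        using E_lincomb[OF L, of l 1 c] by eventually_elim (simp add: algebra_simps)
    qed (use L in \<open>auto intro!: L2_measurable L2_diff L2_add L2_scale E_L2\<close>)
    then show ?thesis
      using L2_norm_sq_sum_bound[of "\<lambda>x. f x - E l f x" "\<lambda>x. c * (k x - E l k x)"] L
      by (simp add: tail_def L2_norm_scale power_mult_distrib mult.assoc L2_scale L2_diff)
  qed
  have vL: "?v \<in> L2"
    using L by auto
  have "?N ?v \<le> (\<integral>\<^sup>+ l. 2 * (if 0 \<le> l then ennreal (2 * l) * ennreal (tail f l) else 0)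
      + ennreal (2 * (norm c)\<^sup>2) * (if 0 \<le> l then ennreal (2 * l) * ennreal (tail k l) else 0) \<partial>lborel)"
  proof (rule nn_integral_mono)
    fix l
    show "(if 0 \<le> l then ennreal (2 * l) * ennreal (tail ?v l) else 0)
      \<le> 2 * (if 0 \<le> l then ennreal (2 * l) * ennreal (tail f l) else 0)
      + ennreal (2 * (norm c)\<^sup>2) * (if 0 \<le> l then ennreal (2 * l) * ennreal (tail k l) else 0)"
    proof (cases "0 \<le> l")
      case True
      have "2 * l * tail ?v l \<le> 2 * l * (2 * tail f l + 2 * (norm c)\<^sup>2 * tail k l)"
        using t True by (intro mult_left_mono) auto
      also have "\<dots> = 2 * (2 * l * tail f l) + 2 * (norm c)\<^sup>2 * (2 * l * tail k l)"
        by (simp add: algebra_simps)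
      finally have "ennreal (2 * l * tail ?v l) \<le> ennreal (2 * (2 * l * tail f l) + 2 * (norm c)\<^sup>2 * (2 * l * tail k l))"
        by (rule ennreal_leI)
      also have "\<dots> = 2 * (ennreal (2 * l) * ennreal (tail f l)) + ennreal (2 * (norm c)\<^sup>2) * (ennreal (2 * l) * ennreal (tail k l))"
        using True by (simp add: ennreal_plus ennreal_mult mult_ac)
      finally show ?thesis
        using True by (simp add: ennreal_mult)
    qed simp
  qed
  also have "\<dots> = 2 * ?N f + ennreal (2 * (norm c)\<^sup>2) * ?N k"
    using L by (subst nn_integral_add) (auto simp: nn_integral_cmult)
  also have "\<dots> < \<infinity>"
    using f k unfolding spectral_domain_id_iff
    by (simp add: ennreal_mult_less_top ennreal_add_eq_top less_top[symmetric] ennreal_mult_eq_top_iff)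
  finally show ?thesis
    using vL by (simp add: spectral_domain_id_iff)
qed

text \<open>The first moment is the integral of the tail, and the tail, a difference of squared
  norms, polarizes to \<open><f, k - E_l k>\<close>. Thus the four spectral integrals become one
  Lebesgue integral.\<close>

lemma spectral_pairing_id:
  assumes f: "f \<in> spectral_domain E of_real" and k: "k \<in> spectral_domain E of_real"
  shows "spectral_pairing E of_real f k
    = (LINT l|lborel. (if 0 \<le> l then L2_inner f (\<lambda>x. k x - E l k x) else 0))"
proof -
  have L: "f \<in> L2" "k \<in> L2"
    using f k by (auto simp: spectral_domain_def)
  define v where "v = (\<lambda>(m::nat) x. f x + \<i> ^ m * k x)"
  have v: "v m \<in> spectral_domain E of_real" for m
    unfolding v_def by (rule spectral_domain_id_add[OF f k])
  then have vL: "v m \<in> L2" for m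
    by (auto simp: spectral_domain_def)
  have int: "has_bochner_integral lborel (\<lambda>l. complex_of_real (if 0 \<le> l then tail (v m) l else 0))
      (complex_of_real (LINT x|\<mu> (v m). x))" for m
    by (intro has_bochner_integral_of_real integral_\<mu>_tail v)
  have "spectral_pairing E of_real f k
      = (\<Sum>m<4. \<i> ^ m * of_real (LINT x|\<mu> (v m). x)) / 4"
    by (simp only: spectral_pairing_def \<mu>_def v_def integral_complex_of_real)
  also have "\<dots> = (LINT l|lborel. (\<Sum>m<4. \<i> ^ m * complex_of_real (if 0 \<le> l then tail (v m) l else 0)) / 4)"
    by (intro has_bochner_integral_integral_eq[symmetric] has_bochner_integral_divide_zero
        has_bochner_integral_sum has_bochner_integral_mult_right int)
  also have "\<dots> = (LINT l|lborel. (if 0 \<le> l then L2_inner f (\<lambda>x. k x - E l k x) else 0))"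
  proof (rule Bochner_Integration.integral_cong[OF refl])
    fix l
    have "(\<Sum>m<4. \<i> ^ m * complex_of_real (tail (v m) l)) / 4
        = (\<Sum>m<4. \<i> ^ m * complex_of_real ((L2_norm (v m))\<^sup>2)) / 4
         - (\<Sum>m<4. \<i> ^ m * complex_of_real ((L2_norm (E l (v m)))\<^sup>2)) / 4"
      using vL by (simp add: tail_def E_defect right_diff_distrib sum_subtractf diff_divide_distrib)
    also have "\<dots> = L2_inner f k - L2_inner (E l f) k"
      unfolding v_def by (simp only: polarization[OF L] E_polarization[OF L])
    also have "\<dots> = L2_inner f (\<lambda>x. k x - E l k x)"
      using L by (simp add: L2_inner_diff_right E_inner)
    finally show "(\<Sum>m<4. \<i> ^ m * complex_of_real (if 0 \<le> l then tail (v m) l else 0)) / 4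
       = (if 0 \<le> l then L2_inner f (\<lambda>x. k x - E l k x) else 0)"
      by (cases "0 \<le> l") auto
  qed
  finally show ?thesis .
qed

text \<open>\<open>heat_weight' \<tau> m\<close> is also minus the derivative of
  \<open>m exp (- \<tau> m)\<close> in m. Hence h is the integral of
  \<open>\<lambda> exp (- \<tau> \<lambda>)\<close> against \<open>dE_\<lambda> g\<close>, which is
  the operator applied to f. The identity is verified on the domain by writing both spectral
  integrals as Lebesgue integrals and exchanging their order.\<close>

theorem spectral_integral_generator:
  assumes g: "g \<in> L2" and \<tau>: "\<tau> > 0"
    and f: "weak_int (heat_weight \<tau>) g f" and h: "weak_int (heat_weight' \<tau>) g h"
  shows "is_spectral_integral E of_real f h"
  unfolding is_spectral_integral_def
proof (intro conjI ballI)
  have fL: "f \<in> L2"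
    by (rule weak_int_L2[OF f])
  show "h \<in> L2"
    by (rule weak_int_L2[OF h])
  \<comment> \<open>\<open>f - E l f\<close> is orthogonal to \<open>E m g\<close> for m \<le> l, so
    only the mass \<open>exp (- \<tau> l)\<close> of the density beyond l contributes. The
    exponential decay of the tail puts f into the domain.\<close>
  have "tail f l \<le> L2_norm g * L2_norm f * exp (- \<tau> * l)" if l: "0 \<le> l" for l
  proof -
    let ?k = "\<lambda>x. f x - E l f x"
    have k: "?k \<in> L2" "L2_norm ?k \<le> L2_norm f"
      using fL E_defect[OF fL, of l] by (auto intro!: power2_le_imp_le[of "L2_norm _" "L2_norm f"])
    have "of_real (tail f l) = (LINT m|lborel. of_real (heat_weight \<tau> m) * L2_inner (E m g) ?k)"
      using f k E_inner_defect[OF fL, of l] by (simp add: tail_def weak_int_def)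
    then have "tail f l = norm (LINT m|lborel. of_real (heat_weight \<tau> m) * L2_inner (E m g) ?k)"
      by (metis abs_of_nonneg norm_of_real tail_nonneg)
    also have "\<dots> \<le> (LINT m|lborel. (if l < m then \<tau> * exp (- \<tau> * m) else 0) * (L2_norm g * L2_norm f))"
    proof (rule Bochner_Integration.integral_norm_bound_integral)
      show "integrable lborel (\<lambda>m. of_real (heat_weight \<tau> m) * L2_inner (E m g) ?k)"
        by (rule weak_integrand_integrable[OF heat_weight_integrable[OF \<tau>] g k(1)])
      show "integrable lborel (\<lambda>m. (if l < m then \<tau> * exp (- \<tau> * m) else 0) * (L2_norm g * L2_norm f))"
        by (intro integrable_mult_left integrable.intros[OF has_bochner_integral_exp_tail'[OF \<tau>]])
      fix m
      have eq: "L2_inner (E m g) ?k = L2_inner (E m g) f - L2_inner (E (min m l) g) f"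
        using g fL by (simp add: L2_inner_diff_right E_inner_min)
      show "norm (of_real (heat_weight \<tau> m) * L2_inner (E m g) ?k)
          \<le> (if l < m then \<tau> * exp (- \<tau> * m) else 0) * (L2_norm g * L2_norm f)"
      proof (cases "l < m")
        case True
        have "norm (L2_inner (E m g) ?k) \<le> L2_norm g * L2_norm f"
          using E_inner_bound[OF g k(1), of m] mult_left_mono[OF k(2) L2_norm_nonneg[of g]] by simp
        then have "heat_weight \<tau> m * norm (L2_inner (E m g) ?k) \<le> heat_weight \<tau> m * (L2_norm g * L2_norm f)"
          by (rule mult_left_mono[OF _ heat_weight_nonneg[OF \<tau>]])
        then show ?thesis
          using True l \<tau> by (simp add: norm_mult heat_weight_def mult.assoc)
      next
        case False
        then show ?thesis
          unfolding eq by (simp add: min_absorb1)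
      qed
    qed
    also have "\<dots> = L2_norm g * L2_norm f * exp (- \<tau> * l)"
      using has_bochner_integral_integral_eq[OF has_bochner_integral_exp_tail'[OF \<tau>, of l]] by simp
    finally show ?thesis .
  qed
  then have "(\<integral>\<^sup>+ l. (if 0 \<le> l then ennreal (2 * l) * ennreal (tail f l) else 0) \<partial>lborel)
     \<le> (\<integral>\<^sup>+ l. ennreal (2 * (L2_norm g * L2_norm f) * (if 0 \<le> l then l ^ 1 * exp (- \<tau> * l) else 0)) \<partial>lborel)"
    by (intro nn_integral_mono) (auto simp flip: ennreal_mult intro!: ennreal_leI
        mult_left_mono simp: mult_ac)
  also have "\<dots> < \<infinity>"
  proof -
    have "integrable lborel (\<lambda>l. 2 * (L2_norm g * L2_norm f) * (if 0 \<le> l then l ^ 1 * exp (- \<tau> * l) else 0))"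
      by (intro integrable_mult_right integrable.intros[OF has_bochner_integral_power_exp] \<tau>)
    then show ?thesis
      by (subst nn_integral_eq_integral) auto
  qed
  finally show fd: "f \<in> spectral_domain E of_real"
    using fL by (simp add: spectral_domain_id_iff)
  fix k
  assume kd: "k \<in> spectral_domain E of_real"
  then have k: "k \<in> L2"
    by (simp add: spectral_domain_def)
  define c where "c l = L2_inner (E l g) k" for l
  define w where "w = heat_weight \<tau>"
  have [measurable]: "c \<in> borel_measurable borel" "w \<in> borel_measurable borel"
    unfolding c_def w_def using g k by measurable
  have w_nonneg: "0 \<le> w m" for m
    unfolding w_def by (rule heat_weight_nonneg[OF \<tau>])
  define C where "C = L2_norm g * L2_norm k"
  have c: "norm (c l) \<le> C" for l
    unfolding c_def C_def by (rule E_inner_bound[OF g k])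
  have wi: "integrable lborel w"
    unfolding w_def by (rule heat_weight_integrable[OF \<tau>])
  have wci: "integrable lborel (\<lambda>m. of_real (w m) * c m)"
    unfolding w_def c_def by (rule weak_integrand_integrable[OF heat_weight_integrable[OF \<tau>] g k])
  \<comment> \<open>The part with m > l of the weak integral defining f. For such m the pairing of
    \<open>E m g\<close> with \<open>k - E l k\<close> is \<open>c m - c l\<close>, and for m \<le>
    l it vanishes; the subtracted constant \<open>c l\<close> carries the weight
    \<open>exp (- \<tau> l)\<close>.\<close>
  define A where "A l = (LINT m|lborel. (if l < m then of_real (w m) * c m else 0))" for l
  have A: "L2_inner f (\<lambda>x. k x - E l k x) = A l - of_real (exp (- \<tau> * l)) * c l" if l: "0 \<le> l" for l
  proof -
    have i1: "integrable lborel (\<lambda>m. if l < m then of_real (w m) * c m else 0)"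
      by (rule Bochner_Integration.integrable_bound[OF wci]) auto
    have i2: "has_bochner_integral lborel (\<lambda>m. of_real (if l < m then \<tau> * exp (- \<tau> * m) else 0) * c l)
        (of_real (exp (- \<tau> * l)) * c l)"
      by (intro has_bochner_integral_mult_left has_bochner_integral_of_real has_bochner_integral_exp_tail' \<tau>)
    have "L2_inner f (\<lambda>x. k x - E l k x)
        = (LINT m|lborel. of_real (heat_weight \<tau> m) * L2_inner (E m g) (\<lambda>x. k x - E l k x))"
      using f k by (auto simp: weak_int_def)
    also have "\<dots> = (LINT m|lborel. (if l < m then of_real (w m) * c m else 0)
        - of_real (if l < m then \<tau> * exp (- \<tau> * m) else 0) * c l)"
    proof (rule Bochner_Integration.integral_cong[OF refl])
      fix m
      have "L2_inner (E m g) (\<lambda>x. k x - E l k x) = c m - c (min m l)"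
        using g k by (simp add: L2_inner_diff_right E_inner_min c_def)
      then show "of_real (heat_weight \<tau> m) * L2_inner (E m g) (\<lambda>x. k x - E l k x)
          = (if l < m then of_real (w m) * c m else 0)
            - of_real (if l < m then \<tau> * exp (- \<tau> * m) else 0) * c l"
        using l by (auto simp: min_def w_def heat_weight_def right_diff_distrib)
    qed
    also have "\<dots> = A l - of_real (exp (- \<tau> * l)) * c l"
      using i1 integrable.intros[OF i2] has_bochner_integral_integral_eq[OF i2] by (simp add: A_def)
    finally show ?thesis .
  qed
  have mwi: "integrable lborel (\<lambda>m. m * w m)"
  proof -
    have "integrable lborel (\<lambda>m. \<tau> * (if 0 \<le> m then m ^ 1 * exp (- \<tau> * m) else 0))"
      by (intro integrable_mult_right integrable.intros[OF has_bochner_integral_power_exp] \<tau>)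
    moreover have "(\<lambda>m. \<tau> * (if 0 \<le> m then m ^ 1 * exp (- \<tau> * m) else 0)) = (\<lambda>m. m * w m)"
      by (auto simp: w_def heat_weight_def)
    ultimately show ?thesis
      by simp
  qed
  have mwci: "integrable lborel (\<lambda>m. of_real (m * w m) * c m)"
    unfolding c_def by (rule weak_integrand_integrable[OF mwi g k])
  have Ico: "has_bochner_integral lborel (\<lambda>l. if 0 \<le> l \<and> l < m then z else 0) (of_real m * z)"
    if "0 \<le> m" for m :: real and z :: complex
  proof -
    have "has_bochner_integral lborel (\<lambda>l. indicator {0..<m} l *\<^sub>R z) (measure lborel {0..<m} *\<^sub>R z)"
      by (intro has_bochner_integral_scaleR_left has_bochner_integral_real_indicator) (auto simp: that)
    then show ?thesis
      using that by (elim has_bochner_integral_cong[THEN iffD1, rotated -1])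
        (auto simp: indicator_def scaleR_conv_of_real)
  qed
  have w0: "w m = 0" if "m < 0" for m
    using that by (simp add: w_def heat_weight_def)
  \<comment> \<open>Integrating \<open>A\<close> over l \<ge> 0 and exchanging the order leaves the
    length m of \<open>[0, m)\<close> as an extra factor; integrability of \<open>m * w m\<close>
    justifies the exchange.\<close>
  have K: "integrable (lborel \<Otimes>\<^sub>M lborel)
      (\<lambda>(m, l). if 0 \<le> l \<and> l < m then of_real (w m) * c m else 0)"
  proof (rule lborel_pair.Fubini_integrable)
    have "(LINT l|lborel. norm (case (m, l) of (m, l) \<Rightarrow> if 0 \<le> l \<and> l < m then of_real (w m) * c m else 0))
        = m * w m * norm (c m)" for m
    proof (cases "0 \<le> m")
      case True
      have "(LINT l|lborel. norm (case (m, l) of (m, l) \<Rightarrow> if 0 \<le> l \<and> l < m then of_real (w m) * c m else 0))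
        = (LINT l|lborel. indicator {0..<m} l * (w m * norm (c m)))"
        by (intro Bochner_Integration.integral_cong) (auto simp: indicator_def norm_mult w_nonneg)
      then show ?thesis
        using True by simp
    qed (simp add: w0 not_le cong: if_cong)
    moreover have "integrable lborel (\<lambda>m. m * w m * norm (c m))"
    proof (rule Bochner_Integration.integrable_bound[OF mwci])
      show "AE m in lborel. norm (m * w m * norm (c m)) \<le> norm (of_real (m * w m) * c m)"
        by (simp add: norm_mult abs_mult)
    qed measurable
    ultimately show "integrable lborel (\<lambda>m. LINT l|lborel. norm (case (m, l) of (m, l) \<Rightarrow>
        if 0 \<le> l \<and> l < m then of_real (w m) * c m else 0))"
      by simp
    have "integrable lborel (\<lambda>l. if 0 \<le> l \<and> l < m then of_real (w m) * c m else 0)" for m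
      using integrable.intros[OF Ico[of m "of_real (w m) * c m"]] by (cases "0 \<le> m") (simp_all add: w0 not_le cong: if_cong)
    then show "AE m in lborel. integrable lborel
        (\<lambda>l. case (m, l) of (m, l) \<Rightarrow> if 0 \<le> l \<and> l < m then of_real (w m) * c m else 0)"
      by simp
  qed measurable
  have Aeq: "(LINT m|lborel. (if 0 \<le> l \<and> l < m then of_real (w m) * c m else 0)) = (if 0 \<le> l then A l else 0)" for l
    by (simp add: A_def)
  have Ai: "integrable lborel (\<lambda>l. if 0 \<le> l then A l else 0)"
    using lborel_pair.integrable_snd[OF K] by (simp add: Aeq)
  have AI: "(LINT l|lborel. (if 0 \<le> l then A l else 0)) = (LINT m|lborel. of_real (m * w m) * c m)"
  proof -
    have "(LINT l|lborel. (if 0 \<le> l then A l else 0))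
       = (LINT m|lborel. LINT l|lborel. (if 0 \<le> l \<and> l < m then of_real (w m) * c m else 0))"
      using lborel_pair.Fubini_integral[OF K] by (simp add: Aeq)
    also have "\<dots> = (LINT m|lborel. of_real (m * w m) * c m)"
    proof (rule Bochner_Integration.integral_cong[OF refl])
      fix m
      show "(LINT l|lborel. (if 0 \<le> l \<and> l < m then of_real (w m) * c m else 0)) = of_real (m * w m) * c m"
        using has_bochner_integral_integral_eq[OF Ico[of m "of_real (w m) * c m"]]
        by (cases "0 \<le> m") (simp_all add: w0 not_le cong: if_cong)
    qed
    finally show ?thesis .
  qed
  let ?e = "\<lambda>l. if 0 \<le> l then l ^ 0 * exp (- \<tau> * l) else 0"
  have eci: "integrable lborel (\<lambda>l. of_real (?e l) * c l)"
    unfolding c_def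
    by (rule weak_integrand_integrable[OF integrable.intros[OF has_bochner_integral_power_exp[OF \<tau>]] g k])
  have "spectral_pairing E of_real f k
      = (LINT l|lborel. (if 0 \<le> l then A l else 0) - of_real (?e l) * c l)"
    unfolding spectral_pairing_id[OF fd kd]
    by (intro Bochner_Integration.integral_cong refl) (auto simp: A)
  also have "\<dots> = (LINT m|lborel. of_real (m * w m) * c m) - (LINT l|lborel. of_real (?e l) * c l)"
    using Ai eci by (simp only: Bochner_Integration.integral_diff AI)
  also have "\<dots> = (LINT m|lborel. of_real (m * w m) * c m - of_real (?e m) * c m)"
    using mwci eci by (simp only: Bochner_Integration.integral_diff)
  \<comment> \<open>\<open>\<tau> m exp (- \<tau> m) - exp (- \<tau> m)\<close> is the weight of the
    generator.\<close>
  also have "\<dots> = (LINT m|lborel. of_real (heat_weight' \<tau> m) * c m)"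
    by (intro Bochner_Integration.integral_cong refl)
      (auto simp: w_def heat_weight_def heat_weight'_def algebra_simps)
  also have "\<dots> = L2_inner h k"
    using h k by (simp add: weak_int_def c_def)
  finally show "L2_inner h k = spectral_pairing E of_real f k"
    by (rule sym)
qed

end

section \<open>Smooth functions with compact support\<close>

text \<open>The flat function \<open>exp (- 1 / y)\<close> times a power of \<open>1 / y\<close>.
  The powers are carried along because differentiation creates them: over all k the family is closed
  under differentiation up to linear combinations.\<close>

definition flat_exp :: "nat \<Rightarrow> real \<Rightarrow> real" where
  "flat_exp k y = (if y > 0 then inverse y ^ k * exp (- inverse y) else 0)"

lemma flat_tendsto_0: "(flat_exp k \<longlongrightarrow> 0) (at 0)"
proof (rule filterlim_split_at)
  have "((\<lambda>y. inverse y ^ k / exp (inverse y)) \<longlongrightarrow> (0::real)) (at_right 0)"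
    by (rule filterlim_compose[OF tendsto_power_div_exp_0 filterlim_inverse_at_top_right])
  moreover have "eventually (\<lambda>y. inverse y ^ k / exp (inverse y) = flat_exp k y) (at_right (0::real))"
    using eventually_at_right_less[of 0] by eventually_elim (simp add: flat_exp_def exp_minus divide_inverse)
  ultimately show "(flat_exp k \<longlongrightarrow> 0) (at_right 0)"
    by (rule Lim_transform_eventually)
  show "(flat_exp k \<longlongrightarrow> 0) (at_left 0)"
    by (rule tendsto_eventually, rule eventually_mono[OF eventually_at_left_real[of "-1"]])
      (auto simp: flat_exp_def)
qed

lemma flat_has_derivative:
  "(flat_exp k has_real_derivative flat_exp (k + 2) y - real k * flat_exp (k + 1) y) (at y)"
proof -
  consider "y > 0" | "y < 0" | "y = 0"
    by linarith
  then show ?thesis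
  proof cases
    case 1
    have "((\<lambda>y. inverse y ^ k * exp (- inverse y)) has_real_derivative
        flat_exp (k + 2) y - real k * flat_exp (k + 1) y) (at y)"
    proof (rule DERIV_cong)
      have "((\<lambda>y. exp (- inverse y)) has_real_derivative exp (- inverse y) * (inverse y)\<^sup>2) (at y)"
        using 1 by (auto intro!: derivative_eq_intros simp: power2_eq_square)
      then show "((\<lambda>y. inverse y ^ k * exp (- inverse y)) has_real_derivative
          (real k * (- (inverse y ^ Suc (Suc 0)) * inverse y ^ (k - Suc 0))) * exp (- inverse y)
          + (exp (- inverse y) * (inverse y)\<^sup>2) * inverse y ^ k) (at y)"
        using 1 by (intro DERIV_mult DERIV_power DERIV_inverse) auto
      show "(real k * (- (inverse y ^ Suc (Suc 0)) * inverse y ^ (k - Suc 0))) * exp (- inverse y)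
          + (exp (- inverse y) * (inverse y)\<^sup>2) * inverse y ^ k = flat_exp (k + 2) y - real k * flat_exp (k + 1) y"
        using 1 by (cases k) (simp_all add: flat_exp_def power2_eq_square algebra_simps)
    qed
    then show ?thesis
      by (rule has_field_derivative_transform_within_open[where S = "{0<..}"])
        (use 1 in \<open>auto simp: flat_exp_def\<close>)
  next
    case 2
    have "((\<lambda>y. 0) has_real_derivative flat_exp (k + 2) y - real k * flat_exp (k + 1) y) (at y)"
      using 2 by (auto simp: flat_exp_def)
    then show ?thesis
      by (rule has_field_derivative_transform_within_open[where S = "{..<0}"])
        (use 2 in \<open>auto simp: flat_exp_def\<close>)
  next
    case 3
    \<comment> \<open>At 0 the difference quotient of \<open>flat_exp k\<close> is
      \<open>flat_exp (k + 1)\<close> itself, whose limit is known.\<close>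
    have "(\<lambda>h. (flat_exp k (0 + h) - flat_exp k 0) / h) = flat_exp (k + 1)"
      by (auto simp: flat_exp_def fun_eq_iff field_simps)
    then show ?thesis
      using flat_tendsto_0[of "k + 1"] unfolding 3 DERIV_def by (simp add: flat_exp_def)
  qed
qed

lemma flat_nonneg: "0 \<le> flat_exp k y"
  by (simp add: flat_exp_def)

text \<open>From \<open>t^2 / 2 \<le> exp t\<close> at \<open>t = 1 / y\<close>. It bounds the
  gradients of the cutoffs.\<close>

lemma flat_2_le: "flat_exp 2 y \<le> 2"
proof (cases "y > 0")
  case True
  have "1 + inverse y + (inverse y)\<^sup>2 / 2 \<le> exp (inverse y)"
    using True by (intro exp_lower_Taylor_quadratic) simp
  then have "(inverse y)\<^sup>2 \<le> 2 * exp (inverse y)"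
    using True by (smt (verit) inverse_nonnegative_iff_nonnegative field_sum_of_halves)
  then show ?thesis
    using True by (simp add: flat_exp_def exp_minus field_simps)
qed (simp add: flat_exp_def)

text \<open>A class of functions closed under directional derivatives, hence consisting of smooth functions.\<close>

inductive bump_algebra :: "('a::euclidean_space \<Rightarrow> real) \<Rightarrow> bool" where
  const: "bump_algebra (\<lambda>x. c)"
| inner: "bump_algebra (\<lambda>x. x \<bullet> v)"
| flat: "bump_algebra (\<lambda>x. flat_exp k (a - b * (x \<bullet> x)))"
| add: "bump_algebra f \<Longrightarrow> bump_algebra g \<Longrightarrow> bump_algebra (\<lambda>x. f x + g x)"
| mult: "bump_algebra f \<Longrightarrow> bump_algebra g \<Longrightarrow> bump_algebra (\<lambda>x. f x * g x)"

lemma flat_quadratic_has_derivative: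
  fixes x :: "'a::euclidean_space"
  shows "((\<lambda>x. flat_exp k (a - b * (x \<bullet> x))) has_derivative
    (\<lambda>v. (flat_exp (k + 2) (a - b * (x \<bullet> x)) + (- real k) * flat_exp (k + 1) (a - b * (x \<bullet> x))) * ((- 2 * b) * (x \<bullet> v)))) (at x)"
proof -
  have "((\<lambda>x. a - b * (x \<bullet> x)) has_derivative (\<lambda>v. (- 2 * b) * (x \<bullet> v))) (at x)"
    by (auto intro!: derivative_eq_intros simp: inner_commute)
  from DERIV_compose_FDERIV[OF flat_has_derivative this] show ?thesis
    by (simp add: mult_ac)
qed

lemma bump_algebra_derivative:
  "bump_algebra f \<Longrightarrow> \<exists>f'. (\<forall>x. (f has_derivative f' x) (at x)) \<and> (\<forall>v. bump_algebra (\<lambda>x. f' x v))"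
proof (induction rule: bump_algebra.induct)
  case (const c)
  show ?case
    by (rule exI[of _ "\<lambda>x v. 0"]) (auto intro: bump_algebra.const)
next
  case (inner w)
  show ?case
    by (rule exI[of _ "\<lambda>x v. v \<bullet> w"]) (auto intro: bump_algebra.const intro!: derivative_eq_intros)
next
  case (flat k a b)
  show ?case
    by (rule exI, intro conjI allI, rule flat_quadratic_has_derivative)
      (intro bump_algebra.intros)
next
  case (add f g)
  then obtain f' g' where *: "\<And>x. (f has_derivative f' x) (at x)" "\<And>v. bump_algebra (\<lambda>x. f' x v)"
    "\<And>x. (g has_derivative g' x) (at x)" "\<And>v. bump_algebra (\<lambda>x. g' x v)"
    by metis
  show ?case
    by (rule exI[of _ "\<lambda>x v. f' x v + g' x v"]) (auto intro!: has_derivative_add bump_algebra.add *)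
next
  case (mult f g)
  then obtain f' g' where *: "\<And>x. (f has_derivative f' x) (at x)" "\<And>v. bump_algebra (\<lambda>x. f' x v)"
    "\<And>x. (g has_derivative g' x) (at x)" "\<And>v. bump_algebra (\<lambda>x. g' x v)"
    by metis
  show ?case
    by (rule exI[of _ "\<lambda>x v. f x * g' x v + f' x v * g x"])
      (auto intro!: has_derivative_mult bump_algebra.add bump_algebra.mult mult.hyps *)
qed

section \<open>Closure properties of \<open>Ck\<close> functions\<close>

lemma Ck_SucI:
  assumes "\<And>x. (f has_derivative f' x) (at x)" "\<And>v. v \<in> Basis \<Longrightarrow> Ck k (\<lambda>x. f' x v)"
  shows "Ck (Suc k) f"
proof -
  have "frechet_derivative f (at x) = f' x" for x
    using frechet_derivative_at[OF assms(1)] by simp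
  then show ?thesis
    using assms by (auto simp: differentiable_def)
qed

lemma Ck_continuous: "Ck k f \<Longrightarrow> continuous_on UNIV f"
  by (cases k) (auto intro!: differentiable_imp_continuous_on simp: differentiable_on_def)

lemma bump_algebra_Ck: "bump_algebra f \<Longrightarrow> Ck k f"
proof (induction k arbitrary: f)
  case 0
  then obtain f' where "\<And>x. (f has_derivative f' x) (at x)"
    using bump_algebra_derivative by blast
  then show ?case
    by (auto intro!: continuous_at_imp_continuous_on dest: has_derivative_continuous)
next
  case (Suc k)
  from bump_algebra_derivative[OF Suc.prems] Suc.IH show ?case
    by (blast intro: Ck_SucI)
qed

lemma Ck_Suc_has_derivative:
  "Ck (Suc k) f \<Longrightarrow> (f has_derivative frechet_derivative f (at x)) (at x)"
  by (simp add: frechet_derivative_works)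

lemma Ck_Suc: "Ck (Suc k) f \<Longrightarrow> Ck k f"
proof (induction k arbitrary: f)
  case 0
  then show ?case
    using Ck_continuous by fastforce
next
  case (Suc k)
  then show ?case
    by (subst Ck.simps) (metis Ck.simps(2))
qed

lemma Ck_linear:
  assumes T: "bounded_linear T"
  shows "Ck k f \<Longrightarrow> Ck k (\<lambda>x. T (f x))"
proof (induction k arbitrary: f)
  case 0
  then show ?case
    using bounded_linear.continuous_on[OF T] by simp
next
  case (Suc k)
  show ?case
  proof (rule Ck_SucI)
    show "((\<lambda>x. T (f x)) has_derivative (\<lambda>v. T (frechet_derivative f (at x) v))) (at x)" for x
      by (rule bounded_linear.has_derivative[OF T Ck_Suc_has_derivative[OF Suc.prems]])
    show "Ck k (\<lambda>x. T (frechet_derivative f (at x) v))" if "v \<in> Basis" for v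
      using Suc.prems that by (intro Suc.IH) simp
  qed
qed

lemma Ck_add: "Ck k f \<Longrightarrow> Ck k g \<Longrightarrow> Ck k (\<lambda>x. f x + g x)"
proof (induction k arbitrary: f g)
  case 0
  then show ?case
    by (simp add: continuous_on_add)
next
  case (Suc k)
  show ?case
  proof (rule Ck_SucI)
    show "((\<lambda>x. f x + g x) has_derivative
        (\<lambda>v. frechet_derivative f (at x) v + frechet_derivative g (at x) v)) (at x)" for x
      by (intro has_derivative_add Ck_Suc_has_derivative[OF Suc.prems(1)] Ck_Suc_has_derivative[OF Suc.prems(2)])
    show "Ck k (\<lambda>x. frechet_derivative f (at x) v + frechet_derivative g (at x) v)" if "v \<in> Basis" for v
      using Suc.prems that by (intro Suc.IH) simp_all
  qed
qed

lemma Ck_mult: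
  fixes f g :: "'a::euclidean_space \<Rightarrow> 'b::real_normed_algebra"
  shows "Ck k f \<Longrightarrow> Ck k g \<Longrightarrow> Ck k (\<lambda>x. f x * g x)"
proof (induction k arbitrary: f g)
  case 0
  then show ?case
    by (simp add: continuous_on_mult)
next
  case (Suc k)
  show ?case
  proof (rule Ck_SucI)
    show "((\<lambda>x. f x * g x) has_derivative
        (\<lambda>v. f x * frechet_derivative g (at x) v + frechet_derivative f (at x) v * g x)) (at x)" for x
      by (intro has_derivative_mult Ck_Suc_has_derivative[OF Suc.prems(1)] Ck_Suc_has_derivative[OF Suc.prems(2)])
    show "Ck k (\<lambda>x. f x * frechet_derivative g (at x) v + frechet_derivative f (at x) v * g x)" if "v \<in> Basis" for v
      using Suc.prems that Suc.prems[THEN Ck_Suc] by (intro Ck_add Suc.IH) simp_all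
  qed
qed

lemma Ck_const: "Ck k (\<lambda>x. c)"
proof (induction k arbitrary: c)
  case (Suc k)
  show ?case
    by (rule Ck_SucI[where f' = "\<lambda>x v. 0"]) (auto intro: Suc.IH)
qed simp

lemma Ck_sum: "(\<And>i. i \<in> I \<Longrightarrow> Ck k (f i)) \<Longrightarrow> Ck k (\<lambda>x. \<Sum>i\<in>I. f i x)"
  by (induction I rule: infinite_finite_induct) (auto intro: Ck_add Ck_const)

lemma frechet_derivative_Basis_expand:
  fixes f :: "'a::euclidean_space \<Rightarrow> 'b::real_normed_vector"
  assumes "f differentiable (at x)"
  shows "frechet_derivative f (at x) v = (\<Sum>b\<in>Basis. (v \<bullet> b) *\<^sub>R frechet_derivative f (at x) b)"
proof -
  have lin: "linear (frechet_derivative f (at x))"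
    using assms by (rule linear_frechet_derivative)
  have "frechet_derivative f (at x) v = frechet_derivative f (at x) (\<Sum>b\<in>Basis. (v \<bullet> b) *\<^sub>R b)"
    by (simp add: euclidean_representation)
  also have "\<dots> = (\<Sum>b\<in>Basis. (v \<bullet> b) *\<^sub>R frechet_derivative f (at x) b)"
    by (simp add: linear_sum[OF lin] linear_cmul[OF lin])
  finally show ?thesis .
qed

text \<open>\<open>Ck\<close> mentions only basis directions. Others occur as well, above all
  \<open>(1, 1, 0)\<close>, along which t - \<tau> is constant.\<close>

lemma Ck_dir_deriv:
  assumes "Ck (Suc k) f"
  shows "Ck k (dir_deriv f v)"
proof -
  have "dir_deriv f v = (\<lambda>x. \<Sum>b\<in>Basis. (v \<bullet> b) *\<^sub>R dir_deriv f b x)"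
    using assms by (intro ext frechet_derivative_Basis_expand) simp
  moreover have "Ck k \<dots>"
    using assms by (intro Ck_sum Ck_linear[OF bounded_linear_scaleR_right]) simp
  ultimately show ?thesis
    by simp
qed

text \<open>Serves the reflections \<open>y -> x - y\<close> and the embeddings
  \<open>x -> (t, \<tau>, x)\<close> of slices. L may map basis vectors to arbitrary directions, so
  the induction relies on \<open>Ck_dir_deriv\<close>.\<close>

lemma Ck_affine:
  assumes L: "bounded_linear L"
  shows "Ck k f \<Longrightarrow> Ck k (\<lambda>x. f (a + L x))"
proof (induction k arbitrary: f)
  case 0
  have "continuous_on UNIV (\<lambda>x. a + L x)"
    by (intro continuous_intros bounded_linear.continuous_on[OF L])
  then show ?case
    using 0 by (auto intro: continuous_on_compose2)
next
  case (Suc k)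
  show ?case
  proof (rule Ck_SucI)
    fix x
    have "((\<lambda>x. a + L x) has_derivative L) (at x)"
      by (auto intro!: derivative_eq_intros bounded_linear.has_derivative[OF L])
    from has_derivative_compose[OF this Ck_Suc_has_derivative[OF Suc.prems]]
    show "((\<lambda>x. f (a + L x)) has_derivative (\<lambda>v. frechet_derivative f (at (a + L x)) (L v))) (at x)" .
    show "Ck k (\<lambda>x. frechet_derivative f (at (a + L x)) (L v))" for v
      using Suc.IH[OF Ck_dir_deriv[OF Suc.prems]] .
  qed
qed

lemma dir_deriv_affine:
  assumes "bounded_linear L" "f differentiable (at (a + L x))"
  shows "dir_deriv (\<lambda>x. f (a + L x)) v x = dir_deriv f (L v) (a + L x)"
proof -
  have "((\<lambda>x. a + L x) has_derivative L) (at x)"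
    by (auto intro!: derivative_eq_intros bounded_linear.has_derivative[OF assms(1)])
  from frechet_derivative_at[OF has_derivative_compose[OF this assms(2)[unfolded frechet_derivative_works]]]
  show ?thesis
    by (simp add: fun_eq_iff)
qed

subsection \<open>Test functions\<close>

lemma test_functionsI:
  assumes "\<And>k. Ck k f" "compact K" "K \<subseteq> D" "\<And>x. f x \<noteq> 0 \<Longrightarrow> x \<in> K"
  shows "f \<in> test_functions D"
proof -
  have "closure {x. f x \<noteq> 0} \<subseteq> K"
    using assms by (intro closure_minimal compact_imp_closed) auto
  then show ?thesis
    using assms closed_Int_compact[of "closure {x. f x \<noteq> 0}" K]
    by (auto simp: test_functions_def Int_absorb2)
qed

text \<open>A single compact set serves the function and all its derivatives, because the function
  is locally zero off the closure of its nonzero set.\<close>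

lemma test_function_support:
  assumes "f \<in> test_functions D"
  obtains K where "compact K" "K \<subseteq> D" "\<And>x. x \<notin> K \<Longrightarrow> f x = 0"
    "\<And>x v. x \<notin> K \<Longrightarrow> dir_deriv f v x = 0"
proof (rule that[of "closure {x. f x \<noteq> 0}"])
  show z: "f x = 0" if "x \<notin> closure {x. f x \<noteq> 0}" for x
    using that closure_subset[of "{x. f x \<noteq> 0}"] by auto
  show "dir_deriv f v x = 0" if x: "x \<notin> closure {x. f x \<noteq> 0}" for x v
  proof -
    have "((\<lambda>x. 0) has_derivative (\<lambda>v. 0)) (at x)"
      by simp
    then have "(f has_derivative (\<lambda>v. 0)) (at x)"
    proof (rule has_derivative_transform_within_open[OF _ open_Compl[OF closed_closure[of "{x. f x \<noteq> 0}"]]])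
      show "0 = f y" if "y \<in> - closure {x. f x \<noteq> 0}" for y
        using z[of y] that by simp
    qed (use x in blast)
    from frechet_derivative_at[OF this] show ?thesis
      by (simp add: fun_eq_iff)
  qed
qed (use assms in \<open>auto simp: test_functions_def\<close>)

lemma test_function_Ck: "f \<in> test_functions D \<Longrightarrow> Ck k f"
  by (simp add: test_functions_def)

lemma test_function_differentiable: "f \<in> test_functions D \<Longrightarrow> f differentiable (at x)"
  using test_function_Ck[of f D "Suc 0"] by simp

lemma test_function_continuous: "f \<in> test_functions D \<Longrightarrow> continuous_on UNIV f"
  using test_function_Ck[of f D 0] by simp

lemma dir_deriv_test_function:
  assumes "f \<in> test_functions D"
  shows "dir_deriv f v \<in> test_functions D"
proof -
  obtain K where K: "compact K" "K \<subseteq> D" "\<And>x. x \<notin> K \<Longrightarrow> dir_deriv f v x = 0"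
    using test_function_support[OF assms] by metis
  show ?thesis
  proof (rule test_functionsI[OF _ K(1,2)])
    show "Ck k (dir_deriv f v)" for k
      by (rule Ck_dir_deriv[OF test_function_Ck[OF assms]])
    show "x \<in> K" if "dir_deriv f v x \<noteq> 0" for x
      using K(3)[of x] that by argo
  qed
qed

lemma test_functions_mono: "D \<subseteq> D' \<Longrightarrow> test_functions D \<subseteq> test_functions D'"
  by (auto simp: test_functions_def)

lemma test_function_measurable:
  "f \<in> test_functions D \<Longrightarrow> f \<in> borel_measurable borel"
  by (intro borel_measurable_continuous_onI test_function_continuous)

lemma test_function_bounded:
  fixes f :: "'a::euclidean_space \<Rightarrow> 'b::real_normed_vector"
  assumes "f \<in> test_functions D"
  obtains B where "B > 0" "\<And>x. norm (f x) \<le> B"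
proof -
  obtain K where K: "compact K" "\<And>x. x \<notin> K \<Longrightarrow> f x = 0"
    using test_function_support[OF assms] by metis
  have "compact (f ` K)"
    using K(1) test_function_continuous[OF assms] continuous_on_subset
    by (intro compact_continuous_image) auto
  then obtain B where B: "B > 0" "\<forall>y\<in>f ` K. norm y \<le> B"
    using bounded_pos compact_imp_bounded by blast
  show ?thesis
  proof (rule that[OF B(1)])
    fix x
    show "norm (f x) \<le> B"
      using B K(2)[of x] by (cases "x \<in> K") auto
  qed
qed

lemma test_function_L2:
  fixes f :: "'a::euclidean_space \<Rightarrow> complex"
  assumes "f \<in> test_functions D"
  shows "f \<in> L2"
proof -
  obtain K where K: "compact K" "\<And>x. x \<notin> K \<Longrightarrow> f x = 0"
    using test_function_support[OF assms] by metis
  obtain B where B: "B > 0" "\<And>x. norm (f x) \<le> B"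
    using test_function_bounded[OF assms] by metis
  have [measurable]: "f \<in> borel_measurable borel"
    by (rule test_function_measurable[OF assms])
  have "integrable lborel (\<lambda>x. (norm (f x))\<^sup>2)"
  proof (rule Bochner_Integration.integrable_bound)
    show "integrable lborel (\<lambda>x. indicator K x * B\<^sup>2)"
      using emeasure_compact_finite[OF K(1)] compact_imp_closed[OF K(1)] by simp
    show "AE x in lborel. norm ((norm (f x))\<^sup>2) \<le> norm (indicator K x * B\<^sup>2)"
      using K(2) B by (auto simp: indicator_def intro!: power_mono)
  qed simp
  then show ?thesis
    by (simp add: L2_def)
qed

lemma test_function_of_real_L2:
  fixes f :: "'a::euclidean_space \<Rightarrow> real"
  assumes "f \<in> test_functions D"
  shows "(\<lambda>x. complex_of_real (f x)) \<in> L2"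
proof (rule test_function_L2)
  obtain K where K: "compact K" "K \<subseteq> D" "\<And>x. x \<notin> K \<Longrightarrow> f x = 0"
    using test_function_support[OF assms] by metis
  show "(\<lambda>x. complex_of_real (f x)) \<in> test_functions D"
    by (rule test_functionsI[OF _ K(1,2)])
      (use K(3) in \<open>auto intro!: Ck_linear[OF bounded_linear_of_real] test_function_Ck[OF assms]\<close>)
qed

section \<open>Mollifiers and cutoff functions\<close>

lemma mollifier_exists:
  assumes "e > 0"
  obtains \<eta> :: "'a::euclidean_space \<Rightarrow> real"
  where "\<eta> \<in> test_functions UNIV" "\<And>x. 0 \<le> \<eta> x" "has_bochner_integral lborel \<eta> 1"
    "\<And>x. \<eta> x \<noteq> 0 \<Longrightarrow> norm x \<le> e"
proof -
  \<comment> \<open>The radial bump \<open>exp (- 1 / (e^2 - (norm x)^2))\<close>, smooth as a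
    member of \<open>bump_algebra\<close>. It is positive on the open ball, hence has a positive
    integral and can be normalized.\<close>
  define b :: "'a \<Rightarrow> real" where "b x = flat_exp 0 (e\<^sup>2 - 1 * (x \<bullet> x))" for x
  have supp: "norm x \<le> e" if "b x \<noteq> 0" for x
  proof -
    have "(norm x)\<^sup>2 \<le> e\<^sup>2"
      using that by (auto simp: b_def flat_exp_def power2_norm_eq_inner split: if_splits)
    then show ?thesis
      by (rule power2_le_imp_le) (use assms in simp)
  qed
  have Ckb: "Ck k b" for k
    unfolding b_def[abs_def] by (intro bump_algebra_Ck bump_algebra.intros)
  have b: "b \<in> test_functions UNIV"
    by (rule test_functionsI[OF Ckb, of "cball 0 e"]) (use supp in auto)
  have nonneg: "0 \<le> b x" for x
    by (simp add: b_def flat_nonneg)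
  have [measurable]: "b \<in> borel_measurable borel"
    by (rule test_function_measurable[OF b])
  have int: "integrable lborel b"
  proof (rule Bochner_Integration.integrable_bound)
    show "integrable lborel (\<lambda>x::'a. indicator (cball 0 e) x :: real)"
      using emeasure_compact_finite[of "cball (0::'a) e"] by simp
    have "b x \<le> 1" for x
      by (simp add: b_def flat_exp_def)
    moreover have "b x = 0" if "\<not> norm x \<le> e" for x
      using supp[of x] that by argo
    ultimately show "AE x in lborel. norm (b x) \<le> norm (indicator (cball 0 e) x :: real)"
      using nonneg by (intro AE_I2) (auto simp: indicator_def)
  qed simp
  have pos: "0 < integral\<^sup>L lborel b"
  proof (rule ccontr)
    assume "\<not> 0 < integral\<^sup>L lborel b"
    then have "integral\<^sup>L lborel b = 0"
      using nonneg by (simp add: integral_nonneg_AE antisym not_less)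
    then have z: "AE x in lborel. b x = 0"
      using integral_nonneg_eq_0_iff_AE[OF int] nonneg by simp
    have p: "b x > 0" if "x \<in> ball 0 e" for x
    proof -
      have "(norm x)\<^sup>2 < e\<^sup>2"
        using that assms by (intro power_strict_mono) auto
      then show ?thesis
        by (simp add: b_def flat_exp_def power2_norm_eq_inner)
    qed
    have "AE x in lborel. x \<notin> ball (0::'a) e"
      using z by eventually_elim (metis p less_irrefl)
    then have "emeasure lborel (ball (0::'a) e) = 0"
      by (subst (asm) AE_iff_measurable[of "ball 0 e"]) auto
    then show False
      using content_ball_pos[OF assms, of "0::'a"] by (simp add: measure_def)
  qed
  show ?thesis
  proof (rule that[of "\<lambda>x. b x / integral\<^sup>L lborel b"])
    have "(\<lambda>x. b x / integral\<^sup>L lborel b) = (\<lambda>x. b x * (1 / integral\<^sup>L lborel b))"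
      by simp
    then have "Ck k (\<lambda>x. b x / integral\<^sup>L lborel b)" for k
      using Ck_mult[OF Ckb Ck_const] by metis
    then show "(\<lambda>x. b x / integral\<^sup>L lborel b) \<in> test_functions UNIV"
      by (rule test_functionsI[of _ "cball 0 e"]) (use supp in auto)
    show "has_bochner_integral lborel (\<lambda>x. b x / integral\<^sup>L lborel b) 1"
      using has_bochner_integral_divide_zero[OF has_bochner_integral_integrable[OF int], of "integral\<^sup>L lborel b"] pos
      by simp
  qed (use nonneg pos supp in auto)
qed

text \<open>The factor \<open>exp 1\<close> makes the value at the centre 1. The function is not
  constant near the centre, so its formula is exported to show that it tends to 1 pointwise as R
  grows. In the derivative, \<open>flat_exp 2\<close> contributes at most 2, the inner derivative
  \<open>2 / R^2\<close>, and \<open>x \<bullet> v\<close> at most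
  \<open>R * norm v\<close>.\<close>

lemma cutoff_exists:
  assumes "R > 0"
  obtains \<kappa> :: "'a::euclidean_space \<Rightarrow> real"
  where "\<kappa> \<in> test_functions UNIV" "\<And>x. 0 \<le> \<kappa> x" "\<And>x. \<kappa> x \<le> 1"
    "\<And>x. \<kappa> x = exp 1 * flat_exp 0 (1 - (norm x / R)\<^sup>2)"
    "\<And>x v. \<bar>dir_deriv \<kappa> v x\<bar> \<le> 4 * exp 1 / R * norm v"
proof -
  define \<kappa> :: "'a \<Rightarrow> real" where "\<kappa> x = exp 1 * flat_exp 0 (1 - (1 / R\<^sup>2) * (x \<bullet> x))" for x
  have eq: "1 - (1 / R\<^sup>2) * (x \<bullet> x) = 1 - (norm x / R)\<^sup>2" for x :: 'a
    by (simp add: power_divide power2_norm_eq_inner)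
  have \<kappa>_eq: "\<kappa> x = exp 1 * flat_exp 0 (1 - (norm x / R)\<^sup>2)" for x
    by (simp only: \<kappa>_def eq)
  have supp: "norm x \<le> R" if "flat_exp k (1 - (norm x / R)\<^sup>2) \<noteq> 0" for x :: 'a and k
  proof -
    have "(norm x / R)\<^sup>2 \<le> 1\<^sup>2"
      using that by (auto simp: flat_exp_def split: if_splits)
    then have "norm x / R \<le> 1"
      by (rule power2_le_imp_le) simp
    then show ?thesis
      using assms by (simp add: field_simps)
  qed
  have "((\<lambda>x. exp 1 * flat_exp 0 (1 - (1 / R\<^sup>2) * (x \<bullet> x))) has_derivative
      (\<lambda>v. exp 1 * (flat_exp 2 (1 - (norm x / R)\<^sup>2) * ((- 2 * (1 / R\<^sup>2)) * (x \<bullet> v))))) (at x)" for x :: 'a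
    using has_derivative_mult_right[OF flat_quadratic_has_derivative[of 0 1 "1 / R\<^sup>2" x], of "exp 1"]
    by (simp add: power2_norm_eq_inner power_divide del: add_2_eq_Suc')
  from frechet_derivative_at[OF this]
  have d: "dir_deriv \<kappa> v x = exp 1 * (flat_exp 2 (1 - (norm x / R)\<^sup>2) * ((- 2 * (1 / R\<^sup>2)) * (x \<bullet> v)))" for x v
    unfolding \<kappa>_def[abs_def] by (rule fun_cong[OF sym])
  show ?thesis
  proof (rule that[of \<kappa>])
    show "\<kappa> \<in> test_functions UNIV"
    proof (rule test_functionsI[of _ "cball 0 R"])
      show "Ck k \<kappa>" for k
        unfolding \<kappa>_def[abs_def] by (intro bump_algebra_Ck bump_algebra.intros)
    qed (use supp in \<open>auto simp: \<kappa>_eq\<close>)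
    show "0 \<le> \<kappa> x" for x
      by (simp add: \<kappa>_eq flat_nonneg)
    show "\<kappa> x \<le> 1" for x
    proof (cases "1 - (norm x / R)\<^sup>2 > 0")
      case True
      then have "1 \<le> inverse (1 - (norm x / R)\<^sup>2)"
        by (intro one_le_inverse) auto
      then have "exp (1 - inverse (1 - (norm x / R)\<^sup>2)) \<le> exp 0"
        by (subst exp_le_cancel_iff) simp
      then show ?thesis
        using True by (simp add: \<kappa>_eq flat_exp_def exp_diff exp_minus divide_inverse)
    qed (simp add: \<kappa>_eq flat_exp_def)
    show "\<kappa> x = exp 1 * flat_exp 0 (1 - (norm x / R)\<^sup>2)" for x
      by (simp add: \<kappa>_eq)
    show "\<bar>dir_deriv \<kappa> v x\<bar> \<le> 4 * exp 1 / R * norm v" for x v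
    proof (cases "norm x \<le> R")
      case True
      have "\<bar>x \<bullet> v\<bar> \<le> R * norm v"
        using Cauchy_Schwarz_ineq2[of x v] mult_right_mono[OF True norm_ge_zero[of v]] by linarith
      then have "\<bar>dir_deriv \<kappa> v x\<bar> \<le> exp 1 * (2 * (2 / R\<^sup>2 * (R * norm v)))"
        unfolding d abs_mult using flat_2_le flat_nonneg assms
        by (intro mult_mono) auto
      then show ?thesis
        using assms by (simp add: power2_eq_square field_simps)
    next
      case False
      then have "flat_exp 2 (1 - (norm x / R)\<^sup>2) = 0"
        using supp[of 2 x] by argo
      then show ?thesis
        using assms by (simp add: d)
    qed
  qed
qed

section \<open>Mollification in \<open>L\<^sup>2\<close>\<close>

lemma lborel_distr_minus:
  fixes x :: "'a::euclidean_space"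
  shows "distr lborel borel (\<lambda>y. x - y) = lborel"
  using lborel_affine[of "-1" x] by (simp add: density_1)

lemma nn_integral_lborel_minus:
  fixes x :: "'a::euclidean_space"
  assumes [measurable]: "F \<in> borel_measurable borel"
  shows "(\<integral>\<^sup>+ y. F (x - y) \<partial>lborel) = (\<integral>\<^sup>+ y. F y \<partial>lborel)"
proof -
  have "(\<integral>\<^sup>+ y. F y \<partial>lborel) = (\<integral>\<^sup>+ y. F y \<partial>distr lborel borel (\<lambda>y. x - y))"
    by (simp add: lborel_distr_minus)
  also have "\<dots> = (\<integral>\<^sup>+ y. F (x - y) \<partial>lborel)"
    by (rule nn_integral_distr) measurable
  finally show ?thesis ..
qed

lemma integral_lborel_minus:
  fixes x :: "'a::euclidean_space" and F :: "'a \<Rightarrow> 'b::{banach, second_countable_topology}"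
  assumes [measurable]: "F \<in> borel_measurable borel"
  shows "(LINT y|lborel. F (x - y)) = (LINT y|lborel. F y)"
proof -
  have "(LINT y|lborel. F y) = (LINT y|distr lborel borel (\<lambda>y. x - y). F y)"
    by (simp add: lborel_distr_minus)
  also have "\<dots> = (LINT y|lborel. F (x - y))"
    by (rule integral_distr) measurable
  finally show ?thesis ..
qed

lemma nn_integral_lborel_shift:
  fixes z :: "'a::euclidean_space"
  assumes [measurable]: "F \<in> borel_measurable borel"
  shows "(\<integral>\<^sup>+ y. F (y - z) \<partial>lborel) = (\<integral>\<^sup>+ y. F y \<partial>lborel)"
proof -
  have "(\<integral>\<^sup>+ y. F y \<partial>lborel) = (\<integral>\<^sup>+ y. F y \<partial>distr lborel borel ((+) (- z)))"
    by (simp add: lborel_distr_plus)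
  also have "\<dots> = (\<integral>\<^sup>+ y. F (- z + y) \<partial>lborel)"
    by (rule nn_integral_distr) measurable
  finally show ?thesis
    by simp
qed

lemma integral_lborel_shift:
  fixes z :: "'a::euclidean_space" and F :: "'a \<Rightarrow> 'b::{banach, second_countable_topology}"
  assumes [measurable]: "F \<in> borel_measurable borel"
  shows "(LINT y|lborel. F (y - z)) = (LINT y|lborel. F y)"
proof -
  have "(LINT y|lborel. F y) = (LINT y|distr lborel borel ((+) (- z)). F y)"
    by (simp add: lborel_distr_plus)
  also have "\<dots> = (LINT y|lborel. F (- z + y))"
    by (rule integral_distr) measurable
  finally show ?thesis
    by simp
qed

lemma L2_shift:
  assumes "f \<in> L2"
  shows "(\<lambda>x. f (x - z)) \<in> L2" "L2_norm (\<lambda>x. f (x - z)) = L2_norm f"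
proof -
  have [measurable]: "f \<in> borel_measurable borel"
    using assms by measurable
  show "(\<lambda>x. f (x - z)) \<in> L2"
    using assms nn_integral_lborel_shift[of "\<lambda>x. ennreal ((norm (f x))\<^sup>2)" z]
    by (simp add: L2_nn_iff)
  show "L2_norm (\<lambda>x. f (x - z)) = L2_norm f"
    using integral_lborel_shift[of "\<lambda>x. (norm (f x))\<^sup>2" z]
    by (simp add: L2_norm_def)
qed

definition translation_continuous :: "('a::euclidean_space \<Rightarrow> complex) \<Rightarrow> bool" where
  "translation_continuous f \<longleftrightarrow>
     (\<forall>z. z \<longlonglongrightarrow> 0 \<longrightarrow> (\<lambda>n. L2_norm (\<lambda>x. f (x - z n) - f x)) \<longlonglongrightarrow> 0)"

lemma L2_dominated_convergence:
  assumes [measurable]: "\<And>n. F n \<in> borel_measurable borel" "f \<in> borel_measurable borel"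
    and w: "integrable lborel w" and bound: "\<And>n. AE x in lborel. (norm (F n x - f x))\<^sup>2 \<le> w x"
    and lim: "AE x in lborel. (\<lambda>n. F n x) \<longlonglongrightarrow> f x"
  shows "(\<lambda>n. L2_norm (\<lambda>x. F n x - f x)) \<longlonglongrightarrow> 0"
proof -
  have "(\<lambda>n. LINT x|lborel. (norm (F n x - f x))\<^sup>2) \<longlonglongrightarrow> (LINT x::'a|lborel. (0::real))"
  proof (rule integral_dominated_convergence[OF _ _ w])
    show "AE x in lborel. (\<lambda>n. (norm (F n x - f x))\<^sup>2) \<longlonglongrightarrow> 0"
      using lim
    proof eventually_elim
      case (elim x)
      have "(\<lambda>n. (norm (F n x - f x))\<^sup>2) \<longlonglongrightarrow> (norm (f x - f x))\<^sup>2"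
        by (intro tendsto_intros elim)
      then show ?case
        by simp
    qed
  qed (use bound in auto)
  from tendsto_real_sqrt[OF this] show ?thesis
    by (simp add: L2_norm_def)
qed

lemma L2_indicator:
  assumes [measurable]: "B \<in> sets borel" and "emeasure lborel B < \<infinity>"
  shows "(\<lambda>x. indicator B x :: complex) \<in> L2"
proof -
  have "(\<lambda>x. (norm (indicator B x :: complex))\<^sup>2) = indicator B"
    by (auto simp: fun_eq_iff indicator_def)
  then show ?thesis
    using assms by (simp add: L2_def)
qed

text \<open>The squared distance is \<open>2 |U| - 2 |U \<inter> (U + z)|\<close>. By openness
  \<open>x - z n \<in> U\<close> eventually for every x in U, so the measure of the intersection
  converges by dominated convergence.\<close>

lemma translation_continuous_open:
  fixes U :: "'a::euclidean_space set"
  assumes U: "open U" "emeasure lborel U < \<infinity>"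
  shows "translation_continuous (\<lambda>x. indicator U x)"
  unfolding translation_continuous_def
proof (intro allI impI)
  fix z :: "nat \<Rightarrow> 'a"
  assume z: "z \<longlonglongrightarrow> 0"
  let ?f = "\<lambda>x. indicator U x :: complex"
  have [measurable]: "U \<in> sets borel"
    using U by simp
  have iU: "integrable lborel (\<lambda>x. indicator U x :: real)"
    using U by simp
  have fL: "?f \<in> L2"
    using U by (intro L2_indicator) auto
  have "(\<lambda>n. LINT x|lborel. indicator U (x - z n) * indicator U x :: real) \<longlonglongrightarrow> (LINT x|lborel. indicator U x)"
  proof (rule integral_dominated_convergence[OF _ _ iU])
    show "AE x in lborel. (\<lambda>n. indicator U (x - z n) * indicator U x :: real) \<longlonglongrightarrow> indicator U x"
    proof (rule AE_I2)
      fix x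
      show "(\<lambda>n. indicator U (x - z n) * indicator U x :: real) \<longlonglongrightarrow> indicator U x"
      proof (cases "x \<in> U")
        case True
        have "(\<lambda>n. x - z n) \<longlonglongrightarrow> x - 0"
          by (intro tendsto_intros z)
        then have "eventually (\<lambda>n. x - z n \<in> U) sequentially"
          using U True by (intro topological_tendstoD) auto
        then have "eventually (\<lambda>n. indicator U (x - z n) * indicator U x = (indicator U x :: real)) sequentially"
          by eventually_elim simp
        then show ?thesis
          by (rule tendsto_eventually)
      qed simp
    qed
  qed (auto simp: indicator_def)
  then have "(\<lambda>n. 2 * (LINT x|lborel. indicator U x) - 2 * (LINT x|lborel. indicator U (x - z n) * indicator U x :: real))
     \<longlonglongrightarrow> 2 * (LINT x|lborel. indicator U x) - 2 * (LINT x|lborel. indicator U x)"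
    by (intro tendsto_intros)
  moreover have "(L2_norm (\<lambda>x. ?f (x - z n) - ?f x))\<^sup>2
      = 2 * (LINT x|lborel. indicator U x) - 2 * (LINT x|lborel. indicator U (x - z n) * indicator U x :: real)" for n
  proof -
    have "(L2_norm ?f)\<^sup>2 = (LINT x|lborel. indicator U x)"
      unfolding L2_norm_sq by (intro Bochner_Integration.integral_cong) (auto simp: indicator_def)
    moreover have "L2_inner (\<lambda>x. ?f (x - z n)) ?f
        = of_real (LINT x|lborel. indicator U (x - z n) * indicator U x :: real)"
      unfolding L2_inner_def by (subst integral_complex_of_real[symmetric])
        (intro Bochner_Integration.integral_cong, auto simp: indicator_def)
    ultimately show ?thesis
      using L2_norm_sq_diff[OF L2_shift(1)[OF fL] fL, of "z n"] L2_shift(2)[OF fL, of "z n"] by simp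
  qed
  ultimately have "(\<lambda>n. (L2_norm (\<lambda>x. ?f (x - z n) - ?f x))\<^sup>2) \<longlonglongrightarrow> 0"
    by simp
  from tendsto_real_sqrt[OF this] show "(\<lambda>n. L2_norm (\<lambda>x. ?f (x - z n) - ?f x)) \<longlonglongrightarrow> 0"
    by simp
qed

text \<open>Translations are isometries of L2, so the approximation error enters twice with the same
  size.\<close>

lemma translation_continuous_approx:
  assumes f: "f \<in> L2"
    and approx: "\<And>e. e > 0 \<Longrightarrow> \<exists>g. g \<in> L2 \<and> translation_continuous g \<and> L2_norm (\<lambda>x. f x - g x) \<le> e"
  shows "translation_continuous f"
  unfolding translation_continuous_def
proof (intro allI impI LIMSEQ_I)
  fix z :: "nat \<Rightarrow> 'a" and e :: real
  assume z: "z \<longlonglongrightarrow> 0" and e: "e > 0"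
  obtain g where g: "g \<in> L2" "translation_continuous g" "L2_norm (\<lambda>x. f x - g x) \<le> e / 4"
    using approx[of "e / 4"] e by auto
  have "(\<lambda>n. L2_norm (\<lambda>x. g (x - z n) - g x)) \<longlonglongrightarrow> 0"
    using g(2) z by (simp add: translation_continuous_def)
  then have "eventually (\<lambda>n. L2_norm (\<lambda>x. g (x - z n) - g x) < e / 2) sequentially"
    using e by (intro order_tendstoD(2)) auto
  then obtain N where N: "\<And>n. n \<ge> N \<Longrightarrow> L2_norm (\<lambda>x. g (x - z n) - g x) < e / 2"
    by (auto simp: eventually_sequentially)
  have "L2_norm (\<lambda>x. f (x - z n) - f x) < e" if "n \<ge> N" for n
  proof -
    let ?f = "\<lambda>x. f (x - z n)" and ?g = "\<lambda>x. g (x - z n)"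
    have fg: "(\<lambda>x. f x - g x) \<in> L2"
      using f g by auto
    have "L2_norm (\<lambda>x. ?f x - f x) \<le> L2_norm (\<lambda>x. ?f x - ?g x) + L2_norm (\<lambda>x. ?g x - f x)"
      by (intro L2_norm_triangle3 L2_shift f g)
    also have "L2_norm (\<lambda>x. ?g x - f x) \<le> L2_norm (\<lambda>x. ?g x - g x) + L2_norm (\<lambda>x. g x - f x)"
      by (intro L2_norm_triangle3 L2_shift f g)
    also have "L2_norm (\<lambda>x. ?f x - ?g x) = L2_norm (\<lambda>x. f x - g x)"
      by (rule L2_shift(2)[OF fg])
    finally show ?thesis
      using g(3) N[OF that] L2_norm_minus_commute[of f g] by simp
  qed
  then show "\<exists>N. \<forall>n\<ge>N. norm (L2_norm (\<lambda>x. f (x - z n) - f x) - 0) < e"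
    by (intro exI[of _ N]) simp
qed

text \<open>Outer regularity approximates A by an open superset, and the L2 distance of the
  indicators is the square root of the measure of the difference.\<close>

lemma translation_continuous_indicator:
  fixes A :: "'a::euclidean_space set"
  assumes A [measurable]: "A \<in> sets borel" and fin: "emeasure lborel A < \<infinity>"
  shows "(\<lambda>x. indicator A x) \<in> L2" "translation_continuous (\<lambda>x. indicator A x)"
proof -
  show L: "(\<lambda>x. indicator A x :: complex) \<in> L2"
    by (rule L2_indicator[OF assms])
  show "translation_continuous (\<lambda>x. indicator A x)"
  proof (rule translation_continuous_approx[OF L])
    fix e :: real
    assume e: "e > 0"
    obtain U where U: "open U" "A \<subseteq> U" "emeasure lborel (U - A) < ennreal (e\<^sup>2)"
      using outer_regular_lborel[OF A, of "e\<^sup>2"] e by auto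
    have [measurable]: "U \<in> sets borel"
      using U by simp
    have "emeasure lborel U \<le> emeasure lborel A + emeasure lborel (U - A)"
      using U by (subst plus_emeasure) (auto intro!: emeasure_mono)
    also have "\<dots> < \<infinity>"
      using fin U(3) by (auto simp: less_top[symmetric] ennreal_add_eq_top)
    finally have Ufin: "emeasure lborel U < \<infinity>" .
    have UL: "(\<lambda>x. indicator U x :: complex) \<in> L2"
      using Ufin by (intro L2_indicator) auto
    have "ennreal ((L2_norm (\<lambda>x. indicator A x - indicator U x :: complex))\<^sup>2)
        = (\<integral>\<^sup>+ x. indicator (U - A) x \<partial>lborel)"
      using U(2) by (subst L2_norm_sq_nn[OF L2_diff[OF L UL]]) (intro nn_integral_cong, auto simp: indicator_def)
    also have "\<dots> \<le> ennreal (e\<^sup>2)"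
      using U(3) by simp
    finally have "(L2_norm (\<lambda>x. indicator A x - indicator U x :: complex))\<^sup>2 \<le> e\<^sup>2"
      by simp
    then have "L2_norm (\<lambda>x. indicator A x - indicator U x :: complex) \<le> e"
      by (rule power2_le_imp_le) (use e in simp)
    then show "\<exists>g. g \<in> L2 \<and> translation_continuous g \<and> L2_norm (\<lambda>x. indicator A x - g x) \<le> e"
      using UL translation_continuous_open[OF U(1) Ufin] by blast
  qed
qed

lemma translation_continuous_add:
  assumes "f \<in> L2" "translation_continuous f" "g \<in> L2" "translation_continuous g"
  shows "translation_continuous (\<lambda>x. f x + g x)"
  unfolding translation_continuous_def
proof (intro allI impI)
  fix z :: "nat \<Rightarrow> 'a"
  assume "z \<longlonglongrightarrow> 0"
  then have "(\<lambda>n. L2_norm (\<lambda>x. f (x - z n) - f x) + L2_norm (\<lambda>x. g (x - z n) - g x)) \<longlonglongrightarrow> 0 + 0"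
    using assms by (intro tendsto_add) (auto simp: translation_continuous_def)
  then have b: "(\<lambda>n. L2_norm (\<lambda>x. f (x - z n) - f x) + L2_norm (\<lambda>x. g (x - z n) - g x)) \<longlonglongrightarrow> 0"
    by simp
  have "L2_norm (\<lambda>x. f (x - z n) + g (x - z n) - (f x + g x))
      \<le> L2_norm (\<lambda>x. f (x - z n) - f x) + L2_norm (\<lambda>x. g (x - z n) - g x)" for n
    using L2_norm_triangle[of "\<lambda>x. f (x - z n) - f x" "\<lambda>x. g (x - z n) - g x"] assms
    by (simp add: L2_diff L2_shift algebra_simps)
  then show "(\<lambda>n. L2_norm (\<lambda>x. f (x - z n) + g (x - z n) - (f x + g x))) \<longlonglongrightarrow> 0"
    by (intro Lim_null_comparison[OF always_eventually b]) simp
qed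

lemma translation_continuous_scale:
  assumes "translation_continuous f"
  shows "translation_continuous (\<lambda>x. c * f x)"
  unfolding translation_continuous_def
proof (intro allI impI)
  fix z :: "nat \<Rightarrow> 'a"
  assume "z \<longlonglongrightarrow> 0"
  then have "(\<lambda>n. norm c * L2_norm (\<lambda>x. f (x - z n) - f x)) \<longlonglongrightarrow> norm c * 0"
    using assms by (intro tendsto_mult tendsto_const) (auto simp: translation_continuous_def)
  then show "(\<lambda>n. L2_norm (\<lambda>x. c * f (x - z n) - c * f x)) \<longlonglongrightarrow> 0"
    by (simp add: right_diff_distrib[symmetric] L2_norm_scale)
qed

lemma translation_continuous_zero: "translation_continuous (\<lambda>x. 0)"
  by (simp add: translation_continuous_def)

lemma L2_simple_approx:
  fixes f :: "'a::euclidean_space \<Rightarrow> complex"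
  assumes f: "f \<in> L2" and e: "e > 0"
  obtains g where "simple_function borel g" "g \<in> L2" "L2_norm (\<lambda>x. f x - g x) \<le> e"
proof -
  have [measurable]: "f \<in> borel_measurable borel"
    using f by measurable
  obtain F where F: "\<And>i. simple_function borel (F i)" "\<And>x. (\<lambda>i. F i x) \<longlonglongrightarrow> f x"
    "\<And>i x. norm (F i x) \<le> 2 * norm (f x)"
    using borel_measurable_implies_sequence_metric[of f borel 0] by auto
  have [measurable]: "F i \<in> borel_measurable borel" for i
    by (rule borel_measurable_simple_function[OF F(1)])
  have "(\<lambda>n. L2_norm (\<lambda>x. F n x - f x)) \<longlonglongrightarrow> 0"
  proof (rule L2_dominated_convergence)
    \<comment> \<open>The simple functions obey \<open>norm (F n x) \<le> 2 * norm (f x)\<close>, so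
      the difference is at most \<open>3 * norm (f x)\<close>; squaring gives 9.\<close>
    show "integrable lborel (\<lambda>x. 9 * (norm (f x))\<^sup>2)"
      using f by (simp add: L2_integrable_sq)
    show "AE x in lborel. (norm (F n x - f x))\<^sup>2 \<le> 9 * (norm (f x))\<^sup>2" for n
    proof (rule AE_I2)
      fix x
      have "norm (F n x - f x) \<le> 3 * norm (f x)"
        using norm_triangle_ineq4[of "F n x" "f x"] F(3)[of n x] by linarith
      then have "(norm (F n x - f x))\<^sup>2 \<le> (3 * norm (f x))\<^sup>2"
        by (intro power_mono) auto
      then show "(norm (F n x - f x))\<^sup>2 \<le> 9 * (norm (f x))\<^sup>2"
        by (simp add: power_mult_distrib)
    qed
  qed (use F(2) in auto)
  then have "eventually (\<lambda>n. L2_norm (\<lambda>x. F n x - f x) < e) sequentially"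
    using e by (intro order_tendstoD(2)) auto
  then obtain n where n: "L2_norm (\<lambda>x. F n x - f x) < e"
    by (auto simp: eventually_sequentially)
  have "F n \<in> L2"
    unfolding L2_def
  proof (intro CollectI conjI)
    show "integrable lborel (\<lambda>x. (norm (F n x))\<^sup>2)"
    proof (rule Bochner_Integration.integrable_bound)
      show "integrable lborel (\<lambda>x. 4 * (norm (f x))\<^sup>2)"
        using f by (simp add: L2_integrable_sq)
      have "(norm (F n x))\<^sup>2 \<le> (2 * norm (f x))\<^sup>2" for x
        using F(3) by (intro power_mono) auto
      then show "AE x in lborel. norm ((norm (F n x))\<^sup>2) \<le> norm (4 * (norm (f x))\<^sup>2)"
        by (simp add: power_mult_distrib)
    qed measurable
  qed measurable
  then show ?thesis
    using n F(1)[of n] L2_norm_minus_commute[of f "F n"] by (intro that[of "F n"]) auto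
qed

lemma translation_continuous_L2:
  fixes f :: "'a::euclidean_space \<Rightarrow> complex"
  assumes "f \<in> L2"
  shows "translation_continuous f"
proof (rule translation_continuous_approx[OF assms])
  fix e :: real
  assume "e > 0"
  then obtain g where g: "simple_function borel g" "g \<in> L2" "L2_norm (\<lambda>x. f x - g x) \<le> e"
    using L2_simple_approx[OF assms] by blast
  have [measurable]: "g \<in> borel_measurable borel"
    using g(2) by measurable
  have fin: "finite (range g)"
    using g(1) by (simp add: simple_function_def)
  \<comment> \<open>The value 0 is left out because its level set may have infinite measure; all
    other level sets are finite by Chebyshev's inequality.\<close>
  have eq: "g = (\<lambda>x. \<Sum>c\<in>range g - {0}. c * indicator (g -` {c}) x)"
  proof
    fix x
    have "(\<Sum>c\<in>range g - {0}. c * indicator (g -` {c}) x) = (\<Sum>c\<in>range g - {0}. if c = g x then g x else 0)"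
      by (intro sum.cong) (auto simp: indicator_def)
    also have "\<dots> = g x"
      using fin by (subst sum.delta) auto
    finally show "g x = (\<Sum>c\<in>range g - {0}. c * indicator (g -` {c}) x)" ..
  qed
  have lev: "(\<lambda>x. indicator (g -` {c}) x :: complex) \<in> L2 \<and> translation_continuous (\<lambda>x. indicator (g -` {c}) x)"
    if c: "c \<noteq> 0" for c
  proof -
    have m: "g -` {c} \<in> sets borel"
      using measurable_sets[of g borel borel "{c}"] by simp
    have "ennreal ((norm c)\<^sup>2) * emeasure lborel (g -` {c}) = (\<integral>\<^sup>+ x. ennreal ((norm c)\<^sup>2) * indicator (g -` {c}) x \<partial>lborel)"
      using m by (simp add: nn_integral_cmult_indicator)
    also have "\<dots> \<le> (\<integral>\<^sup>+ x. ennreal ((norm (g x))\<^sup>2) \<partial>lborel)"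
      by (intro nn_integral_mono) (auto simp: indicator_def)
    also have "\<dots> < \<infinity>"
      using g(2) by (simp add: L2_nn_iff)
    finally have "emeasure lborel (g -` {c}) < \<infinity>"
      using c by (auto simp: ennreal_mult_less_top)
    then show ?thesis
      using translation_continuous_indicator[OF m] by auto
  qed
  have "(\<lambda>x. \<Sum>c\<in>C. c * indicator (g -` {c}) x) \<in> L2 \<and> translation_continuous (\<lambda>x. \<Sum>c\<in>C. c * indicator (g -` {c}) x)"
    if "finite C" "0 \<notin> C" for C
    using that
  proof (induction C rule: finite_induct)
    case empty
    then show ?case
      by (simp add: translation_continuous_zero)
  next
    case (insert c C)
    then have "c \<noteq> 0" "0 \<notin> C"
      by auto
    note IH = insert.IH[OF \<open>0 \<notin> C\<close>] and l = lev[OF \<open>c \<noteq> 0\<close>]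
    show ?case
      unfolding sum.insert[OF insert.hyps]
      by (intro conjI L2_add L2_scale translation_continuous_add translation_continuous_scale
          IH[THEN conjunct1] IH[THEN conjunct2] l[THEN conjunct1] l[THEN conjunct2])
  qed
  from this[of "range g - {0}"] have "translation_continuous g"
    using fin eq by simp
  then show "\<exists>g. g \<in> L2 \<and> translation_continuous g \<and> L2_norm (\<lambda>x. f x - g x) \<le> e"
    using g by blast
qed

section \<open>Convolution with test functions\<close>

definition conv :: "('a::euclidean_space \<Rightarrow> complex) \<Rightarrow> ('a \<Rightarrow> real) \<Rightarrow> 'a \<Rightarrow> complex" where
  "conv f \<eta> x = (LINT y|lborel. f y * of_real (\<eta> (x - y)))"

lemma test_function_reflect:
  assumes "\<eta> \<in> test_functions UNIV"
  shows "(\<lambda>y. \<eta> (x - y)) \<in> test_functions UNIV"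
    and "dir_deriv (\<lambda>y. \<eta> (x - y)) v y = - dir_deriv \<eta> v (x - y)"
proof -
  have L: "bounded_linear (\<lambda>y::'a. - y)"
    by (rule bounded_linear_minus[OF bounded_linear_ident])
  obtain K where K: "compact K" "\<And>y. y \<notin> K \<Longrightarrow> \<eta> y = 0"
    using test_function_support[OF assms] by metis
  show "(\<lambda>y. \<eta> (x - y)) \<in> test_functions UNIV"
  proof (rule test_functionsI)
    show "Ck k (\<lambda>y. \<eta> (x - y))" for k
      using Ck_affine[OF L test_function_Ck[OF assms], of k x] by simp
    show "compact ((\<lambda>y. x - y) ` K)"
      by (intro compact_continuous_image K continuous_intros)
    show "y \<in> (\<lambda>y. x - y) ` K" if "\<eta> (x - y) \<noteq> 0" for y
      using K(2)[of "x - y"] that by (intro image_eqI[of _ _ "x - y"]) (simp, argo)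
  qed simp
  have "dir_deriv (\<lambda>y. \<eta> (x + - y)) v y = dir_deriv \<eta> (- v) (x + - y)"
    by (rule dir_deriv_affine[OF L test_function_differentiable[OF assms]])
  also have "\<dots> = - dir_deriv \<eta> v (x - y)"
    using linear_neg[OF linear_frechet_derivative[OF test_function_differentiable[OF assms, of "x - y"]]]
    by simp
  finally show "dir_deriv (\<lambda>y. \<eta> (x - y)) v y = - dir_deriv \<eta> v (x - y)"
    by simp
qed

lemma conv_integrable:
  assumes "f \<in> L2" "\<eta> \<in> test_functions UNIV"
  shows "integrable lborel (\<lambda>y. f y * of_real (\<eta> (x - y)))"
  by (rule L2_integrable_prod[OF assms(1) test_function_of_real_L2[OF test_function_reflect(1)[OF assms(2)]]])

text \<open>Heine-Cantor on a ball slightly larger than the support: if two points are closer than 1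
  and one of them lies in the support, both lie in this ball.\<close>

lemma uniformly_continuous_test_function:
  fixes \<eta> :: "'a::euclidean_space \<Rightarrow> real"
  assumes \<eta>: "\<eta> \<in> test_functions UNIV" and e: "e > 0"
  obtains d where "d > 0" "\<And>x y. dist x y < d \<Longrightarrow> \<bar>\<eta> x - \<eta> y\<bar> < e"
proof -
  obtain K where K: "compact K" "\<And>x. x \<notin> K \<Longrightarrow> \<eta> x = 0"
    using test_function_support[OF \<eta>] by metis
  obtain R where R: "\<And>x. x \<in> K \<Longrightarrow> norm x \<le> R"
    using compact_imp_bounded[OF K(1)] by (auto simp: bounded_iff)
  have "uniformly_continuous_on (cball 0 (R + 1)) \<eta>"
    by (rule compact_uniformly_continuous)
      (use continuous_on_subset[OF test_function_continuous[OF \<eta>]] in auto)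
  then obtain d where d: "d > 0"
    "\<And>x y. x \<in> cball 0 (R + 1) \<Longrightarrow> y \<in> cball 0 (R + 1) \<Longrightarrow> dist y x < d \<Longrightarrow> dist (\<eta> y) (\<eta> x) < e"
    using e unfolding uniformly_continuous_on_def by metis
  show ?thesis
  proof (rule that[of "min d 1"])
    fix x y :: 'a
    assume xy: "dist x y < min d 1"
    show "\<bar>\<eta> x - \<eta> y\<bar> < e"
    proof (cases "x \<in> K \<or> y \<in> K")
      case True
      have "norm x \<le> norm y + dist x y" "norm y \<le> norm x + dist x y"
        using norm_triangle_ineq2[of x y] norm_triangle_ineq2[of y x]
        by (auto simp: dist_norm norm_minus_commute)
      then have "x \<in> cball 0 (R + 1)" "y \<in> cball 0 (R + 1)"
        using True R xy by fastforce+
      then show ?thesis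
        using d(2)[of y x] xy by (simp add: dist_real_def)
    next
      case False
      then show ?thesis
        using K(2)[of x] K(2)[of y] e by simp
    qed
  qed (use d in simp)
qed

text \<open>First-order Taylor expansion whose error is uniform in the base point, by uniform
  continuity of the derivatives. The uniformity allows linearizing under an integral over the base
  point.\<close>

lemma test_function_linearization:
  fixes \<eta> :: "'a::euclidean_space \<Rightarrow> real"
  assumes \<eta>: "\<eta> \<in> test_functions UNIV" and e: "e > 0"
  obtains d where "d > 0"
    "\<And>x h. norm h < d \<Longrightarrow> \<bar>\<eta> (x + h) - \<eta> x - dir_deriv \<eta> h x\<bar> \<le> e * norm h"
proof -
  \<comment> \<open>The derivative in direction v is a sum over \<open>DIM('a)\<close> basis
    vectors, each term being off by at most \<open>norm v * e'\<close>.\<close>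
  define e' where "e' = e / DIM('a)"
  have e': "e' > 0"
    using e by (simp add: e'_def)
  have "\<exists>d>0. \<forall>x y. dist x y < d \<longrightarrow> \<bar>dir_deriv \<eta> b x - dir_deriv \<eta> b y\<bar> < e'" for b
    using uniformly_continuous_test_function[OF dir_deriv_test_function[OF \<eta>, of b] e'] by metis
  then obtain d where d: "\<And>b. d b > 0"
    "\<And>b x y. dist x y < d b \<Longrightarrow> \<bar>dir_deriv \<eta> b x - dir_deriv \<eta> b y\<bar> < e'"
    by metis
  define \<delta> where "\<delta> = Min (d ` (Basis :: 'a set))"
  have \<delta>: "\<delta> > 0" "\<And>b. b \<in> Basis \<Longrightarrow> \<delta> \<le> d b"
    using d(1) by (auto simp: \<delta>_def)
  have diff: "\<bar>dir_deriv \<eta> v x - dir_deriv \<eta> v y\<bar> \<le> e * norm v" if "dist x y < \<delta>" for x y v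
  proof -
    have "dir_deriv \<eta> v x - dir_deriv \<eta> v y = (\<Sum>b\<in>Basis. (v \<bullet> b) * (dir_deriv \<eta> b x - dir_deriv \<eta> b y))"
      by (simp add: frechet_derivative_Basis_expand[OF test_function_differentiable[OF \<eta>], of x v]
          frechet_derivative_Basis_expand[OF test_function_differentiable[OF \<eta>], of y v]
          sum_subtractf right_diff_distrib)
    also have "\<bar>\<dots>\<bar> \<le> (\<Sum>b\<in>(Basis::'a set). norm v * e')"
    proof (rule order_trans[OF sum_abs], rule sum_mono)
      fix b :: 'a
      assume b: "b \<in> Basis"
      have "\<bar>dir_deriv \<eta> b x - dir_deriv \<eta> b y\<bar> \<le> e'"
        using d(2)[of x y b] \<delta>(2)[OF b] that by simp
      then show "\<bar>(v \<bullet> b) * (dir_deriv \<eta> b x - dir_deriv \<eta> b y)\<bar> \<le> norm v * e'"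
        unfolding abs_mult using Basis_le_norm[OF b, of v] by (intro mult_mono) auto
    qed
    also have "\<dots> = e * norm v"
      by (simp add: e'_def)
    finally show ?thesis .
  qed
  show ?thesis
  proof (rule that[OF \<delta>(1)])
    fix x h :: 'a
    assume h: "norm h < \<delta>"
    have "norm (\<eta> (x + h) - \<eta> x - frechet_derivative \<eta> (at x) ((x + h) - x)) \<le> norm ((x + h) - x) * e"
    proof (rule differentiable_bound_linearization[where S = "ball x \<delta>"])
      show "x + t *\<^sub>R (x + h - x) \<in> ball x \<delta>" if "t \<in> {0..1}" for t
      proof -
        have "\<bar>t\<bar> * norm h \<le> 1 * norm h"
          using that by (intro mult_right_mono) auto
        then show ?thesis
          using h by (simp add: dist_norm)
      qed
      show "(\<eta> has_derivative frechet_derivative \<eta> (at y)) (at y within ball x \<delta>)" for y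
        using test_function_differentiable[OF \<eta>, of y] frechet_derivative_works has_derivative_at_withinI by blast
      show "onorm (frechet_derivative \<eta> (at y) - frechet_derivative \<eta> (at x)) \<le> e" if "y \<in> ball x \<delta>" for y
      proof (rule onorm_le)
        show "norm ((frechet_derivative \<eta> (at y) - frechet_derivative \<eta> (at x)) v) \<le> e * norm v" for v
          using diff[of y x v] that by (simp add: dist_commute)
      qed
    qed (use \<delta> in simp)
    then show "\<bar>\<eta> (x + h) - \<eta> x - dir_deriv \<eta> h x\<bar> \<le> e * norm h"
      by (simp add: mult.commute)
  qed
qed

text \<open>Differentiation under the integral by linearizing \<eta> uniformly. For
  \<open>norm (y - x) < 1\<close> the remainder is supported in the ball of radius R + 1 about x,
  where f is integrable.\<close>

lemma conv_has_derivative: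
  assumes f: "f \<in> L2" and \<eta>: "\<eta> \<in> test_functions UNIV"
  shows "(conv f \<eta> has_derivative (\<lambda>v. conv f (dir_deriv \<eta> v) x)) (at x)"
proof -
  obtain K where K: "compact K" "\<And>x. x \<notin> K \<Longrightarrow> \<eta> x = 0" "\<And>x v. x \<notin> K \<Longrightarrow> dir_deriv \<eta> v x = 0"
    using test_function_support[OF \<eta>] by metis
  obtain R where R: "\<And>x. x \<in> K \<Longrightarrow> norm x \<le> R"
    using compact_imp_bounded[OF K(1)] by (auto simp: bounded_iff)
  note \<eta>' = dir_deriv_test_function[OF \<eta>]
  define M where "M = (LINT y|lborel. norm (f y) * indicator (cball x (R + 1)) y)"
  have iM: "integrable lborel (\<lambda>y. norm (f y) * indicator (cball x (R + 1)) y)"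
  proof -
    have "(\<lambda>y. indicator (cball x (R + 1)) y :: complex) \<in> L2"
      using emeasure_lborel_cball_finite[of x "R + 1"] by (intro L2_indicator) auto
    moreover have "(\<lambda>y. norm (f y * indicator (cball x (R + 1)) y)) = (\<lambda>y. norm (f y) * indicator (cball x (R + 1)) y)"
      by (auto simp: fun_eq_iff norm_mult split: split_indicator)
    ultimately show ?thesis
      using integrable_norm[OF L2_integrable_prod[OF f]] by metis
  qed
  have M: "0 \<le> M"
    unfolding M_def by (intro integral_nonneg_AE) (auto simp: indicator_def)
  show ?thesis
    unfolding has_derivative_at_alt
  proof (intro conjI allI impI)
    have lin: "linear (frechet_derivative \<eta> (at y))" for y
      by (rule linear_frechet_derivative[OF test_function_differentiable[OF \<eta>]])
    have "linear (\<lambda>v. conv f (dir_deriv \<eta> v) x)"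
    proof (rule linearI)
      show "conv f (dir_deriv \<eta> (a + b)) x = conv f (dir_deriv \<eta> a) x + conv f (dir_deriv \<eta> b) x" for a b
        unfolding conv_def
        by (subst Bochner_Integration.integral_add[symmetric])
          (auto intro!: conv_integrable f \<eta>' simp: linear_add[OF lin] distrib_left)
      show "conv f (dir_deriv \<eta> (c *\<^sub>R a)) x = c *\<^sub>R conv f (dir_deriv \<eta> a) x" for c a
        unfolding conv_def
        by (subst integral_scaleR_right[symmetric]) (simp add: linear_cmul[OF lin] scaleR_conv_of_real mult_ac)
    qed
    then show "bounded_linear (\<lambda>v. conv f (dir_deriv \<eta> v) x)"
      by (simp add: linear_conv_bounded_linear)
    fix e :: real
    assume e: "0 < e"
    \<comment> \<open>M may be 0, hence the 1 in the denominator.\<close>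
    define e' where "e' = e / (M + 1)"
    have e': "e' > 0" "e' * M \<le> e"
      using e M by (auto simp: e'_def field_simps)
    obtain d where d: "d > 0"
      "\<And>z h. norm h < d \<Longrightarrow> \<bar>\<eta> (z + h) - \<eta> z - dir_deriv \<eta> h z\<bar> \<le> e' * norm h"
      using test_function_linearization[OF \<eta> e'(1)] by metis
    have "norm (conv f \<eta> y - conv f \<eta> x - conv f (dir_deriv \<eta> (y - x)) x) \<le> e * norm (y - x)"
      if y: "norm (y - x) < min d 1" for y
    proof -
      let ?h = "y - x"
      let ?r = "\<lambda>z. \<eta> (x - z + ?h) - \<eta> (x - z) - dir_deriv \<eta> ?h (x - z)"
      have r: "\<bar>?r z\<bar> \<le> e' * norm ?h * indicator (cball x (R + 1)) z" for z
      proof (cases "z \<in> cball x (R + 1)")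
        case True
        then show ?thesis
          using d(2)[of ?h "x - z"] y by simp
      next
        case False
        then have z: "norm (x - z) > R + 1"
          by (simp add: dist_norm)
        then have "norm (x - z + ?h) > R"
          using norm_triangle_ineq2[of "x - z" "- ?h"] norm_minus_commute[of x y] y by simp
        then have "x - z \<notin> K" "x - z + ?h \<notin> K"
          using z R[of "x - z"] R[of "x - z + ?h"] by auto
        then show ?thesis
          using K(2,3) False by simp
      qed
      note i = conv_integrable[OF f \<eta>, of y] conv_integrable[OF f \<eta>, of x] conv_integrable[OF f \<eta>', of x ?h]
      have r_eq: "(\<lambda>z. f z * of_real (?r z)) = (\<lambda>z. f z * of_real (\<eta> (y - z)) - f z * of_real (\<eta> (x - z))
          - f z * of_real (dir_deriv \<eta> ?h (x - z)))"
        by (simp add: right_diff_distrib)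
      have "conv f \<eta> y - conv f \<eta> x - conv f (dir_deriv \<eta> ?h) x = (LINT z|lborel. f z * of_real (?r z))"
        unfolding conv_def r_eq using i by simp
      also have "norm \<dots> \<le> (LINT z|lborel. e' * norm ?h * (norm (f z) * indicator (cball x (R + 1)) z))"
      proof (rule Bochner_Integration.integral_norm_bound_integral)
        show "integrable lborel (\<lambda>z. f z * of_real (?r z))"
          unfolding r_eq using i by simp
        show "norm (f z * of_real (?r z)) \<le> e' * norm ?h * (norm (f z) * indicator (cball x (R + 1)) z)" for z
          unfolding norm_mult norm_of_real using mult_left_mono[OF r[of z] norm_ge_zero[of "f z"]]
          by (simp add: mult_ac)
      qed (use iM in simp)
      also have "\<dots> = (e' * M) * norm ?h"
        unfolding M_def integral_mult_right_zero by simp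
      also have "\<dots> \<le> e * norm ?h"
        using e'(2) by (intro mult_right_mono) auto
      finally show ?thesis .
    qed
    then show "\<exists>d>0. \<forall>y. norm (y - x) < d \<longrightarrow>
        norm (conv f \<eta> y - conv f \<eta> x - conv f (dir_deriv \<eta> (y - x)) x) \<le> e * norm (y - x)"
      using d(1) by (intro exI[of _ "min d 1"]) auto
  qed
qed

lemma conv_Ck: "f \<in> L2 \<Longrightarrow> \<eta> \<in> test_functions UNIV \<Longrightarrow> Ck k (conv f \<eta>)"
proof (induction k arbitrary: \<eta>)
  case 0
  show ?case
    by (simp, intro continuous_at_imp_continuous_on ballI has_derivative_continuous)
      (rule conv_has_derivative[OF 0])
next
  case (Suc k)
  show ?case
    by (rule Ck_SucI[OF conv_has_derivative[OF Suc.prems]])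
      (intro Suc.IH dir_deriv_test_function Suc.prems)
qed

text \<open>The distributional derivative is tested against \<open>y \<mapsto> \<eta> (x - y)\<close>.\<close>

lemma conv_weak_deriv:
  assumes "weak_deriv UNIV v f g" "\<eta> \<in> test_functions UNIV"
  shows "conv f (dir_deriv \<eta> v) x = conv g \<eta> x"
proof -
  have "(LINT y|lborel. f y * of_real (dir_deriv (\<lambda>y. \<eta> (x - y)) v y))
      = - (LINT y|lborel. g y * of_real (\<eta> (x - y)))"
    using assms(1) test_function_reflect(1)[OF assms(2), of x]
    by (simp add: weak_deriv_def set_lebesgue_integral_def)
  then show ?thesis
    by (simp add: test_function_reflect(2)[OF assms(2)] conv_def)
qed

text \<open>Since \<eta> is a probability density, Jensen's inequality bounds the squared pointwise
  error by the \<eta>-average of the squares of \<open>norm (f (x - z) - f x)\<close>. Tonelli then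
  leaves the L2 distances of f to its translates by points of the support of \<eta>.\<close>

lemma conv_L2_bound:
  assumes f: "f \<in> L2" and \<eta>: "\<eta> \<in> test_functions UNIV" "\<And>x. 0 \<le> \<eta> x" "has_bochner_integral lborel \<eta> 1"
    and S: "\<And>z. \<eta> z \<noteq> 0 \<Longrightarrow> L2_norm (\<lambda>x. f (x - z) - f x) \<le> S" and "S \<ge> 0"
  shows "(\<lambda>x. conv f \<eta> x - f x) \<in> L2" "L2_norm (\<lambda>x. conv f \<eta> x - f x) \<le> S"
proof -
  have [measurable]: "f \<in> borel_measurable borel"
    using f by measurable
  have [measurable]: "\<eta> \<in> borel_measurable borel"
    by (rule test_function_measurable[OF \<eta>(1)])
  have [measurable]: "conv f \<eta> \<in> borel_measurable borel"
    using Ck_continuous[OF conv_Ck[OF f \<eta>(1), of 0]] by (rule borel_measurable_continuous_onI)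
  have one: "(\<integral>\<^sup>+ z. ennreal (\<eta> z) \<partial>lborel) = 1"
    using \<eta>(2,3) by (subst nn_integral_eq_integral) (auto simp: has_bochner_integral_iff)
  have pt: "ennreal ((norm (conv f \<eta> x - f x))\<^sup>2) \<le> (\<integral>\<^sup>+ z. ennreal (\<eta> z) * ennreal ((norm (f (x - z) - f x))\<^sup>2) \<partial>lborel)" for x
  proof -
    have i1: "integrable lborel (\<lambda>z. f (x - z) * of_real (\<eta> z))"
    proof -
      have "(\<lambda>z. f (x - z)) \<in> L2"
        using f nn_integral_lborel_minus[of "\<lambda>x. ennreal ((norm (f x))\<^sup>2)" x] by (simp add: L2_nn_iff)
      then show ?thesis
        by (rule L2_integrable_prod[OF _ test_function_of_real_L2[OF \<eta>(1)]])
    qed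
    have i2: "has_bochner_integral lborel (\<lambda>z. f x * of_real (\<eta> z)) (f x * of_real 1)"
      by (intro has_bochner_integral_mult_right has_bochner_integral_of_real \<eta>)
    have "conv f \<eta> x = (LINT z|lborel. f (x - z) * of_real (\<eta> (x - (x - z))))"
      unfolding conv_def by (rule integral_lborel_minus[symmetric]) measurable
    then have eq: "conv f \<eta> x - f x = (LINT z|lborel. (f (x - z) - f x) * of_real (\<eta> z))"
      using i1 integrable.intros[OF i2] has_bochner_integral_integral_eq[OF i2]
      by (simp add: left_diff_distrib)
    have "integrable lborel (\<lambda>z. (f (x - z) - f x) * of_real (\<eta> z))"
      using i1 integrable.intros[OF i2] by (simp add: left_diff_distrib)
    then have "ennreal (norm (conv f \<eta> x - f x)) \<le> (\<integral>\<^sup>+ z. ennreal (norm ((f (x - z) - f x) * of_real (\<eta> z))) \<partial>lborel)"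
      unfolding eq by (rule integral_norm_bound_ennreal)
    \<comment> \<open>Splitting \<eta> into two square roots lets Cauchy-Schwarz play the part of
      Jensen's inequality: one factor integrates to 1.\<close>
    also have "\<dots> = (\<integral>\<^sup>+ z. ennreal (sqrt (\<eta> z)) * ennreal (sqrt (\<eta> z) * norm (f (x - z) - f x)) \<partial>lborel)"
      using \<eta>(2) by (intro nn_integral_cong) (simp add: ennreal_mult[symmetric] norm_mult mult_ac flip: mult.assoc)
    finally have "ennreal (norm (conv f \<eta> x - f x)) ^ 2
        \<le> (\<integral>\<^sup>+ z. ennreal (sqrt (\<eta> z)) * ennreal (sqrt (\<eta> z) * norm (f (x - z) - f x)) \<partial>lborel)\<^sup>2"
      by (intro power_mono) auto
    also have "\<dots> \<le> (\<integral>\<^sup>+ z. ennreal (sqrt (\<eta> z)) ^ 2 \<partial>lborel) * (\<integral>\<^sup>+ z. ennreal (sqrt (\<eta> z) * norm (f (x - z) - f x)) ^ 2 \<partial>lborel)"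
      by (rule Cauchy_Schwarz_nn_integral) measurable
    also have "\<dots> = (\<integral>\<^sup>+ z. ennreal (\<eta> z) * ennreal ((norm (f (x - z) - f x))\<^sup>2) \<partial>lborel)"
      using one \<eta>(2) by (simp add: ennreal_power power_mult_distrib ennreal_mult)
    finally show ?thesis
      by (simp add: ennreal_power)
  qed
  have "(\<integral>\<^sup>+ x. ennreal ((norm (conv f \<eta> x - f x))\<^sup>2) \<partial>lborel)
      \<le> (\<integral>\<^sup>+ x. (\<integral>\<^sup>+ z. ennreal (\<eta> z) * ennreal ((norm (f (x - z) - f x))\<^sup>2) \<partial>lborel) \<partial>lborel)"
    by (rule nn_integral_mono) (rule pt)
  also have "\<dots> = (\<integral>\<^sup>+ z. (\<integral>\<^sup>+ x. ennreal (\<eta> z) * ennreal ((norm (f (x - z) - f x))\<^sup>2) \<partial>lborel) \<partial>lborel)"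
    by (rule lborel_pair.Fubini') measurable
  also have "\<dots> \<le> (\<integral>\<^sup>+ z. ennreal (\<eta> z) * ennreal (S\<^sup>2) \<partial>lborel)"
  proof (rule nn_integral_mono)
    fix z
    have "(\<integral>\<^sup>+ x. ennreal (\<eta> z) * ennreal ((norm (f (x - z) - f x))\<^sup>2) \<partial>lborel)
        = ennreal (\<eta> z) * ennreal ((L2_norm (\<lambda>x. f (x - z) - f x))\<^sup>2)"
      using f by (subst nn_integral_cmult) (auto simp: L2_norm_sq_nn L2_diff L2_shift)
    also have "\<dots> \<le> ennreal (\<eta> z) * ennreal (S\<^sup>2)"
    proof (cases "\<eta> z = 0")
      case False
      then show ?thesis
        using S[of z] by (intro mult_left_mono ennreal_leI power_mono) auto
    qed simp
    finally show "(\<integral>\<^sup>+ x. ennreal (\<eta> z) * ennreal ((norm (f (x - z) - f x))\<^sup>2) \<partial>lborel) \<le> ennreal (\<eta> z) * ennreal (S\<^sup>2)" .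
  qed
  also have "\<dots> = ennreal (S\<^sup>2)"
    by (subst nn_integral_multc) (auto simp: one)
  finally have le: "(\<integral>\<^sup>+ x. ennreal ((norm (conv f \<eta> x - f x))\<^sup>2) \<partial>lborel) \<le> ennreal (S\<^sup>2)" .
  then show L: "(\<lambda>x. conv f \<eta> x - f x) \<in> L2"
    by (auto simp: L2_nn_iff intro: le_less_trans)
  have "(L2_norm (\<lambda>x. conv f \<eta> x - f x))\<^sup>2 \<le> S\<^sup>2"
    using le by (simp add: L2_norm_sq_nn[OF L, symmetric])
  then show "L2_norm (\<lambda>x. conv f \<eta> x - f x) \<le> S"
    by (rule power2_le_imp_le) fact
qed

definition mollifiers :: "(nat \<Rightarrow> 'a::euclidean_space \<Rightarrow> real) \<Rightarrow> bool" where
  "mollifiers \<eta> \<longleftrightarrow> (\<forall>n. \<eta> n \<in> test_functions UNIV \<and> (\<forall>x. 0 \<le> \<eta> n x) \<and> has_bochner_integral lborel (\<eta> n) 1 \<and>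
     (\<forall>x. \<eta> n x \<noteq> 0 \<longrightarrow> norm x \<le> 1 / real (Suc n)))"

lemma mollifiers_exist: "\<exists>\<eta>. mollifiers (\<eta> :: nat \<Rightarrow> 'a::euclidean_space \<Rightarrow> real)"
proof -
  have "\<exists>\<eta>::'a \<Rightarrow> real. \<eta> \<in> test_functions UNIV \<and> (\<forall>x. 0 \<le> \<eta> x) \<and> has_bochner_integral lborel \<eta> 1 \<and>
     (\<forall>x. \<eta> x \<noteq> 0 \<longrightarrow> norm x \<le> 1 / real (Suc n))" for n
    using mollifier_exists[of "1 / real (Suc n)"] by (metis divide_pos_pos of_nat_0_less_iff zero_less_Suc zero_less_one)
  then show ?thesis
    unfolding mollifiers_def by metis
qed

lemma conv_mollifiers_L2:
  assumes f: "f \<in> L2" and \<eta>: "mollifiers \<eta>"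
  shows "conv f (\<eta> n) \<in> L2"
proof -
  have "L2_norm (\<lambda>x. f (x - z) - f x) \<le> 2 * L2_norm f" for z
    using L2_norm_triangle_diff[of "\<lambda>x. f (x - z)" f] L2_shift[OF f, of z] f by simp
  then have "(\<lambda>x. conv f (\<eta> n) x - f x) \<in> L2"
    using f \<eta> by (intro conv_L2_bound(1)[where S = "2 * L2_norm f"]) (auto simp: mollifiers_def)
  from L2_add[OF this f] show ?thesis
    by simp
qed

text \<open>Translation continuity is a statement about sequences; a contradiction turns it into one
  radius d for all shifts, and \<open>conv_L2_bound\<close> applies once the mollifier is supported
  within that radius.\<close>

lemma conv_mollifiers_tendsto:
  assumes f: "f \<in> L2" and \<eta>: "mollifiers \<eta>"
  shows "(\<lambda>n. L2_norm (\<lambda>x. conv f (\<eta> n) x - f x)) \<longlonglongrightarrow> 0"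
proof (rule LIMSEQ_I)
  fix e :: real
  assume e: "e > 0"
  have "\<exists>d>0. \<forall>z. norm z < d \<longrightarrow> L2_norm (\<lambda>x. f (x - z) - f x) \<le> e / 2"
  proof (rule ccontr)
    assume "\<not> ?thesis"
    then have "\<forall>n. \<exists>z. norm z < 1 / real (Suc n) \<and> L2_norm (\<lambda>x. f (x - z) - f x) > e / 2"
      by (metis not_le divide_pos_pos of_nat_0_less_iff zero_less_Suc zero_less_one)
    then obtain z where z: "\<And>n. norm (z n) < 1 / real (Suc n)" "\<And>n. L2_norm (\<lambda>x. f (x - z n) - f x) > e / 2"
      by metis
    have "(\<lambda>n. 1 / real (Suc n)) \<longlonglongrightarrow> 0"
      by real_asymp
    then have "z \<longlonglongrightarrow> 0"
      by (rule Lim_null_comparison[rotated]) (use z(1) in \<open>auto intro!: always_eventually less_imp_le\<close>)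
    then have "(\<lambda>n. L2_norm (\<lambda>x. f (x - z n) - f x)) \<longlonglongrightarrow> 0"
      using translation_continuous_L2[OF f] by (simp add: translation_continuous_def)
    then have "eventually (\<lambda>n. L2_norm (\<lambda>x. f (x - z n) - f x) < e / 2) sequentially"
      using e by (intro order_tendstoD(2)) auto
    then show False
      using z(2) by (auto simp: eventually_sequentially not_less dest: less_imp_le) (meson less_asym order_refl)
  qed
  then obtain d where d: "d > 0" "\<And>z. norm z < d \<Longrightarrow> L2_norm (\<lambda>x. f (x - z) - f x) \<le> e / 2"
    by blast
  obtain N where N: "1 / real (Suc N) < d"
    using reals_Archimedean[OF d(1)] by (auto simp: inverse_eq_divide)
  have "L2_norm (\<lambda>x. conv f (\<eta> n) x - f x) \<le> e / 2" if "n \<ge> N" for n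
  proof (rule conv_L2_bound(2)[OF f])
    have "1 / real (Suc n) \<le> 1 / real (Suc N)"
      using that by (intro divide_left_mono) auto
    then show "L2_norm (\<lambda>x. f (x - z) - f x) \<le> e / 2" if "\<eta> n z \<noteq> 0" for z
      using \<eta> that N by (intro d(2)) (force simp: mollifiers_def)
  qed (use \<eta> e in \<open>auto simp: mollifiers_def\<close>)
  then show "\<exists>N. \<forall>n\<ge>N. norm (L2_norm (\<lambda>x. conv f (\<eta> n) x - f x) - 0) < e"
    using e by (intro exI[of _ N]) force
qed

lemma L2_norm_mono:
  assumes [measurable]: "f \<in> borel_measurable borel" and g: "g \<in> L2"
    and le: "\<And>x. norm (f x) \<le> C * norm (g x)" and C: "C \<ge> 0"
  shows "f \<in> L2" "L2_norm f \<le> C * L2_norm g"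
proof -
  have sq: "(norm (f x))\<^sup>2 \<le> C\<^sup>2 * (norm (g x))\<^sup>2" for x
    using power_mono[OF le[of x], of 2] by (simp add: power_mult_distrib)
  have i: "integrable lborel (\<lambda>x. C\<^sup>2 * (norm (g x))\<^sup>2)"
    using L2_integrable_sq[OF g] by simp
  then have j: "integrable lborel (\<lambda>x. (norm (f x))\<^sup>2)"
    by (rule Bochner_Integration.integrable_bound) (use sq in auto)
  then show "f \<in> L2"
    by (simp add: L2_def)
  have "(L2_norm f)\<^sup>2 \<le> (LINT x|lborel. C\<^sup>2 * (norm (g x))\<^sup>2)"
    unfolding L2_norm_sq by (rule integral_mono[OF j i sq])
  then have "(L2_norm f)\<^sup>2 \<le> (C * L2_norm g)\<^sup>2"
    by (simp add: L2_norm_sq power_mult_distrib)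
  then show "L2_norm f \<le> C * L2_norm g"
    by (rule power2_le_imp_le) (use C in simp)
qed

text \<open>Mollify, then cut off. The weak derivative passes through the convolution, and the term
  in which the cutoff is differentiated is of order 1/n.\<close>

lemma H1_test_function_approx:
  fixes f :: "'a::euclidean_space \<Rightarrow> complex"
  assumes f: "f \<in> L2" and G: "\<And>b. b \<in> Basis \<Longrightarrow> G b \<in> L2" "\<And>b. b \<in> Basis \<Longrightarrow> weak_deriv UNIV b f (G b)"
  obtains \<psi> :: "nat \<Rightarrow> 'a \<Rightarrow> complex" where "\<And>n. \<psi> n \<in> test_functions UNIV"
    "(\<lambda>n. L2_norm (\<lambda>x. \<psi> n x - f x)) \<longlonglongrightarrow> 0"
    "\<And>b. b \<in> Basis \<Longrightarrow> (\<lambda>n. L2_norm (\<lambda>x. dir_deriv (\<psi> n) b x - G b x)) \<longlonglongrightarrow> 0"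
proof -
  obtain \<eta> :: "nat \<Rightarrow> 'a \<Rightarrow> real" where \<eta>: "mollifiers \<eta>"
    using mollifiers_exist by blast
  then have \<eta>t: "\<eta> n \<in> test_functions UNIV" for n
    by (simp add: mollifiers_def)
  have "\<exists>\<kappa>::'a \<Rightarrow> real. \<kappa> \<in> test_functions UNIV \<and> (\<forall>x. 0 \<le> \<kappa> x) \<and> (\<forall>x. \<kappa> x \<le> 1) \<and>
      (\<forall>x. \<kappa> x = exp 1 * flat_exp 0 (1 - (norm x / real (Suc n))\<^sup>2)) \<and>
      (\<forall>x v. \<bar>dir_deriv \<kappa> v x\<bar> \<le> 4 * exp 1 / real (Suc n) * norm v)" for n
    using cutoff_exists[of "real (Suc n)"] by (metis of_nat_0_less_iff zero_less_Suc)
  then obtain \<kappa> :: "nat \<Rightarrow> 'a \<Rightarrow> real" where \<kappa>: "\<And>n. \<kappa> n \<in> test_functions UNIV"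
    "\<And>n x. 0 \<le> \<kappa> n x" "\<And>n x. \<kappa> n x \<le> 1"
    "\<And>n x. \<kappa> n x = exp 1 * flat_exp 0 (1 - (norm x / real (Suc n))\<^sup>2)"
    "\<And>n x v. \<bar>dir_deriv (\<kappa> n) v x\<bar> \<le> 4 * exp 1 / real (Suc n) * norm v"
    by metis
  have \<kappa>_lim: "(\<lambda>n. \<kappa> n x) \<longlonglongrightarrow> 1" for x
  proof -
    have "(\<lambda>n. norm x / real (Suc n)) \<longlonglongrightarrow> 0"
      by real_asymp
    then have lim: "(\<lambda>n. 1 - (norm x / real (Suc n))\<^sup>2) \<longlonglongrightarrow> 1 - 0\<^sup>2"
      by (intro tendsto_diff tendsto_const tendsto_power)
    have cont: "isCont (flat_exp 0) (1 - 0\<^sup>2)"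
      by (rule DERIV_isCont[OF flat_has_derivative])
    from tendsto_mult[OF tendsto_const isCont_tendsto_compose[OF cont lim], of "exp 1"] show ?thesis
      unfolding \<kappa>(4) by (simp add: flat_exp_def exp_minus)
  qed
  have [measurable]: "\<kappa> n \<in> borel_measurable borel" "\<eta> n \<in> borel_measurable borel" for n
    using \<kappa>(1) \<eta>t by (auto intro: test_function_measurable)
  have cut_L2: "(\<lambda>x. of_real (\<kappa> n x) * g x) \<in> L2" "L2_norm (\<lambda>x. of_real (\<kappa> n x) * g x) \<le> L2_norm g"
    if "g \<in> L2" for g n
  proof -
    have [measurable]: "g \<in> borel_measurable borel"
      using that by measurable
    have "norm (of_real (\<kappa> n x) * g x) \<le> 1 * norm (g x)" for x
      unfolding norm_mult using \<kappa>(2,3)[of n x] by (intro mult_right_mono) auto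
    from L2_norm_mono[OF _ that this] show "(\<lambda>x. of_real (\<kappa> n x) * g x) \<in> L2"
      "L2_norm (\<lambda>x. of_real (\<kappa> n x) * g x) \<le> L2_norm g"
      by simp_all
  qed
  have cut: "(\<lambda>n. L2_norm (\<lambda>x. of_real (\<kappa> n x) * conv g (\<eta> n) x - g x)) \<longlonglongrightarrow> 0" if g: "g \<in> L2" for g
  proof -
    have [measurable]: "g \<in> borel_measurable borel"
      using g by measurable
    have "(\<lambda>n. L2_norm (\<lambda>x. of_real (\<kappa> n x) * g x - g x)) \<longlonglongrightarrow> 0"
    proof (rule L2_dominated_convergence[OF _ _ L2_integrable_sq[OF g]])
      show "AE x in lborel. (norm (of_real (\<kappa> n x) * g x - g x))\<^sup>2 \<le> (norm (g x))\<^sup>2" for n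
      proof (intro AE_I2 power_mono)
        fix x
        have "of_real (\<kappa> n x) * g x - g x = of_real (\<kappa> n x - 1) * g x"
          by (simp add: left_diff_distrib)
        then have "norm (of_real (\<kappa> n x) * g x - g x) = \<bar>\<kappa> n x - 1\<bar> * norm (g x)"
          by (simp only: norm_mult norm_of_real)
        also have "\<dots> \<le> 1 * norm (g x)"
          using \<kappa>(2,3)[of n x] by (intro mult_right_mono) auto
        finally show "norm (of_real (\<kappa> n x) * g x - g x) \<le> norm (g x)"
          by simp
      qed simp
      have "(\<lambda>n. of_real (\<kappa> n x) * g x) \<longlonglongrightarrow> of_real 1 * g x" for x
        by (intro tendsto_intros \<kappa>_lim)
      then show "AE x in lborel. (\<lambda>n. of_real (\<kappa> n x) * g x) \<longlonglongrightarrow> g x"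
        by simp
    qed measurable
    then have "(\<lambda>n. L2_norm (\<lambda>x. conv g (\<eta> n) x - g x) + L2_norm (\<lambda>x. of_real (\<kappa> n x) * g x - g x)) \<longlonglongrightarrow> 0 + 0"
      by (intro tendsto_add conv_mollifiers_tendsto[OF g \<eta>])
    then have b: "(\<lambda>n. L2_norm (\<lambda>x. conv g (\<eta> n) x - g x) + L2_norm (\<lambda>x. of_real (\<kappa> n x) * g x - g x)) \<longlonglongrightarrow> 0"
      by simp
    have "L2_norm (\<lambda>x. of_real (\<kappa> n x) * conv g (\<eta> n) x - g x)
        \<le> L2_norm (\<lambda>x. conv g (\<eta> n) x - g x) + L2_norm (\<lambda>x. of_real (\<kappa> n x) * g x - g x)" for n
    proof -
      note c = conv_mollifiers_L2[OF g \<eta>, of n]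
      have "L2_norm (\<lambda>x. of_real (\<kappa> n x) * conv g (\<eta> n) x - g x)
          \<le> L2_norm (\<lambda>x. of_real (\<kappa> n x) * conv g (\<eta> n) x - of_real (\<kappa> n x) * g x)
            + L2_norm (\<lambda>x. of_real (\<kappa> n x) * g x - g x)"
        by (intro L2_norm_triangle3 cut_L2 c g)
      moreover have "L2_norm (\<lambda>x. of_real (\<kappa> n x) * conv g (\<eta> n) x - of_real (\<kappa> n x) * g x)
          \<le> L2_norm (\<lambda>x. conv g (\<eta> n) x - g x)"
        using cut_L2(2)[OF L2_diff[OF c g], of n] by (simp add: right_diff_distrib)
      ultimately show ?thesis
        by simp
    qed
    then show ?thesis
      by (intro Lim_null_comparison[OF always_eventually b]) simp
  qed
  define \<psi> where "\<psi> n x = of_real (\<kappa> n x) * conv f (\<eta> n) x" for n x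
  have \<psi>': "dir_deriv (\<psi> n) b x = of_real (\<kappa> n x) * conv (G b) (\<eta> n) x + of_real (dir_deriv (\<kappa> n) b x) * conv f (\<eta> n) x"
    if b: "b \<in> Basis" for n b x
  proof -
    have "(\<kappa> n has_derivative frechet_derivative (\<kappa> n) (at x)) (at x)"
      using test_function_differentiable[OF \<kappa>(1)] frechet_derivative_works by blast
    from has_derivative_mult[OF bounded_linear.has_derivative[OF bounded_linear_of_real this]
        conv_has_derivative[OF f \<eta>t]]
    have "(\<psi> n has_derivative (\<lambda>v. of_real (\<kappa> n x) * conv f (dir_deriv (\<eta> n) v) x
        + of_real (frechet_derivative (\<kappa> n) (at x) v) * conv f (\<eta> n) x)) (at x)"
      unfolding \<psi>_def[abs_def] .
    from frechet_derivative_at[OF this, symmetric] show ?thesis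
      by (simp add: conv_weak_deriv[OF G(2)[OF b] \<eta>t])
  qed
  show ?thesis
  proof (rule that[of \<psi>])
    show "\<psi> n \<in> test_functions UNIV" for n
    proof -
      obtain K where K: "compact K" "\<And>x. x \<notin> K \<Longrightarrow> \<kappa> n x = 0"
        using test_function_support[OF \<kappa>(1)[of n]] by metis
      show ?thesis
      proof (rule test_functionsI[OF _ K(1)])
        show "Ck k (\<psi> n)" for k
          unfolding \<psi>_def[abs_def]
          by (intro Ck_mult Ck_linear[OF bounded_linear_of_real] test_function_Ck[OF \<kappa>(1)] conv_Ck f \<eta>t)
        show "x \<in> K" if "\<psi> n x \<noteq> 0" for x
          using K(2)[of x] that by (cases "x \<in> K") (simp_all add: \<psi>_def)
      qed simp
    qed
    show "(\<lambda>n. L2_norm (\<lambda>x. \<psi> n x - f x)) \<longlonglongrightarrow> 0"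
      unfolding \<psi>_def by (rule cut[OF f])
    fix b :: 'a
    assume b: "b \<in> Basis"
    have db [measurable]: "(\<lambda>x. dir_deriv (\<kappa> n) b x) \<in> borel_measurable borel" for n
      by (rule test_function_measurable[OF dir_deriv_test_function[OF \<kappa>(1)]])
    have t: "L2_norm (\<lambda>x. dir_deriv (\<psi> n) b x - G b x)
        \<le> L2_norm (\<lambda>x. of_real (\<kappa> n x) * conv (G b) (\<eta> n) x - G b x)
          + 4 * exp 1 / real (Suc n) * L2_norm (conv f (\<eta> n))" for n
    proof -
      note cf = conv_mollifiers_L2[OF f \<eta>, of n] and cG = conv_mollifiers_L2[OF G(1)[OF b] \<eta>, of n]
      have [measurable]: "conv f (\<eta> n) \<in> borel_measurable borel"
        using cf by measurable
      have m: "(\<lambda>x. of_real (dir_deriv (\<kappa> n) b x) * conv f (\<eta> n) x) \<in> borel_measurable borel"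
        by measurable
      have le: "norm (of_real (dir_deriv (\<kappa> n) b x) * conv f (\<eta> n) x) \<le> 4 * exp 1 / real (Suc n) * norm (conv f (\<eta> n) x)" for x
        unfolding norm_mult using \<kappa>(5)[of n x b] b by (intro mult_right_mono) auto
      note d = L2_norm_mono[OF m cf le]
      have "L2_norm (\<lambda>x. (of_real (\<kappa> n x) * conv (G b) (\<eta> n) x - G b x) + of_real (dir_deriv (\<kappa> n) b x) * conv f (\<eta> n) x)
        \<le> L2_norm (\<lambda>x. of_real (\<kappa> n x) * conv (G b) (\<eta> n) x - G b x)
          + L2_norm (\<lambda>x. of_real (dir_deriv (\<kappa> n) b x) * conv f (\<eta> n) x)"
        by (intro L2_norm_triangle L2_diff cut_L2 cG G(1)[OF b] d(1)) simp
      moreover have "L2_norm (\<lambda>x. of_real (dir_deriv (\<kappa> n) b x) * conv f (\<eta> n) x) \<le> 4 * exp 1 / real (Suc n) * L2_norm (conv f (\<eta> n))"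
        by (rule d(2)) simp
      moreover have "(\<lambda>x. dir_deriv (\<psi> n) b x - G b x)
         = (\<lambda>x. (of_real (\<kappa> n x) * conv (G b) (\<eta> n) x - G b x) + of_real (dir_deriv (\<kappa> n) b x) * conv f (\<eta> n) x)"
        unfolding \<psi>'[OF b] by (simp add: algebra_simps)
      ultimately show ?thesis
        by simp
    qed
    have "(\<lambda>n. L2_norm (conv f (\<eta> n))) \<longlonglongrightarrow> L2_norm f"
      by (rule L2_norm_tendsto[OF conv_mollifiers_L2[OF f \<eta>] f conv_mollifiers_tendsto[OF f \<eta>]])
    moreover have "(\<lambda>n. 4 * exp 1 / real (Suc n)) \<longlonglongrightarrow> 0"
      by real_asymp
    ultimately have "(\<lambda>n. L2_norm (\<lambda>x. of_real (\<kappa> n x) * conv (G b) (\<eta> n) x - G b x)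
          + 4 * exp 1 / real (Suc n) * L2_norm (conv f (\<eta> n))) \<longlonglongrightarrow> 0 + 0 * L2_norm f"
      by (intro tendsto_add tendsto_mult cut[OF G(1)[OF b]])
    then have lim: "(\<lambda>n. L2_norm (\<lambda>x. of_real (\<kappa> n x) * conv (G b) (\<eta> n) x - G b x)
          + 4 * exp 1 / real (Suc n) * L2_norm (conv f (\<eta> n))) \<longlonglongrightarrow> 0"
      by simp
    show "(\<lambda>n. L2_norm (\<lambda>x. dir_deriv (\<psi> n) b x - G b x)) \<longlonglongrightarrow> 0"
      by (rule Lim_null_comparison[OF always_eventually lim]) (use t in simp)
  qed
qed

section \<open>The energy estimate\<close>

lemma quadratic_form_inner:
  fixes A :: "real ^ 'n ^ 'n"
  shows "(\<Sum>i\<in>UNIV. \<Sum>k\<in>UNIV. A $ i $ k * u $ i * v $ k) = u \<bullet> (A *v v)"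
  by (simp add: inner_vec_def matrix_vector_mult_def sum_distrib_left mult_ac)

text \<open>Ellipticity sees only the quadratic form. An entry is recovered by polarization with the
  sum and the difference of two unit vectors, whose norms are at most 2; symmetry of \<sigma>
  identifies the two mixed terms.\<close>

lemma admissible_bounded:
  fixes \<sigma> :: "real ^ 'n \<Rightarrow> real ^ 'n ^ 'n"
  assumes "admissible \<sigma>"
  obtains C where "C \<ge> 0" "\<And>x i k. \<bar>\<sigma> x $ i $ k\<bar> \<le> C"
proof -
  obtain c0 where c0: "0 < c0"
    "\<And>x \<xi>. c0 * (norm \<xi>)\<^sup>2 \<le> \<xi> \<bullet> (\<sigma> x *v \<xi>)" "\<And>x \<xi>. \<xi> \<bullet> (\<sigma> x *v \<xi>) \<le> inverse c0 * (norm \<xi>)\<^sup>2"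
    and sym: "\<And>x. transpose (\<sigma> x) = \<sigma> x"
    using assms unfolding admissible_def quadratic_form_inner by metis
  have Q: "0 \<le> \<xi> \<bullet> (\<sigma> x *v \<xi>)" "\<xi> \<bullet> (\<sigma> x *v \<xi>) \<le> inverse c0 * 4" if "norm \<xi> \<le> 2" for x \<xi>
  proof -
    have "0 \<le> c0 * (norm \<xi>)\<^sup>2"
      using c0(1) by simp
    then show "0 \<le> \<xi> \<bullet> (\<sigma> x *v \<xi>)"
      using c0(2)[of \<xi> x] by linarith
    have "(norm \<xi>)\<^sup>2 \<le> 2\<^sup>2"
      using that by (intro power_mono) auto
    then have "inverse c0 * (norm \<xi>)\<^sup>2 \<le> inverse c0 * 4"
      using c0(1) by (intro mult_left_mono) auto
    then show "\<xi> \<bullet> (\<sigma> x *v \<xi>) \<le> inverse c0 * 4"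
      using c0(3)[of \<xi> x] by linarith
  qed
  have "\<bar>\<sigma> x $ i $ k\<bar> \<le> inverse c0 * 4" for x i k
  proof -
    let ?u = "axis i 1 :: real ^ 'n" and ?v = "axis k 1 :: real ^ 'n"
    have ent: "axis i 1 \<bullet> (\<sigma> x *v axis k 1) = \<sigma> x $ i $ k" for i k
      by (simp add: matrix_vector_mult_basis inner_axis' column_def)
    have "\<sigma> x $ k $ i = \<sigma> x $ i $ k"
      using sym[of x] by (metis transpose_def vec_lambda_beta)
    then have "(?u + ?v) \<bullet> (\<sigma> x *v (?u + ?v)) - (?u - ?v) \<bullet> (\<sigma> x *v (?u - ?v)) = 4 * \<sigma> x $ i $ k"
      using ent[of i k] ent[of k i]
      by (simp add: matrix_vector_right_distrib matrix_vector_mult_diff_distrib inner_add_left inner_add_right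
          inner_diff_left inner_diff_right)
    moreover have "norm (?u + ?v) \<le> 2" "norm (?u - ?v) \<le> 2"
      using norm_triangle_ineq[of ?u ?v] norm_triangle_ineq4[of ?u ?v] by simp_all
    ultimately show ?thesis
      using Q[of "?u + ?v" x] Q[of "?u - ?v" x] by linarith
  qed
  with c0(1) show ?thesis
    by (intro that[of "inverse c0 * 4"]) auto
qed

lemma admissible_measurable:
  assumes "admissible \<sigma>"
  shows "(\<lambda>x. \<sigma> x $ i $ k) \<in> borel_measurable borel"
proof -
  obtain C where C: "C > 0" "\<And>x z. norm (\<sigma> x - \<sigma> z) \<le> C * norm (x - z)"
    using assms unfolding admissible_def by metis
  have "C-lipschitz_on UNIV \<sigma>"
    using C by (auto simp: lipschitz_on_def dist_norm)
  then have "continuous_on UNIV \<sigma>"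
    by (rule lipschitz_on_continuous_on)
  then show ?thesis
    by (intro borel_measurable_continuous_onI continuous_intros)
qed

text \<open>The weak equation is tested with approximations of the conjugate of f; in the limit the
  pairing of h with f equals the Hermitian form of \<sigma> at G, which ellipticity bounds from
  below.\<close>

lemma energy_estimate:
  fixes \<sigma> :: "real ^ 'n \<Rightarrow> real ^ 'n ^ 'n" and G :: "real ^ 'n \<Rightarrow> complex ^ 'n"
  assumes \<sigma>: "admissible \<sigma>"
    and c0: "\<And>x \<xi>. c0 * (norm \<xi>)\<^sup>2 \<le> (\<Sum>i\<in>UNIV. \<Sum>k\<in>UNIV. \<sigma> x $ i $ k * \<xi> $ i * \<xi> $ k)"
    and f: "f \<in> L2" and h: "h \<in> L2"
    and G: "\<And>i. (\<lambda>x. G x $ i) \<in> L2" "\<And>i. weak_deriv UNIV (axis i 1) f (\<lambda>x. G x $ i)"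
    and eq: "\<And>\<phi>. \<phi> \<in> test_functions UNIV \<Longrightarrow>
      (LINT x|lborel. (\<Sum>i\<in>UNIV. \<Sum>k\<in>UNIV.
              of_real (\<sigma> x $ i $ k) * G x $ k * of_real (dir_deriv \<phi> (axis i 1) x)))
           = (LINT x|lborel. h x * of_real (\<phi> x))"
  shows "c0 * (\<Sum>i\<in>UNIV. (L2_norm (\<lambda>x. G x $ i))\<^sup>2) \<le> L2_norm h * L2_norm f"
proof -
  obtain C where C: "C \<ge> 0" "\<And>x i k. \<bar>\<sigma> x $ i $ k\<bar> \<le> C"
    using admissible_bounded[OF \<sigma>] by metis
  note [measurable] = admissible_measurable[OF \<sigma>]
  have \<sigma>G: "(\<lambda>x. of_real (\<sigma> x $ i $ k) * G x $ k) \<in> L2" for i k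
    by (rule L2_bounded_mult[OF G(1), where C = C]) (use C in auto)
  \<comment> \<open>The weak equation is given for real test functions, while the approximations of
    f are complex; their conjugates are split into real and imaginary parts.\<close>
  have complex_test: "(\<Sum>i\<in>UNIV. \<Sum>k\<in>UNIV. L2_inner (\<lambda>x. of_real (\<sigma> x $ i $ k) * G x $ k) (dir_deriv \<psi> (axis i 1)))
      = L2_inner h \<psi>" if \<psi>: "\<psi> \<in> test_functions UNIV" for \<psi> :: "real ^ 'n \<Rightarrow> complex"
  proof -
    obtain K where K: "compact K" "\<And>x. x \<notin> K \<Longrightarrow> \<psi> x = 0"
      using test_function_support[OF \<psi>] by metis
    have part: "(\<lambda>x. T (\<psi> x)) \<in> test_functions UNIV"
      "dir_deriv (\<lambda>x. T (\<psi> x)) v x = T (dir_deriv \<psi> v x)" if T: "bounded_linear T" for T :: "complex \<Rightarrow> real" and v x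
    proof -
      show "(\<lambda>x. T (\<psi> x)) \<in> test_functions UNIV"
      proof (rule test_functionsI[OF _ K(1)])
        show "x \<in> K" if "T (\<psi> x) \<noteq> 0" for x
          using K(2)[of x] that linear_0[OF bounded_linear.linear[OF T]] by (cases "x \<in> K") simp_all
      qed (auto intro!: Ck_linear[OF T] test_function_Ck[OF \<psi>])
      have "(\<psi> has_derivative frechet_derivative \<psi> (at x)) (at x)"
        using test_function_differentiable[OF \<psi>] frechet_derivative_works by blast
      from frechet_derivative_at[OF bounded_linear.has_derivative[OF T this], symmetric]
      show "dir_deriv (\<lambda>x. T (\<psi> x)) v x = T (dir_deriv \<psi> v x)"
        by simp
    qed
    note re = part[OF bounded_linear_Re] and im = part[OF bounded_linear_Im]
    let ?S = "\<lambda>\<phi> x. (\<Sum>i\<in>UNIV. \<Sum>k\<in>UNIV. of_real (\<sigma> x $ i $ k) * G x $ k * complex_of_real (dir_deriv \<phi> (axis i 1) x))"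
    have iS: "integrable lborel (?S \<phi>)" if "\<phi> \<in> test_functions UNIV" for \<phi> :: "real ^ 'n \<Rightarrow> real"
      using L2_integrable_prod[OF \<sigma>G test_function_of_real_L2[OF dir_deriv_test_function[OF that]]]
      by (intro Bochner_Integration.integrable_sum) auto
    have ih: "integrable lborel (\<lambda>x. h x * of_real (\<phi> x))" if "\<phi> \<in> test_functions UNIV" for \<phi> :: "real ^ 'n \<Rightarrow> real"
      by (rule L2_integrable_prod[OF h test_function_of_real_L2[OF that]])
    have cnj_eq: "cnj z = of_real (Re z) - \<i> * of_real (Im z)" for z
      by (simp add: complex_eq_iff)
    have "(\<Sum>i\<in>UNIV. \<Sum>k\<in>UNIV. L2_inner (\<lambda>x. of_real (\<sigma> x $ i $ k) * G x $ k) (dir_deriv \<psi> (axis i 1)))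
        = (LINT x|lborel. (\<Sum>i\<in>UNIV. \<Sum>k\<in>UNIV. of_real (\<sigma> x $ i $ k) * G x $ k * cnj (dir_deriv \<psi> (axis i 1) x)))"
      unfolding L2_inner_def using L2_integrable_inner[OF \<sigma>G test_function_L2[OF dir_deriv_test_function[OF \<psi>]]]
      by (simp add: Bochner_Integration.integral_sum)
    also have "\<dots> = (LINT x|lborel. ?S (\<lambda>x. Re (\<psi> x)) x - \<i> * ?S (\<lambda>x. Im (\<psi> x)) x)"
      unfolding re im cnj_eq
      by (simp add: right_diff_distrib sum_subtractf sum_distrib_left mult_ac)
    also have "\<dots> = (LINT x|lborel. ?S (\<lambda>x. Re (\<psi> x)) x) - \<i> * (LINT x|lborel. ?S (\<lambda>x. Im (\<psi> x)) x)"
      using iS[OF re(1)] iS[OF im(1)] by simp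
    also have "\<dots> = (LINT x|lborel. h x * of_real (Re (\<psi> x))) - \<i> * (LINT x|lborel. h x * of_real (Im (\<psi> x)))"
      by (simp only: eq[OF re(1)] eq[OF im(1)])
    also have "\<dots> = (LINT x|lborel. h x * of_real (Re (\<psi> x)) - \<i> * (h x * of_real (Im (\<psi> x))))"
      using ih[OF re(1)] ih[OF im(1)] by simp
    also have "\<dots> = L2_inner h \<psi>"
      unfolding L2_inner_def cnj_eq by (simp add: right_diff_distrib mult_ac)
    finally show ?thesis .
  qed
  \<comment> \<open>The approximation lemma indexes derivatives by basis vectors, the gradient G by
    coordinates; the choice inverts \<open>axis _ 1\<close>.\<close>
  define H :: "real ^ 'n \<Rightarrow> real ^ 'n \<Rightarrow> complex" where "H b x = G x $ (SOME i. b = axis i 1)" for b x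
  have H: "H (axis i 1) = (\<lambda>x. G x $ i)" for i
  proof -
    have "(SOME j. axis i (1::real) = axis j 1) = i"
      by (rule some_equality) (auto simp: axis_eq_axis)
    then show ?thesis
      by (simp add: H_def fun_eq_iff)
  qed
  have HL: "H b \<in> L2" "weak_deriv UNIV b f (H b)" if b: "b \<in> Basis" for b
  proof -
    obtain i where "b = axis i 1"
      using b by (auto simp: Basis_vec_def)
    then show "H b \<in> L2" "weak_deriv UNIV b f (H b)"
      using G H by simp_all
  qed
  obtain \<psi> :: "nat \<Rightarrow> real ^ 'n \<Rightarrow> complex" where \<psi>: "\<And>n. \<psi> n \<in> test_functions UNIV"
    "(\<lambda>n. L2_norm (\<lambda>x. \<psi> n x - f x)) \<longlonglongrightarrow> 0"
    "\<And>b. b \<in> Basis \<Longrightarrow> (\<lambda>n. L2_norm (\<lambda>x. dir_deriv (\<psi> n) b x - H b x)) \<longlonglongrightarrow> 0"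
    using H1_test_function_approx[of f H, OF f HL] by blast
  have "(\<lambda>n. L2_inner h (\<psi> n)) \<longlonglongrightarrow> L2_inner h f"
    by (rule L2_inner_tendsto_right[OF test_function_L2[OF \<psi>(1)] f h \<psi>(2)])
  moreover have "(\<lambda>n. \<Sum>i\<in>UNIV. \<Sum>k\<in>UNIV. L2_inner (\<lambda>x. of_real (\<sigma> x $ i $ k) * G x $ k) (dir_deriv (\<psi> n) (axis i 1)))
      \<longlonglongrightarrow> (\<Sum>i\<in>UNIV. \<Sum>k\<in>UNIV. L2_inner (\<lambda>x. of_real (\<sigma> x $ i $ k) * G x $ k) (\<lambda>x. G x $ i))"
    using \<psi>(3)[of "axis _ 1"]
    by (intro tendsto_sum L2_inner_tendsto_right test_function_L2[OF dir_deriv_test_function[OF \<psi>(1)]] \<sigma>G G)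
      (simp add: H axis_in_Basis_iff)
  ultimately have "(\<Sum>i\<in>UNIV. \<Sum>k\<in>UNIV. L2_inner (\<lambda>x. of_real (\<sigma> x $ i $ k) * G x $ k) (\<lambda>x. G x $ i)) = L2_inner h f"
    unfolding complex_test[OF \<psi>(1)] by (rule LIMSEQ_unique[rotated])
  also have "(\<Sum>i\<in>UNIV. \<Sum>k\<in>UNIV. L2_inner (\<lambda>x. of_real (\<sigma> x $ i $ k) * G x $ k) (\<lambda>x. G x $ i))
      = (LINT x|lborel. (\<Sum>i\<in>UNIV. \<Sum>k\<in>UNIV. of_real (\<sigma> x $ i $ k) * G x $ k * cnj (G x $ i)))"
    unfolding L2_inner_def using L2_integrable_inner[OF \<sigma>G G(1)]
    by (simp add: Bochner_Integration.integral_sum)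
  finally have main: "(LINT x|lborel. (\<Sum>i\<in>UNIV. \<Sum>k\<in>UNIV. of_real (\<sigma> x $ i $ k) * G x $ k * cnj (G x $ i))) = L2_inner h f" .
  let ?q = "\<lambda>x. \<Sum>i\<in>UNIV. \<Sum>k\<in>UNIV. of_real (\<sigma> x $ i $ k) * G x $ k * cnj (G x $ i)"
  have iq: "integrable lborel ?q"
    using L2_integrable_inner[OF \<sigma>G G(1)] by (intro Bochner_Integration.integrable_sum) auto
  have "c0 * (\<Sum>i\<in>UNIV. (L2_norm (\<lambda>x. G x $ i))\<^sup>2) = (LINT x|lborel. c0 * (\<Sum>i\<in>UNIV. (norm (G x $ i))\<^sup>2))"
    using L2_integrable_sq[OF G(1)] by (simp add: L2_norm_sq Bochner_Integration.integral_sum)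
  also have "\<dots> \<le> (LINT x|lborel. Re (?q x))"
  proof (rule integral_mono)
    show "integrable lborel (\<lambda>x. c0 * (\<Sum>i\<in>UNIV. (norm (G x $ i))\<^sup>2))"
      using L2_integrable_sq[OF G(1)] by (intro integrable_mult_right Bochner_Integration.integrable_sum) auto
    show "integrable lborel (\<lambda>x. Re (?q x))"
      by (rule integrable_Re[OF iq])
    fix x
    \<comment> \<open>As \<sigma> is real, the real part of the Hermitian form at G is the sum of
      the quadratic forms at the real and the imaginary part of G.\<close>
    let ?a = "\<chi> i. Re (G x $ i)" and ?b = "\<chi> i. Im (G x $ i)"
    have "Re (?q x) = (\<Sum>i\<in>UNIV. \<Sum>k\<in>UNIV. \<sigma> x $ i $ k * ?a $ i * ?a $ k) + (\<Sum>i\<in>UNIV. \<Sum>k\<in>UNIV. \<sigma> x $ i $ k * ?b $ i * ?b $ k)"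
      by (simp add: sum.distrib[symmetric] algebra_simps)
    also have "\<dots> \<ge> c0 * (norm ?a)\<^sup>2 + c0 * (norm ?b)\<^sup>2"
      by (intro add_mono c0)
    also have "c0 * (norm ?a)\<^sup>2 + c0 * (norm ?b)\<^sup>2 = c0 * (\<Sum>i\<in>UNIV. (norm (G x $ i))\<^sup>2)"
    proof -
      have n: "(norm v)\<^sup>2 = (\<Sum>i\<in>UNIV. (v $ i)\<^sup>2)" for v :: "real ^ 'n"
        by (simp only: power2_norm_eq_inner inner_vec_def) (simp add: power2_eq_square)
      show ?thesis
        unfolding n by (simp add: cmod_power2 sum.distrib distrib_left)
    qed
    finally show "c0 * (\<Sum>i\<in>UNIV. (norm (G x $ i))\<^sup>2) \<le> Re (?q x)" .
  qed
  also have "\<dots> = Re (L2_inner h f)"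
    unfolding main[symmetric] by (rule integral_Re[OF iq])
  also have "\<dots> \<le> L2_norm h * L2_norm f"
    using L2_cauchy_schwarz[OF h f] complex_Re_le_cmod order_trans by blast
  finally show ?thesis .
qed

section \<open>Slices of functions on products\<close>

lemma borel_measurable_fst [measurable]:
  "(fst :: 's::second_countable_topology \<times> 'a::second_countable_topology \<Rightarrow> 's) \<in> borel_measurable borel"
  by (intro borel_measurable_continuous_onI continuous_intros)

lemma borel_measurable_snd [measurable]:
  "(snd :: 's::second_countable_topology \<times> 'a::second_countable_topology \<Rightarrow> 'a) \<in> borel_measurable borel"
  by (intro borel_measurable_continuous_onI continuous_intros)

lemma nn_integral_slices:
  fixes f :: "'s::euclidean_space \<times> 'a::euclidean_space \<Rightarrow> ennreal"
  assumes [measurable]: "f \<in> borel_measurable borel"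
  shows "(\<integral>\<^sup>+ q. f q \<partial>lborel) = (\<integral>\<^sup>+ s. (\<integral>\<^sup>+ x. f (s, x) \<partial>lborel) \<partial>lborel)"
  unfolding lborel_prod[symmetric]
  by (rule lborel.nn_integral_fst[symmetric]) (simp add: lborel_prod)

lemma integral_slices:
  fixes f :: "'s::euclidean_space \<times> 'a::euclidean_space \<Rightarrow> complex"
  assumes "integrable lborel f"
  shows "AE s in lborel. integrable lborel (\<lambda>x. f (s, x))"
    and "integrable lborel (\<lambda>s. LINT x|lborel. f (s, x))"
    and "(LINT q|lborel. f q) = (LINT s|lborel. LINT x|lborel. f (s, x))"
proof -
  have i: "integrable (lborel \<Otimes>\<^sub>M lborel) (\<lambda>(s, x). f (s, x))"
    using assms by (simp add: lborel_prod)
  show "AE s in lborel. integrable lborel (\<lambda>x. f (s, x))"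
    using lborel_pair.AE_integrable_fst[OF i] by simp
  show "integrable lborel (\<lambda>s. LINT x|lborel. f (s, x))"
    using lborel_pair.integrable_fst[OF i] by simp
  show "(LINT q|lborel. f q) = (LINT s|lborel. LINT x|lborel. f (s, x))"
    using lborel_pair.integral_fst[OF i] by (simp add: lborel_prod)
qed

lemma AE_lborel_fst:
  assumes "AE s in lborel. P s"
  shows "AE q in lborel. P (fst (q :: 's::euclidean_space \<times> 'a::euclidean_space))"
proof -
  obtain N where N: "N \<in> null_sets lborel" "{s. \<not> P s} \<subseteq> N"
    using assms unfolding eventually_ae_filter by auto
  have "N \<times> (UNIV :: 'a set) \<in> null_sets lborel"
  proof (rule null_setsI)
    have "emeasure (lborel \<Otimes>\<^sub>M lborel) (N \<times> (UNIV :: 'a set)) = emeasure lborel N * emeasure lborel (UNIV :: 'a set)"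
      using N(1) by (intro lborel.emeasure_pair_measure_Times) auto
    then show "emeasure lborel (N \<times> (UNIV :: 'a set)) = 0"
      using N(1) by (simp add: lborel_prod null_setsD1)
    have "N \<times> (UNIV :: 'a set) \<in> sets (lborel \<Otimes>\<^sub>M lborel)"
      using N(1) by (intro pair_measureI) auto
    then show "N \<times> (UNIV :: 'a set) \<in> sets lborel"
      by (simp only: lborel_prod)
  qed
  then show ?thesis
    by (rule AE_I') (use N(2) in auto)
qed

lemma AE_slices:
  assumes "AE q in lborel. P (q :: 's::euclidean_space \<times> 'a::euclidean_space)"
  shows "AE s in lborel. AE x in lborel. P (s, x)"
  using assms unfolding lborel_prod[symmetric] by (rule lborel_pair.AE_pair)

text \<open>The shear \<open>(t, \<tau>) \<mapsto> (t - \<tau>, \<tau>)\<close> preserves Lebesgue measure.\<close>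

lemma nn_integral_shear:
  fixes F K :: "real \<Rightarrow> ennreal"
  assumes [measurable]: "F \<in> borel_measurable borel" "K \<in> borel_measurable borel"
  shows "(\<integral>\<^sup>+ s. F (fst s - snd s) * K (snd s) \<partial>lborel) = (\<integral>\<^sup>+ r. F r \<partial>lborel) * (\<integral>\<^sup>+ \<tau>. K \<tau> \<partial>lborel)"
proof -
  have "(\<integral>\<^sup>+ s. F (fst s - snd s) * K (snd s) \<partial>lborel) = (\<integral>\<^sup>+ t. (\<integral>\<^sup>+ \<tau>. F (t - \<tau>) * K \<tau> \<partial>lborel) \<partial>lborel)"
    by (subst nn_integral_slices) simp_all
  also have "\<dots> = (\<integral>\<^sup>+ \<tau>. (\<integral>\<^sup>+ t. F (t - \<tau>) * K \<tau> \<partial>lborel) \<partial>lborel)"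
    by (rule lborel_pair.Fubini'[symmetric]) measurable
  also have "\<dots> = (\<integral>\<^sup>+ \<tau>. (\<integral>\<^sup>+ r. F r \<partial>lborel) * K \<tau> \<partial>lborel)"
    by (simp add: nn_integral_multc nn_integral_lborel_shift)
  also have "\<dots> = (\<integral>\<^sup>+ r. F r \<partial>lborel) * (\<integral>\<^sup>+ \<tau>. K \<tau> \<partial>lborel)"
    by (simp add: nn_integral_cmult)
  finally show ?thesis .
qed

lemma AE_shear:
  assumes "AE r in lborel. P (r :: real)"
  shows "AE s in lborel. P (fst s - snd s)"
proof -
  obtain N where N: "N \<in> null_sets lborel" "{s. \<not> P s} \<subseteq> N"
    using assms unfolding eventually_ae_filter by auto
  have [measurable]: "N \<in> sets borel"
    using N(1) by auto
  \<comment> \<open>The integral of the constant 1 over \<tau> is infinite; the product still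
    vanishes because \<open>0 * \<infinity> = 0\<close> in \<open>ennreal\<close>.\<close>
  have "(\<integral>\<^sup>+ s. indicator N (fst s - snd s) \<partial>(lborel :: (real \<times> real) measure)) = 0"
    using nn_integral_shear[of "indicator N" "\<lambda>\<tau>. 1"] N(1) by (simp add: null_setsD1)
  then have "AE s in (lborel :: (real \<times> real) measure). (indicator N (fst s - snd s) :: ennreal) = 0"
    by (subst (asm) nn_integral_0_iff_AE) auto
  then show ?thesis
    by eventually_elim (use N(2) in \<open>auto simp: indicator_def split: if_splits\<close>)
qed

text \<open>The triple nests to the right, whereas slicing by the pair
  \<open>s = (t, \<tau>)\<close> needs it nested to the left. Both nestings give the same iterated
  integral by Tonelli.\<close>

lemma lborel_assoc:
  "distr (lborel :: ((real \<times> real) \<times> 'a::euclidean_space) measure) borel (\<lambda>(s, x). (fst s, snd s, x)) = lborel"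
proof (rule measure_eqI)
  fix A :: "(real \<times> real \<times> 'a) set"
  assume "A \<in> sets (distr (lborel :: ((real \<times> real) \<times> 'a) measure) borel (\<lambda>(s, x). (fst s, snd s, x)))"
  then have [measurable]: "A \<in> sets borel"
    by simp
  have [measurable]: "(\<lambda>(s, x). (fst s, snd s, x)) \<in> borel_measurable (borel :: ((real \<times> real) \<times> 'a) measure)"
    unfolding split_beta by (intro borel_measurable_continuous_onI continuous_intros)
  have "emeasure (distr (lborel :: ((real \<times> real) \<times> 'a) measure) borel (\<lambda>(s, x). (fst s, snd s, x))) A
      = (\<integral>\<^sup>+ q. indicator A q \<partial>distr (lborel :: ((real \<times> real) \<times> 'a) measure) borel (\<lambda>(s, x). (fst s, snd s, x)))"
    by simp
  also have "\<dots> = (\<integral>\<^sup>+ p. indicator A (case p of (s, x) \<Rightarrow> (fst s, snd s, x)) \<partial>(lborel :: ((real \<times> real) \<times> 'a) measure))"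
    by (rule nn_integral_distr) auto
  also have "\<dots> = (\<integral>\<^sup>+ s. (\<integral>\<^sup>+ x. indicator A (fst s, snd s, x) \<partial>lborel) \<partial>lborel)"
    by (subst nn_integral_slices) simp_all
  also have "\<dots> = (\<integral>\<^sup>+ t. (\<integral>\<^sup>+ \<tau>. (\<integral>\<^sup>+ x. indicator A (t, \<tau>, x) \<partial>lborel) \<partial>lborel) \<partial>lborel)"
  proof (subst nn_integral_slices)
    have [measurable]: "(\<lambda>p. (fst (fst p), snd (fst p), snd p)) \<in> borel_measurable (borel :: ((real \<times> real) \<times> 'a) measure)"
      by (intro borel_measurable_continuous_onI continuous_intros)
    have "(\<lambda>p. indicator A (fst (fst p), snd (fst p), snd p) :: ennreal) \<in> borel_measurable (borel :: ((real \<times> real) \<times> 'a) measure)"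
      by measurable
    then show "(\<lambda>s. \<integral>\<^sup>+ x. indicator A (fst s, snd s, x) \<partial>lborel) \<in> borel_measurable borel"
      using lborel.borel_measurable_nn_integral_fst[of "\<lambda>p. indicator A (fst (fst p), snd (fst p), snd p)" borel]
      by (simp add: borel_prod)
  qed simp
  also have "\<dots> = (\<integral>\<^sup>+ t. (\<integral>\<^sup>+ r. indicator A (t, r) \<partial>lborel) \<partial>lborel)"
  proof (rule nn_integral_cong)
    fix t
    show "(\<integral>\<^sup>+ \<tau>. (\<integral>\<^sup>+ x. indicator A (t, \<tau>, x) \<partial>lborel) \<partial>lborel) = (\<integral>\<^sup>+ r. indicator A (t, r) \<partial>lborel)"
      by (subst nn_integral_slices) simp_all
  qed
  also have "\<dots> = (\<integral>\<^sup>+ q. indicator A q \<partial>lborel)"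
    by (subst nn_integral_slices) simp_all
  finally show "emeasure (distr (lborel :: ((real \<times> real) \<times> 'a) measure) borel (\<lambda>(s, x). (fst s, snd s, x))) A = emeasure lborel A"
    by simp
qed simp

definition assoc :: "(real \<times> real) \<times> 'a::euclidean_space \<Rightarrow> real \<times> real \<times> 'a" where
  "assoc p = (fst (fst p), snd (fst p), snd p)"

lemma assoc_measurable [measurable]: "assoc \<in> borel_measurable borel"
  unfolding assoc_def[abs_def] by (intro borel_measurable_continuous_onI continuous_intros)

lemma distr_assoc: "distr lborel borel assoc = lborel"
  using lborel_assoc by (simp add: assoc_def[abs_def] split_beta')

lemma nn_integral_assoc:
  assumes [measurable]: "f \<in> borel_measurable borel"
  shows "(\<integral>\<^sup>+ q. f q \<partial>lborel) = (\<integral>\<^sup>+ p. f (assoc p) \<partial>lborel)"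
  by (subst distr_assoc[symmetric]) (rule nn_integral_distr; measurable)

lemma nn_integral_triple:
  fixes f :: "real \<times> real \<times> 'a::euclidean_space \<Rightarrow> ennreal"
  assumes [measurable]: "f \<in> borel_measurable borel"
  shows "(\<integral>\<^sup>+ q. f q \<partial>lborel) = (\<integral>\<^sup>+ s. (\<integral>\<^sup>+ x. f (fst s, snd s, x) \<partial>lborel) \<partial>lborel)"
  by (subst nn_integral_assoc, measurable) (subst nn_integral_slices, simp_all add: assoc_def)

lemma integrable_assoc:
  fixes f :: "real \<times> real \<times> 'a::euclidean_space \<Rightarrow> complex"
  assumes "integrable lborel f"
  shows "integrable lborel (\<lambda>p. f (assoc p))" "(LINT q|lborel. f q) = (LINT p|lborel. f (assoc p))"
proof -
  have [measurable]: "f \<in> borel_measurable borel"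
    using borel_measurable_integrable[OF assms] by simp
  have "integrable (distr lborel borel assoc) f"
    using assms by (simp only: distr_assoc)
  then show "integrable lborel (\<lambda>p. f (assoc p))"
    by (subst (asm) integrable_distr_eq) auto
  show "(LINT q|lborel. f q) = (LINT p|lborel. f (assoc p))"
    by (subst distr_assoc[symmetric]) (rule integral_distr; measurable)
qed

lemma integral_triple:
  fixes f :: "real \<times> real \<times> 'a::euclidean_space \<Rightarrow> complex"
  assumes "integrable lborel f"
  shows "AE s in lborel. integrable lborel (\<lambda>x. f (fst s, snd s, x))"
    and "integrable lborel (\<lambda>s. LINT x|lborel. f (fst s, snd s, x))"
    and "(LINT q|lborel. f q) = (LINT s|lborel. LINT x|lborel. f (fst s, snd s, x))"
  using integral_slices[OF integrable_assoc(1)[OF assms]] integrable_assoc(2)[OF assms]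
  by (simp_all add: assoc_def)

lemma integral_eq_triple:
  fixes f g :: "real \<times> real \<times> 'a::euclidean_space \<Rightarrow> complex"
  assumes f: "integrable lborel f" and g: "integrable lborel g"
    and eq: "AE s in lborel. (LINT x|lborel. f (fst s, snd s, x)) = (LINT x|lborel. g (fst s, snd s, x))"
  shows "(LINT q|lborel. f q) = (LINT q|lborel. g q)"
  unfolding integral_triple(3)[OF f] integral_triple(3)[OF g]
  by (rule integral_cong_AE[OF _ _ eq])
    (use integral_triple(2)[OF f] integral_triple(2)[OF g] in \<open>auto dest: borel_measurable_integrable\<close>)

lemma AE_triple:
  assumes "AE s in lborel. P (s :: real \<times> real)"
  shows "AE q in lborel. P (fst q, fst (snd (q :: real \<times> real \<times> 'a::euclidean_space)))"
proof -
  obtain N where N: "N \<in> null_sets lborel" "{s. \<not> P s} \<subseteq> N"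
    using assms unfolding eventually_ae_filter by auto
  have [measurable]: "N \<in> sets borel"
    using N(1) by auto
  let ?A = "{q :: real \<times> real \<times> 'a. (fst q, fst (snd q)) \<in> N}"
  have m: "?A \<in> sets borel"
  proof -
    have "(\<lambda>q :: real \<times> real \<times> 'a. (fst q, fst (snd q))) \<in> borel_measurable borel"
      by (intro borel_measurable_continuous_onI continuous_intros)
    from measurable_sets[OF this, of N] show ?thesis
      by (simp add: vimage_def)
  qed
  have "emeasure lborel ?A = (\<integral>\<^sup>+ q. indicator ?A q \<partial>lborel)"
    using m by simp
  also have "\<dots> = (\<integral>\<^sup>+ s. (\<integral>\<^sup>+ x. indicator ?A (fst s, snd s, x) \<partial>(lborel :: 'a measure)) \<partial>lborel)"
    using m by (intro nn_integral_triple) simp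
  also have "\<dots> = (\<integral>\<^sup>+ s. (\<integral>\<^sup>+ x. indicator N s \<partial>(lborel :: 'a measure)) \<partial>lborel)"
    by (simp add: indicator_def)
  also have "\<dots> = (\<integral>\<^sup>+ s. 0 \<partial>(lborel :: (real \<times> real) measure))"
  proof (rule nn_integral_cong_AE)
    show "AE s in lborel. (\<integral>\<^sup>+ x. indicator N s \<partial>(lborel :: 'a measure)) = 0"
      using AE_not_in[OF N(1)] by eventually_elim simp
  qed
  finally have "?A \<in> null_sets lborel"
    using m by (intro null_setsI) auto
  then show ?thesis
    by (rule AE_I') (use N(2) in auto)
qed

section \<open>Square integrability slice by slice\<close>

lemma L2_slices:
  fixes f :: "'s::euclidean_space \<times> 'a::euclidean_space \<Rightarrow> complex"
  assumes f: "f \<in> L2"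
  shows "AE s in lborel. (\<lambda>x. f (s, x)) \<in> L2"
proof -
  have [measurable]: "f \<in> borel_measurable borel"
    using f by measurable
  have "(\<integral>\<^sup>+ s. (\<integral>\<^sup>+ x. ennreal ((norm (f (s, x)))\<^sup>2) \<partial>lborel) \<partial>lborel) \<noteq> \<infinity>"
    using f nn_integral_slices[of "\<lambda>q. ennreal ((norm (f q))\<^sup>2)"] by (simp add: L2_nn_iff)
  then have "AE s in lborel. (\<integral>\<^sup>+ x. ennreal ((norm (f (s, x)))\<^sup>2) \<partial>lborel) \<noteq> \<infinity>"
    by (intro nn_integral_PInf_AE) auto
  then show ?thesis
    by eventually_elim (simp add: L2_nn_iff less_top)
qed

lemma L2_norm_sq_slices:
  fixes f :: "'s::euclidean_space \<times> 'a::euclidean_space \<Rightarrow> complex"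
  assumes [measurable]: "f \<in> borel_measurable borel" and "\<And>s. (\<lambda>x. f (s, x)) \<in> L2"
  shows "(\<integral>\<^sup>+ q. ennreal ((norm (f q))\<^sup>2) \<partial>lborel) = (\<integral>\<^sup>+ s. ennreal ((L2_norm (\<lambda>x. f (s, x)))\<^sup>2) \<partial>lborel)"
  by (subst nn_integral_slices) (simp_all add: L2_norm_sq_nn assms(2))

lemma L2_norm_slices_measurable:
  fixes f :: "'s::euclidean_space \<times> 'a::euclidean_space \<Rightarrow> complex"
  assumes [measurable]: "f \<in> borel_measurable borel"
  shows "(\<lambda>s. L2_norm (\<lambda>x. f (s, x))) \<in> borel_measurable borel"
  unfolding L2_norm_def by measurable

text \<open>The slices \<open>Fs s\<close> carry no joint measurability of their own; it is inherited, along an almost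
  everywhere convergent subsequence, from the approximations \<open>F n\<close>.\<close>

lemma L2_slices_limit_measurable:
  fixes F :: "nat \<Rightarrow> 's::euclidean_space \<times> 'a::euclidean_space \<Rightarrow> complex"
  assumes F [measurable]: "\<And>n. F n \<in> borel_measurable borel"
    and FL: "\<And>n s. (\<lambda>x. F n (s, x)) \<in> L2" and FsL: "\<And>s. Fs s \<in> L2"
    and lim: "\<And>s. (\<lambda>n. L2_norm (\<lambda>x. F n (s, x) - Fs s x)) \<longlonglongrightarrow> 0"
    and bound: "\<And>n s. L2_norm (\<lambda>x. F n (s, x)) \<le> B s"
    and [measurable]: "B \<in> borel_measurable borel" and fin: "(\<integral>\<^sup>+ s. ennreal ((B s)\<^sup>2) \<partial>lborel) < \<infinity>"
  obtains Fm where "Fm \<in> borel_measurable borel" "AE s in lborel. AE x in lborel. Fm (s, x) = Fs s x"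
proof -
  have B: "0 \<le> B s" for s
    using order_trans[OF L2_norm_nonneg bound] .
  have F_L2: "F n \<in> L2" for n
  proof -
    have "(\<integral>\<^sup>+ q. ennreal ((norm (F n q))\<^sup>2) \<partial>lborel) = (\<integral>\<^sup>+ s. ennreal ((L2_norm (\<lambda>x. F n (s, x)))\<^sup>2) \<partial>lborel)"
      by (rule L2_norm_sq_slices[OF F FL])
    also have "\<dots> \<le> (\<integral>\<^sup>+ s. ennreal ((B s)\<^sup>2) \<partial>lborel)"
      by (intro nn_integral_mono ennreal_leI power_mono bound) simp
    finally show ?thesis
      using fin by (simp add: L2_nn_iff)
  qed
  have Cauchy: "\<exists>N. \<forall>m\<ge>N. \<forall>n\<ge>N. L2_norm (\<lambda>q. F m q - F n q) < e" if e: "e > 0" for e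
  proof (rule ccontr)
    assume "\<not> ?thesis"
    then have "\<forall>N. \<exists>m n. m \<ge> N \<and> n \<ge> N \<and> e \<le> L2_norm (\<lambda>q. F m q - F n q)"
      by (metis not_le)
    \<comment> \<open>Dominated convergence is about sequences, whereas the Cauchy condition has two
      indices. A counterexample provides two index sequences tending to infinity, along which the
      slice distances are dominated by \<open>2 * B s\<close>.\<close>
    then obtain a b where ab: "\<And>N. a N \<ge> N" "\<And>N. b N \<ge> N" "\<And>N. e \<le> L2_norm (\<lambda>q. F (a N) q - F (b N) q)"
      by metis
    have ab_top: "filterlim a at_top sequentially" "filterlim b at_top sequentially"
      using ab by (auto intro!: filterlim_at_top_mono[OF filterlim_ident])
    have dL: "(\<lambda>x. F m (s, x) - F n (s, x)) \<in> L2" for m n s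
      by (intro L2_diff FL)
    have [measurable]: "(\<lambda>s. L2_norm (\<lambda>x. F m (s, x) - F n (s, x))) \<in> borel_measurable borel" for m n
      by (rule L2_norm_slices_measurable[of "\<lambda>q. F m q - F n q"]) measurable
    have "(\<lambda>N. \<integral>\<^sup>+ s. ennreal ((L2_norm (\<lambda>x. F (a N) (s, x) - F (b N) (s, x)))\<^sup>2) \<partial>lborel)
        \<longlonglongrightarrow> (\<integral>\<^sup>+ s. 0 \<partial>(lborel :: 's measure))"
    proof (rule nn_integral_dominated_convergence[where w = "\<lambda>s. ennreal (4 * (B s)\<^sup>2)"])
      show "AE s in lborel. ennreal ((L2_norm (\<lambda>x. F (a N) (s, x) - F (b N) (s, x)))\<^sup>2) \<le> ennreal (4 * (B s)\<^sup>2)" for N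
      proof (intro AE_I2 ennreal_leI)
        fix s
        have "L2_norm (\<lambda>x. F (a N) (s, x) - F (b N) (s, x)) \<le> 2 * B s"
          using L2_norm_triangle_diff[OF FL FL, of "a N" s "b N" s] bound[of "a N" s] bound[of "b N" s] by linarith
        then have "(L2_norm (\<lambda>x. F (a N) (s, x) - F (b N) (s, x)))\<^sup>2 \<le> (2 * B s)\<^sup>2"
          by (intro power_mono) auto
        then show "(L2_norm (\<lambda>x. F (a N) (s, x) - F (b N) (s, x)))\<^sup>2 \<le> 4 * (B s)\<^sup>2"
          by (simp add: power_mult_distrib)
      qed
      have "(\<integral>\<^sup>+ s. ennreal (4 * (B s)\<^sup>2) \<partial>lborel) = ennreal 4 * (\<integral>\<^sup>+ s. ennreal ((B s)\<^sup>2) \<partial>lborel)"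
        by (subst nn_integral_cmult[symmetric]) (auto simp: ennreal_mult simp del: ennreal_numeral)
      also have "\<dots> < \<infinity>"
        using fin by (simp add: ennreal_mult_less_top del: ennreal_numeral)
      finally show "(\<integral>\<^sup>+ s. ennreal (4 * (B s)\<^sup>2) \<partial>lborel) < \<infinity>" .
      show "AE s in lborel. (\<lambda>N. ennreal ((L2_norm (\<lambda>x. F (a N) (s, x) - F (b N) (s, x)))\<^sup>2)) \<longlonglongrightarrow> 0"
      proof (rule AE_I2)
        fix s
        have "(\<lambda>N. L2_norm (\<lambda>x. F (a N) (s, x) - Fs s x) + L2_norm (\<lambda>x. F (b N) (s, x) - Fs s x)) \<longlonglongrightarrow> 0 + 0"
          by (intro tendsto_add filterlim_compose[OF lim] ab_top)
        then have l: "(\<lambda>N. L2_norm (\<lambda>x. F (a N) (s, x) - Fs s x) + L2_norm (\<lambda>x. F (b N) (s, x) - Fs s x)) \<longlonglongrightarrow> 0"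
          by simp
        have "L2_norm (\<lambda>x. F (a N) (s, x) - F (b N) (s, x))
            \<le> L2_norm (\<lambda>x. F (a N) (s, x) - Fs s x) + L2_norm (\<lambda>x. F (b N) (s, x) - Fs s x)" for N
          using L2_norm_triangle3[OF FL[of "a N" s] FsL[of s] FL[of "b N" s]]
            L2_norm_minus_commute[of "Fs s" "\<lambda>x. F (b N) (s, x)"] by simp
        then have "(\<lambda>N. L2_norm (\<lambda>x. F (a N) (s, x) - F (b N) (s, x))) \<longlonglongrightarrow> 0"
          by (intro Lim_null_comparison[OF always_eventually l]) simp
        from tendsto_ennrealI[OF tendsto_power[OF this, of 2]]
        show "(\<lambda>N. ennreal ((L2_norm (\<lambda>x. F (a N) (s, x) - F (b N) (s, x)))\<^sup>2)) \<longlonglongrightarrow> 0"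
          by simp
      qed
    qed measurable
    moreover have "(\<integral>\<^sup>+ s. ennreal ((L2_norm (\<lambda>x. F (a N) (s, x) - F (b N) (s, x)))\<^sup>2) \<partial>lborel)
        = ennreal ((L2_norm (\<lambda>q. F (a N) q - F (b N) q))\<^sup>2)" for N
      using L2_norm_sq_slices[of "\<lambda>q. F (a N) q - F (b N) q"] dL F_L2
      by (subst L2_norm_sq_nn) (auto simp: L2_diff)
    ultimately have "(\<lambda>N. ennreal ((L2_norm (\<lambda>q. F (a N) q - F (b N) q))\<^sup>2)) \<longlonglongrightarrow> 0"
      by simp
    then have "eventually (\<lambda>N. ennreal ((L2_norm (\<lambda>q. F (a N) q - F (b N) q))\<^sup>2) < ennreal (e\<^sup>2)) sequentially"
      using e by (intro order_tendstoD(2)) auto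
    then obtain N where "(L2_norm (\<lambda>q. F (a N) q - F (b N) q))\<^sup>2 < e\<^sup>2"
      by (auto simp: eventually_sequentially ennreal_less_iff)
    moreover have "e\<^sup>2 \<le> (L2_norm (\<lambda>q. F (a N) q - F (b N) q))\<^sup>2"
      using ab(3) e by (intro power_mono) auto
    ultimately show False
      by simp
  qed
  obtain r where r: "strict_mono r" and conv: "AE q in lborel. convergent (\<lambda>k. F (r k) q)"
    using L2_Cauchy_AE_subseq[OF F_L2 Cauchy] by blast
  define Fm where "Fm q = lim (\<lambda>k. F (r k) q)" for q
  have Fm [measurable]: "Fm \<in> borel_measurable borel"
    unfolding Fm_def by measurable
  have "AE s in lborel. AE x in lborel. convergent (\<lambda>k. F (r k) (s, x))"
    by (rule AE_slices[OF conv])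
  then have "AE s in lborel. AE x in lborel. Fm (s, x) = Fs s x"
  proof eventually_elim
    case (elim s)
    have [measurable]: "Fs s \<in> borel_measurable borel"
      using FsL[of s] by measurable
    have al: "AE x in lborel. (\<lambda>k. F (r k) (s, x) - Fs s x) \<longlonglongrightarrow> Fm (s, x) - Fs s x"
      using elim by eventually_elim (auto simp: Fm_def convergent_LIMSEQ_iff intro!: tendsto_diff)
    have rl: "(\<lambda>k. L2_norm (\<lambda>x. F (r k) (s, x) - Fs s x)) \<longlonglongrightarrow> 0"
      by (rule filterlim_compose[OF lim filterlim_subseq[OF r]])
    \<comment> \<open>Along the subsequence the slices converge to \<open>Fm (s, _)\<close> almost
      everywhere and to \<open>Fs s\<close> in norm; Fatou's lemma bounds the distance of the two
      limits by every positive e.\<close>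
    have *: "(\<lambda>x. Fm (s, x) - Fs s x) \<in> L2 \<and> L2_norm (\<lambda>x. Fm (s, x) - Fs s x) \<le> e" if "e > 0" for e
    proof -
      have "eventually (\<lambda>k. L2_norm (\<lambda>x. F (r k) (s, x) - Fs s x) < e) sequentially"
        using order_tendstoD(2)[OF rl that] .
      then have ev: "eventually (\<lambda>k. L2_norm (\<lambda>x. F (r k) (s, x) - Fs s x) \<le> e) sequentially"
        by eventually_elim simp
      show ?thesis
        using L2_norm_le_of_AE_limit[of "\<lambda>k x. F (r k) (s, x) - Fs s x" "\<lambda>x. Fm (s, x) - Fs s x" e]
          L2_diff[OF FL FsL] al ev by simp
    qed
    have "L2_norm (\<lambda>x. Fm (s, x) - Fs s x) \<le> 0"
    proof (rule field_le_epsilon)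
      show "L2_norm (\<lambda>x. Fm (s, x) - Fs s x) \<le> 0 + e" if "e > 0" for e
        using *[OF that] by linarith
    qed
    then have "L2_norm (\<lambda>x. Fm (s, x) - Fs s x) = 0"
      using L2_norm_nonneg[of "\<lambda>x. Fm (s, x) - Fs s x"] by linarith
    from AE_zero_if_L2_norm_zero[OF conjunct1[OF *[OF zero_less_one]] this]
    show ?case
      by simp
  qed
  with Fm show ?thesis
    by (rule that)
qed

section \<open>The heat flow of a time-dependent function\<close>

text \<open>Linearity in the base vector at the level of weak integrals. It lets contractivity act
  on the difference \<open>u(t - \<tau>) - u(t)\<close>.\<close>

lemma (in identity_resolution) weak_int_base_diff:
  assumes "weak_int w g h" "weak_int w g' h'" "integrable lborel w" "g \<in> L2" "g' \<in> L2"
  shows "weak_int w (\<lambda>x. g x - g' x) (\<lambda>x. h x - h' x)"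
  unfolding weak_int_def
proof (intro conjI ballI)
  show "(\<lambda>x. h x - h' x) \<in> L2"
    using assms by (auto dest: weak_int_L2)
  fix k :: "'a \<Rightarrow> complex"
  assume k: "k \<in> L2"
  have "L2_inner (E l (\<lambda>x. g x - g' x)) k = L2_inner (E l g) k - L2_inner (E l g') k" for l
    using E_inner_lincomb[OF assms(4,5) k, of l 1 "-1"] by simp
  then show "L2_inner (\<lambda>x. h x - h' x) k
      = (LINT l|lborel. of_real (w l) * L2_inner (E l (\<lambda>x. g x - g' x)) k)"
    using assms k weak_integrand_integrable[OF assms(3,4) k] weak_integrand_integrable[OF assms(3,5) k]
    by (simp add: L2_inner_diff_left weak_int_L2 right_diff_distrib) (simp add: weak_int_def)
qed

text \<open>The extension by 0 to \<tau> \<le> 0 produces one function on the whole space, which can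
  be translated and integrated without regard to a domain.\<close>

definition heat_extension ::
  "(real ^ 'n \<Rightarrow> real ^ 'n \<Rightarrow> real \<Rightarrow> real) \<Rightarrow> (real \<times> (real ^ 'n) \<Rightarrow> complex) \<Rightarrow> real \<times> real \<times> (real ^ 'n) \<Rightarrow> complex"
  where "heat_extension p u = (\<lambda>(t, \<tau>, x). if 0 < \<tau> then LINT z|lborel. of_real (p x z \<tau>) * u (t - \<tau>, z) else 0)"

text \<open>p is continuous only for \<tau> > 0. Multiplied by the indicator of this open set it
  becomes jointly Borel, and then so is the integral over z as a function of the remaining
  variables.\<close>

lemma heat_extension_measurable:
  fixes p :: "real ^ 'n \<Rightarrow> real ^ 'n \<Rightarrow> real \<Rightarrow> real"
  assumes p: "continuous_on {(x, z, \<tau>). 0 < \<tau>} (\<lambda>(x, z, \<tau>). p x z \<tau>)"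
    and [measurable]: "u \<in> borel_measurable borel"
  shows "heat_extension p u \<in> borel_measurable borel"
proof -
  let ?S = "{q :: (real ^ 'n) \<times> (real ^ 'n) \<times> real. 0 < snd (snd q)}"
  define P where "P q = indicator ?S q *\<^sub>R (\<lambda>(x, z, \<tau>). p x z \<tau>) q" for q
  have "continuous_on ?S (\<lambda>(x, z, \<tau>). p x z \<tau>)"
    by (rule continuous_on_subset[OF p]) auto
  moreover have "?S \<in> sets borel"
    by (intro borel_open open_Collect_less continuous_intros)
  ultimately have [measurable]: "P \<in> borel_measurable borel"
    unfolding P_def by (intro borel_measurable_continuous_on_indicator)
  have "(\<lambda>(q, z). of_real (P (snd (snd q), z, fst (snd q))) * u (fst q - fst (snd q), z))
      \<in> borel_measurable ((borel :: (real \<times> real \<times> (real ^ 'n)) measure) \<Otimes>\<^sub>M lborel)"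
    by measurable
  from lborel.borel_measurable_lebesgue_integral[OF this]
  have "(\<lambda>q. LINT z|lborel. of_real (P (snd (snd q), z, fst (snd q))) * u (fst q - fst (snd q), z))
      \<in> borel_measurable (borel :: (real \<times> real \<times> (real ^ 'n)) measure)"
    by simp
  moreover have "heat_extension p u
      = (\<lambda>q. LINT z|lborel. of_real (P (snd (snd q), z, fst (snd q))) * u (fst q - fst (snd q), z))"
    by (auto simp: heat_extension_def P_def fun_eq_iff)
  ultimately show ?thesis
    by simp
qed

text \<open>Every time slice of u is required to lie in L2, not almost every one, so that the
  semigroup acts on all slices without exceptional sets. A given u is brought into this form by
  changing it on a null set of times.\<close>

locale heat_flow = identity_resolution E
  for E :: "real \<Rightarrow> (real ^ 'n \<Rightarrow> complex) \<Rightarrow> (real ^ 'n \<Rightarrow> complex)" +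
  fixes \<sigma> :: "real ^ 'n \<Rightarrow> real ^ 'n ^ 'n"
    and p :: "real ^ 'n \<Rightarrow> real ^ 'n \<Rightarrow> real \<Rightarrow> real"
    and u :: "real \<times> (real ^ 'n) \<Rightarrow> complex"
  assumes admissible: "admissible \<sigma>"
    and generator: "\<And>f h. is_spectral_integral E of_real f h \<Longrightarrow> div_form_op \<sigma> f h"
    and kernel_continuous: "continuous_on {(x, z, \<tau>). 0 < \<tau>} (\<lambda>(x, z, \<tau>). p x z \<tau>)"
    and kernel_heat: "\<And>\<tau> g. 0 < \<tau> \<Longrightarrow> g \<in> L2 \<Longrightarrow>
      is_spectral_integral E (\<lambda>l. of_real (exp (- \<tau> * l))) g (\<lambda>x. LINT z|lborel. of_real (p x z \<tau>) * g z)"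
    and u_L2: "u \<in> L2"
    and u_slice: "\<And>t. (\<lambda>x. u (t, x)) \<in> L2"
begin

definition P :: "real \<Rightarrow> (real ^ 'n \<Rightarrow> complex) \<Rightarrow> real ^ 'n \<Rightarrow> complex" where
  "P \<tau> g x = (LINT z|lborel. of_real (p x z \<tau>) * g z)"

abbreviation ut :: "real \<Rightarrow> real ^ 'n \<Rightarrow> complex" where
  "ut t \<equiv> (\<lambda>x. u (t, x))"

abbreviation V :: "real \<times> real \<times> (real ^ 'n) \<Rightarrow> complex" where
  "V \<equiv> heat_extension p u"

lemma V_eq: "0 < \<tau> \<Longrightarrow> V (t, \<tau>, x) = P \<tau> (ut (t - \<tau>)) x"
  by (simp add: heat_extension_def P_def)

lemma V_eq_0: "\<tau> \<le> 0 \<Longrightarrow> V (t, \<tau>, x) = 0"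
  by (simp add: heat_extension_def)

lemma u_measurable [measurable]: "u \<in> borel_measurable borel"
  using u_L2 by measurable

lemma V_measurable [measurable]: "V \<in> borel_measurable borel"
  by (rule heat_extension_measurable[OF kernel_continuous u_measurable])

lemma P_heat: "0 < \<tau> \<Longrightarrow> g \<in> L2 \<Longrightarrow> weak_int (heat_weight \<tau>) g (P \<tau> g)"
  unfolding P_def[abs_def] by (intro weak_int_heat kernel_heat)

lemma P_L2: "0 < \<tau> \<Longrightarrow> g \<in> L2 \<Longrightarrow> P \<tau> g \<in> L2"
  by (rule weak_int_L2[OF P_heat])

lemma P_contraction: "0 < \<tau> \<Longrightarrow> g \<in> L2 \<Longrightarrow> L2_norm (P \<tau> g) \<le> L2_norm g"
  by (rule heat_contraction[OF P_heat])

lemma V_slice: "0 < \<tau> \<Longrightarrow> (\<lambda>x. V (t, \<tau>, x)) = P \<tau> (ut (t - \<tau>))"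
  by (simp add: V_eq fun_eq_iff)

lemma V_slice_L2: "(\<lambda>x. V (t, \<tau>, x)) \<in> L2"
proof (cases "0 < \<tau>")
  case True
  then show ?thesis
    by (simp only: V_slice P_L2 u_slice)
next
  case False
  then show ?thesis
    by (simp add: V_eq_0)
qed

lemma V_slice_norm: "L2_norm (\<lambda>x. V (t, \<tau>, x)) \<le> L2_norm (ut (t - \<tau>))"
proof (cases "0 < \<tau>")
  case True
  then show ?thesis
    by (simp only: V_slice P_contraction u_slice)
next
  case False
  then show ?thesis
    by (simp add: V_eq_0)
qed

text \<open>The divergence-form operator applied to \<open>P \<tau> g\<close>. The choice is made
  for each \<tau> and g by itself, so it carries no measurability in these parameters.\<close>

definition LP :: "real \<Rightarrow> (real ^ 'n \<Rightarrow> complex) \<Rightarrow> real ^ 'n \<Rightarrow> complex" where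
  "LP \<tau> g = (SOME h. weak_int (heat_weight' \<tau>) g h)"

lemma LP:
  assumes "0 < \<tau>" "g \<in> L2"
  shows "weak_int (heat_weight' \<tau>) g (LP \<tau> g)"
proof -
  obtain h where "weak_int (heat_weight' \<tau>) g h"
    using heat_generator_exists[of g "\<lambda>\<tau>. P \<tau> g", OF assms(2) P_heat[OF _ assms(2)] assms(1)] by blast
  then show ?thesis
    unfolding LP_def by (rule someI[of "weak_int (heat_weight' \<tau>) g"])
qed

lemma LP_L2: "0 < \<tau> \<Longrightarrow> g \<in> L2 \<Longrightarrow> LP \<tau> g \<in> L2"
  by (rule weak_int_L2[OF LP])

lemma P_gradient_exists:
  assumes "0 < \<tau>" "g \<in> L2"
  shows "\<exists>G :: real ^ 'n \<Rightarrow> complex ^ 'n.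
        (\<forall>i. (\<lambda>x. G x $ i) \<in> L2 \<and> weak_deriv UNIV (axis i 1) (P \<tau> g) (\<lambda>x. G x $ i)) \<and>
        (\<forall>\<phi>\<in>test_functions UNIV.
           (LINT x|lborel. (\<Sum>i\<in>UNIV. \<Sum>k\<in>UNIV.
              of_real (\<sigma> x $ i $ k) * G x $ k * of_real (dir_deriv \<phi> (axis i 1) x)))
           = (LINT x|lborel. LP \<tau> g x * of_real (\<phi> x)))"
proof -
  have "is_spectral_integral E of_real (P \<tau> g) (LP \<tau> g)"
    by (rule spectral_integral_generator[OF assms(2,1) P_heat[OF assms] LP[OF assms]])
  from generator[OF this] show ?thesis
    unfolding div_form_op_def by blast
qed

text \<open>A weak gradient of \<open>P \<tau> g\<close>, again chosen for each \<tau> and g by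
  itself; a version that is Borel in all variables is constructed in
  \<open>gradient_measurable\<close>.\<close>

definition DP :: "real \<Rightarrow> (real ^ 'n \<Rightarrow> complex) \<Rightarrow> real ^ 'n \<Rightarrow> complex ^ 'n" where
  "DP \<tau> g = (SOME G.
        (\<forall>i. (\<lambda>x. G x $ i) \<in> L2 \<and> weak_deriv UNIV (axis i 1) (P \<tau> g) (\<lambda>x. G x $ i)) \<and>
        (\<forall>\<phi>\<in>test_functions UNIV.
           (LINT x|lborel. (\<Sum>i\<in>UNIV. \<Sum>k\<in>UNIV.
              of_real (\<sigma> x $ i $ k) * G x $ k * of_real (dir_deriv \<phi> (axis i 1) x)))
           = (LINT x|lborel. LP \<tau> g x * of_real (\<phi> x))))"

lemma
  assumes "0 < \<tau>" "g \<in> L2"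
  shows DP_L2: "(\<lambda>x. DP \<tau> g x $ i) \<in> L2"
    and DP_weak: "weak_deriv UNIV (axis i 1) (P \<tau> g) (\<lambda>x. DP \<tau> g x $ i)"
    and DP_eq: "\<phi> \<in> test_functions UNIV \<Longrightarrow>
           (LINT x|lborel. (\<Sum>i\<in>UNIV. \<Sum>k\<in>UNIV.
              of_real (\<sigma> x $ i $ k) * DP \<tau> g x $ k * of_real (dir_deriv \<phi> (axis i 1) x)))
           = (LINT x|lborel. LP \<tau> g x * of_real (\<phi> x))"
  using someI_ex[OF P_gradient_exists[OF assms]] unfolding DP_def[symmetric] by blast+

definition c0 :: real where
  "c0 = (SOME c. 0 < c \<and>
    (\<forall>x \<xi>. c * (norm \<xi>)\<^sup>2 \<le> (\<Sum>i\<in>UNIV. \<Sum>k\<in>UNIV. \<sigma> x $ i $ k * \<xi> $ i * \<xi> $ k)))"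

lemma c0: "0 < c0" "c0 * (norm \<xi>)\<^sup>2 \<le> (\<Sum>i\<in>UNIV. \<Sum>k\<in>UNIV. \<sigma> x $ i $ k * \<xi> $ i * \<xi> $ k)"
proof -
  have "\<exists>c>0. \<forall>x \<xi>. c * (norm \<xi>)\<^sup>2 \<le> (\<Sum>i\<in>UNIV. \<Sum>k\<in>UNIV. \<sigma> x $ i $ k * \<xi> $ i * \<xi> $ k)"
    using admissible unfolding admissible_def by blast
  from someI_ex[OF this] show "0 < c0"
    "c0 * (norm \<xi>)\<^sup>2 \<le> (\<Sum>i\<in>UNIV. \<Sum>k\<in>UNIV. \<sigma> x $ i $ k * \<xi> $ i * \<xi> $ k)"
    unfolding c0_def[symmetric] by auto
qed

text \<open>The generator costs the factor \<open>6 / \<tau>\<close>, and ellipticity the division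
  by \<open>c0\<close>. The bound is not integrable in \<tau> near 0, so square integrability of the
  gradient is claimed on compact subsets of \<tau> > 0.\<close>

lemma DP_norm:
  assumes \<tau>: "0 < \<tau>" and g: "g \<in> L2"
  shows "(L2_norm (\<lambda>x. DP \<tau> g x $ i))\<^sup>2 \<le> 6 / c0 / \<tau> * (L2_norm g)\<^sup>2"
proof -
  have "c0 * (L2_norm (\<lambda>x. DP \<tau> g x $ i))\<^sup>2 \<le> c0 * (\<Sum>i\<in>UNIV. (L2_norm (\<lambda>x. DP \<tau> g x $ i))\<^sup>2)"
    using c0(1) by (intro mult_left_mono member_le_sum) auto
  also have "\<dots> \<le> L2_norm (LP \<tau> g) * L2_norm (P \<tau> g)"
    by (rule energy_estimate[OF admissible c0(2) P_L2[OF assms] LP_L2[OF assms] DP_L2[OF assms] DP_weak[OF assms] DP_eq[OF assms]])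
  also have "\<dots> \<le> (6 / \<tau> * L2_norm g) * L2_norm g"
    by (intro mult_mono P_contraction[OF assms]
        heat_generator_norm_le[of g "\<lambda>\<tau>. P \<tau> g", OF g P_heat[OF _ g] \<tau> LP[OF assms]]) (use \<tau> in auto)
  finally show ?thesis
    using c0(1) \<tau> by (simp add: field_simps power2_eq_square)
qed

lemma nn_integral_u: "(\<integral>\<^sup>+ t. ennreal ((L2_norm (ut t))\<^sup>2) \<partial>lborel) < \<infinity>"
  using L2_norm_sq_slices[of u] u_slice u_L2 by (simp add: L2_nn_iff)

lemma ut_norm_measurable [measurable]: "(\<lambda>t. L2_norm (ut t)) \<in> borel_measurable borel"
  by (rule L2_norm_slices_measurable) measurable

text \<open>On a compact subset of \<tau> > 0 the variable \<tau> lies in some \<open>[a, b]\<close>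
  with a > 0, which bounds the factor \<open>C + C / \<tau>\<close>; the shear then separates t -
  \<tau> from \<tau>. The shape of the factor covers both the flow and its gradient, singular at
  \<tau> = 0.\<close>

lemma local_L2:
  fixes f :: "real \<times> real \<times> (real ^ 'n) \<Rightarrow> complex"
  assumes [measurable]: "f \<in> borel_measurable borel"
    and slice: "AE s in lborel. 0 < snd s \<longrightarrow> (\<lambda>x. f (fst s, snd s, x)) \<in> L2 \<and>
      (L2_norm (\<lambda>x. f (fst s, snd s, x)))\<^sup>2 \<le> (C + C / snd s) * (L2_norm (ut (fst s - snd s)))\<^sup>2"
    and C: "0 \<le> C" and K: "compact K" "K \<subseteq> {q. 0 < fst (snd q)}"
  shows "(\<lambda>q. indicator K q * f q) \<in> L2"
proof (cases "K = {}")
  case False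
  have cont: "continuous_on K (\<lambda>q. fst (snd q))"
    by (intro continuous_intros)
  obtain qa where qa: "qa \<in> K" "\<And>q. q \<in> K \<Longrightarrow> fst (snd qa) \<le> fst (snd q)"
    using continuous_attains_inf[OF K(1) False cont] by blast
  obtain qb where qb: "qb \<in> K" "\<And>q. q \<in> K \<Longrightarrow> fst (snd q) \<le> fst (snd qb)"
    using continuous_attains_sup[OF K(1) False cont] by blast
  define a b where "a = fst (snd qa)" and "b = fst (snd qb)"
  have a: "0 < a"
    using qa(1) K(2) by (auto simp: a_def)
  have Kb: "K \<in> sets borel"
    using K(1) by (simp add: borel_compact)
  note [measurable] = Kb
  have "(\<integral>\<^sup>+ q. ennreal ((norm (indicator K q * f q))\<^sup>2) \<partial>lborel)
      = (\<integral>\<^sup>+ s. (\<integral>\<^sup>+ x. ennreal ((norm (indicator K (fst s, snd s, x) * f (fst s, snd s, x)))\<^sup>2) \<partial>lborel) \<partial>lborel)"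
    by (rule nn_integral_triple) measurable
  also have "\<dots> \<le> (\<integral>\<^sup>+ s. ennreal ((L2_norm (ut (fst s - snd s)))\<^sup>2) * (ennreal (C + C / a) * indicator {a..b} (snd s)) \<partial>lborel)"
  proof (rule nn_integral_mono_AE)
    show "AE s in lborel. (\<integral>\<^sup>+ x. ennreal ((norm (indicator K (fst s, snd s, x) * f (fst s, snd s, x)))\<^sup>2) \<partial>lborel)
       \<le> ennreal ((L2_norm (ut (fst s - snd s)))\<^sup>2) * (ennreal (C + C / a) * indicator {a..b} (snd s))"
      using slice
    proof eventually_elim
      case (elim s)
      show ?case
      proof (cases "snd s \<in> {a..b}")
        case True
        then have s: "0 < snd s"
          using a by auto
        have "(\<integral>\<^sup>+ x. ennreal ((norm (indicator K (fst s, snd s, x) * f (fst s, snd s, x)))\<^sup>2) \<partial>lborel)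
            \<le> (\<integral>\<^sup>+ x. ennreal ((norm (f (fst s, snd s, x)))\<^sup>2) \<partial>lborel)"
          by (intro nn_integral_mono ennreal_leI) (auto simp: indicator_def)
        also have "\<dots> = ennreal ((L2_norm (\<lambda>x. f (fst s, snd s, x)))\<^sup>2)"
          using elim s by (simp add: L2_norm_sq_nn)
        also have "\<dots> \<le> ennreal ((C + C / snd s) * (L2_norm (ut (fst s - snd s)))\<^sup>2)"
          using elim s by (intro ennreal_leI) simp
        also have "\<dots> \<le> ennreal ((L2_norm (ut (fst s - snd s)))\<^sup>2 * (C + C / a))"
        proof (intro ennreal_leI)
          have "C / snd s \<le> C / a"
            using True a C by (intro divide_left_mono) auto
          then have "(C + C / snd s) * (L2_norm (ut (fst s - snd s)))\<^sup>2 \<le> (C + C / a) * (L2_norm (ut (fst s - snd s)))\<^sup>2"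
            by (intro mult_right_mono) auto
          then show "(C + C / snd s) * (L2_norm (ut (fst s - snd s)))\<^sup>2 \<le> (L2_norm (ut (fst s - snd s)))\<^sup>2 * (C + C / a)"
            by (simp add: mult.commute)
        qed
        finally show ?thesis
          using True a C by (simp add: ennreal_mult)
      next
        case False
        then have "(fst s, snd s, x) \<notin> K" for x
          using qa(2)[of "(fst s, snd s, x)"] qb(2)[of "(fst s, snd s, x)"] by (auto simp: a_def b_def)
        then show ?thesis
          by simp
      qed
    qed
  qed
  also have "\<dots> = (\<integral>\<^sup>+ t. ennreal ((L2_norm (ut t))\<^sup>2) \<partial>lborel) * (\<integral>\<^sup>+ \<tau>. ennreal (C + C / a) * indicator {a..b} \<tau> \<partial>lborel)"
    by (rule nn_integral_shear) measurable
  also have "\<dots> < \<infinity>"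
    using nn_integral_u by (simp add: nn_integral_cmult_indicator ennreal_mult_less_top emeasure_lborel_Icc_eq)
  finally show ?thesis
    by (simp add: L2_nn_iff)
qed simp

lemma V_local_L2:
  assumes "compact K" "K \<subseteq> {q. 0 < fst (snd q)}"
  shows "(\<lambda>q. indicator K q * V q) \<in> L2"
proof (rule local_L2[OF V_measurable _ _ assms, where C = 1])
  show "AE s in lborel. 0 < snd s \<longrightarrow> (\<lambda>x. V (fst s, snd s, x)) \<in> L2 \<and>
      (L2_norm (\<lambda>x. V (fst s, snd s, x)))\<^sup>2 \<le> (1 + 1 / snd s) * (L2_norm (ut (fst s - snd s)))\<^sup>2"
  proof (intro AE_I2 impI conjI V_slice_L2)
    fix s :: "real \<times> real"
    assume s: "0 < snd s"
    have "(L2_norm (\<lambda>x. V (fst s, snd s, x)))\<^sup>2 \<le> (L2_norm (ut (fst s - snd s)))\<^sup>2"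
      by (intro power_mono V_slice_norm) simp
    also have "\<dots> \<le> (1 + 1 / snd s) * (L2_norm (ut (fst s - snd s)))\<^sup>2"
      using s by (simp add: distrib_right)
    finally show "(L2_norm (\<lambda>x. V (fst s, snd s, x)))\<^sup>2 \<le> (1 + 1 / snd s) * (L2_norm (ut (fst s - snd s)))\<^sup>2" .
  qed
qed simp

text \<open>The mollification of \<open>DP\<close> in x equals the convolution of V with a
  derivative of the mollifier, and this is Borel in all variables because V is. On every slice the
  mollifications converge to \<open>DP\<close> in L2, and the limit taken in all variables is the
  Borel version.\<close>

lemma gradient_measurable:
  obtains G where "G \<in> borel_measurable borel"
    "AE s in lborel. 0 < snd s \<longrightarrow> (AE x in lborel. G (fst s, snd s, x) = DP (snd s) (ut (fst s - snd s)) x $ i)"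
proof -
  obtain \<eta> :: "nat \<Rightarrow> real ^ 'n \<Rightarrow> real" where \<eta>: "mollifiers \<eta>"
    using mollifiers_exist by blast
  then have \<eta>t: "\<eta> n \<in> test_functions UNIV" for n
    by (simp add: mollifiers_def)
  \<comment> \<open>The factor \<open>sqrt \<tau>\<close> cancels the singularity of the gradient
    bound at \<tau> = 0 and \<open>exp (- \<tau>)\<close> provides integrability at infinity, so the
    weighted gradient is square integrable in all variables. Being positive for \<tau> > 0, the
    weight is divided out at the end.\<close>
  define w :: "real \<Rightarrow> real" where "w \<tau> = (if 0 < \<tau> then sqrt \<tau> * exp (- \<tau>) else 0)" for \<tau>
  have [measurable]: "w \<in> borel_measurable borel"
    unfolding w_def by measurable
  have w_nonneg: "0 \<le> w \<tau>" for \<tau>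
    by (simp add: w_def)
  define F where "F n q = of_real (w (snd (fst q))) * conv (\<lambda>x. V (fst (fst q), snd (fst q), x)) (dir_deriv (\<eta> n) (axis i 1)) (snd q)"
    for n and q :: "(real \<times> real) \<times> (real ^ 'n)"
  define D where "D s = (if 0 < snd s then (\<lambda>x. DP (snd s) (ut (fst s - snd s)) x $ i) else (\<lambda>x. 0))"
    for s :: "real \<times> real"
  define Fs where "Fs s x = of_real (w (snd s)) * D s x" for s x
  \<comment> \<open>A mollification is within twice the norm of \<open>D s\<close> of
    \<open>D s\<close> itself, whence the 3; the root comes from \<open>DP_norm\<close>.\<close>
  define B where "B s = 3 * sqrt (6 / c0) * (exp (- snd s) * indicator {0<..} (snd s) * L2_norm (ut (fst s - snd s)))"
    for s :: "real \<times> real"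
  have D_L2: "D s \<in> L2" for s
    using DP_L2[OF _ u_slice] by (auto simp: D_def)
  have F_eq: "F n (s, x) = of_real (w (snd s)) * conv (D s) (\<eta> n) x" for n s x
  proof (cases "0 < snd s")
    case True
    then have "F n (s, x) = of_real (w (snd s)) * conv (P (snd s) (ut (fst s - snd s))) (dir_deriv (\<eta> n) (axis i 1)) x"
      by (simp add: F_def V_slice)
    then show ?thesis
      using True by (simp add: D_def conv_weak_deriv[OF DP_weak[OF True u_slice] \<eta>t])
  next
    case False
    then show ?thesis
      by (simp add: F_def w_def)
  qed
  obtain Fm where Fm [measurable]: "Fm \<in> borel_measurable borel"
    and Fm_eq: "AE s in lborel. AE x in lborel. Fm (s, x) = Fs s x"
  proof (rule L2_slices_limit_measurable[of F Fs B])
    fix n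
    have [measurable]: "dir_deriv (\<eta> n) (axis i 1) \<in> borel_measurable borel"
      by (rule test_function_measurable[OF dir_deriv_test_function[OF \<eta>t]])
    have "(\<lambda>(q, y). V (fst (fst q), snd (fst q), y) * of_real (dir_deriv (\<eta> n) (axis i 1) (snd q - y)))
      \<in> borel_measurable ((borel :: ((real \<times> real) \<times> (real ^ 'n)) measure) \<Otimes>\<^sub>M lborel)"
      by measurable
    from lborel.borel_measurable_lebesgue_integral[OF this]
    show "F n \<in> borel_measurable borel"
      unfolding F_def[abs_def] conv_def by measurable
    show "(\<lambda>x. F n (s, x)) \<in> L2" for s
      unfolding F_eq by (intro L2_scale conv_mollifiers_L2 D_L2 \<eta>)
    show "Fs s \<in> L2" for s
      unfolding Fs_def[abs_def] by (intro L2_scale D_L2)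
    show "L2_norm (\<lambda>x. F n (s, x)) \<le> B s" for s
    proof -
      have "L2_norm (\<lambda>x. conv (D s) (\<eta> n) x - D s x) \<le> 2 * L2_norm (D s)"
      proof (rule conv_L2_bound(2)[OF D_L2])
        show "L2_norm (\<lambda>x. D s (x - z) - D s x) \<le> 2 * L2_norm (D s)" for z
          using L2_norm_triangle_diff[of "\<lambda>x. D s (x - z)" "D s"] L2_shift[OF D_L2, of s z] D_L2[of s] by simp
      qed (use \<eta> in \<open>auto simp: mollifiers_def\<close>)
      then have "L2_norm (conv (D s) (\<eta> n)) \<le> 3 * L2_norm (D s)"
        using L2_norm_triangle[of "\<lambda>x. conv (D s) (\<eta> n) x - D s x" "D s"]
          conv_mollifiers_L2[OF D_L2 \<eta>, of s n] D_L2[of s] by (simp add: L2_diff)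
      moreover have "w (snd s) * L2_norm (D s) \<le> sqrt (6 / c0) * (exp (- snd s) * indicator {0<..} (snd s) * L2_norm (ut (fst s - snd s)))"
      proof (cases "0 < snd s")
        case True
        have "L2_norm (D s) \<le> sqrt (6 / c0 / snd s * (L2_norm (ut (fst s - snd s)))\<^sup>2)"
          using DP_norm[OF True u_slice, of "fst s - snd s" i] True by (simp add: D_def real_le_rsqrt)
        then have "w (snd s) * L2_norm (D s) \<le> w (snd s) * sqrt (6 / c0 / snd s * (L2_norm (ut (fst s - snd s)))\<^sup>2)"
          by (intro mult_left_mono w_nonneg)
        also have "\<dots> = sqrt (6 / c0) * (exp (- snd s) * L2_norm (ut (fst s - snd s)))"
          using True c0(1) by (simp add: w_def real_sqrt_mult real_sqrt_divide)
        finally show ?thesis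
          using True by simp
      next
        case False
        then show ?thesis
          by (simp add: w_def)
      qed
      ultimately have "w (snd s) * L2_norm (conv (D s) (\<eta> n)) \<le> B s"
        using mult_left_mono[of "L2_norm (conv (D s) (\<eta> n))" "3 * L2_norm (D s)" "w (snd s)"] w_nonneg[of "snd s"]
        by (simp add: B_def)
      then show ?thesis
        unfolding F_eq using w_nonneg[of "snd s"] by (simp add: L2_norm_scale)
    qed
  next
    show "(\<lambda>n. L2_norm (\<lambda>x. F n (s, x) - Fs s x)) \<longlonglongrightarrow> 0" for s
    proof -
      have "(\<lambda>n. norm (complex_of_real (w (snd s))) * L2_norm (\<lambda>x. conv (D s) (\<eta> n) x - D s x))
          \<longlonglongrightarrow> norm (complex_of_real (w (snd s))) * 0"
        by (intro tendsto_mult tendsto_const conv_mollifiers_tendsto D_L2 \<eta>)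
      then show ?thesis
        unfolding F_eq Fs_def by (simp only: right_diff_distrib[symmetric] L2_norm_scale mult_zero_right)
    qed
    show "B \<in> borel_measurable borel"
      unfolding B_def[abs_def] by measurable
    have "(\<integral>\<^sup>+ s. ennreal ((B s)\<^sup>2) \<partial>lborel)
        \<le> (\<integral>\<^sup>+ s. ennreal ((L2_norm (ut (fst s - snd s)))\<^sup>2) * (ennreal (9 * (6 / c0)) * (ennreal (exp (- snd s)) * indicator {0..} (snd s))) \<partial>lborel)"
    proof (rule nn_integral_mono)
      fix s :: "real \<times> real"
      show "ennreal ((B s)\<^sup>2) \<le> ennreal ((L2_norm (ut (fst s - snd s)))\<^sup>2) * (ennreal (9 * (6 / c0)) * (ennreal (exp (- snd s)) * indicator {0..} (snd s)))"
      proof (cases "0 < snd s")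
        case True
        have "exp (- snd s) * exp (- snd s) \<le> exp (- snd s) * 1"
          using True by (intro mult_left_mono) auto
        then have "(exp (- snd s))\<^sup>2 \<le> exp (- snd s)"
          by (simp add: power2_eq_square)
        then have "(B s)\<^sup>2 \<le> (L2_norm (ut (fst s - snd s)))\<^sup>2 * (9 * (6 / c0) * exp (- snd s))"
          using True c0(1) mult_left_mono[of "(exp (- snd s))\<^sup>2" "exp (- snd s)" "9 * (6 / c0) * (L2_norm (ut (fst s - snd s)))\<^sup>2"]
          by (simp add: B_def power_mult_distrib mult_ac)
        then have "ennreal ((B s)\<^sup>2) \<le> ennreal ((L2_norm (ut (fst s - snd s)))\<^sup>2 * (9 * (6 / c0) * exp (- snd s)))"
          by (rule ennreal_leI)
        also have "\<dots> = ennreal ((L2_norm (ut (fst s - snd s)))\<^sup>2) * (ennreal (9 * (6 / c0)) * ennreal (exp (- snd s)))"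
        proof -
          have "0 \<le> 9 * (6 / c0)"
            using c0(1) by simp
          then show ?thesis
            by (simp only: ennreal_mult'[OF zero_le_power2] ennreal_mult'[of "9 * (6 / c0)"])
        qed
        finally show ?thesis
          using True by simp
      qed (simp add: B_def)
    qed
    also have "\<dots> = (\<integral>\<^sup>+ t. ennreal ((L2_norm (ut t))\<^sup>2) \<partial>lborel)
        * (\<integral>\<^sup>+ \<tau>. ennreal (9 * (6 / c0)) * (ennreal (exp (- \<tau>)) * indicator {0..} \<tau>) \<partial>lborel)"
      by (rule nn_integral_shear) measurable
    also have "(\<integral>\<^sup>+ \<tau>. ennreal (9 * (6 / c0)) * (ennreal (exp (- \<tau>)) * indicator {0..} \<tau>) \<partial>lborel) = ennreal (9 * (6 / c0))"
      using nn_intergal_power_times_exp_Ici[of 0] by (subst nn_integral_cmult) auto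
    also have "(\<integral>\<^sup>+ t. ennreal ((L2_norm (ut t))\<^sup>2) \<partial>lborel) * ennreal (9 * (6 / c0)) < \<infinity>"
      using nn_integral_u by (simp add: ennreal_mult_less_top)
    finally show "(\<integral>\<^sup>+ s. ennreal ((B s)\<^sup>2) \<partial>lborel) < \<infinity>" .
  qed (rule that)
  define G where "G q = Fm ((fst q, fst (snd q)), snd (snd q)) / of_real (w (fst (snd q)))" for q
  show ?thesis
  proof (rule that)
    show "G \<in> borel_measurable borel"
      unfolding G_def[abs_def] by measurable
    show "AE s in lborel. 0 < snd s \<longrightarrow> (AE x in lborel. G (fst s, snd s, x) = DP (snd s) (ut (fst s - snd s)) x $ i)"
      using Fm_eq
    proof eventually_elim
      case (elim s)
      show ?case
      proof
        assume s: "0 < snd s"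
        show "AE x in lborel. G (fst s, snd s, x) = DP (snd s) (ut (fst s - snd s)) x $ i"
          using elim
        proof eventually_elim
          case (elim x)
          then show ?case
            using s by (simp add: G_def Fs_def D_def w_def)
        qed
      qed
    qed
  qed
qed

end

section \<open>Slices of test functions\<close>

lemma test_function_slice:
  fixes \<phi> :: "real \<times> real \<times> 'a::euclidean_space \<Rightarrow> real"
  assumes \<phi>: "\<phi> \<in> test_functions D"
  shows "(\<lambda>x. \<phi> (t, \<tau>, x)) \<in> test_functions UNIV"
    and "dir_deriv (\<lambda>x. \<phi> (t, \<tau>, x)) v x = dir_deriv \<phi> (0, 0, v) (t, \<tau>, x)"
proof -
  have L: "bounded_linear (\<lambda>x::'a. (0::real, 0::real, x))"
    by (intro bounded_linear_Pair bounded_linear_zero bounded_linear_ident)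
  obtain K where K: "compact K" "\<And>q. q \<notin> K \<Longrightarrow> \<phi> q = 0"
    using test_function_support[OF \<phi>] by metis
  show "(\<lambda>x. \<phi> (t, \<tau>, x)) \<in> test_functions UNIV"
  proof (rule test_functionsI)
    show "Ck k (\<lambda>x. \<phi> (t, \<tau>, x))" for k
      using Ck_affine[OF L test_function_Ck[OF \<phi>], of k "(t, \<tau>, 0)"] by simp
    show "compact ((\<lambda>q. snd (snd q)) ` K)"
      by (intro compact_continuous_image continuous_intros K)
    show "x \<in> (\<lambda>q. snd (snd q)) ` K" if "\<phi> (t, \<tau>, x) \<noteq> 0" for x
    proof (rule image_eqI)
      show "(t, \<tau>, x) \<in> K"
        using K(2)[of "(t, \<tau>, x)"] that by argo
    qed simp
  qed simp
  show "dir_deriv (\<lambda>x. \<phi> (t, \<tau>, x)) v x = dir_deriv \<phi> (0, 0, v) (t, \<tau>, x)"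
    using dir_deriv_affine[OF L test_function_differentiable[OF \<phi>], of "(t, \<tau>, 0)" x v] by simp
qed

lemma integrable_lborel_shift:
  fixes F :: "'a::euclidean_space \<Rightarrow> complex"
  assumes "integrable lborel F"
  shows "integrable lborel (\<lambda>y. F (y - z))"
proof -
  have [measurable]: "F \<in> borel_measurable borel"
    using borel_measurable_integrable[OF assms] by simp
  have "integrable (distr lborel borel ((+) (- z))) F"
    using assms by (simp only: lborel_distr_plus)
  then have "integrable lborel (\<lambda>y. F (- z + y))"
    by (subst (asm) integrable_distr_eq) auto
  then show ?thesis
    by simp
qed

section \<open>Transport in the direction of constant t - \<tau>\<close>

context heat_flow
begin

abbreviation upper :: "(real \<times> real \<times> (real ^ 'n)) set" where
  "upper \<equiv> {q. 0 < fst (snd q)}"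

lemma test_function_vanishes:
  assumes \<phi>: "\<phi> \<in> test_functions upper" and "\<tau> \<le> 0"
  shows "\<phi> (t, \<tau>, x) = 0" "dir_deriv \<phi> v (t, \<tau>, x) = 0"
proof -
  obtain K where K: "K \<subseteq> upper" "\<And>q. q \<notin> K \<Longrightarrow> \<phi> q = 0" "\<And>q v. q \<notin> K \<Longrightarrow> dir_deriv \<phi> v q = 0"
    using test_function_support[OF \<phi>] by metis
  have "(t, \<tau>, x) \<notin> K"
    using K(1) assms(2) by auto
  then show "\<phi> (t, \<tau>, x) = 0" "dir_deriv \<phi> v (t, \<tau>, x) = 0"
    using K(2,3) by blast+
qed

lemma integrable_local_L2_test:
  fixes \<phi> :: "real \<times> real \<times> (real ^ 'n) \<Rightarrow> real"
  assumes f: "\<And>K. compact K \<Longrightarrow> K \<subseteq> upper \<Longrightarrow> (\<lambda>q. indicator K q * f q) \<in> L2"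
    and \<phi>: "\<phi> \<in> test_functions upper"
  shows "integrable lborel (\<lambda>q. f q * of_real (\<phi> q))"
proof -
  obtain K where K: "compact K" "K \<subseteq> upper" "\<And>q. q \<notin> K \<Longrightarrow> \<phi> q = 0"
    using test_function_support[OF \<phi>] by metis
  have "integrable lborel (\<lambda>q. (indicator K q * f q) * of_real (\<phi> q))"
    by (rule L2_integrable_prod[OF f[OF K(1,2)] test_function_of_real_L2[OF \<phi>]])
  moreover have "(\<lambda>q. (indicator K q * f q) * of_real (\<phi> q)) = (\<lambda>q. f q * of_real (\<phi> q))"
    using K(3) by (auto simp: indicator_def fun_eq_iff)
  ultimately show ?thesis
    by simp
qed

text \<open>Transport along \<open>(1, 1, 0)\<close> keeps \<open>t - \<tau>\<close> fixed, so it moves the heat flow of a single slice of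
  \<open>u\<close>; the difference quotients are moved from the test function to the flow.\<close>

lemma
  fixes \<phi> :: "real \<times> real \<times> (real ^ 'n) \<Rightarrow> real"
  assumes \<phi>: "\<phi> \<in> test_functions upper"
  shows weak_transport_measurable: "(\<lambda>s. if 0 < snd s
        then (LINT x|lborel. LP (snd s) (ut (fst s - snd s)) x * of_real (\<phi> (fst s, snd s, x))) else 0)
      \<in> borel_measurable lborel"
    and weak_transport: "(LINT q|lborel. V q * of_real (dir_deriv \<phi> (1, 1, 0) q))
    = (LINT s|lborel. (if 0 < snd s
        then (LINT x|lborel. LP (snd s) (ut (fst s - snd s)) x * of_real (\<phi> (fst s, snd s, x))) else 0))"
proof -
  define d :: "real \<times> real \<times> (real ^ 'n)" where "d = (1, 1, 0)"
  have \<phi>U: "\<phi> \<in> test_functions UNIV"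
    using \<phi> test_functions_mono[of upper UNIV] by auto
  have d_pos: "0 < norm d"
    by (simp add: d_def prod_eq_iff)
  obtain K where K: "compact K" "K \<subseteq> upper" "\<And>q. q \<notin> K \<Longrightarrow> \<phi> q = 0" "\<And>q v. q \<notin> K \<Longrightarrow> dir_deriv \<phi> v q = 0"
    using test_function_support[OF \<phi>] by metis
  obtain a where a: "0 < a" "\<And>q. q \<in> K \<Longrightarrow> a \<le> fst (snd q)"
  proof (cases "K = {}")
    case True
    then show ?thesis
      using that[of 1] by auto
  next
    case False
    have "continuous_on K (\<lambda>q. fst (snd q))"
      by (intro continuous_intros)
    then obtain q0 where "q0 \<in> K" "\<And>q. q \<in> K \<Longrightarrow> fst (snd q0) \<le> fst (snd q)"
      using continuous_attains_inf[OF K(1) False] by blast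
    then show ?thesis
      using that[of "fst (snd q0)"] K(2) by auto
  qed
  obtain R where R: "\<And>q. q \<in> K \<Longrightarrow> norm q \<le> R"
    using compact_imp_bounded[OF K(1)] by (auto simp: bounded_iff)
  obtain \<delta> where \<delta>: "0 < \<delta>"
    "\<And>q h. norm h < \<delta> \<Longrightarrow> \<bar>\<phi> (q + h) - \<phi> q - dir_deriv \<phi> h q\<bar> \<le> 1 * norm h"
    using test_function_linearization[OF \<phi>U zero_less_one] by metis
  obtain B where B: "0 < B" "\<And>q. norm (dir_deriv \<phi> d q) \<le> B"
    using test_function_bounded[OF dir_deriv_test_function[OF \<phi>]] by metis
  \<comment> \<open>Three demands on the step: at most \<open>a / 2\<close>, so that
    \<open>\<tau> - X n \<ge> \<tau> / 2\<close> on the support of \<phi>; at most 1, so that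
    supports move by at most \<open>norm d\<close>; and short enough for the linearization with
    \<delta>.\<close>
  define c where "c = min (min (a / 2) 1) (\<delta> / (2 * norm d))"
  define X where "X n = c / real (Suc n)" for n
  have c: "0 < c" "c \<le> a / 2" "c \<le> 1" "c * norm d < \<delta>"
  proof -
    show "0 < c" "c \<le> a / 2" "c \<le> 1"
      using a(1) \<delta>(1) d_pos by (auto simp: c_def)
    have "c * norm d \<le> \<delta> / (2 * norm d) * norm d"
      by (intro mult_right_mono) (auto simp: c_def)
    also have "\<dots> < \<delta>"
      using \<delta>(1) d_pos by simp
    finally show "c * norm d < \<delta>" .
  qed
  have X: "X \<longlonglongrightarrow> 0" "0 < X n" "X n \<le> c" for n
    unfolding X_def using c(1) by (real_asymp, auto simp: field_simps)
  have lin: "linear (frechet_derivative \<phi> (at q))" for q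
    by (rule linear_frechet_derivative[OF test_function_differentiable[OF \<phi>]])
  \<comment> \<open>Contains the supports of \<phi> and of all translates
    \<open>\<phi> (q + X n d)\<close>, and still keeps away from \<tau> = 0.\<close>
  define K' :: "(real \<times> real \<times> (real ^ 'n)) set" where "K' = cball 0 (R + norm d) \<inter> {q. a / 2 \<le> fst (snd q)}"
  have K': "compact K'" "K' \<subseteq> upper"
  proof -
    have "closed {q :: real \<times> real \<times> (real ^ 'n). a / 2 \<le> fst (snd q)}"
      by (intro closed_Collect_le continuous_intros)
    then show "compact K'"
      unfolding K'_def by (intro compact_Int_closed compact_cball)
    show "K' \<subseteq> upper"
      using a(1) by (auto simp: K'_def)
  qed
  have [measurable]: "\<phi> \<in> borel_measurable borel" "dir_deriv \<phi> v \<in> borel_measurable borel" for v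
    by (rule test_function_measurable[OF \<phi>], rule test_function_measurable[OF dir_deriv_test_function[OF \<phi>]])
  have [measurable]: "K' \<in> sets borel"
    using K'(1) by (simp add: borel_compact)
  have supp: "\<phi> q = 0" "\<phi> (q + X n *\<^sub>R d) = 0" if q: "q \<notin> K'" for q n
  proof -
    have "q \<notin> K"
    proof
      assume "q \<in> K"
      then have "norm q \<le> R + norm d" "a / 2 \<le> fst (snd q)"
        using R[of q] a(1) a(2)[of q] norm_ge_zero[of d] by linarith+
      then have "q \<in> K'"
        by (simp add: K'_def)
      then show False
        using q by simp
    qed
    then show "\<phi> q = 0"
      by (rule K(3))
    have "q + X n *\<^sub>R d \<notin> K"
    proof
      assume k: "q + X n *\<^sub>R d \<in> K"
      have "norm q \<le> norm (q + X n *\<^sub>R d) + norm (X n *\<^sub>R d)"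
        using norm_triangle_ineq4[of "q + X n *\<^sub>R d" "X n *\<^sub>R d"] by simp
      also have "norm (X n *\<^sub>R d) \<le> 1 * norm d"
        unfolding norm_scaleR using X(2,3)[of n] c(3) by (intro mult_right_mono) auto
      finally have "norm q \<le> R + norm d"
        using R[OF k] by simp
      moreover have "a / 2 \<le> fst (snd q)"
        using a(2)[OF k] X(3)[of n] c(2) by (simp add: d_def)
      ultimately have "q \<in> K'"
        by (simp add: K'_def)
      then show False
        using q by simp
    qed
    then show "\<phi> (q + X n *\<^sub>R d) = 0"
      by (rule K(3))
  qed
  define dq where "dq n q = (\<phi> (q + X n *\<^sub>R d) - \<phi> q) / X n" for n q
  have [measurable]: "dq n \<in> borel_measurable borel" for n
    unfolding dq_def by measurable
  have dq_close: "\<bar>dq n q - dir_deriv \<phi> d q\<bar> \<le> e * norm d"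
    if "\<bar>\<phi> (q + X n *\<^sub>R d) - \<phi> q - dir_deriv \<phi> (X n *\<^sub>R d) q\<bar> \<le> e * norm (X n *\<^sub>R d)" for n q e
  proof -
    have "dq n q - dir_deriv \<phi> d q = (\<phi> (q + X n *\<^sub>R d) - \<phi> q - dir_deriv \<phi> (X n *\<^sub>R d) q) / X n"
      using X(2)[of n] by (simp add: dq_def linear_cmul[OF lin] field_simps)
    then have "\<bar>dq n q - dir_deriv \<phi> d q\<bar> \<le> e * norm (X n *\<^sub>R d) / X n"
      using that X(2)[of n] by (simp add: abs_divide pos_divide_le_eq mult_ac)
    also have "\<dots> = e * norm d"
      using X(2)[of n] by simp
    finally show ?thesis .
  qed
  have dq_lim: "(\<lambda>n. dq n q) \<longlonglongrightarrow> dir_deriv \<phi> d q" for q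
  proof (rule LIMSEQ_I)
    fix e :: real
    assume e: "e > 0"
    define e' where "e' = e / (2 * norm d)"
    have e': "0 < e'" "e' * norm d < e"
      using e d_pos by (auto simp: e'_def)
    obtain \<delta>' where \<delta>': "0 < \<delta>'"
      "\<And>q h. norm h < \<delta>' \<Longrightarrow> \<bar>\<phi> (q + h) - \<phi> q - dir_deriv \<phi> h q\<bar> \<le> e' * norm h"
      using test_function_linearization[OF \<phi>U e'(1)] by metis
    have "(\<lambda>n. norm (X n *\<^sub>R d)) \<longlonglongrightarrow> norm (0 *\<^sub>R d)"
      by (intro tendsto_norm tendsto_scaleR X tendsto_const)
    then have "eventually (\<lambda>n. norm (X n *\<^sub>R d) < \<delta>') sequentially"
      using \<delta>'(1) by (intro order_tendstoD(2)) auto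
    then obtain N where "\<And>n. n \<ge> N \<Longrightarrow> norm (X n *\<^sub>R d) < \<delta>'"
      by (auto simp: eventually_sequentially)
    then have "norm (dq n q - dir_deriv \<phi> d q) < e" if "n \<ge> N" for n
      using dq_close[OF \<delta>'(2), of n q] that e'(2) by fastforce
    then show "\<exists>N. \<forall>n\<ge>N. norm (dq n q - dir_deriv \<phi> d q) < e"
      by blast
  qed
  have dq_bound: "\<bar>dq n q\<bar> \<le> (B + norm d) * indicator K' q" for n q
  proof (cases "q \<in> K'")
    case True
    have "norm (X n *\<^sub>R d) \<le> c * norm d"
      unfolding norm_scaleR using X(2,3)[of n] by (intro mult_right_mono) auto
    then have "norm (X n *\<^sub>R d) < \<delta>"
      using c(4) by linarith
    then have "\<bar>dq n q - dir_deriv \<phi> d q\<bar> \<le> 1 * norm d"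
      by (intro dq_close \<delta>(2))
    then have "\<bar>dq n q\<bar> \<le> B + norm d"
      using B(2)[of q] by simp
    then show ?thesis
      using True by simp
  next
    case False
    then show ?thesis
      by (simp add: dq_def supp)
  qed
  have VK': "integrable lborel (\<lambda>q. indicator K' q * V q)"
  proof -
    have "(\<lambda>q. indicator K' q :: complex) \<in> L2"
      using emeasure_compact_finite[OF K'(1)] by (intro L2_indicator) auto
    from L2_integrable_prod[OF V_local_L2[OF K'] this]
    have "integrable lborel (\<lambda>q. indicator K' q * V q * indicator K' q)" .
    moreover have "(\<lambda>q. indicator K' q * V q * indicator K' q) = (\<lambda>q. indicator K' q * V q)"
      by (auto simp: indicator_def fun_eq_iff)
    ultimately show ?thesis
      by simp
  qed
  have V_lim: "(\<lambda>n. LINT q|lborel. V q * of_real (dq n q)) \<longlonglongrightarrow> (LINT q|lborel. V q * of_real (dir_deriv \<phi> d q))"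
  proof (rule integral_dominated_convergence)
    show "integrable lborel (\<lambda>q. (B + norm d) * norm (indicator K' q * V q))"
      using VK' by (intro integrable_mult_right integrable_norm)
    show "AE q in lborel. (\<lambda>n. V q * of_real (dq n q)) \<longlonglongrightarrow> V q * of_real (dir_deriv \<phi> d q)"
      by (intro AE_I2 tendsto_mult tendsto_const tendsto_of_real dq_lim)
    show "AE q in lborel. norm (V q * of_real (dq n q)) \<le> (B + norm d) * norm (indicator K' q * V q)" for n
    proof (rule AE_I2)
      fix q
      show "norm (V q * of_real (dq n q)) \<le> (B + norm d) * norm (indicator K' q * V q)"
        using mult_left_mono[OF dq_bound[of n q] norm_ge_zero[of "V q"]]
        by (simp add: norm_mult mult_ac split: split_indicator_asm split_indicator)
    qed
  qed measurable
  have V\<phi>: "integrable lborel (\<lambda>q. V q * of_real (\<phi> q))"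
    by (rule integrable_local_L2_test[OF V_local_L2 \<phi>])
  \<comment> \<open>A translation by \<open>X n\<close> times d moves the quotient from \<phi> to V
    and reverses the step: a forward quotient of \<phi> becomes a backward quotient of V.\<close>
  define W where "W n q = (V (q - X n *\<^sub>R d) - V q) / of_real (X n) * of_real (\<phi> q)" for n q
  have shift: "integrable lborel (W n)" "(LINT q|lborel. V q * of_real (dq n q)) = (LINT q|lborel. W n q)" for n
  proof -
    have Vdq: "integrable lborel (\<lambda>q. V q * of_real (dq n q))"
    proof (rule Bochner_Integration.integrable_bound)
      show "integrable lborel (\<lambda>q. of_real (B + norm d) * (indicator K' q * V q))"
        using VK' by (rule integrable_mult_right)
      show "AE q in lborel. norm (V q * of_real (dq n q)) \<le> norm (of_real (B + norm d) * (indicator K' q * V q))"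
      proof (rule AE_I2)
        fix q
        show "norm (V q * of_real (dq n q)) \<le> norm (of_real (B + norm d) * (indicator K' q * V q))"
          using mult_left_mono[OF dq_bound[of n q] norm_ge_zero[of "V q"]] B(1) norm_ge_zero[of d]
          unfolding norm_mult norm_of_real
          by (simp add: mult_ac abs_of_nonneg del: norm_ge_zero split: split_indicator_asm split_indicator)
      qed
    qed measurable
    define F where "F q = V q * of_real (\<phi> (q + X n *\<^sub>R d))" for q
    have F_eq: "F = (\<lambda>q. of_real (X n) * (V q * of_real (dq n q)) + V q * of_real (\<phi> q))"
      using X(2)[of n] by (auto simp: F_def dq_def fun_eq_iff field_simps)
    have Fi: "integrable lborel F"
      unfolding F_eq using Vdq V\<phi> by (intro Bochner_Integration.integrable_add integrable_mult_right)
    have Fm: "F \<in> borel_measurable borel"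
      using borel_measurable_integrable[OF Fi] by simp
    have F_shift: "F (q - X n *\<^sub>R d) = V (q - X n *\<^sub>R d) * of_real (\<phi> q)" for q
      by (simp add: F_def)
    have Fsi: "integrable lborel (\<lambda>q. V (q - X n *\<^sub>R d) * of_real (\<phi> q))"
      using integrable_lborel_shift[OF Fi, of "X n *\<^sub>R d"] unfolding F_shift .
    have W_eq: "W n = (\<lambda>q. (V (q - X n *\<^sub>R d) * of_real (\<phi> q) - V q * of_real (\<phi> q)) / of_real (X n))"
      by (simp add: W_def fun_eq_iff left_diff_distrib diff_divide_distrib)
    show "integrable lborel (W n)"
      unfolding W_eq using Fsi V\<phi> by (intro integrable_divide_zero Bochner_Integration.integrable_diff) simp_all
    have "(LINT q|lborel. V (q - X n *\<^sub>R d) * of_real (\<phi> q)) = (LINT q|lborel. F q)"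
      using integral_lborel_shift[OF Fm, of "X n *\<^sub>R d"] unfolding F_shift .
    then have "(LINT q|lborel. W n q) = ((LINT q|lborel. F q) - (LINT q|lborel. V q * of_real (\<phi> q))) / of_real (X n)"
      unfolding W_eq using Fsi V\<phi> by simp
    also have "\<dots> = (LINT q|lborel. V q * of_real (dq n q))"
      unfolding F_eq using Vdq V\<phi> X(2)[of n] by simp
    finally show "(LINT q|lborel. V q * of_real (dq n q)) = (LINT q|lborel. W n q)" ..
  qed
  have \<phi>s: "(\<lambda>x. complex_of_real (\<phi> (fst s, snd s, x))) \<in> L2" for s
    by (rule test_function_of_real_L2[OF test_function_slice(1)[OF \<phi>]])
  define H where "H s = (if 0 < snd s
        then (LINT x|lborel. LP (snd s) (ut (fst s - snd s)) x * of_real (\<phi> (fst s, snd s, x))) else 0)" for s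
  have \<phi>0: "\<phi> (fst s, snd s, x) = 0" if "\<not> (a \<le> snd s \<and> snd s \<le> R)" for s x
  proof (rule K(3), rule notI)
    assume k: "(fst s, snd s, x) \<in> K"
    have "\<bar>snd s\<bar> \<le> norm (fst s, snd s, x)"
      using norm_snd_le[of "(snd s, x)" "fst s"] norm_fst_le[of "snd s" x] by simp
    then show False
      using R[OF k] a(2)[OF k] that by simp
  qed
  \<comment> \<open>Both points have the same t - \<tau>, so the quotient of V is a difference
    quotient of the semigroup applied to one fixed slice of u.\<close>
  have W_slice: "(LINT x|lborel. W n (fst s, snd s, x)) = L2_inner
      (\<lambda>x. (P (snd s - X n) (ut (fst s - snd s)) x - P (snd s) (ut (fst s - snd s)) x) / of_real (X n))
      (\<lambda>x. of_real (\<phi> (fst s, snd s, x)))" if s: "a \<le> snd s" for n s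
  proof -
    have "0 < snd s" "0 < snd s - X n"
      using s a(1) X(3)[of n] c(2) by auto
    then show ?thesis
      unfolding L2_inner_def W_def by (simp add: V_eq d_def)
  qed
  have mW: "(\<lambda>s. LINT x|lborel. W n (fst s, snd s, x)) \<in> borel_measurable lborel" for n
    by (rule borel_measurable_integrable[OF integral_triple(2)[OF shift(1)]])
  have lim: "(\<lambda>n. LINT x|lborel. W n (fst s, snd s, x)) \<longlonglongrightarrow> H s" for s
  proof (cases "a \<le> snd s")
    case True
    then have s: "0 < snd s"
      using a(1) by simp
    have Xs: "X n \<le> snd s / 2" for n
      using True X(3)[of n] c(2) by simp
    note g = u_slice[of "fst s - snd s"]
    have PL: "(\<lambda>x. (P (snd s - X n) (ut (fst s - snd s)) x - P (snd s) (ut (fst s - snd s)) x) / of_real (X n)) \<in> L2" for n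
      using s Xs[of n] X(2)[of n] by (intro L2_divide L2_diff P_L2 g) auto
    have "(\<lambda>n. L2_inner
        (\<lambda>x. (P (snd s - X n) (ut (fst s - snd s)) x - P (snd s) (ut (fst s - snd s)) x) / of_real (X n))
        (\<lambda>x. of_real (\<phi> (fst s, snd s, x))))
      \<longlonglongrightarrow> L2_inner (LP (snd s) (ut (fst s - snd s))) (\<lambda>x. of_real (\<phi> (fst s, snd s, x)))"
      by (rule L2_inner_tendsto_left[OF PL LP_L2[OF s g] \<phi>s
            heat_quotient_tendsto[of _ "\<lambda>\<tau>. P \<tau> (ut (fst s - snd s))", OF g P_heat[OF _ g] LP[OF s g] X(1,2) Xs]])
    then show ?thesis
      unfolding W_slice[OF True] H_def using s by (simp add: L2_inner_def)
  next
    case False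
    then show ?thesis
      by (simp add: W_def H_def \<phi>0)
  qed
  \<comment> \<open>\<open>LP\<close> has no measurability in s of its own; H inherits it as a
    pointwise limit of the slice integrals of W.\<close>
  have mH: "H \<in> borel_measurable lborel"
    by (rule borel_measurable_LIMSEQ_metric[OF mW lim])
  then show "(\<lambda>s. if 0 < snd s
        then (LINT x|lborel. LP (snd s) (ut (fst s - snd s)) x * of_real (\<phi> (fst s, snd s, x))) else 0)
      \<in> borel_measurable lborel"
    by (simp add: H_def[abs_def])
  have "(\<lambda>n. LINT s|lborel. LINT x|lborel. W n (fst s, snd s, x)) \<longlonglongrightarrow> (LINT s|lborel. H s)"
  proof (rule integral_dominated_convergence)
    \<comment> \<open>The quotient bound \<open>6 / \<tau> \<le> 6 / a\<close> times the norms of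
      the slices of u and \<phi>, whose product is at most the sum of their squares. Confining
      \<tau> to \<open>[a, R]\<close> makes the first square integrable in s.\<close>
    let ?w = "\<lambda>s. 6 / a * ((L2_norm (ut (fst s - snd s)))\<^sup>2 * indicator {a..R} (snd s)
        + (L2_norm (\<lambda>x. complex_of_real (\<phi> (fst s, snd s, x))))\<^sup>2)"
    show "AE s in lborel. (\<lambda>n. LINT x|lborel. W n (fst s, snd s, x)) \<longlonglongrightarrow> H s"
      using lim by simp
    show "H \<in> borel_measurable lborel" "(\<lambda>s. LINT x|lborel. W n (fst s, snd s, x)) \<in> borel_measurable lborel" for n
      by (rule mH mW)+
    show "AE s in lborel. norm (LINT x|lborel. W n (fst s, snd s, x)) \<le> ?w s" for n
    proof (rule AE_I2)
      fix s :: "real \<times> real"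
      show "norm (LINT x|lborel. W n (fst s, snd s, x)) \<le> ?w s"
      proof (cases "a \<le> snd s \<and> snd s \<le> R")
        case True
        then have s: "0 < snd s" "X n \<le> snd s / 2"
          using a(1) X(3)[of n] c(2) by auto
        note g = u_slice[of "fst s - snd s"]
        let ?N = "L2_norm (ut (fst s - snd s))" and ?M = "L2_norm (\<lambda>x. complex_of_real (\<phi> (fst s, snd s, x)))"
        have "norm (LINT x|lborel. W n (fst s, snd s, x))
            \<le> L2_norm (\<lambda>x. (P (snd s - X n) (ut (fst s - snd s)) x - P (snd s) (ut (fst s - snd s)) x) / of_real (X n)) * ?M"
          unfolding W_slice[OF conjunct1[OF True]]
          using s X(2)[of n] by (intro L2_cauchy_schwarz \<phi>s L2_divide L2_diff P_L2 g) auto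
        also have "\<dots> \<le> (6 / snd s * ?N) * ?M"
          by (intro mult_right_mono L2_norm_nonneg
              heat_quotient_norm_le[of _ "\<lambda>\<tau>. P \<tau> (ut (fst s - snd s))", OF g P_heat[OF _ g] X(2) s(2)])
        also have "\<dots> \<le> 6 / a * (?N * ?M)"
        proof -
          have "6 / snd s * (?N * ?M) \<le> 6 / a * (?N * ?M)"
            using True a(1) by (intro mult_right_mono divide_left_mono) auto
          then show ?thesis
            by (simp add: mult.assoc)
        qed
        also have "\<dots> \<le> 6 / a * (?N\<^sup>2 + ?M\<^sup>2)"
        proof (rule mult_left_mono)
          have "2 * ?N * ?M \<le> ?N\<^sup>2 + ?M\<^sup>2"
            by (rule sum_squares_bound)
          moreover have "0 \<le> ?N * ?M"
            by simp
          ultimately show "?N * ?M \<le> ?N\<^sup>2 + ?M\<^sup>2"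
            by linarith
        qed (use a(1) in simp)
        finally show ?thesis
          using True by simp
      next
        case False
        then have "(LINT x|lborel. W n (fst s, snd s, x)) = 0"
          by (simp add: W_def \<phi>0)
        then show ?thesis
          using a(1) by (simp add: indicator_def)
      qed
    qed
    have m1: "(\<lambda>s. (L2_norm (ut (fst s - snd s)))\<^sup>2 * indicator {a..R} (snd s)) \<in> borel_measurable (borel :: (real \<times> real) measure)"
      by measurable
    have m2: "(\<lambda>s. (L2_norm (\<lambda>x. complex_of_real (\<phi> (fst s, snd s, x))))\<^sup>2) \<in> borel_measurable (borel :: (real \<times> real) measure)"
    proof -
      have "(\<lambda>q. complex_of_real (\<phi> (assoc q))) \<in> borel_measurable borel"
        by measurable
      from L2_norm_slices_measurable[OF this]
      have "(\<lambda>s. L2_norm (\<lambda>x. complex_of_real (\<phi> (fst s, snd s, x)))) \<in> borel_measurable (borel :: (real \<times> real) measure)"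
        by (simp add: assoc_def)
      then show ?thesis
        by measurable
    qed
    have "integrable lborel (\<lambda>s. (L2_norm (ut (fst s - snd s)))\<^sup>2 * indicator {a..R} (snd s))"
    proof (rule integrableI_bounded)
      have "(\<integral>\<^sup>+ s. ennreal (norm ((L2_norm (ut (fst s - snd s)))\<^sup>2 * indicator {a..R} (snd s))) \<partial>lborel)
          = (\<integral>\<^sup>+ s. ennreal ((L2_norm (ut (fst s - snd s)))\<^sup>2) * indicator {a..R} (snd s) \<partial>lborel)"
        by (intro nn_integral_cong) (auto simp: indicator_def)
      also have "\<dots> = (\<integral>\<^sup>+ t. ennreal ((L2_norm (ut t))\<^sup>2) \<partial>lborel) * (\<integral>\<^sup>+ \<tau>. indicator {a..R} \<tau> \<partial>lborel)"
        by (rule nn_integral_shear) measurable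
      also have "\<dots> < \<infinity>"
        using nn_integral_u by (simp add: ennreal_mult_less_top emeasure_lborel_Icc_eq)
      finally show "(\<integral>\<^sup>+ s. ennreal (norm ((L2_norm (ut (fst s - snd s)))\<^sup>2 * indicator {a..R} (snd s))) \<partial>lborel) < \<infinity>" .
    qed (use m1 in simp)
    moreover have "integrable lborel (\<lambda>s. (L2_norm (\<lambda>x. complex_of_real (\<phi> (fst s, snd s, x))))\<^sup>2)"
    proof (rule integrableI_bounded)
      have "(\<integral>\<^sup>+ s. ennreal (norm ((L2_norm (\<lambda>x. complex_of_real (\<phi> (fst s, snd s, x))))\<^sup>2)) \<partial>lborel)
          = (\<integral>\<^sup>+ s. (\<integral>\<^sup>+ x. ennreal ((norm (complex_of_real (\<phi> (fst s, snd s, x))))\<^sup>2) \<partial>lborel) \<partial>lborel)"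
        using L2_norm_sq_nn[OF \<phi>s] by (intro nn_integral_cong) simp
      also have "\<dots> = (\<integral>\<^sup>+ q. ennreal ((norm (complex_of_real (\<phi> q)))\<^sup>2) \<partial>lborel)"
        by (rule nn_integral_triple[symmetric]) measurable
      also have "\<dots> < \<infinity>"
        using test_function_of_real_L2[OF \<phi>] by (simp add: L2_nn_iff)
      finally show "(\<integral>\<^sup>+ s. ennreal (norm ((L2_norm (\<lambda>x. complex_of_real (\<phi> (fst s, snd s, x))))\<^sup>2)) \<partial>lborel) < \<infinity>" .
    qed (use m2 in simp)
    ultimately show "integrable lborel ?w"
      by (intro integrable_mult_right Bochner_Integration.integrable_add)
  qed
  then have "(\<lambda>n. LINT q|lborel. V q * of_real (dq n q)) \<longlonglongrightarrow> (LINT s|lborel. H s)"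
    unfolding shift(2) integral_triple(3)[OF shift(1)] .
  from LIMSEQ_unique[OF V_lim this]
  show "(LINT q|lborel. V q * of_real (dir_deriv \<phi> (1, 1, 0) q))
    = (LINT s|lborel. (if 0 < snd s
        then (LINT x|lborel. LP (snd s) (ut (fst s - snd s)) x * of_real (\<phi> (fst s, snd s, x))) else 0))"
    by (simp add: H_def d_def)
qed

end

section \<open>The weak equation and the initial value\<close>

context heat_flow
begin

text \<open>Three functions occur, since the formula for U uses the original u while the slice
  arguments need the modified one. W carries the measurability, V the slice identities, and they are
  exchanged under integrals only.\<close>

lemma weak_solution:
  assumes U: "\<And>t \<tau> x. 0 < \<tau> \<Longrightarrow> U t \<tau> x = W (t, \<tau>, x)"
    and Wm [measurable]: "W \<in> borel_measurable borel" and WV: "AE q in lborel. W q = V q"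
  shows "weak_extension_solution \<sigma> ({-T<..<T} \<times> {0<..} \<times> UNIV) U"
proof -
  let ?D = "{-T<..<T} \<times> {0<..} \<times> UNIV :: (real \<times> real \<times> (real ^ 'n)) set"
  have D_upper: "?D \<subseteq> upper"
    by auto
  have D_borel [measurable]: "?D \<in> sets borel"
    by (intro borel_open open_Times) auto
  have tD: "\<phi> \<in> test_functions upper" if "\<phi> \<in> test_functions ?D" for \<phi> :: "real \<times> real \<times> (real ^ 'n) \<Rightarrow> real"
    using that test_functions_mono[OF D_upper] by blast
  have "\<exists>H. H \<in> borel_measurable borel \<and>
    (AE s in lborel. 0 < snd s \<longrightarrow> (AE x in lborel. H (fst s, snd s, x) = DP (snd s) (ut (fst s - snd s)) x $ i))" for i
    by (rule gradient_measurable[of i]) blast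
  then have "\<exists>H. \<forall>i. H i \<in> borel_measurable borel \<and>
    (AE s in lborel. 0 < snd s \<longrightarrow> (AE x in lborel. H i (fst s, snd s, x) = DP (snd s) (ut (fst s - snd s)) x $ i))"
    by (intro choice allI)
  then obtain H where HH: "\<forall>i. H i \<in> borel_measurable borel \<and>
    (AE s in lborel. 0 < snd s \<longrightarrow> (AE x in lborel. H i (fst s, snd s, x) = DP (snd s) (ut (fst s - snd s)) x $ i))"
    by blast
  have H [measurable]: "H i \<in> borel_measurable borel"
    and H_eq: "AE s in lborel. 0 < snd s \<longrightarrow>
      (AE x in lborel. H i (fst s, snd s, x) = DP (snd s) (ut (fst s - snd s)) x $ i)" for i
    using HH by simp_all
  have H_slice: "(\<lambda>x. H i (fst s, snd s, x)) \<in> L2 \<and>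
      L2_norm (\<lambda>x. H i (fst s, snd s, x)) = L2_norm (\<lambda>x. DP (snd s) (ut (fst s - snd s)) x $ i)"
    if s: "0 < snd s" and eq: "AE x in lborel. H i (fst s, snd s, x) = DP (snd s) (ut (fst s - snd s)) x $ i" for i s
  proof -
    note DL = DP_L2[OF s u_slice[of "fst s - snd s"], of i]
    have [measurable]: "(\<lambda>x. DP (snd s) (ut (fst s - snd s)) x $ i) \<in> borel_measurable borel"
      using DL by measurable
    have m: "(\<lambda>x. H i (fst s, snd s, x)) \<in> borel_measurable borel"
      by measurable
    have "(\<integral>\<^sup>+ x. ennreal ((norm (H i (fst s, snd s, x)))\<^sup>2) \<partial>lborel)
        = (\<integral>\<^sup>+ x. ennreal ((norm (DP (snd s) (ut (fst s - snd s)) x $ i))\<^sup>2) \<partial>lborel)"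
      by (rule nn_integral_cong_AE) (use eq in auto)
    then have "(\<lambda>x. H i (fst s, snd s, x)) \<in> L2"
      using DL m by (simp add: L2_nn_iff)
    moreover have "L2_norm (\<lambda>x. H i (fst s, snd s, x)) = L2_norm (\<lambda>x. DP (snd s) (ut (fst s - snd s)) x $ i)"
      by (rule L2_norm_cong_AE[OF m _ eq]) measurable
    ultimately show ?thesis ..
  qed
  have H_local: "(\<lambda>q. indicator K q * H i q) \<in> L2" if K: "compact K" "K \<subseteq> upper" for K i
  proof (rule local_L2[OF H _ _ K, where C = "6 / c0"])
    show "AE s in lborel. 0 < snd s \<longrightarrow> (\<lambda>x. H i (fst s, snd s, x)) \<in> L2 \<and>
      (L2_norm (\<lambda>x. H i (fst s, snd s, x)))\<^sup>2 \<le> (6 / c0 + 6 / c0 / snd s) * (L2_norm (ut (fst s - snd s)))\<^sup>2"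
      using H_eq[of i]
    proof eventually_elim
      case (elim s)
      show ?case
      proof
        assume s: "0 < snd s"
        have "6 / c0 / snd s * (L2_norm (ut (fst s - snd s)))\<^sup>2
            \<le> (6 / c0 + 6 / c0 / snd s) * (L2_norm (ut (fst s - snd s)))\<^sup>2"
          using c0(1) by (intro mult_right_mono) auto
        then show "(\<lambda>x. H i (fst s, snd s, x)) \<in> L2 \<and>
            (L2_norm (\<lambda>x. H i (fst s, snd s, x)))\<^sup>2 \<le> (6 / c0 + 6 / c0 / snd s) * (L2_norm (ut (fst s - snd s)))\<^sup>2"
          using H_slice[OF s, of i] elim s DP_norm[OF s u_slice, of "fst s - snd s" i] by simp
      qed
    qed
  qed (use c0(1) in simp)
  have W_local: "(\<lambda>q. indicator K q * W q) \<in> L2" if K: "compact K" "K \<subseteq> upper" for K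
  proof -
    have [measurable]: "K \<in> sets borel"
      using K(1) by (simp add: borel_compact)
    have "(\<integral>\<^sup>+ q. ennreal ((norm (indicator K q * W q))\<^sup>2) \<partial>lborel) = (\<integral>\<^sup>+ q. ennreal ((norm (indicator K q * V q))\<^sup>2) \<partial>lborel)"
      by (rule nn_integral_cong_AE) (use WV in \<open>auto elim!: eventually_mono\<close>)
    then show ?thesis
      using V_local_L2[OF K] by (simp add: L2_nn_iff)
  qed
  have loc: "loc_L2 ?D f"
    if f [measurable]: "f \<in> borel_measurable borel"
      and L: "\<And>K. compact K \<Longrightarrow> K \<subseteq> upper \<Longrightarrow> (\<lambda>q. indicator K q * f q) \<in> L2" for f
    unfolding loc_L2_def
  proof (intro conjI allI impI)
    show "set_borel_measurable lborel ?D f"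
      unfolding set_borel_measurable_def by measurable
    fix K
    assume K: "compact K \<and> K \<subseteq> ?D"
    have "integrable lborel (\<lambda>q. (norm (indicator K q * f q))\<^sup>2)"
      using L[of K] K D_upper by (intro L2_integrable_sq) blast
    moreover have "(\<lambda>q. (norm (indicator K q * f q))\<^sup>2) = (\<lambda>q. indicator K q *\<^sub>R (norm (f q))\<^sup>2)"
      by (auto simp: fun_eq_iff indicator_def)
    ultimately show "set_integrable lborel K (\<lambda>q. (norm (f q))\<^sup>2)"
      by (simp add: set_integrable_def)
  qed
  have UW: "(\<lambda>(t, \<tau>, x). U t \<tau> x) q = W q" if "q \<in> ?D" for q
    using that U by (cases q) auto
  have loc_cong: "loc_L2 ?D f" if "loc_L2 ?D g" "\<And>q. q \<in> ?D \<Longrightarrow> f q = g q"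
    for f g :: "real \<times> real \<times> (real ^ 'n) \<Rightarrow> complex"
  proof -
    have "(\<lambda>q. indicator ?D q *\<^sub>R f q) = (\<lambda>q. indicator ?D q *\<^sub>R g q)"
      using that(2) by (auto simp: fun_eq_iff indicator_def)
    moreover have "(\<lambda>q. indicator K q *\<^sub>R (norm (f q))\<^sup>2) = (\<lambda>q. indicator K q *\<^sub>R (norm (g q))\<^sup>2)"
      if "K \<subseteq> ?D" for K
      using that \<open>\<And>q. q \<in> ?D \<Longrightarrow> f q = g q\<close> by (auto simp: fun_eq_iff indicator_def)
    ultimately show ?thesis
      using that(1) unfolding loc_L2_def set_borel_measurable_def set_integrable_def by auto
  qed
  \<comment> \<open>Test functions and their derivatives vanish off the domain, so its integrals
    become integrals over the whole space, where slicing and the shear are available.\<close>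
  have whole: "(LINT q:?D|lborel. f q) = (LINT q|lborel. g q)"
    if "\<And>q. q \<in> ?D \<Longrightarrow> f q = g q" "\<And>q. q \<notin> ?D \<Longrightarrow> g q = 0"
    for f g :: "real \<times> real \<times> (real ^ 'n) \<Rightarrow> complex"
    unfolding set_lebesgue_integral_def
    by (rule Bochner_Integration.integral_cong) (use that in \<open>auto simp: indicator_def\<close>)
  have off_D: "\<phi> q = 0" "dir_deriv \<phi> v q = 0" if \<phi>: "\<phi> \<in> test_functions ?D" and q: "q \<notin> ?D"
    for \<phi> :: "real \<times> real \<times> (real ^ 'n) \<Rightarrow> real" and q v
  proof -
    obtain K where "K \<subseteq> ?D" "\<And>q. q \<notin> K \<Longrightarrow> \<phi> q = 0" "\<And>q v. q \<notin> K \<Longrightarrow> dir_deriv \<phi> v q = 0"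
      using test_function_support[OF \<phi>] by metis
    then show "\<phi> q = 0" "dir_deriv \<phi> v q = 0"
      using q by blast+
  qed
  define G where "G q = (\<chi> i. H i q)" for q
  have G: "(\<lambda>q. G q $ i) = H i" for i
    by (simp add: G_def)
  have W_test: "(LINT q|lborel. W q * of_real (\<phi> q)) = (LINT q|lborel. V q * of_real (\<phi> q))"
    "integrable lborel (\<lambda>q. W q * of_real (\<phi> q))"
    if \<phi>: "\<phi> \<in> test_functions upper" for \<phi>
  proof -
    have [measurable]: "\<phi> \<in> borel_measurable borel"
      by (rule test_function_measurable[OF \<phi>])
    show "(LINT q|lborel. W q * of_real (\<phi> q)) = (LINT q|lborel. V q * of_real (\<phi> q))"
    proof (rule integral_cong_AE)
      show "AE q in lborel. W q * of_real (\<phi> q) = V q * of_real (\<phi> q)"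
        using WV by eventually_elim simp
    qed measurable
    show "integrable lborel (\<lambda>q. W q * of_real (\<phi> q))"
      by (rule integrable_local_L2_test[OF W_local \<phi>])
  qed
  have weak: "weak_deriv ?D (0, 0, axis i 1) (\<lambda>(t, \<tau>, x). U t \<tau> x) (H i)" for i
    unfolding weak_deriv_def
  proof
    fix \<phi> :: "real \<times> real \<times> (real ^ 'n) \<Rightarrow> real"
    assume \<phi>D: "\<phi> \<in> test_functions ?D"
    note \<phi> = tD[OF \<phi>D] and \<phi>' = dir_deriv_test_function[OF tD[OF \<phi>D]]
    let ?v = "(0, 0, axis i 1) :: real \<times> real \<times> (real ^ 'n)"
    have "(LINT q:?D|lborel. (case q of (t, \<tau>, x) \<Rightarrow> U t \<tau> x) * of_real (dir_deriv \<phi> ?v q))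
        = (LINT q|lborel. W q * of_real (dir_deriv \<phi> ?v q))"
      by (rule whole) (use UW off_D[OF \<phi>D] in auto)
    also have "\<dots> = (LINT q|lborel. V q * of_real (dir_deriv \<phi> ?v q))"
      by (rule W_test(1)[OF \<phi>'])
    also have "\<dots> = (LINT q|lborel. - (H i q * of_real (\<phi> q)))"
    proof (rule integral_eq_triple)
      show "integrable lborel (\<lambda>q. V q * of_real (dir_deriv \<phi> ?v q))"
        by (rule integrable_local_L2_test[OF V_local_L2 \<phi>'])
      show "integrable lborel (\<lambda>q. - (H i q * of_real (\<phi> q)))"
        using integrable_local_L2_test[OF H_local \<phi>] by simp
      show "AE s in lborel. (LINT x|lborel. V (fst s, snd s, x) * of_real (dir_deriv \<phi> ?v (fst s, snd s, x)))
          = (LINT x|lborel. - (H i (fst s, snd s, x) * of_real (\<phi> (fst s, snd s, x))))"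
        using H_eq[of i]
      proof eventually_elim
        case (elim s)
        show ?case
        proof (cases "0 < snd s")
          case True
          note g = u_slice[of "fst s - snd s"]
          note \<phi>s = test_function_slice[OF \<phi>, of "fst s" "snd s"]
          have eq: "AE x in lborel. H i (fst s, snd s, x) = DP (snd s) (ut (fst s - snd s)) x $ i"
            using elim True by simp
          have "(LINT x|lborel. V (fst s, snd s, x) * of_real (dir_deriv \<phi> ?v (fst s, snd s, x)))
              = - (LINT x|lborel. DP (snd s) (ut (fst s - snd s)) x $ i * of_real (\<phi> (fst s, snd s, x)))"
            using DP_weak[OF True g, of i] \<phi>s(1) True
            by (simp add: weak_deriv_def set_lebesgue_integral_def V_eq \<phi>s(2)[symmetric])
          also have "(LINT x|lborel. DP (snd s) (ut (fst s - snd s)) x $ i * of_real (\<phi> (fst s, snd s, x)))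
              = (LINT x|lborel. H i (fst s, snd s, x) * of_real (\<phi> (fst s, snd s, x)))"
          proof (rule integral_cong_AE)
            have [measurable]: "(\<lambda>x. DP (snd s) (ut (fst s - snd s)) x $ i) \<in> borel_measurable borel"
              using DP_L2[OF True g] by measurable
            have [measurable]: "(\<lambda>x. \<phi> (fst s, snd s, x)) \<in> borel_measurable borel"
              by (rule test_function_measurable[OF \<phi>s(1)])
            show "(\<lambda>x. DP (snd s) (ut (fst s - snd s)) x $ i * of_real (\<phi> (fst s, snd s, x))) \<in> borel_measurable lborel"
              "(\<lambda>x. H i (fst s, snd s, x) * of_real (\<phi> (fst s, snd s, x))) \<in> borel_measurable lborel"
              by measurable
            show "AE x in lborel. DP (snd s) (ut (fst s - snd s)) x $ i * of_real (\<phi> (fst s, snd s, x))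
                = H i (fst s, snd s, x) * of_real (\<phi> (fst s, snd s, x))"
              using eq by eventually_elim simp
          qed
          finally show ?thesis
            by simp
        next
          case False
          then show ?thesis
            using test_function_vanishes[OF \<phi>] by simp
        qed
      qed
    qed
    also have "\<dots> = - (LINT q|lborel. H i q * of_real (\<phi> q))"
      by simp
    also have "(LINT q|lborel. H i q * of_real (\<phi> q)) = (LINT q:?D|lborel. H i q * of_real (\<phi> q))"
      by (rule whole[symmetric]) (use off_D[OF \<phi>D] in auto)
    finally show "(LINT q:?D|lborel. (case q of (t, \<tau>, x) \<Rightarrow> U t \<tau> x) * of_real (dir_deriv \<phi> ?v q))
        = - (LINT q:?D|lborel. H i q * of_real (\<phi> q))" .
  qed
  \<comment> \<open>The elliptic part is evaluated on each slice and yields the integral of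
    \<open>LP\<close> against \<phi>; the transport part yields the same integral with the opposite
    sign.\<close>
  have equation: "(LINT (t, \<tau>, x):?D|lborel.
              - U t \<tau> x * of_real (dir_deriv \<phi> (1, 0, 0) (t, \<tau>, x) + dir_deriv \<phi> (0, 1, 0) (t, \<tau>, x))
              + (\<Sum>i\<in>UNIV. \<Sum>k\<in>UNIV. of_real (\<sigma> x $ i $ k) * G (t, \<tau>, x) $ k *
                   of_real (dir_deriv \<phi> (0, 0, axis i 1) (t, \<tau>, x)))) = 0"
    if \<phi>D: "\<phi> \<in> test_functions ?D" for \<phi>
  proof -
    note \<phi> = tD[OF \<phi>D] and \<phi>' = dir_deriv_test_function[OF tD[OF \<phi>D]]
    let ?d = "(1, 1, 0) :: real \<times> real \<times> (real ^ 'n)"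
    have dd: "dir_deriv \<phi> (1, 0, 0) q + dir_deriv \<phi> (0, 1, 0) q = dir_deriv \<phi> ?d q" for q
      using linear_add[OF linear_frechet_derivative[OF test_function_differentiable[OF \<phi>, of q]], of "(1, 0, 0)" "(0, 1, 0)"]
      by simp
    define S where "S q = (\<Sum>i\<in>UNIV. \<Sum>k\<in>UNIV. of_real (\<sigma> (snd (snd q)) $ i $ k) * H k q *
        of_real (dir_deriv \<phi> (0, 0, axis i 1) q))" for q
    obtain C where C: "C \<ge> 0" "\<And>x i k. \<bar>\<sigma> x $ i $ k\<bar> \<le> C"
      using admissible_bounded[OF admissible] by metis
    note [measurable] = admissible_measurable[OF admissible]
    have \<sigma>H_local: "(\<lambda>q. indicator K q * (of_real (\<sigma> (snd (snd q)) $ i $ k) * H k q)) \<in> L2"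
      if K: "compact K" "K \<subseteq> upper" for K i k
    proof -
      have m: "(\<lambda>q :: real \<times> real \<times> (real ^ 'n). complex_of_real (\<sigma> (snd (snd q)) $ i $ k)) \<in> borel_measurable borel"
        by measurable
      have "(\<lambda>q. of_real (\<sigma> (snd (snd q)) $ i $ k) * (indicator K q * H k q)) \<in> L2"
        by (rule L2_bounded_mult[OF H_local[OF K] m, where C = C]) (use C in auto)
      then show ?thesis
        by (simp add: mult_ac)
    qed
    have Si: "integrable lborel S"
      unfolding S_def[abs_def]
      by (intro Bochner_Integration.integrable_sum integrable_local_L2_test[OF \<sigma>H_local \<phi>'])
    have "(LINT (t, \<tau>, x):?D|lborel.
              - U t \<tau> x * of_real (dir_deriv \<phi> (1, 0, 0) (t, \<tau>, x) + dir_deriv \<phi> (0, 1, 0) (t, \<tau>, x))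
              + (\<Sum>i\<in>UNIV. \<Sum>k\<in>UNIV. of_real (\<sigma> x $ i $ k) * G (t, \<tau>, x) $ k *
                   of_real (dir_deriv \<phi> (0, 0, axis i 1) (t, \<tau>, x))))
        = (LINT q|lborel. - (W q * of_real (dir_deriv \<phi> ?d q)) + S q)"
    proof (rule whole)
      fix q
      show "(case q of (t, \<tau>, x) \<Rightarrow>
              - U t \<tau> x * of_real (dir_deriv \<phi> (1, 0, 0) (t, \<tau>, x) + dir_deriv \<phi> (0, 1, 0) (t, \<tau>, x))
              + (\<Sum>i\<in>UNIV. \<Sum>k\<in>UNIV. of_real (\<sigma> x $ i $ k) * G (t, \<tau>, x) $ k *
                   of_real (dir_deriv \<phi> (0, 0, axis i 1) (t, \<tau>, x))))
          = - (W q * of_real (dir_deriv \<phi> ?d q)) + S q" if "q \<in> ?D"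
        using UW[OF that] unfolding S_def by (cases q) (simp only: dd prod.case G_def vec_lambda_beta snd_conv mult_minus_left)
      show "- (W q * of_real (dir_deriv \<phi> ?d q)) + S q = 0" if "q \<notin> ?D"
        using off_D(2)[OF \<phi>D that] by (simp add: S_def)
    qed
    also have "\<dots> = - (LINT q|lborel. V q * of_real (dir_deriv \<phi> ?d q)) + (LINT q|lborel. S q)"
      using W_test[OF \<phi>'] Si by simp
    also have "(LINT q|lborel. S q) = (LINT s|lborel. LINT x|lborel. S (fst s, snd s, x))"
      by (rule integral_triple(3)[OF Si])
    also have "\<dots> = (LINT s|lborel. (if 0 < snd s
        then (LINT x|lborel. LP (snd s) (ut (fst s - snd s)) x * of_real (\<phi> (fst s, snd s, x))) else 0))"
    proof -
      have "AE s in lborel. \<forall>i\<in>UNIV. 0 < snd s \<longrightarrow>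
          (AE x in lborel. H i (fst s, snd s, x) = DP (snd s) (ut (fst s - snd s)) x $ i)"
        using H_eq by (intro AE_finite_allI) auto
      then have ae: "AE s in lborel. (LINT x|lborel. S (fst s, snd s, x)) = (if 0 < snd s
        then (LINT x|lborel. LP (snd s) (ut (fst s - snd s)) x * of_real (\<phi> (fst s, snd s, x))) else 0)"
      proof eventually_elim
        case (elim s)
        show ?case
        proof (cases "0 < snd s")
          case True
          note g = u_slice[of "fst s - snd s"]
          note \<phi>s = test_function_slice[OF \<phi>, of "fst s" "snd s"]
          have [measurable]: "(\<lambda>x. DP (snd s) (ut (fst s - snd s)) x $ i) \<in> borel_measurable borel" for i
            using DP_L2[OF True g] by measurable
          have [measurable]: "(\<lambda>x. dir_deriv \<phi> v (fst s, snd s, x)) \<in> borel_measurable borel" for v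
            by (rule test_function_measurable[OF test_function_slice(1)[OF \<phi>']])
          have all: "AE x in lborel. \<forall>i\<in>UNIV. H i (fst s, snd s, x) = DP (snd s) (ut (fst s - snd s)) x $ i"
            using elim True by (intro AE_finite_allI) auto
          have "(LINT x|lborel. S (fst s, snd s, x)) = (LINT x|lborel. (\<Sum>i\<in>UNIV. \<Sum>k\<in>UNIV.
              of_real (\<sigma> x $ i $ k) * DP (snd s) (ut (fst s - snd s)) x $ k * of_real (dir_deriv \<phi> (0, 0, axis i 1) (fst s, snd s, x))))"
            unfolding S_def snd_conv
          proof (rule integral_cong_AE)
            show "AE x in lborel. (\<Sum>i\<in>UNIV. \<Sum>k\<in>UNIV. of_real (\<sigma> x $ i $ k) * H k (fst s, snd s, x) *
                of_real (dir_deriv \<phi> (0, 0, axis i 1) (fst s, snd s, x)))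
              = (\<Sum>i\<in>UNIV. \<Sum>k\<in>UNIV. of_real (\<sigma> x $ i $ k) * DP (snd s) (ut (fst s - snd s)) x $ k *
                of_real (dir_deriv \<phi> (0, 0, axis i 1) (fst s, snd s, x)))"
              using all by eventually_elim simp
          qed measurable
          also have "\<dots> = (LINT x|lborel. LP (snd s) (ut (fst s - snd s)) x * of_real (\<phi> (fst s, snd s, x)))"
            using DP_eq[OF True g \<phi>s(1)] by (simp only: \<phi>s(2))
          finally show ?thesis
            using True by simp
        next
          case False
          then show ?thesis
            using test_function_vanishes[OF \<phi>] by (simp add: S_def)
        qed
      qed
      show ?thesis
      proof (rule integral_cong_AE)
        show m: "(\<lambda>s. LINT x|lborel. S (fst s, snd s, x)) \<in> borel_measurable lborel"
          by (rule borel_measurable_integrable[OF integral_triple(2)[OF Si]])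
        show "(\<lambda>s. if 0 < snd s then (LINT x|lborel. LP (snd s) (ut (fst s - snd s)) x * of_real (\<phi> (fst s, snd s, x))) else 0)
          \<in> borel_measurable lborel"
          by (rule weak_transport_measurable[OF \<phi>])
      qed (rule ae)
    qed
    also have "\<dots> = (LINT q|lborel. V q * of_real (dir_deriv \<phi> ?d q))"
      by (rule weak_transport[OF \<phi>, symmetric])
    finally show ?thesis
      by simp
  qed
  show ?thesis
    unfolding weak_extension_solution_def
  proof (intro conjI exI[of _ G] allI ballI)
    show "loc_L2 ?D (\<lambda>(t, \<tau>, x). U t \<tau> x)"
      by (rule loc_cong[OF loc[OF Wm W_local] UW])
    show "loc_L2 ?D (\<lambda>q. G q $ i)" for i
      unfolding G by (rule loc[OF H H_local])
    show "weak_deriv ?D (0, 0, axis i 1) (\<lambda>(t, \<tau>, x). U t \<tau> x) (\<lambda>q. G q $ i)" for i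
      unfolding G by (rule weak)
  qed (rule equation)
qed

text \<open>The two error terms are integrated in t separately. The first is governed by the
  translations by \<open>(X n, 0)\<close> in space-time; the second tends to 0 for each t and is
  dominated by four times the squared norm of the slice.\<close>

lemma initial_value:
  assumes X: "X \<longlonglongrightarrow> 0" "\<And>n. 0 < X n"
  shows "(\<lambda>n. \<integral>\<^sup>+ q. ennreal ((norm (V (fst q, X n, snd q) - u q))\<^sup>2) \<partial>lborel) \<longlonglongrightarrow> 0"
proof -
  define A where "A n = (\<integral>\<^sup>+ t. ennreal ((L2_norm (\<lambda>x. ut (t - X n) x - ut t x))\<^sup>2) \<partial>lborel)" for n
  define B where "B n = (\<integral>\<^sup>+ t. ennreal ((L2_norm (\<lambda>x. P (X n) (ut t) x - ut t x))\<^sup>2) \<partial>lborel)" for n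
  \<comment> \<open>Expresses the semigroup on a fixed slice through the Borel function V, which
    makes the integrand of B measurable in t.\<close>
  have PV: "P (X n) (ut t) x = V (t + X n, X n, x)" for n t x
    using X(2)[of n] by (simp add: V_eq)
  have mB: "(\<lambda>t. L2_norm (\<lambda>x. P (X n) (ut t) x - ut t x)) \<in> borel_measurable borel" for n
    using L2_norm_slices_measurable[of "\<lambda>q. V (fst q + X n, X n, snd q) - u q"]
    unfolding PV by simp
  have mA: "(\<lambda>t. L2_norm (\<lambda>x. ut (t - X n) x - ut t x)) \<in> borel_measurable borel" for n
    using L2_norm_slices_measurable[of "\<lambda>q. u (fst q - X n, snd q) - u q"] by simp
  have A_lim: "A \<longlonglongrightarrow> 0"
  proof -
    have z: "(\<lambda>n. (X n, 0 :: real ^ 'n)) \<longlonglongrightarrow> 0"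
      using tendsto_Pair[OF X(1) tendsto_const[of "0 :: real ^ 'n"]] by (simp add: zero_prod_def)
    have "A n = ennreal ((L2_norm (\<lambda>q. u (q - (X n, 0)) - u q))\<^sup>2)" for n
    proof -
      have L: "(\<lambda>q. u (q - (X n, 0)) - u q) \<in> L2"
        by (intro L2_diff L2_shift u_L2)
      have m: "(\<lambda>q. u (q - (X n, 0)) - u q) \<in> borel_measurable borel"
        using L by measurable
      have "(\<integral>\<^sup>+ q. ennreal ((norm (u (q - (X n, 0)) - u q))\<^sup>2) \<partial>lborel) = A n"
        unfolding A_def
        by (subst L2_norm_sq_slices[OF m]) (auto intro!: L2_diff u_slice)
      then show ?thesis
        using L2_norm_sq_nn[OF L] by simp
    qed
    moreover have "(\<lambda>n. L2_norm (\<lambda>q. u (q - (X n, 0)) - u q)) \<longlonglongrightarrow> 0"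
      using translation_continuous_L2[OF u_L2] z by (simp add: translation_continuous_def)
    from tendsto_ennrealI[OF tendsto_power[OF this, of 2]]
    have "(\<lambda>n. ennreal ((L2_norm (\<lambda>q. u (q - (X n, 0)) - u q))\<^sup>2)) \<longlonglongrightarrow> 0"
      by simp
    ultimately show ?thesis
      by presburger
  qed
  have B_lim: "B \<longlonglongrightarrow> 0"
  proof -
    have "B \<longlonglongrightarrow> (\<integral>\<^sup>+ t. 0 \<partial>(lborel :: real measure))"
      unfolding B_def
    proof (rule nn_integral_dominated_convergence[where w = "\<lambda>t. ennreal (4 * (L2_norm (ut t))\<^sup>2)"])
      show "AE t in lborel. ennreal ((L2_norm (\<lambda>x. P (X n) (ut t) x - ut t x))\<^sup>2) \<le> ennreal (4 * (L2_norm (ut t))\<^sup>2)" for n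
      proof (intro AE_I2 ennreal_leI)
        fix t
        have "L2_norm (\<lambda>x. P (X n) (ut t) x - ut t x) \<le> 2 * L2_norm (ut t)"
          using L2_norm_triangle_diff[OF P_L2[OF X(2) u_slice] u_slice, of n t t]
            P_contraction[OF X(2) u_slice, of n t] by linarith
        then have "(L2_norm (\<lambda>x. P (X n) (ut t) x - ut t x))\<^sup>2 \<le> (2 * L2_norm (ut t))\<^sup>2"
          by (intro power_mono) auto
        then show "(L2_norm (\<lambda>x. P (X n) (ut t) x - ut t x))\<^sup>2 \<le> 4 * (L2_norm (ut t))\<^sup>2"
          by (simp add: power_mult_distrib)
      qed
      have "(\<integral>\<^sup>+ t. ennreal (4 * (L2_norm (ut t))\<^sup>2) \<partial>lborel) = ennreal 4 * (\<integral>\<^sup>+ t. ennreal ((L2_norm (ut t))\<^sup>2) \<partial>lborel)"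
        by (subst nn_integral_cmult[symmetric]) (auto simp: ennreal_mult simp del: ennreal_numeral)
      also have "\<dots> < \<infinity>"
        using nn_integral_u by (simp add: ennreal_mult_less_top del: ennreal_numeral)
      finally show "(\<integral>\<^sup>+ t. ennreal (4 * (L2_norm (ut t))\<^sup>2) \<partial>lborel) < \<infinity>" .
      have "X n \<noteq> 0" for n
        using X(2)[of n] by simp
      then have X_right: "filterlim X (at_right 0) sequentially"
        using X by (simp add: filterlim_at)
      show "AE t in lborel. (\<lambda>n. ennreal ((L2_norm (\<lambda>x. P (X n) (ut t) x - ut t x))\<^sup>2)) \<longlonglongrightarrow> 0"
      proof (rule AE_I2)
        fix t
        have "((\<lambda>\<tau>. L2_norm (\<lambda>x. P \<tau> (ut t) x - ut t x)) \<longlongrightarrow> 0) (at_right 0)"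
          by (rule heat_tendsto[OF P_heat[OF _ u_slice] u_slice])
        from tendsto_ennrealI[OF tendsto_power[OF filterlim_compose[OF this X_right], of 2]]
        show "(\<lambda>n. ennreal ((L2_norm (\<lambda>x. P (X n) (ut t) x - ut t x))\<^sup>2)) \<longlonglongrightarrow> 0"
          by simp
      qed
    qed (use mB in auto)
    then show ?thesis
      by simp
  qed
  have le: "(\<integral>\<^sup>+ q. ennreal ((norm (V (fst q, X n, snd q) - u q))\<^sup>2) \<partial>lborel) \<le> 2 * A n + 2 * B n" for n
  proof -
    have "(\<integral>\<^sup>+ q. ennreal ((norm (V (fst q, X n, snd q) - u q))\<^sup>2) \<partial>lborel)
        = (\<integral>\<^sup>+ t. ennreal ((L2_norm (\<lambda>x. V (t, X n, x) - u (t, x)))\<^sup>2) \<partial>lborel)"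
      by (subst L2_norm_sq_slices) (auto intro!: L2_diff V_slice_L2 u_slice)
    also have "\<dots> \<le> (\<integral>\<^sup>+ t. 2 * ennreal ((L2_norm (\<lambda>x. ut (t - X n) x - ut t x))\<^sup>2)
        + 2 * ennreal ((L2_norm (\<lambda>x. P (X n) (ut t) x - ut t x))\<^sup>2) \<partial>lborel)"
    proof (rule nn_integral_mono)
      fix t
      note P1 = P_heat[OF X(2)[of n] u_slice[of "t - X n"]] and P2 = P_heat[OF X(2)[of n] u_slice[of t]]
      let ?f = "\<lambda>x. P (X n) (ut (t - X n)) x - P (X n) (ut t) x"
      let ?g = "\<lambda>x. P (X n) (ut t) x - ut t x"
      have "L2_norm ?f \<le> L2_norm (\<lambda>x. ut (t - X n) x - ut t x)"
        by (rule heat_contraction[OF weak_int_base_diff[OF P1 P2 heat_weight_integrable[OF X(2)] u_slice u_slice] X(2)])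
          (intro L2_diff u_slice)
      then have f: "(L2_norm ?f)\<^sup>2 \<le> (L2_norm (\<lambda>x. ut (t - X n) x - ut t x))\<^sup>2"
        by (intro power_mono) auto
      have "(\<lambda>x. V (t, X n, x) - u (t, x)) = (\<lambda>x. ?f x + ?g x)"
        using X(2)[of n] by (simp add: V_eq)
      then have "(L2_norm (\<lambda>x. V (t, X n, x) - u (t, x)))\<^sup>2 \<le> 2 * (L2_norm ?f)\<^sup>2 + 2 * (L2_norm ?g)\<^sup>2"
        using L2_norm_sq_sum_bound[of ?f ?g] X(2)[of n] by (simp add: L2_diff P_L2 u_slice)
      also have "\<dots> \<le> 2 * (L2_norm (\<lambda>x. ut (t - X n) x - ut t x))\<^sup>2 + 2 * (L2_norm ?g)\<^sup>2"
        using f by simp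
      finally have "ennreal ((L2_norm (\<lambda>x. V (t, X n, x) - u (t, x)))\<^sup>2)
          \<le> ennreal (2 * (L2_norm (\<lambda>x. ut (t - X n) x - ut t x))\<^sup>2 + 2 * (L2_norm ?g)\<^sup>2)"
        by (rule ennreal_leI)
      then show "ennreal ((L2_norm (\<lambda>x. V (t, X n, x) - u (t, x)))\<^sup>2)
          \<le> 2 * ennreal ((L2_norm (\<lambda>x. ut (t - X n) x - ut t x))\<^sup>2) + 2 * ennreal ((L2_norm ?g)\<^sup>2)"
        by (simp add: ennreal_plus ennreal_mult)
    qed
    also have "\<dots> = 2 * A n + 2 * B n"
      unfolding A_def B_def using mA mB by (subst nn_integral_add) (auto simp: nn_integral_cmult)
    finally show ?thesis .
  qed
  have "(\<lambda>n. 2 * A n + 2 * B n) \<longlonglongrightarrow> 2 * 0 + 2 * 0"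
    by (intro tendsto_add ennreal_tendsto_cmult A_lim B_lim) auto
  then have lim: "(\<lambda>n. 2 * A n + 2 * B n) \<longlonglongrightarrow> 0"
    by simp
  show ?thesis
    by (rule tendsto_sandwich[OF _ _ tendsto_const lim]) (auto intro: always_eventually le)
qed

end

text \<open>The last condition holds because u vanishes identically at the times
  \<open>- T - \<tau> \<le> - T\<close>. For the other two, the flow is built from a modification of
  u, and U agrees with it except on the null set of pairs (t, \<tau>) for which the slice at time t
  - \<tau> was changed.\<close>

theorem lemma3p1:
  fixes \<Omega> :: "(real ^ 'n) set"
    and s T :: real
    and f :: "real \<times> (real ^ 'n) \<Rightarrow> complex"
    and \<sigma> :: "nat \<Rightarrow> real ^ 'n \<Rightarrow> real ^ 'n ^ 'n"
    and p :: "nat \<Rightarrow> real ^ 'n \<Rightarrow> real ^ 'n \<Rightarrow> real \<Rightarrow> real"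
    and u :: "nat \<Rightarrow> real \<times> (real ^ 'n) \<Rightarrow> complex"
    and U :: "nat \<Rightarrow> real \<Rightarrow> real \<Rightarrow> real ^ 'n \<Rightarrow> complex"
  assumes "CARD('n) \<ge> 2"
    and "0 < s" and "s < 1"
    and "0 < T"
    and "bounded \<Omega>" and "open \<Omega>" and "lipschitz_boundary \<Omega>"
    and "f \<in> test_functions (cyl T (- closure \<Omega>))"
    and "\<And>j. j \<in> {1, 2} \<Longrightarrow> admissible (\<sigma> j)"
    and "\<And>j x. j \<in> {1, 2} \<Longrightarrow> x \<in> - closure \<Omega> \<Longrightarrow> \<sigma> j x = mat 1"
    and "\<And>j. j \<in> {1, 2} \<Longrightarrow> nonlocal_solution (\<sigma> j) s T \<Omega> f (u j)"
    and "\<And>j t x. j \<in> {1, 2} \<Longrightarrow> t \<le> - T \<Longrightarrow> u j (t, x) = 0"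
    and "\<And>j. j \<in> {1, 2} \<Longrightarrow> heat_kernel (\<sigma> j) (p j)"
    and "\<And>j t \<tau> x. j \<in> {1, 2} \<Longrightarrow>
           U j t \<tau> x = (LINT z|lborel. of_real (p j x z \<tau>) * u j (t - \<tau>, z))"
  shows "\<forall>j\<in>{1, 2}.
           weak_extension_solution (\<sigma> j) ({-T<..<T} \<times> {0<..} \<times> UNIV) (U j) \<and>
           ((\<lambda>\<tau>. \<integral>\<^sup>+ (t, x) \<in> cyl T UNIV. ennreal ((norm (U j t \<tau> x - u j (t, x)))\<^sup>2) \<partial>lborel)
              \<longlongrightarrow> 0) (at_right 0) \<and>
           (\<forall>\<tau>>0. \<forall>x. U j (- T) \<tau> x = 0)"
proof (intro ballI conjI)
  fix j :: nat
  assume j: "j \<in> {1, 2}"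
  note U = assms(14)[OF j]
  have uL: "u j \<in> L2"
    using assms(11)[OF j] by (simp add: nonlocal_solution_def parabolic_H_def)
  have [measurable]: "u j \<in> borel_measurable borel"
    using uL by measurable
  obtain E where cont: "continuous_on {(x, z, \<tau>). 0 < \<tau>} (\<lambda>(x, z, \<tau>). p j x z \<tau>)"
    and E: "spectral_resolution (\<sigma> j) E"
    and heat: "\<And>\<tau> g. 0 < \<tau> \<Longrightarrow> g \<in> L2 \<Longrightarrow>
      is_spectral_integral E (\<lambda>l. of_real (exp (- \<tau> * l))) g (\<lambda>x. LINT z|lborel. of_real (p j x z \<tau>) * g z)"
    using assms(13)[OF j] unfolding heat_kernel_def by blast
  \<comment> \<open>Only almost all time slices of \<open>u j\<close> lie in \<open>L\<^sup>2\<close>; the others are set to \<open>0\<close>.\<close>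
  define S where "S = {r. (\<lambda>x. u j (r, x)) \<in> L2}"
  have S_AE: "AE r in lborel. r \<in> S"
    using L2_slices[OF uL] by (simp add: S_def)
  \<comment> \<open>By Tonelli the slice integrals depend measurably on the time, so the good times
    form a Borel set and the modification of u stays Borel.\<close>
  have S_eq: "S = {r. (\<integral>\<^sup>+ x. ennreal ((norm (u j (r, x)))\<^sup>2) \<partial>lborel) < \<infinity>}"
  proof -
    have "(\<lambda>x. u j (r, x)) \<in> borel_measurable borel" for r
      by measurable
    then show ?thesis
      by (simp add: S_def L2_nn_iff)
  qed
  have [measurable]: "S \<in> sets borel"
    unfolding S_eq by measurable
  define u' where "u' q = (if fst q \<in> S then u j q else 0)" for q
  have [measurable]: "u' \<in> borel_measurable borel"
    unfolding u'_def by measurable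
  have u'_AE: "AE q in lborel. u' q = u j q"
    using AE_lborel_fst[OF S_AE] by eventually_elim (simp add: u'_def)
  have u'L: "u' \<in> L2"
  proof -
    have "(\<integral>\<^sup>+ q. ennreal ((norm (u' q))\<^sup>2) \<partial>lborel) = (\<integral>\<^sup>+ q. ennreal ((norm (u j q))\<^sup>2) \<partial>lborel)"
      by (rule nn_integral_cong_AE) (use u'_AE in \<open>auto elim!: eventually_mono\<close>)
    then show ?thesis
      using uL by (simp add: L2_nn_iff)
  qed
  interpret heat_flow E "\<sigma> j" "p j" u'
  proof
    show "resolution_of_identity E"
      using E by (simp add: spectral_resolution_def)
    show "admissible (\<sigma> j)"
      by (rule assms(9)[OF j])
    show "div_form_op (\<sigma> j) f h" if "is_spectral_integral E of_real f h" for f h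
      using E that by (simp add: spectral_resolution_def)
    show "(\<lambda>x. u' (t, x)) \<in> L2" for t
      by (cases "t \<in> S") (auto simp: u'_def S_def)
  qed (fact cont heat u'L)+
  show "weak_extension_solution (\<sigma> j) ({-T<..<T} \<times> {0<..} \<times> UNIV) (U j)"
  proof (rule weak_solution)
    show "U j t \<tau> x = heat_extension (p j) (u j) (t, \<tau>, x)" if "0 < \<tau>" for t \<tau> x
      using that by (simp add: U heat_extension_def)
    show "heat_extension (p j) (u j) \<in> borel_measurable borel"
      by (rule heat_extension_measurable[OF cont]) measurable
    \<comment> \<open>The exceptional set consists of the points where t - \<tau> lies in a null
      set; by the shear it is null.\<close>
    show "AE q in lborel. heat_extension (p j) (u j) q = V q"
      using AE_triple[OF AE_shear[OF S_AE]]
      by eventually_elim (auto simp: heat_extension_def u'_def)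
  qed
  show "((\<lambda>\<tau>. \<integral>\<^sup>+ (t, x) \<in> cyl T UNIV. ennreal ((norm (U j t \<tau> x - u j (t, x)))\<^sup>2) \<partial>lborel) \<longlongrightarrow> 0) (at_right 0)"
    unfolding tendsto_at_iff_sequentially comp_def
  proof (intro allI impI)
    fix X :: "nat \<Rightarrow> real"
    assume X0: "\<forall>n. X n \<in> {0<..} - {0}" and X: "X \<longlonglongrightarrow> 0"
    then have Xpos: "0 < X n" for n
      by auto
    have le: "(\<integral>\<^sup>+ (t, x) \<in> cyl T UNIV. ennreal ((norm (U j t (X n) x - u j (t, x)))\<^sup>2) \<partial>lborel)
        \<le> (\<integral>\<^sup>+ q. ennreal ((norm (V (fst q, X n, snd q) - u' q))\<^sup>2) \<partial>lborel)" for n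
    proof (rule nn_integral_mono_AE)
      \<comment> \<open>Here \<tau> is fixed at \<open>X n\<close>, so the exceptional times form a
        translate of the null complement of S.\<close>
      have "AE r in lborel. r - X n \<in> S"
      proof -
        obtain N where N: "N \<in> null_sets lborel" "{r. \<not> r \<in> S} \<subseteq> N"
          using S_AE unfolding eventually_ae_filter by auto
        have [measurable]: "N \<in> sets borel"
          using N(1) by auto
        have "(\<integral>\<^sup>+ r. indicator N (r - X n) \<partial>lborel) = (\<integral>\<^sup>+ r. indicator N r \<partial>lborel)"
          by (rule nn_integral_lborel_shift) measurable
        also have "\<dots> = 0"
          using N(1) by (simp add: null_setsD1)
        finally have "AE r in lborel. (indicator N (r - X n) :: ennreal) = 0"
          by (subst (asm) nn_integral_0_iff_AE) auto
        then show ?thesis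
          by eventually_elim (use N(2) in \<open>auto simp: indicator_def split: if_splits\<close>)
      qed
      from AE_lborel_fst[OF this] u'_AE
      show "AE q in lborel. (case q of (t, x) \<Rightarrow> ennreal ((norm (U j t (X n) x - u j (t, x)))\<^sup>2)) * indicator (cyl T UNIV) q
          \<le> ennreal ((norm (V (fst q, X n, snd q) - u' q))\<^sup>2)"
      proof eventually_elim
        case (elim q)
        obtain t x where q: "q = (t, x)"
          by (cases q)
        have "U j t (X n) x = V (t, X n, x)"
          using elim(1) Xpos[of n] by (simp add: U heat_extension_def u'_def q)
        then show ?case
          using elim(2) by (simp add: q indicator_def)
      qed
    qed
    show "(\<lambda>n. \<integral>\<^sup>+ (t, x) \<in> cyl T UNIV. ennreal ((norm (U j t (X n) x - u j (t, x)))\<^sup>2) \<partial>lborel) \<longlonglongrightarrow> 0"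
      by (rule tendsto_sandwich[OF _ _ tendsto_const initial_value[OF X Xpos]]) (auto intro: always_eventually le)
  qed
  show "\<forall>\<tau>>0. \<forall>x. U j (- T) \<tau> x = 0"
    by (simp add: U assms(12)[OF j])
qed

end
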